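(* Let $G^0$ be a connected finite undirected (multi)graph on $n$ vertices and let $\chi$ be the size of a minimum cut of $G^0$. For every real $\alpha\ge1$, there are fewer than $13n^{2\alpha}$ compact cuts of size at most $\alpha\chi$ in $G^0$. Moreover, these cuts can be enumerated (by a randomized algorithm) in expected time $\tilde O(n^{2\alpha})$.
   Context: An $r$-way cut of a connected graph $G$ is a partition $\{U_1,\dots,U_r\}$ of $V(G)$ into $r$ pairwise disjoint sets (clusters); a cut is an $r$-way cut for any $r\ge2$. An edge crosses the cut if its endpoints lie in different clusters; the size of the cut is the number of crossing edges. The cut is compact if the subgraph induced by each cluster is connected. A min cut is a cut of minimum size (necessarily a compact 2-way cut). *)

theory Defs
  imports "HOL-Probability.Probability" "HOL-Library.Disjoint_Sets"
begin

section \<open>Multigraphs and cuts\<close>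

text \<open>An edge has a set of one or two end points; parallel edges are distinct elements of
  \<open>edges G\<close> with equal \<open>ends\<close>. Loops are permitted, but never cross a cut.\<close>

record ('v, 'e) multigraph =
  verts :: "'v set"
  edges :: "'e set"
  ends :: "'e \<Rightarrow> 'v set"

definition finite_multigraph :: "('v, 'e) multigraph \<Rightarrow> bool" where
  "finite_multigraph G \<longleftrightarrow> finite (verts G) \<and> finite (edges G) \<and>
     (\<forall>e\<in>edges G. ends G e \<subseteq> verts G \<and> card (ends G e) \<in> {1, 2})"

definition adjacency :: "('v, 'e) multigraph \<Rightarrow> ('v \<times> 'v) set" where
  "adjacency G = {(u, v). \<exists>e\<in>edges G. ends G e = {u, v}}"

definition connected_graph :: "('v, 'e) multigraph \<Rightarrow> bool" where
  "connected_graph G \<longleftrightarrow>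
     verts G \<noteq> {} \<and> (\<forall>u\<in>verts G. \<forall>v\<in>verts G. (u, v) \<in> (adjacency G)\<^sup>*)"

definition induced_subgraph :: "('v, 'e) multigraph \<Rightarrow> 'v set \<Rightarrow> ('v, 'e) multigraph" where
  "induced_subgraph G U = G\<lparr>verts := U, edges := {e \<in> edges G. ends G e \<subseteq> U}\<rparr>"

text \<open>\<^const>\<open>partition_on\<close> requires the clusters to be nonempty.\<close>

definition is_r_way_cut :: "('v, 'e) multigraph \<Rightarrow> nat \<Rightarrow> 'v set set \<Rightarrow> bool" where
  "is_r_way_cut G r P \<longleftrightarrow> partition_on (verts G) P \<and> finite P \<and> card P = r"

definition is_cut :: "('v, 'e) multigraph \<Rightarrow> 'v set set \<Rightarrow> bool" where
  "is_cut G P \<longleftrightarrow> (\<exists>r\<ge>2. is_r_way_cut G r P)"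

definition crosses :: "('v, 'e) multigraph \<Rightarrow> 'v set set \<Rightarrow> 'e \<Rightarrow> bool" where
  "crosses G P e \<longleftrightarrow>
     (\<exists>u\<in>ends G e. \<exists>v\<in>ends G e. \<exists>U\<in>P. \<exists>W\<in>P. u \<in> U \<and> v \<in> W \<and> U \<noteq> W)"

definition cut_size :: "('v, 'e) multigraph \<Rightarrow> 'v set set \<Rightarrow> nat" where
  "cut_size G P = card {e \<in> edges G. crosses G P e}"

definition compact_cut :: "('v, 'e) multigraph \<Rightarrow> 'v set set \<Rightarrow> bool" where
  "compact_cut G P \<longleftrightarrow> is_cut G P \<and> (\<forall>U\<in>P. connected_graph (induced_subgraph G U))"

text \<open>Only meaningful for graphs with at least two vertices; a one-vertex graph has no cut.\<close>

definition min_cut_size :: "('v, 'e) multigraph \<Rightarrow> nat" where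
  "min_cut_size G = Min (cut_size G ` {P. is_cut G P})"

definition small_compact_cuts :: "real \<Rightarrow> ('v, 'e) multigraph \<Rightarrow> 'v set set set" where
  "small_compact_cuts \<alpha> G =
     {P. compact_cut G P \<and> real (cut_size G P) \<le> \<alpha> * real (min_cut_size G)}"

section \<open>Randomized word RAM\<close>

text \<open>
  Programs are structured programs over registers and a random-access memory, both of which hold
  words below a modulus \<open>B\<close> (a power of two); all arithmetic is modulo \<open>B\<close>.
  As \<open>\<alpha>\<close> is an arbitrary, possibly uncomputable, real number, the machine can access it in
  exactly one way, namely the test \<open>LeAlpha a b\<close>: whether \<open>a \<le> \<alpha> * b\<close> for words \<open>a\<close> and \<open>b\<close>.
\<close>

datatype exp =
    Const nat
  | Reg nat
  | Load exp
  | Plus exp exp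
  | Minus exp exp
  | Times exp exp
  | Div exp exp
  | Mod exp exp
  | Less exp exp
  | LeAlpha exp exp

text \<open>
  \<open>Sample r e\<close> stores in register \<open>r\<close> a fresh uniformly random word below the value of \<open>e\<close>.
  \<open>Report b k\<close> outputs a partition, see below.
\<close>

datatype prog =
    Skip
  | Assign nat exp
  | Store exp exp
  | Sample nat exp
  | Report exp exp
  | Seq prog prog
  | If exp prog prog
  | While exp prog

record state =
  regs :: "nat \<Rightarrow> nat"
  mem :: "nat \<Rightarrow> nat"
  clock :: nat
  reported :: "nat set set list"

primrec exp_val :: "real \<Rightarrow> nat \<Rightarrow> exp \<Rightarrow> state \<Rightarrow> nat" where
  "exp_val \<alpha> B (Const c) s = c mod B"
| "exp_val \<alpha> B (Reg r) s = regs s r"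
| "exp_val \<alpha> B (Load a) s = mem s (exp_val \<alpha> B a s)"
| "exp_val \<alpha> B (Plus a b) s = (exp_val \<alpha> B a s + exp_val \<alpha> B b s) mod B"
| "exp_val \<alpha> B (Minus a b) s = (exp_val \<alpha> B a s + (B - exp_val \<alpha> B b s)) mod B"
| "exp_val \<alpha> B (Times a b) s = (exp_val \<alpha> B a s * exp_val \<alpha> B b s) mod B"
| "exp_val \<alpha> B (Div a b) s = exp_val \<alpha> B a s div exp_val \<alpha> B b s"
| "exp_val \<alpha> B (Mod a b) s = exp_val \<alpha> B a s mod exp_val \<alpha> B b s"
| "exp_val \<alpha> B (Less a b) s = (if exp_val \<alpha> B a s < exp_val \<alpha> B b s then 1 else 0)"
| "exp_val \<alpha> B (LeAlpha a b) s =
     (if real (exp_val \<alpha> B a s) \<le> \<alpha> * real (exp_val \<alpha> B b s) then 1 else 0)"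

text \<open>
  Writing down each cut vertex by vertex would cost a factor \<open>n\<close> per cut and is impossible within
  the claimed time (a cycle has \<open>n * (n - 1) div 2\<close> minimum cuts). So, as usual for such
  enumerations, the current cut is kept in memory in an implicit form that can be read off in
  linear time: a parent-pointer (union-find) array of \<open>k\<close> cells, two vertices being in the same
  cluster iff they are in the same component of the pointer structure. Pointers to numbers that
  are not vertices are ignored.
\<close>

definition pointer_partition :: "nat \<Rightarrow> (nat \<Rightarrow> nat) \<Rightarrow> nat set set" where
  "pointer_partition k parent =
     (let R = {(v, parent v) | v. v < k \<and> parent v < k}
      in {..<k} // {(u, v). u < k \<and> v < k \<and> (u, v) \<in> (R \<union> R\<inverse>)\<^sup>*})"

definition tick :: "state \<Rightarrow> state" where
  "tick s = s\<lparr>clock := Suc (clock s)\<rparr>"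

partial_function (spmf) while_spmf ::
  "('s \<Rightarrow> bool) \<Rightarrow> ('s \<Rightarrow> 's) \<Rightarrow> ('s \<Rightarrow> 's spmf) \<Rightarrow> 's \<Rightarrow> 's spmf" where
  "while_spmf g t f s =
     (if g s then bind_spmf (f (t s)) (while_spmf g t f) else return_spmf (t s))"

text \<open>
  The distribution of the final state, nontermination being the missing probability mass. Every
  primitive command and every evaluation of a guard takes one unit of time. (A program is a fixed
  object, independent of the input, so the sizes of its expressions only matter up to a constant
  factor.)
\<close>

primrec exec :: "real \<Rightarrow> nat \<Rightarrow> prog \<Rightarrow> state \<Rightarrow> state spmf" where
  "exec \<alpha> B Skip s = return_spmf (tick s)"
| "exec \<alpha> B (Assign r e) s =
     return_spmf (tick (s\<lparr>regs := (regs s)(r := exp_val \<alpha> B e s)\<rparr>))"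
| "exec \<alpha> B (Store a e) s =
     return_spmf (tick (s\<lparr>mem := (mem s)(exp_val \<alpha> B a s := exp_val \<alpha> B e s)\<rparr>))"
| "exec \<alpha> B (Sample r e) s =
     (let k = exp_val \<alpha> B e s in
      if k = 0 then return_spmf (tick (s\<lparr>regs := (regs s)(r := 0)\<rparr>))
      else map_spmf (\<lambda>x. tick (s\<lparr>regs := (regs s)(r := x)\<rparr>)) (spmf_of_set {..<k}))"
| "exec \<alpha> B (Report b k) s =
     return_spmf (tick (s\<lparr>reported := reported s @
       [pointer_partition (exp_val \<alpha> B k s) (\<lambda>v. mem s ((exp_val \<alpha> B b s + v) mod B))]\<rparr>))"
| "exec \<alpha> B (Seq c d) s = bind_spmf (exec \<alpha> B c s) (exec \<alpha> B d)"
| "exec \<alpha> B (If e c d) s =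
     (if exp_val \<alpha> B e s \<noteq> 0 then exec \<alpha> B c (tick s) else exec \<alpha> B d (tick s))"
| "exec \<alpha> B (While e c) s =
     while_spmf (\<lambda>s. exp_val \<alpha> B e s \<noteq> 0) tick (exec \<alpha> B c) s"

definition expected_time :: "state spmf \<Rightarrow> ennreal" where
  "expected_time p =
     (\<integral>\<^sup>+ x. (case x of None \<Rightarrow> \<infinity> | Some s \<Rightarrow> of_nat (clock s)) \<partial>measure_pmf p)"

section \<open>Running a program on a multigraph\<close>

text \<open>
  The input graph has the vertices \<open>0, \<dots>, n - 1\<close>. It is given by \<open>n\<close> (in register 0) and by its
  \<open>n \<times> n\<close> adjacency matrix of edge multiplicities (in row-major order from address 0): the number
  of edges is not bounded in terms of \<open>n\<close>, so they cannot be listed one by one within a time bound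
  depending on \<open>n\<close> only.
  Words have \<open>\<kappa> * \<lceil>log 2 (n + m)\<rceil>\<close> bits, where \<open>m\<close> is the number of edges, so that the
  multiplicities and the addresses of polynomially many cells fit into words.
\<close>

definition multiplicity_of :: "('v, 'e) multigraph \<Rightarrow> 'v \<Rightarrow> 'v \<Rightarrow> nat" where
  "multiplicity_of G u v = card {e \<in> edges G. ends G e = {u, v}}"

definition initial_state :: "(nat, 'e) multigraph \<Rightarrow> state" where
  "initial_state G = (let n = card (verts G) in
     \<lparr>regs = (\<lambda>r. if r = 0 then n else 0),
      mem = (\<lambda>a. if a < n * n then multiplicity_of G (a div n) (a mod n) else 0),
      clock = 0,
      reported = []\<rparr>)"

definition word_modulus :: "nat \<Rightarrow> ('v, 'e) multigraph \<Rightarrow> nat" where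
  "word_modulus \<kappa> G = 2 ^ (\<kappa> * nat \<lceil>log 2 (real (card (verts G) + card (edges G)))\<rceil>)"

definition run :: "real \<Rightarrow> nat \<Rightarrow> prog \<Rightarrow> (nat, 'e) multigraph \<Rightarrow> state spmf" where
  "run \<alpha> \<kappa> c G = exec \<alpha> (word_modulus \<kappa> G) c (initial_state G)"

definition lists_exactly :: "'a list \<Rightarrow> 'a set \<Rightarrow> bool" where
  "lists_exactly xs A \<longleftrightarrow> distinct xs \<and> set xs = A"

text \<open>
  Enumeration in expected time soft-O of \<open>n powr q\<close> by a Monte Carlo algorithm: with high
  probability, that is, probability at least \<open>1 - 1 / n ^ d\<close> for any prescribed \<open>d\<close>, the reported
  partitions are exactly the wanted ones, without repetition. The program does not depend on the
  graph. Edges may be taken to be natural numbers, since there are finitely many.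
\<close>

definition enumerable_in_soft_O ::
  "real \<Rightarrow> ((nat, nat) multigraph \<Rightarrow> nat set set set) \<Rightarrow> real \<Rightarrow> bool" where
  "enumerable_in_soft_O \<alpha> cuts q \<longleftrightarrow>
     (\<forall>d::nat. \<exists>c \<kappa> (C::real) (l::nat). \<forall>G. \<forall>n\<ge>2.
        finite_multigraph G \<and> connected_graph G \<and> verts G = {..<n} \<longrightarrow>
        expected_time (run \<alpha> \<kappa> c G) \<le> ennreal (C * real n powr q * ln (real n) ^ l) \<and>
        measure (measure_spmf (run \<alpha> \<kappa> c G)) {s. lists_exactly (reported s) (cuts G)}
          \<ge> 1 - 1 / real n ^ d)"

end

theory Submission
  imports Defs
begin

text \<open>
  Let \<open>a = 2 * \<alpha>\<close>. As long as \<open>k\<close> contracted vertices are left, every one of them has degree at least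
  \<open>\<chi>\<close>, so at most a fraction \<open>a / k\<close> of the edges crosses a given cut of size at most \<open>\<alpha> * \<chi>\<close>.
  Averaging over the edge to be contracted bounds the number of such cuts by
  \<open>k / (k - a)\<close> times the bound for \<open>k - 1\<close> vertices, down to about \<open>a\<close> vertices, where \<open>fact k\<close>
  bounds the number of all partitions.

  For the enumeration, a random edge is contracted and the visit of the next level is repeated once
  with probability about \<open>a / (k - a)\<close>. This makes up for the survival probability \<open>1 - a / k\<close>:
  a given cut is met with probability \<open>\<Omega>(1 / log n)\<close>, while level \<open>k\<close> is visited \<open>O((n / k) powr a)\<close>
  times in expectation, at a cost of \<open>O(k)\<close> each. To stay within this cost the contraction is done in
  place and undone on the way back. Only adjacent vertices are merged, so every intermediate partition is a
  compact cut; conversely, a compact cut different from the current partition always leaves an edge that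
  may be contracted, and below a constant level a uniformly random pair of vertices is good enough.
  \<open>O((log n)\<^sup>2)\<close> visits of the top level meet all wanted cuts with high probability. A first such
  round finds the size of a minimum cut, a second one reports the cuts. Repetitions are recognised by the
  fingerprint \<open>\<Sum>u v. x u * x v\<close>, with \<open>u\<close> and \<open>v\<close> ranging over the pairs in a common cluster and \<open>x\<close>
  random, which is used directly as an address.

  Running time and failure probability are both bounded by potentials that do not increase in
  expectation in one step of the search.
\<close>


section \<open>Cuts as crossing weights\<close>

text \<open>The revisit probability keeps the expected number of surviving copies of a cut at one:
  the contraction at level k is survived with probability at least 1 - a / k, and 1 + a / (k - a)
  visits on average make up for it. This is a critical branching process, so the survival
  probability decays like 1 / log n instead of the n powr (- a) of a single descent. Of the two
  logarithms in the number of top visits, one offsets this decay, the other turns a constant failure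
  probability into n ^ (- e).

  Since \<alpha> can only be compared with, an integer \<open>k1\<close> \<ge> a replaces a in the
  denominator; above level \<open>k0\<close> \<ge> 2 * \<open>k1\<close>, the difference k -
  \<open>k1\<close> exceeds k / 2.

  The fingerprint has to be maintained under merging and undo and still separate partitions. Sums of
  x over clusters are additive under merging; the difference of two sums of their squares is affine
  in each single x v, which is what bounds collisions.

  The count comes out as n powr (2 * \<alpha>) itself; the factor 13 leaves room for the strict
  inequality.\<close>

definition same :: "'v set set \<Rightarrow> 'v \<Rightarrow> 'v \<Rightarrow> bool" where
  "same P u v \<longleftrightarrow> (\<exists>U\<in>P. u \<in> U \<and> v \<in> U)"

definition merge :: "'v \<Rightarrow> 'v \<Rightarrow> ('v \<Rightarrow> 'v) \<Rightarrow> 'v \<Rightarrow> 'v" where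
  "merge b a lab v = (if lab v = b then a else lab v)"

lemma sum_swap3:
  fixes f :: "'a \<Rightarrow> 'b \<Rightarrow> 'c \<Rightarrow> 'd::comm_monoid_add"
  shows "(\<Sum>u\<in>A. \<Sum>v\<in>B. \<Sum>e\<in>E. f u v e) = (\<Sum>e\<in>E. \<Sum>u\<in>A. \<Sum>v\<in>B. f u v e)"
proof -
  have "(\<Sum>u\<in>A. \<Sum>v\<in>B. \<Sum>e\<in>E. f u v e) = (\<Sum>u\<in>A. \<Sum>e\<in>E. \<Sum>v\<in>B. f u v e)"
    by (intro sum.cong refl) (rule sum.swap)
  also have "\<dots> = (\<Sum>e\<in>E. \<Sum>u\<in>A. \<Sum>v\<in>B. f u v e)" by (rule sum.swap)
  finally show ?thesis .
qed

lemma sum_swap4: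
  fixes f :: "'a \<Rightarrow> 'b \<Rightarrow> 'c \<Rightarrow> 'g \<Rightarrow> 'd::comm_monoid_add"
  shows "(\<Sum>r\<in>A. \<Sum>s\<in>B. \<Sum>u\<in>C. \<Sum>v\<in>D. f r s u v) = (\<Sum>u\<in>C. \<Sum>v\<in>D. \<Sum>r\<in>A. \<Sum>s\<in>B. f r s u v)"
proof -
  have "(\<Sum>r\<in>A. \<Sum>s\<in>B. \<Sum>u\<in>C. \<Sum>v\<in>D. f r s u v) = (\<Sum>u\<in>C. \<Sum>r\<in>A. \<Sum>s\<in>B. \<Sum>v\<in>D. f r s u v)"
    by (rule sum_swap3)
  also have "\<dots> = (\<Sum>u\<in>C. \<Sum>v\<in>D. \<Sum>r\<in>A. \<Sum>s\<in>B. f r s u v)"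
    by (intro sum.cong refl sum_swap3)
  finally show ?thesis .
qed

locale mgraph =
  fixes G :: "('v, 'e) multigraph"
  assumes fin: "finite_multigraph G" and conn: "connected_graph G"
begin

abbreviation V where "V \<equiv> verts G"

definition mu :: "'v \<Rightarrow> 'v \<Rightarrow> nat" where
  "mu u v = (if u = v then 0 else multiplicity_of G u v)"

text \<open>Ordered pairs count every edge twice. The program keeps the same doubled quantities and
  never halves them; \<open>xw (=)\<close> is twice the number of edges that are not loops.\<close>

definition xw :: "('v \<Rightarrow> 'v \<Rightarrow> bool) \<Rightarrow> nat" where
  "xw R = (\<Sum>u\<in>V. \<Sum>v\<in>V. if R u v then 0 else mu u v)"

definition wt :: "('v \<Rightarrow> 'v) \<Rightarrow> 'v \<Rightarrow> 'v \<Rightarrow> nat" where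
  "wt lab r s = (\<Sum>u\<in>V. \<Sum>v\<in>V. if lab u = r \<and> lab v = s then mu u v else 0)"

definition dg :: "('v \<Rightarrow> 'v) \<Rightarrow> 'v \<Rightarrow> nat" where
  "dg lab r = (\<Sum>u\<in>V. \<Sum>v\<in>V. if lab u = r \<and> lab v \<noteq> r then mu u v else 0)"

text \<open>A labelling sends each vertex to the representative of its class. Idempotence makes the
  image of \<open>V\<close> the vertex set of the contracted graph.\<close>

definition lab_ok :: "('v \<Rightarrow> 'v) \<Rightarrow> bool" where
  "lab_ok lab \<longleftrightarrow> (\<forall>v\<in>V. lab v \<in> V \<and> lab (lab v) = lab v)"

definition part :: "('v \<Rightarrow> 'v) \<Rightarrow> 'v set set" where
  "part lab = V // {(u, v). u \<in> V \<and> v \<in> V \<and> lab u = lab v}"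

text \<open>\<open>P\<close> has survived the contraction described by \<open>lab\<close>: it is
  still a partition of the contracted graph.\<close>

definition coarser :: "'v set set \<Rightarrow> ('v \<Rightarrow> 'v) \<Rightarrow> bool" where
  "coarser P lab \<longleftrightarrow> (\<forall>v\<in>V. same P v (lab v))"

lemma finV [simp]: "finite V" and finE [simp]: "finite (edges G)"
  using fin by (auto simp: finite_multigraph_def)

lemma V_ne: "V \<noteq> {}" using conn by (auto simp: connected_graph_def)

lemma ends_pair:
  assumes "e \<in> edges G"
  obtains p q where "p \<in> V" "q \<in> V" "ends G e = {p, q}"
proof -
  have 1: "ends G e \<subseteq> V" "card (ends G e) = 1 \<or> card (ends G e) = 2"
    using fin assms by (auto simp: finite_multigraph_def)
  from 1(2) show thesis
  proof
    assume "card (ends G e) = 1"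
    then obtain p where "ends G e = {p}" by (auto simp: card_1_singleton_iff)
    with 1 that[of p p] show ?thesis by auto
  next
    assume "card (ends G e) = 2"
    then obtain p q where "ends G e = {p,q}" by (auto simp: card_2_iff)
    with 1 that[of p q] show ?thesis by auto
  qed
qed

lemma mu_sym: "mu u v = mu v u"
  by (auto simp: mu_def multiplicity_of_def insert_commute)

lemma mu_self [simp]: "mu u u = 0" by (simp add: mu_def)

lemma mu_eq: "mu u v = (\<Sum>e\<in>edges G. if u \<noteq> v \<and> ends G e = {u,v} then 1 else 0)"
  by (auto simp: mu_def multiplicity_of_def sum.If_cases Int_def)

lemma mu_pos_iff: "mu u v > 0 \<longleftrightarrow> u \<noteq> v \<and> (\<exists>e\<in>edges G. ends G e = {u,v})"
proof -
  have "finite {e \<in> edges G. ends G e = {u,v}}" by simp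
  then show ?thesis unfolding mu_def multiplicity_of_def
    by (auto simp: card_gt_0_iff)
qed

lemma same_refl: "partition_on V P \<Longrightarrow> v \<in> V \<Longrightarrow> same P v v"
  unfolding same_def partition_on_def by auto

lemma same_sym: "same P u v \<Longrightarrow> same P v u"
  unfolding same_def by auto

lemma same_trans: "partition_on V P \<Longrightarrow> same P u v \<Longrightarrow> same P v w \<Longrightarrow> same P u w"
  unfolding same_def partition_on_def disjoint_def by blast

lemma crosses_iff:
  assumes "partition_on V P" "p \<in> V" "q \<in> V" "ends G e = {p,q}"
  shows "crosses G P e \<longleftrightarrow> \<not> same P p q"
proof -
  have ex: "\<exists>U\<in>P. v \<in> U" if "v \<in> V" for v using that assms(1) by (auto simp: partition_on_def)
  have un: "U = W" if "U \<in> P" "W \<in> P" "v \<in> U" "v \<in> W" for U W v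
    using that assms(1) unfolding partition_on_def disjoint_def by blast
  show ?thesis
  proof
    assume "crosses G P e"
    then obtain u v U W where h: "u \<in> {p,q}" "v \<in> {p,q}" "U\<in>P" "W\<in>P" "u \<in> U" "v \<in> W" "U \<noteq> W"
      unfolding crosses_def assms(4) by blast
    then show "\<not> same P p q" unfolding same_def using un by blast
  next
    assume n: "\<not> same P p q"
    obtain U W where "U \<in> P" "p \<in> U" "W \<in> P" "q \<in> W" using ex assms by blast
    then show "crosses G P e" unfolding crosses_def assms(4) using n unfolding same_def by blast
  qed
qed

text \<open>An edge is realised by the two orientations of its pair of ends; a loop by none, since
  it lies within one cluster.\<close>

lemma xw_cut_size:
  assumes P: "partition_on V P"
  shows "xw (same P) = 2 * cut_size G P"
proof -
  have "xw (same P) = (\<Sum>u\<in>V. \<Sum>v\<in>V. \<Sum>e\<in>edges G. if \<not> same P u v \<and> u \<noteq> v \<and> ends G e = {u,v} then 1 else 0)"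
    unfolding xw_def by (intro sum.cong refl) (auto simp: mu_eq)
  also have "\<dots> = (\<Sum>e\<in>edges G. \<Sum>u\<in>V. \<Sum>v\<in>V. if \<not> same P u v \<and> u \<noteq> v \<and> ends G e = {u,v} then 1 else 0)"
    by (rule sum_swap3)
  also have "\<dots> = (\<Sum>e\<in>edges G. if crosses G P e then 2 else 0)"
  proof (intro sum.cong refl)
    fix e assume "e \<in> edges G"
    then obtain p q where pq: "p \<in> V" "q \<in> V" "ends G e = {p, q}" by (rule ends_pair)
    have "(\<Sum>u\<in>V. \<Sum>v\<in>V. if \<not> same P u v \<and> u \<noteq> v \<and> ends G e = {u,v} then 1 else 0)
      = (\<Sum>z\<in>V\<times>V. if \<not> same P (fst z) (snd z) \<and> fst z \<noteq> snd z \<and> {p,q} = {fst z,snd z} then 1 else (0::nat))"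
      by (simp add: sum.cartesian_product pq(3) split_beta)
    also have "\<dots> = card {z\<in>V\<times>V. \<not> same P (fst z) (snd z) \<and> fst z \<noteq> snd z \<and> {p,q} = {fst z,snd z}}"
      by (simp add: sum.If_cases Int_def)
    also have "{z\<in>V\<times>V. \<not> same P (fst z) (snd z) \<and> fst z \<noteq> snd z \<and> {p,q} = {fst z,snd z}}
        = (if same P p q then {} else {(p,q),(q,p)})"
      using pq same_sym[of P] same_refl[OF P] by (auto simp: doubleton_eq_iff)
    also have "card \<dots> = (if crosses G P e then 2 else 0)"
      using crosses_iff[OF P pq] same_refl[OF P pq(1)] by (cases "p = q") auto
    finally show "(\<Sum>u\<in>V. \<Sum>v\<in>V. if \<not> same P u v \<and> u \<noteq> v \<and> ends G e = {u,v} then 1 else 0)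
      = (if crosses G P e then 2 else (0::nat))" .
  qed
  also have "\<dots> = 2 * cut_size G P" by (simp add: cut_size_def sum.If_cases Int_def)
  finally show ?thesis .
qed

lemma partition_on_eqI:
  assumes "partition_on V P" "partition_on V Q" "\<And>u v. u \<in> V \<Longrightarrow> v \<in> V \<Longrightarrow> same P u v = same Q u v"
  shows "P = Q"
proof -
  have s: "same R u v \<Longrightarrow> u \<in> V \<and> v \<in> V" if "partition_on V R" for R u v
    using that partition_onD1[OF that(1)] unfolding same_def by blast
  have "same P u v = same Q u v" for u v
    using s[OF assms(1), of u v] s[OF assms(2), of u v] assms(3)[of u v] by metis
  then have "{(x,y). \<exists>p\<in>P. x \<in> p \<and> y \<in> p} = {(x,y). \<exists>p\<in>Q. x \<in> p \<and> y \<in> p}"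
    unfolding same_def by simp
  then show ?thesis
    using partition_on_eq_quotient[OF assms(1)] partition_on_eq_quotient[OF assms(2)] by metis
qed

section \<open>Labellings, their partitions and merging\<close>

lemma part_equiv: "equiv V {(u, v). u \<in> V \<and> v \<in> V \<and> lab u = lab v}"
  by (auto simp: equiv_def refl_on_def sym_def trans_def)

lemma part_partition: "partition_on V (part lab)"
  unfolding part_def by (rule partition_on_quotient[OF part_equiv])

lemma same_part: "u \<in> V \<Longrightarrow> v \<in> V \<Longrightarrow> same (part lab) u v \<longleftrightarrow> lab u = lab v"
  unfolding same_def part_def by (force simp: quotient_def)

lemma coarser_part: "lab_ok lab \<Longrightarrow> coarser (part lab) lab"
  unfolding coarser_def lab_ok_def by (metis same_part)

lemma coarserD: "partition_on V P \<Longrightarrow> coarser P lab \<Longrightarrow> u \<in> V \<Longrightarrow> v \<in> V \<Longrightarrow>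
   same P (lab u) (lab v) = same P u v"
  unfolding coarser_def by (meson same_sym same_trans)

lemma lab_id [simp]: "lab_ok (\<lambda>v. v)" by (simp add: lab_ok_def)

lemma coarser_id: "partition_on V P \<Longrightarrow> coarser P (\<lambda>v. v)"
  by (simp add: coarser_def same_refl)

lemma reps_sub: "lab_ok lab \<Longrightarrow> lab ` V \<subseteq> V" by (auto simp: lab_ok_def)

lemma reps_fix: "lab_ok lab \<Longrightarrow> r \<in> lab ` V \<Longrightarrow> lab r = r" by (auto simp: lab_ok_def)

lemma merge_ok:
  assumes "lab_ok lab" "a \<in> lab ` V" "b \<in> lab ` V" "a \<noteq> b"
  shows "lab_ok (merge b a lab)"
  using assms by (auto simp: lab_ok_def merge_def)

lemma merge_reps:
  assumes "lab_ok lab" "a \<in> lab ` V" "b \<in> lab ` V" "a \<noteq> b"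
  shows "merge b a lab ` V = lab ` V - {b}"
  using assms by (auto simp: merge_def lab_ok_def image_iff)

text \<open>Merging two representatives keeps exactly the cuts that do not separate them. Counting
  and search both rest on this.\<close>

lemma merge_coarser:
  assumes P: "partition_on V P" and l: "lab_ok lab" and c: "coarser P lab" and b: "b \<in> lab ` V"
  shows "coarser P (merge b a lab) \<longleftrightarrow> same P a b"
proof
  assume "coarser P (merge b a lab)"
  moreover have "b \<in> V" "lab b = b" using l b reps_sub reps_fix by auto
  ultimately show "same P a b" unfolding coarser_def merge_def using same_sym by force
next
  assume "same P a b"
  then show "coarser P (merge b a lab)" unfolding coarser_def merge_def
    using c unfolding coarser_def using same_trans[OF P] same_sym by force
qed

text \<open>Clusters of a coarser partition are unions of classes, so its crossing weight can be
  read off the contracted graph.\<close>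

lemma xw_reps:
  assumes P: "partition_on V P" and l: "lab_ok lab" and c: "coarser P lab"
  shows "(\<Sum>r\<in>lab`V. \<Sum>s\<in>lab`V. if same P r s then 0 else wt lab r s) = xw (same P)"
proof -
  have "(\<Sum>r\<in>lab`V. \<Sum>s\<in>lab`V. if same P r s then 0 else wt lab r s)
     = (\<Sum>r\<in>lab`V. \<Sum>s\<in>lab`V. \<Sum>u\<in>V. \<Sum>v\<in>V. if lab u = r \<and> lab v = s then (if same P r s then 0 else mu u v) else 0)"
    by (intro sum.cong refl, rename_tac r s, case_tac "same P r s") (simp_all add: wt_def cong: if_cong)
  also have "\<dots> = (\<Sum>u\<in>V. \<Sum>v\<in>V. \<Sum>r\<in>lab`V. \<Sum>s\<in>lab`V. if lab u = r \<and> lab v = s then (if same P r s then 0 else mu u v) else 0)"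
    by (rule sum_swap4)
  also have "\<dots> = (\<Sum>u\<in>V. \<Sum>v\<in>V. if same P u v then 0 else mu u v)"
  proof (intro sum.cong refl)
    fix u v assume uv: "u \<in> V" "v \<in> V"
    have "(\<Sum>r\<in>lab`V. \<Sum>s\<in>lab`V. if lab u = r \<and> lab v = s then (if same P r s then 0 else mu u v) else 0)
       = (\<Sum>r\<in>lab`V. if r = lab u then (\<Sum>s\<in>lab`V. if s = lab v then (if same P r s then 0 else mu u v) else 0) else 0)"
      by (intro sum.cong refl) auto
    also have "\<dots> = (if same P (lab u) (lab v) then 0 else mu u v)" using uv by simp
    finally show "(\<Sum>r\<in>lab`V. \<Sum>s\<in>lab`V. if lab u = r \<and> lab v = s then (if same P r s then 0 else mu u v) else 0)
       = (if same P u v then 0 else mu u v)" using coarserD[OF P c] uv by simp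
  qed
  finally show ?thesis by (simp add: xw_def)
qed

lemma xw_same_part: "xw (same (part lab)) = xw (\<lambda>u v. lab u = lab v)"
  unfolding xw_def by (intro sum.cong refl) (simp add: same_part)

lemma dg_sum:
  assumes l: "lab_ok lab"
  shows "(\<Sum>r\<in>lab`V. dg lab r) = xw (same (part lab))"
proof -
  have "(\<Sum>r\<in>lab`V. dg lab r) = (\<Sum>u\<in>V. \<Sum>v\<in>V. \<Sum>r\<in>lab`V. if lab u = r \<and> lab v \<noteq> r then mu u v else 0)"
    unfolding dg_def by (rule sum_swap3[symmetric])
  also have "\<dots> = (\<Sum>u\<in>V. \<Sum>v\<in>V. if lab u = lab v then 0 else mu u v)"
  proof (intro sum.cong refl)
    fix u v assume uv: "u \<in> V" "v \<in> V"
    have "(\<Sum>r\<in>lab`V. if lab u = r \<and> lab v \<noteq> r then mu u v else 0)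
       = (\<Sum>r\<in>lab`V. if r = lab u then (if lab u = lab v then 0 else mu u v) else 0)"
      by (intro sum.cong refl) auto
    then show "(\<Sum>r\<in>lab`V. if lab u = r \<and> lab v \<noteq> r then mu u v else 0) = (if lab u = lab v then 0 else mu u v)"
      using uv by simp
  qed
  finally show ?thesis unfolding xw_same_part unfolding xw_def .
qed

section \<open>Cuts and the minimum cut size\<close>

lemma cut_finite: "finite {P. is_cut G P}"
  by (rule finite_subset[OF _ finitely_many_partition_on[of V]])
     (auto simp: is_cut_def is_r_way_cut_def)

lemma min_cut_le: "is_cut G P \<Longrightarrow> min_cut_size G \<le> cut_size G P"
  unfolding min_cut_size_def using cut_finite by (intro Min_le) auto

lemma is_cut_iff: "is_cut G P \<longleftrightarrow> partition_on V P \<and> card P \<ge> 2"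
  unfolding is_cut_def is_r_way_cut_def using finite_elements[OF finV] by auto

lemma is_cutI:
  assumes P: "partition_on V P" and uv: "u \<in> V" "v \<in> V" "\<not> same P u v"
  shows "is_cut G P"
proof -
  obtain U where "U \<in> P" "u \<in> U" using P uv by (auto simp: partition_on_def)
  moreover obtain W where "W \<in> P" "v \<in> W" using P uv by (auto simp: partition_on_def)
  ultimately have h: "U \<in> P" "u \<in> U" "W \<in> P" "v \<in> W" by auto
  then have "U \<noteq> W" using uv by (auto simp: same_def)
  have "card {U,W} \<le> card P" by (rule card_mono) (use h finite_elements[OF finV P] in auto)
  then show ?thesis using P \<open>U \<noteq> W\<close> by (simp add: is_cut_iff)
qed

lemma cut_witness:
  assumes "is_cut G P" obtains u v where "u \<in> V" "v \<in> V" "\<not> same P u v"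
proof -
  have P: "partition_on V P" "card P \<ge> 2" using assms by (auto simp: is_cut_iff)
  then have "finite P" using finite_elements[OF finV] by blast
  then obtain U W where h: "U \<in> P" "W \<in> P" "U \<noteq> W"
    using P(2) by (metis card_le_Suc0_iff_eq not_less_eq_eq numeral_2_eq_2)
  moreover have "U \<noteq> {}" "W \<noteq> {}" using h P by (auto simp: partition_on_def)
  ultimately obtain u v where uv: "u \<in> U" "v \<in> W" by blast
  have "\<not> same P u v" unfolding same_def
    using disjointD[OF partition_onD2[OF P(1)]] h uv by blast
  moreover have "u \<in> V" "v \<in> V" using uv h P by (auto simp: partition_on_def)
  ultimately show thesis using that by blast
qed

text \<open>One contracted vertex against all the others is a 2-way cut of the original graph, of
  size equal to the degree. Hence the original minimum cut size stays a lower bound for degrees at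
  every level.\<close>

lemma dg_ge:
  assumes l: "lab_ok lab" and r: "r \<in> lab ` V" and k: "card (lab ` V) \<ge> 2"
  shows "min_cut_size G \<le> dg lab r"
proof -
  let ?R = "\<lambda>u v. (lab u = r) = (lab v = r)"
  define P where "P = V // {(u, v). u \<in> V \<and> v \<in> V \<and> ?R u v}"
  have eq: "equiv V {(u, v). u \<in> V \<and> v \<in> V \<and> ?R u v}"
    by (auto simp: equiv_def refl_on_def sym_def trans_def)
  have P: "partition_on V P" unfolding P_def by (rule partition_on_quotient[OF eq])
  have sP: "same P u v \<longleftrightarrow> ?R u v" if "u \<in> V" "v \<in> V" for u v
    using that unfolding same_def P_def by (force simp: quotient_def)
  have "\<exists>s\<in>lab ` V. s \<noteq> r"
  proof (rule ccontr)
    assume "\<not> ?thesis" then have "lab ` V \<subseteq> {r}" by auto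
    then have "card (lab ` V) \<le> 1" using card_mono[of "{r}"] by fastforce
    then show False using k by simp
  qed
  then obtain s where "s \<in> lab ` V" "s \<noteq> r" by auto
  then have "is_cut G P" using r l by (intro is_cutI[OF P, of r s]) (auto simp: lab_ok_def sP)
  then have "min_cut_size G \<le> cut_size G P" by (rule min_cut_le)
  moreover have "2 * cut_size G P = 2 * dg lab r"
  proof -
    have "2 * cut_size G P = xw (same P)" using xw_cut_size[OF P] by simp
    also have "\<dots> = (\<Sum>u\<in>V. \<Sum>v\<in>V. (if lab u = r \<and> lab v \<noteq> r then mu u v else 0) + (if lab v = r \<and> lab u \<noteq> r then mu v u else 0))"
      unfolding xw_def by (intro sum.cong refl) (auto simp: sP mu_sym)
    also have "\<dots> = dg lab r + (\<Sum>u\<in>V. \<Sum>v\<in>V. (if lab v = r \<and> lab u \<noteq> r then mu v u else 0))"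
      by (simp add: sum.distrib dg_def)
    also have "(\<Sum>u\<in>V. \<Sum>v\<in>V. (if lab v = r \<and> lab u \<noteq> r then mu v u else 0)) = dg lab r"
      unfolding dg_def by (rule sum.swap)
    finally show ?thesis by simp
  qed
  ultimately show ?thesis by simp
qed

text \<open>Handshake lemma in the contracted graph: the degrees, each bounded by
  \<open>dg_ge\<close>, add up to twice the number of its edges.\<close>

lemma xw_ge:
  assumes "lab_ok lab" "card (lab ` V) \<ge> 2"
  shows "card (lab ` V) * min_cut_size G \<le> xw (same (part lab))"
  unfolding dg_sum[OF assms(1), symmetric]
  using sum_mono[of "lab ` V" "\<lambda>_. min_cut_size G" "dg lab"] dg_ge[OF assms(1) _ assms(2)] by simp

lemma boundary_edge:
  assumes "(u, v) \<in> r\<^sup>*" "Q u" "\<not> Q v"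
  obtains x y where "(x, y) \<in> r" "Q x" "\<not> Q y"
  using assms by (induction rule: rtrancl_induct) blast+

lemma adjacency_mu: "(x, y) \<in> adjacency G \<Longrightarrow> x \<in> V \<and> y \<in> V \<and> (x \<noteq> y \<longrightarrow> mu x y > 0)"
  using fin unfolding adjacency_def finite_multigraph_def by (auto simp: mu_pos_iff)

lemma cut_size_pos:
  assumes "is_cut G P" shows "cut_size G P > 0"
proof -
  have P: "partition_on V P" using assms by (simp add: is_cut_iff)
  obtain u v where uv: "u \<in> V" "v \<in> V" "\<not> same P u v" using assms by (rule cut_witness)
  have "(u, v) \<in> (adjacency G)\<^sup>*" using conn uv by (auto simp: connected_graph_def)
  then obtain x y where xy: "(x, y) \<in> adjacency G" "same P u x" "\<not> same P u y"
    by (rule boundary_edge[where Q = "same P u"]) (use uv same_refl[OF P] in auto)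
  then have "\<not> same P x y" using same_trans[OF P] by blast
  obtain e where "e \<in> edges G" "ends G e = {x,y}" using xy by (auto simp: adjacency_def)
  then have "e \<in> {e \<in> edges G. crosses G P e}"
    using crosses_iff[OF P _ _ \<open>ends G e = {x,y}\<close>] adjacency_mu[OF xy(1)] \<open>\<not> same P x y\<close> by auto
  then show ?thesis unfolding cut_size_def by (auto simp: card_gt_0_iff)
qed

lemma min_cut_attained:
  assumes "card V \<ge> 2"
  obtains P where "is_cut G P" "cut_size G P = min_cut_size G"
proof -
  obtain u v where "u \<in> V" "v \<in> V" "u \<noteq> v"
    using assms finV by (metis card_le_Suc0_iff_eq not_less_eq_eq numeral_2_eq_2)
  then have "is_cut G (part (\<lambda>v. v))" by (intro is_cutI[OF part_partition, of u v]) (auto simp: same_part)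
  then have "min_cut_size G \<in> cut_size G ` {P. is_cut G P}"
    unfolding min_cut_size_def using cut_finite by (intro Min_in) auto
  with that show thesis by auto
qed

lemma min_cut_pos: "card V \<ge> 2 \<Longrightarrow> min_cut_size G > 0"
  using min_cut_attained cut_size_pos by metis

section \<open>Compactness of labellings\<close>

definition conn_in :: "'v set \<Rightarrow> bool" where
  "conn_in U \<longleftrightarrow> (\<forall>u\<in>U. \<forall>v\<in>U. (u, v) \<in> {(x, y). x \<in> U \<and> y \<in> U \<and> mu x y > 0}\<^sup>*)"

definition compact_lab :: "('v \<Rightarrow> 'v) \<Rightarrow> bool" where
  "compact_lab lab \<longleftrightarrow> (\<forall>r\<in>lab ` V. conn_in {v\<in>V. lab v = r})"

lemma conn_in_iff:
  assumes "U \<subseteq> V" "U \<noteq> {}"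
  shows "connected_graph (induced_subgraph G U) \<longleftrightarrow> conn_in U"
proof -
  let ?A = "adjacency (induced_subgraph G U)" and ?B = "{(x, y). x \<in> U \<and> y \<in> U \<and> mu x y > 0}"
  have "?B \<subseteq> ?A" by (auto simp: adjacency_def induced_subgraph_def mu_pos_iff)
  \<comment> \<open>Loops add only reflexive pairs, which the closure absorbs.\<close>
  moreover have "?A \<subseteq> ?B\<^sup>="
    by (auto simp: adjacency_def induced_subgraph_def mu_pos_iff)
  then have "?A \<subseteq> ?B\<^sup>*" by fast
  ultimately have "?A\<^sup>* = ?B\<^sup>*" by (rule rtrancl_subset)
  then show ?thesis using assms by (simp add: connected_graph_def conn_in_def induced_subgraph_def)
qed

lemma part_eq_image: "part lab = (\<lambda>r. {v\<in>V. lab v = r}) ` (lab ` V)"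
proof -
  have "{(u, v). u \<in> V \<and> v \<in> V \<and> lab u = lab v} `` {x} = {v\<in>V. lab v = lab x}" if "x \<in> V" for x
    using that by auto
  then show ?thesis unfolding part_def quotient_def image_image by auto
qed

lemma is_cut_part:
  assumes "lab_ok lab"
  shows "is_cut G (part lab) \<longleftrightarrow> card (lab ` V) \<ge> 2"
proof -
  have "inj_on (\<lambda>r. {v\<in>V. lab v = r}) (lab ` V)" by (auto simp: inj_on_def)
  then have "card (part lab) = card (lab ` V)" by (simp add: part_eq_image card_image)
  then show ?thesis by (simp add: is_cut_iff part_partition)
qed

lemma compact_part:
  assumes "lab_ok lab" "card (lab ` V) \<ge> 2"
  shows "compact_cut G (part lab) \<longleftrightarrow> compact_lab lab"
proof -
  have "connected_graph (induced_subgraph G {v\<in>V. lab v = r}) \<longleftrightarrow> conn_in {v\<in>V. lab v = r}" if "r \<in> lab ` V" for r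
    by (rule conn_in_iff) (use that in auto)
  then have "(\<forall>U\<in>part lab. connected_graph (induced_subgraph G U)) \<longleftrightarrow> compact_lab lab"
    unfolding compact_lab_def part_eq_image by simp
  then show ?thesis unfolding compact_cut_def using is_cut_part[OF assms(1)] assms(2) by simp
qed

lemma compact_id: "compact_lab (\<lambda>v. v)"
  by (auto simp: compact_lab_def conn_in_def)

lemma wt_pos: "wt lab r s > 0 \<longleftrightarrow> (\<exists>u\<in>V. \<exists>v\<in>V. lab u = r \<and> lab v = s \<and> mu u v > 0)"
  unfolding wt_def by (auto simp flip: neq0_conv)

lemma conn_in_Un:
  assumes A: "conn_in A" and B: "conn_in B" and xy: "x \<in> A" "y \<in> B" "mu x y > 0"
  shows "conn_in (A \<union> B)"
proof -
  let ?R = "\<lambda>U. {(x, y). x \<in> U \<and> y \<in> U \<and> mu x y > 0}"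
  have mA: "(?R A)\<^sup>* \<subseteq> (?R (A \<union> B))\<^sup>*" and mB: "(?R B)\<^sup>* \<subseteq> (?R (A \<union> B))\<^sup>*"
    by (intro rtrancl_mono; auto)+
  have e: "(x,y) \<in> (?R (A \<union> B))\<^sup>*" "(y,x) \<in> (?R (A \<union> B))\<^sup>*"
    by (rule r_into_rtrancl, use xy mu_sym[of x y] in auto)+
  have 1: "(u,x) \<in> (?R (A \<union> B))\<^sup>*" "(x,u) \<in> (?R (A \<union> B))\<^sup>*" if u: "u \<in> A \<union> B" for u
  proof -
    have "(u,x) \<in> (?R (A \<union> B))\<^sup>* \<and> (x,u) \<in> (?R (A \<union> B))\<^sup>*"
    proof (cases "u \<in> A")
      case True
      then show ?thesis using A xy mA unfolding conn_in_def by blast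
    next
      case False
      then have "(u,y) \<in> (?R (A \<union> B))\<^sup>*" "(y,u) \<in> (?R (A \<union> B))\<^sup>*"
        using u B xy mB unfolding conn_in_def by blast+
      then show ?thesis using e by (meson rtrancl_trans)
    qed
    then show "(u,x) \<in> (?R (A \<union> B))\<^sup>*" "(x,u) \<in> (?R (A \<union> B))\<^sup>*" by auto
  qed
  show ?thesis unfolding conn_in_def
  proof (intro ballI)
    fix u v assume "u \<in> A \<union> B" "v \<in> A \<union> B"
    then show "(u, v) \<in> (?R (A \<union> B))\<^sup>*" using 1(1)[of u] 1(2)[of v] by (meson rtrancl_trans)
  qed
qed

lemma compact_merge:
  assumes l: "lab_ok lab" and c: "compact_lab lab" and ab: "a \<in> lab ` V" "b \<in> lab ` V" "a \<noteq> b"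
    and w: "wt lab a b > 0"
  shows "compact_lab (merge b a lab)"
  unfolding compact_lab_def
proof
  fix r assume r: "r \<in> merge b a lab ` V"
  have rr: "r \<in> lab ` V" "r \<noteq> b" using r merge_reps[OF l ab] by auto
  show "conn_in {v \<in> V. merge b a lab v = r}"
  proof (cases "r = a")
    case True
    obtain x y where "x \<in> V" "y \<in> V" "lab x = a" "lab y = b" "mu x y > 0" using w by (auto simp: wt_pos)
    then have "conn_in ({v\<in>V. lab v = a} \<union> {v\<in>V. lab v = b})"
      using c ab by (intro conn_in_Un[of _ _ x y]) (auto simp: compact_lab_def)
    moreover have "{v \<in> V. merge b a lab v = r} = {v\<in>V. lab v = a} \<union> {v\<in>V. lab v = b}"
      using True ab by (auto simp: merge_def)
    ultimately show ?thesis by simp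
  next
    case False
    then have "{v \<in> V. merge b a lab v = r} = {v\<in>V. lab v = r}" using rr by (auto simp: merge_def)
    then show ?thesis using c[unfolded compact_lab_def, rule_format, OF rr(1)] by simp
  qed
qed

text \<open>Some cluster of \<open>P\<close> contains two different classes. As the cluster is
  connected, a path inside it leaves a class along an edge, and this edge may be contracted without
  destroying \<open>P\<close>.\<close>

lemma contractible_pair:
  assumes P: "compact_cut G P" and l: "lab_ok lab" and c: "coarser P lab" and ne: "P \<noteq> part lab"
  obtains r s where "r \<in> lab ` V" "s \<in> lab ` V" "r \<noteq> s" "same P r s" "wt lab r s > 0"
proof -
  have pP: "partition_on V P" using P by (auto simp: compact_cut_def is_cut_iff)
  have "\<exists>u\<in>V. \<exists>v\<in>V. same P u v \<noteq> (lab u = lab v)"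
    using partition_on_eqI[OF pP part_partition] ne same_part by blast
  then obtain u v where uv: "u \<in> V" "v \<in> V" "same P u v \<noteq> (lab u = lab v)" by auto
  have "same P u v" "lab u \<noteq> lab v"
    using uv coarserD[OF pP c uv(1,2)] same_refl[OF pP] l by (auto simp: lab_ok_def)
  then obtain U where U: "U \<in> P" "u \<in> U" "v \<in> U" by (auto simp: same_def)
  have UV: "U \<subseteq> V" using U pP by (auto simp: partition_on_def)
  have "conn_in U" using P U conn_in_iff[OF UV] by (auto simp: compact_cut_def)
  then have "(u, v) \<in> {(x, y). x \<in> U \<and> y \<in> U \<and> mu x y > 0}\<^sup>*" using U by (simp add: conn_in_def)
  then obtain x y where xy: "(x, y) \<in> {(x, y). x \<in> U \<and> y \<in> U \<and> mu x y > 0}" "lab x = lab u" "lab y \<noteq> lab u"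
    by (rule boundary_edge[where Q = "\<lambda>z. lab z = lab u"]) (use \<open>lab u \<noteq> lab v\<close> in auto)
  then have h: "x \<in> V" "y \<in> V" "mu x y > 0" "same P x y" using UV U by (auto simp: same_def)
  show thesis
    by (rule that[of "lab x" "lab y"]) (use h xy coarserD[OF pP c h(1,2)] imageI[of x V lab] imageI[of y V lab] in \<open>auto simp: wt_pos\<close>)
qed

text \<open>Splitting the clusters of a minimum cut into their connected components makes no further
  edge cross, so the size stays minimal.\<close>

lemma compact_min_cut:
  assumes "card V \<ge> 2"
  obtains P where "compact_cut G P" "cut_size G P = min_cut_size G"
proof -
  obtain P where P: "is_cut G P" "cut_size G P = min_cut_size G" using min_cut_attained[OF assms] by auto
  have pP: "partition_on V P" using P by (simp add: is_cut_iff)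
  obtain u0 v0 where uv0: "u0 \<in> V" "v0 \<in> V" "\<not> same P u0 v0" using P(1) by (rule cut_witness)
  let ?E = "{(x, y). x \<in> V \<and> y \<in> V \<and> same P x y \<and> mu x y > 0}"
  let ?Q = "{(x, y). x \<in> V \<and> y \<in> V \<and> (x, y) \<in> ?E\<^sup>*}"
  have "sym ?E" using same_sym mu_sym by (auto simp: sym_def)
  then have symE: "sym (?E\<^sup>*)" by (rule sym_rtrancl)
  have eq: "equiv V ?Q"
  proof (rule equivI)
    show "sym ?Q" using symE unfolding sym_def by fast
    show "trans ?Q" unfolding trans_def by (fast intro: rtrancl_trans)
  qed (auto simp: refl_on_def)
  define Q where "Q = V // ?Q"
  have Q: "partition_on V Q" unfolding Q_def by (rule partition_on_quotient[OF eq])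
  have sQ: "same Q u v \<longleftrightarrow> (u, v) \<in> ?E\<^sup>*" if uv: "u \<in> V" "v \<in> V" for u v
  proof
    assume "same Q u v"
    then obtain U where U: "U \<in> Q" "u \<in> U" "v \<in> U" by (auto simp: same_def)
    then have "(u, v) \<in> ?Q" using quotient_eq_iff[OF eq, of U U u v] by (auto simp: Q_def)
    then show "(u, v) \<in> ?E\<^sup>*" by simp
  next
    assume "(u, v) \<in> ?E\<^sup>*"
    then have "v \<in> ?Q `` {u}" using uv by auto
    moreover have "u \<in> ?Q `` {u}" using uv by auto
    moreover have "?Q `` {u} \<in> Q" unfolding Q_def using uv(1) by (rule quotientI)
    ultimately show "same Q u v" unfolding same_def[of Q u v] by (intro bexI[of _ "?Q `` {u}"] conjI)
  qed
  have EP: "same P u v" if "(u, v) \<in> ?E\<^sup>*" "u \<in> V" for u v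
    using that(1)
  proof (induction rule: rtrancl_induct)
    case base
    then show ?case by (rule same_refl[OF pP that(2)])
  next
    case (step y z)
    then have "same P y z" by simp
    with step(3) show ?case by (rule same_trans[OF pP])
  qed
  have cutQ: "is_cut G Q" using uv0 EP sQ by (intro is_cutI[OF Q, of u0 v0]) auto
  have "xw (same Q) = xw (same P)"
    unfolding xw_def
  proof (intro sum.cong refl)
    fix u v assume uv: "u \<in> V" "v \<in> V"
    show "(if same Q u v then 0 else mu u v) = (if same P u v then 0 else mu u v)"
    proof (cases "same P u v \<and> mu u v > 0")
      case True
      then have "(u, v) \<in> ?E\<^sup>*" using uv by auto
      then show ?thesis using True sQ uv by simp
    next
      case False
      then show ?thesis using sQ[OF uv] EP[of u v] uv by auto
    qed
  qed
  then have sz: "cut_size G Q = min_cut_size G" using xw_cut_size[OF Q] xw_cut_size[OF pP] P by simp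
  have "connected_graph (induced_subgraph G U)" if U: "U \<in> Q" for U
  proof -
    have UV: "U \<subseteq> V" "U \<noteq> {}" using U Q by (auto simp: partition_on_def)
    have "(u, v) \<in> {(x, y). x \<in> U \<and> y \<in> U \<and> mu x y > 0}\<^sup>*" if uv: "u \<in> U" "v \<in> U" for u v
    proof -
      have uvV: "u \<in> V" "v \<in> V" using uv UV by auto
      have "(u, v) \<in> ?E\<^sup>*" using sQ[OF uvV] uv U by (auto simp: same_def)
      then have "(u, v) \<in> {(x, y). x \<in> U \<and> y \<in> U \<and> mu x y > 0}\<^sup>* \<and> v \<in> U"
      proof (induction rule: rtrancl_induct)
        case (step y z)
        then have "y \<in> V" "z \<in> V" by auto
        then have "same Q y z" using sQ step by auto
        moreover have "y \<in> U" using step by simp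
        ultimately obtain W where "W \<in> Q" "y \<in> W" "z \<in> W" by (auto simp: same_def)
        then have "z \<in> U" using disjointD[OF partition_onD2[OF Q]] U \<open>y \<in> U\<close> by blast
        then show ?case using step by (auto intro: rtrancl_into_rtrancl)
      qed (use uv in auto)
      then show ?thesis by simp
    qed
    then show ?thesis using conn_in_iff[OF UV] by (simp add: conn_in_def)
  qed
  then have "compact_cut G Q" using cutQ by (simp add: compact_cut_def)
  with sz that show thesis by blast
qed

section \<open>Weights and degrees under merging\<close>

lemma wt_sym: "wt lab r s = wt lab s r"
  unfolding wt_def by (subst sum.swap) (intro sum.cong refl, auto simp: mu_sym)

lemma wt_merge_other:
  assumes "r \<noteq> a" "r \<noteq> b" "s \<noteq> a" "s \<noteq> b"
  shows "wt (merge b a lab) r s = wt lab r s"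
  unfolding wt_def merge_def using assms by (intro sum.cong refl) auto

lemma wt_merge:
  assumes "a \<noteq> b" "s \<noteq> a" "s \<noteq> b"
  shows "wt (merge b a lab) a s = wt lab a s + wt lab b s"
  unfolding wt_def merge_def sum.distrib[symmetric] using assms by (intro sum.cong refl) auto

lemma dg_merge_other:
  assumes "r \<noteq> a" "r \<noteq> b"
  shows "dg (merge b a lab) r = dg lab r"
  unfolding dg_def merge_def using assms by (intro sum.cong refl) auto

text \<open>The edges between \<open>a\<close> and \<open>b\<close> become internal, after having
  been counted in both degrees.\<close>

lemma dg_merge:
  assumes "a \<noteq> b"
  shows "dg (merge b a lab) a + 2 * wt lab a b = dg lab a + dg lab b"
proof -
  have "dg (merge b a lab) a + (wt lab a b + wt lab b a) = dg lab a + dg lab b"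
    unfolding dg_def merge_def wt_def sum.distrib[symmetric] using assms by (intro sum.cong refl) auto
  then show ?thesis by (simp add: wt_sym[of lab b a])
qed

lemma wt_le_dg: "r \<noteq> s \<Longrightarrow> wt lab r s \<le> dg lab r"
  unfolding wt_def dg_def by (intro sum_mono) auto

lemma dg_reps:
  assumes l: "lab_ok lab" and r: "r \<in> lab ` V"
  shows "dg lab r = (\<Sum>s\<in>lab ` V - {r}. wt lab r s)"
proof -
  have "(\<Sum>s\<in>lab ` V - {r}. wt lab r s) = (\<Sum>u\<in>V. \<Sum>v\<in>V. \<Sum>s\<in>lab ` V - {r}. if lab u = r \<and> lab v = s then mu u v else 0)"
    unfolding wt_def by (rule sum_swap3[symmetric])
  also have "\<dots> = dg lab r" unfolding dg_def
  proof (intro sum.cong refl)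
    fix u v assume "u \<in> V" "v \<in> V"
    have "(\<Sum>s\<in>lab ` V - {r}. if lab u = r \<and> lab v = s then mu u v else 0)
        = (\<Sum>s\<in>lab ` V - {r}. if s = lab v then (if lab u = r then mu u v else 0) else 0)"
      by (intro sum.cong refl) auto
    then show "(\<Sum>s\<in>lab ` V - {r}. if lab u = r \<and> lab v = s then mu u v else 0)
       = (if lab u = r \<and> lab v \<noteq> r then mu u v else 0)" using \<open>v \<in> V\<close> by auto
  qed
  finally show ?thesis by simp
qed

end


section \<open>The number of small cuts\<close>

text \<open>The mean of \<open>y - 1\<close> and \<open>y\<close> with weights \<open>s\<close> and
  \<open>1 - s\<close> is \<open>y - s\<close>. With \<open>s\<close> the fractional part of
  \<open>a\<close>, multiplying these inequalities over \<open>y\<close> replaces a Gamma quotient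
  by the factorial and the power in \<open>coarse_bound\<close>.\<close>

lemma weighted_am_gm:
  fixes y s :: real
  assumes "y > 1" "0 \<le> s" "s \<le> 1"
  shows "(y - 1) powr s * y powr (1 - s) \<le> y - s"
proof -
  have cv: "convex_on {0<..} (\<lambda>x. - ln (x::real))" using minus_log_convex[of "exp 1"] by (simp add: log_def)
  have "- ln ((1 - s) *\<^sub>R y + s *\<^sub>R (y - 1)) \<le> (1 - s) * (- ln y) + s * (- ln (y - 1))"
    by (rule convex_onD[OF cv]) (use assms in auto)
  then have "s * ln (y - 1) + (1 - s) * ln y \<le> ln (y - s)" by (simp add: algebra_simps)
  then have "exp (s * ln (y - 1) + (1 - s) * ln y) \<le> exp (ln (y - s))" by simp
  then show ?thesis using assms by (simp add: powr_def exp_add)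
qed

lemma fact_le_pow: "j \<le> n \<Longrightarrow> (fact n :: real) \<le> real n ^ j * fact (n - j)"
proof -
  assume "j \<le> n"
  have "(fact n :: nat) = (fact n div fact (n - j)) * fact (n - j)"
    by (rule dvd_div_mult_self[symmetric]) (simp add: fact_dvd)
  also have "\<dots> \<le> n ^ j * fact (n - j)" by (intro mult_right_mono fact_div_fact_le_pow \<open>j \<le> n\<close>) simp
  finally have "real (fact n) \<le> real (n ^ j * fact (n - j))" by (rule of_nat_mono)
  then show ?thesis by simp
qed

text \<open>An upper bound for \<open>fact (j + 1) * (\<Prod>i=j+2..k. i / (i - a))\<close> with \<open>j = \<lfloor>a\<rfloor>\<close>.\<close>

definition coarse_bound :: "real \<Rightarrow> nat \<Rightarrow> real" where
  "coarse_bound a k = (let j = nat \<lfloor>a\<rfloor> in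
     if k \<le> j + 1 then fact k
     else fact k / (fact (k - j - 1) * real (k - j) powr (1 - (a - real j))))"

text \<open>Write \<open>a = j + s\<close> and \<open>y = k - j\<close>, so that
  \<open>k - a = y - s\<close>. After cancelling factorials, what remains is
  \<open>weighted_am_gm\<close> multiplied by \<open>(y - 1) powr (1 - s)\<close>.\<close>

lemma coarse_bound_step:
  assumes a: "a \<ge> 0" and k: "k > nat \<lfloor>a\<rfloor> + 1"
  shows "real k / (real k - a) * coarse_bound a (k - 1) \<le> coarse_bound a k"
proof -
  define j where "j = nat \<lfloor>a\<rfloor>"
  define s where "s = a - real j"
  have s: "0 \<le> s" "s < 1" using a unfolding s_def j_def by linarith+
  define y where "y = k - j"
  have y: "y \<ge> 2" "k = y + j" using k unfolding y_def j_def by auto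
  have ky: "real k - a = real y - s" using y s_def by simp
  \<comment> \<open>For \<open>y = 2\<close> the previous level falls into the factorial branch; the
    general formula agrees there, its denominator being 1.\<close>
  have b1: "coarse_bound a (k - 1) = fact (k - 1) / (fact (y - 2) * real (y - 1) powr (1 - s))"
    using y unfolding coarse_bound_def Let_def j_def[symmetric] s_def[symmetric]
    by (cases "y = 2") (auto simp: numeral_2_eq_2)
  have b2: "coarse_bound a k = fact k / (fact (y - 1) * real y powr (1 - s))"
    using y unfolding coarse_bound_def Let_def j_def[symmetric] s_def[symmetric] by auto
  have fk: "(fact k :: real) = real k * fact (k - 1)" using y by (intro fact_reduce) auto
  have fy: "(fact (y - 1) :: real) = real (y - 1) * fact (y - 2)" using y fact_reduce[of "y - 1", where 'a = real] by (simp add: numeral_2_eq_2)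
  have key: "real (y - 1) * real y powr (1 - s) \<le> (real y - s) * real (y - 1) powr (1 - s)"
  proof -
    have "(real y - 1) powr s * real y powr (1 - s) * (real y - 1) powr (1 - s) \<le> (real y - s) * (real y - 1) powr (1 - s)"
      by (intro mult_right_mono weighted_am_gm) (use y s in auto)
    moreover have "(real y - 1) powr s * (real y - 1) powr (1 - s) = real y - 1"
      using y by (simp flip: powr_add)
    ultimately show ?thesis using y by (simp add: of_nat_diff mult_ac)
  qed
  have "1 / ((real y - s) * real (y - 1) powr (1 - s)) \<le> 1 / (real (y - 1) * real y powr (1 - s))"
    by (rule divide_left_mono[OF key]) (use y s in auto)
  then have "real k * fact (k - 1) / fact (y - 2) * (1 / ((real y - s) * real (y - 1) powr (1 - s)))
     \<le> real k * fact (k - 1) / fact (y - 2) * (1 / (real (y - 1) * real y powr (1 - s)))"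
    by (rule mult_left_mono) simp
  then show ?thesis unfolding b1 b2 ky fk fy by (simp add: mult_ac)
qed

text \<open>The quotient of factorials contributes at most \<open>n ^ j * y\<close>, and
  \<open>y / y powr (1 - s) = y powr s\<close> is at most \<open>n powr s\<close>.\<close>

lemma coarse_bound_le:
  assumes a: "a \<ge> 0" and n: "n \<ge> 1"
  shows "coarse_bound a n \<le> real n powr a"
proof -
  define j where "j = nat \<lfloor>a\<rfloor>"
  define s where "s = a - real j"
  have s: "0 \<le> s" "s < 1" using a unfolding s_def j_def by linarith+
  show ?thesis
  proof (cases "n \<le> j + 1")
    case True
    have "(fact n :: real) \<le> real n ^ (n - 1) * fact (n - (n - 1))" by (rule fact_le_pow) simp
    also have "\<dots> = real n powr real (n - 1) * 1" using n by (subst powr_realpow) auto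
    also have "\<dots> \<le> real n powr a" using n True s s_def by (simp add: powr_mono)
    finally show ?thesis using True by (simp add: coarse_bound_def j_def)
  next
    case False
    define y where "y = n - j"
    have y: "y \<ge> 2" "n = y + j" using False unfolding y_def by auto
    have "(fact n :: real) \<le> real n ^ j * fact y" using fact_le_pow[of j n] y by simp
    also have "(fact y :: real) = real y * fact (y - 1)" using y by (intro fact_reduce) auto
    finally have 1: "fact n / (fact (y - 1) * real y powr (1 - s)) \<le> (real n ^ j * (real y * fact (y - 1))) / (fact (y - 1) * real y powr (1 - s))"
      by (rule divide_right_mono) simp
    also have "\<dots> = real n ^ j * (real y / real y powr (1 - s))" by simp
    also have "real y / real y powr (1 - s) = real y powr s"
      using y by (simp add: powr_diff)
    also have "real n ^ j * real y powr s \<le> real n ^ j * real n powr s"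
      using y s by (intro mult_left_mono powr_mono2) auto
    also have "\<dots> = real n powr a" using n by (simp add: s_def flip: powr_realpow powr_add)
    finally show ?thesis using False y unfolding coarse_bound_def Let_def j_def[symmetric] s_def[symmetric] by simp
  qed
qed

section \<open>Counting cuts of contracted graphs\<close>

context mgraph begin

text \<open>A partition of the representatives is determined by sending each index to the first one
  in its cluster. Index \<open>i\<close> then has at most \<open>i + 1\<close> possible
  values.\<close>

lemma card_coarser_le:
  assumes l: "lab_ok lab"
  shows "card {P. partition_on V P \<and> coarser P lab} \<le> fact (card (lab ` V))"
proof -
  let ?k = "card (lab ` V)"
  obtain e where e: "bij_betw e {0..<?k} (lab ` V)" using ex_bij_betw_nat_finite[of "lab ` V"] by auto
  let ?g = "\<lambda>P. \<lambda>i\<in>{0..<?k}. LEAST i'. same P (e i) (e i')"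
  have eV: "e i \<in> V" if "i < ?k" for i using bij_betwE[OF e] that reps_sub[OF l] by (metis atLeastLessThan_iff le0 subsetD)
  have "inj_on ?g {P. partition_on V P \<and> coarser P lab}"
  proof (rule inj_onI, clarify)
    fix P Q assume P: "partition_on V P" "coarser P lab" and Q: "partition_on V Q" "coarser Q lab" and eq: "?g P = ?g Q"
    have L: "same R (e i) (e (LEAST i'. same R (e i) (e i')))" if "partition_on V R" "i < ?k" for R i
      by (rule LeastI[of _ i]) (rule same_refl[OF that(1) eV[OF that(2)]])
    have g: "same R (e i) (e i') \<longleftrightarrow> ?g R i = ?g R i'" if R: "partition_on V R" and i: "i < ?k" "i' < ?k" for R i i'
    proof
      assume s: "same R (e i) (e i')"
      have "same R (e i) = same R (e i')"
      proof
        fix z show "same R (e i) z = same R (e i') z"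
          using same_trans[OF R s, of z] same_trans[OF R same_sym[OF s], of z] by argo
      qed
      then show "?g R i = ?g R i'" using i by simp
    next
      assume "?g R i = ?g R i'"
      then have "(LEAST m. same R (e i) (e m)) = (LEAST m. same R (e i') (e m))" using i by simp
      then show "same R (e i) (e i')" using L[OF R i(1)] same_sym[OF L[OF R i(2)]] same_trans[OF R] by metis
    qed
    show "P = Q"
    proof (rule partition_on_eqI[OF P(1) Q(1)])
      fix u v assume uv: "u \<in> V" "v \<in> V"
      then have "lab u \<in> e ` {0..<?k}" "lab v \<in> e ` {0..<?k}" using e by (auto simp: bij_betw_def)
      then obtain i i' where i: "i < ?k" "i' < ?k" "lab u = e i" "lab v = e i'" by auto
      have "same P u v = same P (lab u) (lab v)" using coarserD[OF P uv] by simp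
      also have "\<dots> = same Q (lab u) (lab v)" unfolding i(3,4) g[OF P(1) i(1,2)] g[OF Q(1) i(1,2)] eq ..
      also have "\<dots> = same Q u v" using coarserD[OF Q uv] by simp
      finally show "same P u v = same Q u v" .
    qed
  qed
  moreover have "?g ` {P. partition_on V P \<and> coarser P lab} \<subseteq> (\<Pi>\<^sub>E i\<in>{0..<?k}. {..i})"
    by (auto intro!: Least_le same_refl eV)
  ultimately have "card {P. partition_on V P \<and> coarser P lab} \<le> card (\<Pi>\<^sub>E i\<in>{0..<?k}. {..i})"
    by (intro card_inj_on_le) (auto intro: finite_PiE)
  also have "\<dots> = (\<Prod>i=0..<?k. Suc i)" by (simp add: card_PiE)
  also have "\<dots> = fact ?k" by (simp add: fact_prod_Suc)
  finally show ?thesis .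
qed

definition coarse_cuts :: "real \<Rightarrow> ('v \<Rightarrow> 'v) \<Rightarrow> 'v set set set" where
  "coarse_cuts \<alpha> lab = {P. partition_on V P \<and> coarser P lab \<and> 2 \<le> card P \<and> real (cut_size G P) \<le> \<alpha> * real (min_cut_size G)}"

lemma finite_coarse_cuts: "finite (coarse_cuts \<alpha> lab)"
  by (rule finite_subset[OF _ finitely_many_partition_on[of V]]) (auto simp: coarse_cuts_def)

lemma same_weight:
  assumes P: "partition_on V P" and l: "lab_ok lab" and c: "coarser P lab"
  shows "(\<Sum>r\<in>lab`V. \<Sum>s\<in>lab`V. if r \<noteq> s \<and> same P r s then wt lab r s else 0) + xw (same P) = xw (same (part lab))"
proof -
  have "(\<Sum>r\<in>lab`V. \<Sum>s\<in>lab`V. if r \<noteq> s \<and> same P r s then wt lab r s else 0) + xw (same P)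
    = (\<Sum>r\<in>lab`V. \<Sum>s\<in>lab`V. if same (part lab) r s then 0 else wt lab r s)"
    unfolding xw_reps[OF P l c, symmetric] sum.distrib[symmetric]
  proof (intro sum.cong refl)
    fix r s assume rs: "r \<in> lab ` V" "s \<in> lab ` V"
    then have "r \<in> V" "s \<in> V" "lab r = r" "lab s = s" using reps_sub[OF l] reps_fix[OF l] by blast+
    then show "(if r \<noteq> s \<and> same P r s then wt lab r s else 0) + (if same P r s then 0 else wt lab r s) = (if same (part lab) r s then 0 else wt lab r s)"
      using same_refl[OF P, of r] same_part[of r s lab] by (cases "r = s") simp_all
  qed
  then show ?thesis using xw_reps[OF part_partition l coarser_part[OF l]] by simp
qed

text \<open>Double counting of pairs consisting of a cut and an edge that does not cross it. Every
  cut leaves at least the fraction \<open>1 - 2 * \<alpha> / k\<close> of the weight uncrossed;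
  every edge, once contracted, leaves at most \<open>F\<close> cuts.\<close>

lemma coarse_cuts_step:
  assumes l: "lab_ok lab" and k: "card (lab ` V) \<ge> 2" "real (card (lab ` V)) > 2 * \<alpha>"
    and F: "\<And>lab'. lab_ok lab' \<Longrightarrow> card (lab' ` V) = card (lab ` V) - 1 \<Longrightarrow> real (card (coarse_cuts \<alpha> lab')) \<le> F"
  shows "real (card (coarse_cuts \<alpha> lab)) \<le> real (card (lab ` V)) / (real (card (lab ` V)) - 2 * \<alpha>) * F"
proof -
  let ?R = "lab ` V" and ?C = "coarse_cuts \<alpha> lab" and ?X = "real (min_cut_size G)"
  define k where "k = real (card ?R)"
  define W where "W = real (xw (same (part lab)))"
  have kpos: "k \<ge> 2" "k > 2 * \<alpha>" using assms k_def by auto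
  have "card V \<ge> 2" using k(1) card_image_le[OF finV, of lab] by simp
  then have Xpos: "?X > 0" using min_cut_pos by simp
  have W: "k * ?X \<le> W" using xw_ge[OF l k(1)] unfolding k_def W_def by (metis of_nat_mult of_nat_mono)
  have Wpos: "W > 0" using W Xpos kpos by (smt (verit) mult_pos_pos)
  have lower: "W * (1 - 2 * \<alpha> / k) \<le> real (\<Sum>r\<in>?R. \<Sum>s\<in>?R. if r \<noteq> s \<and> same P r s then wt lab r s else 0)" if P: "P \<in> ?C" for P
  proof -
    have h: "partition_on V P" "coarser P lab" "real (cut_size G P) \<le> \<alpha> * ?X" using P by (auto simp: coarse_cuts_def)
    have "W = real (\<Sum>r\<in>?R. \<Sum>s\<in>?R. if r \<noteq> s \<and> same P r s then wt lab r s else 0) + 2 * real (cut_size G P)"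
      using arg_cong[OF same_weight[OF h(1) l h(2)], of real] unfolding W_def xw_cut_size[OF h(1)]
      by (simp only: of_nat_add of_nat_mult of_nat_numeral)
    moreover have "2 * \<alpha> * ?X \<le> 2 * \<alpha> / k * W"
    \<comment> \<open>For negative \<alpha> the size bound on \<open>P\<close> is
      contradictory.\<close>
    proof (cases "\<alpha> \<ge> 0")
      case True
      have "2 * \<alpha> / k * (k * ?X) \<le> 2 * \<alpha> / k * W" using W True kpos by (intro mult_left_mono) auto
      then show ?thesis using kpos by simp
    next
      case False
      then have "\<alpha> * ?X < 0" using Xpos by (simp add: mult_neg_pos)
      then show ?thesis using h(3) by linarith
    qed
    ultimately show ?thesis using h(3) by (simp add: algebra_simps)
  qed
  have "real (card ?C) * (W * (1 - 2 * \<alpha> / k)) \<le> (\<Sum>P\<in>?C. real (\<Sum>r\<in>?R. \<Sum>s\<in>?R. if r \<noteq> s \<and> same P r s then wt lab r s else 0))"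
    using sum_mono[of ?C "\<lambda>_. W * (1 - 2 * \<alpha> / k)"] lower by simp
  also have "\<dots> = real (\<Sum>r\<in>?R. \<Sum>s\<in>?R. \<Sum>P\<in>?C. if r \<noteq> s \<and> same P r s then wt lab r s else 0)"
    unfolding of_nat_sum by (rule sum_swap3[symmetric])
  also have "\<dots> = (\<Sum>r\<in>?R. \<Sum>s\<in>?R. (if r \<noteq> s then real (wt lab r s) else 0) * real (card {P\<in>?C. same P r s}))"
    unfolding of_nat_sum
    by (intro sum.cong refl, rename_tac r s, case_tac "r = s")
       (simp_all add: if_distrib[of real] sum.If_cases finite_coarse_cuts Int_def mult.commute)
  also have "\<dots> \<le> (\<Sum>r\<in>?R. \<Sum>s\<in>?R. (if r \<noteq> s then real (wt lab r s) else 0) * F)"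
  proof (intro sum_mono)
    fix r s assume rs: "r \<in> ?R" "s \<in> ?R"
    show "(if r \<noteq> s then real (wt lab r s) else 0) * real (card {P\<in>?C. same P r s}) \<le> (if r \<noteq> s then real (wt lab r s) else 0) * F"
    proof (cases "r = s")
      case False
      have "{P\<in>?C. same P r s} \<subseteq> coarse_cuts \<alpha> (merge s r lab)"
        using merge_coarser[OF _ l _ rs(2)] by (auto simp: coarse_cuts_def)
      then have "card {P\<in>?C. same P r s} \<le> card (coarse_cuts \<alpha> (merge s r lab))"
        by (intro card_mono finite_coarse_cuts)
      also have "real \<dots> \<le> F"
        by (rule F[OF merge_ok[OF l rs False]]) (use merge_reps[OF l rs False] rs in simp)
      finally show ?thesis by (intro mult_left_mono) auto
    qed simp
  qed
  also have "\<dots> = W * F"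
  proof -
    have "(\<Sum>r\<in>?R. \<Sum>s\<in>?R. if r \<noteq> s then real (wt lab r s) else 0) = W"
    proof -
      have "(\<Sum>r\<in>?R. \<Sum>s\<in>?R. if r \<noteq> s then real (wt lab r s) else 0)
         = real (\<Sum>r\<in>?R. \<Sum>s\<in>?R. if same (part lab) r s then 0 else wt lab r s)"
        unfolding of_nat_sum
      proof (intro sum.cong refl)
        fix r s assume rs: "r \<in> lab ` V" "s \<in> lab ` V"
        then have "r \<in> V" "s \<in> V" "lab r = r" "lab s = s" using reps_sub[OF l] reps_fix[OF l] by blast+
        then show "(if r \<noteq> s then real (wt lab r s) else 0) = real (if same (part lab) r s then 0 else wt lab r s)"
          using same_part[of r s lab] by simp
      qed
      then show ?thesis unfolding W_def using xw_reps[OF part_partition l coarser_part[OF l]] by simp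
    qed
    then have "W * F = (\<Sum>r\<in>?R. \<Sum>s\<in>?R. if r \<noteq> s then real (wt lab r s) else 0) * F" by simp
    then show ?thesis unfolding sum_distrib_right by simp
  qed
  finally have "real (card ?C) * (1 - 2 * \<alpha> / k) \<le> F" using Wpos by (simp add: mult.left_commute)
  moreover have "1 - 2 * \<alpha> / k = (k - 2 * \<alpha>) / k" using kpos by (simp add: field_simps)
  ultimately show ?thesis using kpos unfolding k_def[symmetric] by (simp add: field_simps)
qed

lemma card_coarse_cuts:
  assumes "\<alpha> \<ge> 1"
  shows "lab_ok lab \<Longrightarrow> card (lab ` V) = k \<Longrightarrow> real (card (coarse_cuts \<alpha> lab)) \<le> coarse_bound (2 * \<alpha>) k"
proof (induction k arbitrary: lab)
  case 0
  then show ?case using V_ne by simp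
next
  case (Suc k)
  show ?case
  \<comment> \<open>At these levels \<open>k - 2 * \<alpha>\<close> may be negative or arbitrarily
    small, so all partitions are counted instead.\<close>
  proof (cases "Suc k \<le> nat \<lfloor>2 * \<alpha>\<rfloor> + 1")
    case True
    have "card (coarse_cuts \<alpha> lab) \<le> card {P. partition_on V P \<and> coarser P lab}"
      by (rule card_mono) (auto simp: coarse_cuts_def intro: finite_subset[OF _ finitely_many_partition_on[of V]])
    also have "\<dots> \<le> fact (Suc k)" using card_coarser_le[OF Suc.prems(1)] Suc.prems(2) by simp
    finally have "real (card (coarse_cuts \<alpha> lab)) \<le> real (fact (Suc k))" by (rule of_nat_mono)
    also have "\<dots> = coarse_bound (2 * \<alpha>) (Suc k)" using True by (simp only: coarse_bound_def Let_def if_True of_nat_fact)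
    finally show ?thesis .
  next
    case False
    have "real (card (coarse_cuts \<alpha> lab)) \<le> real (Suc k) / (real (Suc k) - 2 * \<alpha>) * coarse_bound (2 * \<alpha>) k"
      using coarse_cuts_step[OF Suc.prems(1), of \<alpha> "coarse_bound (2 * \<alpha>) k"] Suc False assms by simp linarith
    also have "\<dots> \<le> coarse_bound (2 * \<alpha>) (Suc k)"
      using coarse_bound_step[of "2 * \<alpha>" "Suc k"] False assms by simp
    finally show ?thesis .
  qed
qed

lemma small_compact_coarse: "small_compact_cuts \<alpha> G \<subseteq> coarse_cuts \<alpha> (\<lambda>v. v)"
  by (auto simp: small_compact_cuts_def coarse_cuts_def compact_cut_def is_cut_iff coarser_id)

lemma finite_small_compact_cuts: "finite (small_compact_cuts \<alpha> G)"
  using finite_subset[OF small_compact_coarse finite_coarse_cuts] .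

theorem card_small_compact_cuts:
  assumes "\<alpha> \<ge> 1"
  shows "real (card (small_compact_cuts \<alpha> G)) \<le> real (card V) powr (2 * \<alpha>)"
proof -
  have "card V \<ge> 1" using V_ne by (simp add: Suc_leI card_gt_0_iff)
  have "real (card (small_compact_cuts \<alpha> G)) \<le> real (card (coarse_cuts \<alpha> (\<lambda>v. v)))"
    by (intro of_nat_mono card_mono finite_coarse_cuts small_compact_coarse)
  also have "\<dots> \<le> coarse_bound (2 * \<alpha>) (card V)" by (rule card_coarse_cuts) (use assms in auto)
  also have "\<dots> \<le> real (card V) powr (2 * \<alpha>)" by (rule coarse_bound_le) (use assms \<open>card V \<ge> 1\<close> in auto)
  finally show ?thesis .
qed

end


section \<open>Weakest pre-expectations\<close>

text \<open>Nontermination counts as \<open>\<infinity>\<close>, so that an upper bound on \<open>wpm\<close> also bounds its probability.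
  An invariant is enforced by giving the value \<open>\<infinity>\<close> to the states that violate it.\<close>

definition wpm :: "'s spmf \<Rightarrow> ('s \<Rightarrow> ennreal) \<Rightarrow> ennreal" where
  "wpm p f = (\<integral>\<^sup>+ y. (case y of None \<Rightarrow> \<infinity> | Some t \<Rightarrow> f t) \<partial>measure_pmf p)"

lemma wpm_return [simp]: "wpm (return_spmf s) f = f s"
  by (simp add: wpm_def nn_integral_return_pmf)

lemma wpm_bind: "wpm (bind_spmf p h) f = wpm p (\<lambda>s. wpm (h s) f)"
proof -
  have "wpm (bind_spmf p h) f = (\<integral>\<^sup>+ y. (\<integral>\<^sup>+ z. (case z of None \<Rightarrow> \<infinity> | Some t \<Rightarrow> f t)
      \<partial>measure_pmf (case y of None \<Rightarrow> return_pmf None | Some a \<Rightarrow> h a)) \<partial>measure_pmf p)"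
    unfolding wpm_def bind_spmf_def by (rule nn_integral_bind_pmf)
  also have "\<dots> = wpm p (\<lambda>s. wpm (h s) f)"
    unfolding wpm_def
    by (intro nn_integral_cong) (simp split: option.split add: nn_integral_return_pmf)
  finally show ?thesis .
qed

lemma wpm_mono: "(\<And>s. f s \<le> g s) \<Longrightarrow> wpm p f \<le> wpm p g"
  unfolding wpm_def by (intro nn_integral_mono) (auto split: option.split)

text \<open>Nontermination contributes \<open>\<infinity>\<close> to both sides with the same
  probability.\<close>

lemma wpm_add: "wpm p (\<lambda>s. f s + g s) = wpm p f + wpm p g"
  unfolding wpm_def by (subst nn_integral_add[symmetric]) (auto intro!: nn_integral_cong split: option.split)

text \<open>The extra summand \<open>g\<close> keeps this true for an empty index set:
  \<open>wpm\<close> of the zero function is infinite unless termination is almost sure.\<close>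

lemma wpm_add_sum:
  "finite I \<Longrightarrow> wpm p (\<lambda>s. g s + (\<Sum>i\<in>I. f i s)) = wpm p g + (\<Sum>i\<in>I. wpm p (f i))"
proof (induction I rule: finite_induct)
  case (insert i I)
  have "wpm p (\<lambda>s. g s + (\<Sum>i\<in>insert i I. f i s)) = wpm p (\<lambda>s. f i s + (g s + (\<Sum>i\<in>I. f i s)))"
    using insert by (simp add: ac_simps)
  also have "\<dots> = wpm p (f i) + (wpm p g + (\<Sum>i\<in>I. wpm p (f i)))"
    using insert.IH by (simp add: wpm_add)
  finally show ?case using insert by (simp add: ac_simps)
qed simp

lemma expected_time_wpm: "expected_time p = wpm p (\<lambda>s. of_nat (clock s))"
  unfolding expected_time_def wpm_def by simp

text \<open>The lost mass is charged with \<open>\<infinity>\<close>, hence it is covered by the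
  bound on failure.\<close>

lemma measure_spmf_ge:
  assumes "wpm p (\<lambda>s. if s \<in> A then 0 else 1) \<le> ennreal b" "0 \<le> b"
  shows "measure (measure_spmf p) A \<ge> 1 - b"
proof -
  have "emeasure (measure_pmf p) (- (Some ` A)) = (\<integral>\<^sup>+ y. indicator (- (Some ` A)) y \<partial>measure_pmf p)" by simp
  also have "\<dots> \<le> wpm p (\<lambda>s. if s \<in> A then 0 else 1)"
    unfolding wpm_def by (intro nn_integral_mono) (auto split: option.split simp: indicator_def)
  also note assms(1)
  finally have "measure (measure_pmf p) (- (Some ` A)) \<le> b"
    using assms(2) by (simp add: measure_pmf.emeasure_eq_measure)
  moreover have "measure (measure_pmf p) (- (Some ` A)) = 1 - measure (measure_pmf p) (Some ` A)"
    using measure_pmf.prob_compl[of "Some ` A" p] by (simp add: Compl_eq_Diff_UNIV)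
  ultimately show ?thesis by (simp add: measure_measure_spmf_conv_measure_pmf)
qed

section \<open>Proof rules for programs\<close>

definition wp :: "real \<Rightarrow> nat \<Rightarrow> prog \<Rightarrow> (state \<Rightarrow> ennreal) \<Rightarrow> state \<Rightarrow> ennreal" where
  "wp \<alpha> B c f s = wpm (exec \<alpha> B c s) f"

lemma wp_Skip [simp]: "wp \<alpha> B Skip f s = f (tick s)"
  and wp_Assign [simp]: "wp \<alpha> B (Assign r e) f s = f (tick (s\<lparr>regs := (regs s)(r := exp_val \<alpha> B e s)\<rparr>))"
  and wp_Store [simp]: "wp \<alpha> B (Store a e) f s = f (tick (s\<lparr>mem := (mem s)(exp_val \<alpha> B a s := exp_val \<alpha> B e s)\<rparr>))"
  and wp_Report [simp]: "wp \<alpha> B (Report b' k) f s = f (tick (s\<lparr>reported := reported s @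
       [pointer_partition (exp_val \<alpha> B k s) (\<lambda>v. mem s ((exp_val \<alpha> B b' s + v) mod B))]\<rparr>))"
  and wp_Seq [simp]: "wp \<alpha> B (Seq c d) f s = wp \<alpha> B c (wp \<alpha> B d f) s"
  and wp_If [simp]: "wp \<alpha> B (If e c d) f s =
     (if exp_val \<alpha> B e s \<noteq> 0 then wp \<alpha> B c f (tick s) else wp \<alpha> B d f (tick s))"
  by (auto simp: wp_def[abs_def] wpm_bind cong: if_cong)

lemma wp_mono: "(\<And>s. f s \<le> g s) \<Longrightarrow> wp \<alpha> B c f s \<le> wp \<alpha> B c g s"
  unfolding wp_def by (rule wpm_mono)

lemma wp_Sample:
  assumes "exp_val \<alpha> B e s = k" "k > 0"
  shows "wp \<alpha> B (Sample r e) f s = (\<Sum>x<k. f (tick (s\<lparr>regs := (regs s)(r := x)\<rparr>))) / of_nat k"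
proof -
  have ne: "{..<k} \<noteq> {}" "finite {..<k}" using assms(2) by (auto intro: exI[of _ 0])
  have "map_spmf h (spmf_of_set {..<k}) = map_pmf (\<lambda>x. Some (h x)) (pmf_of_set {..<k})" for h :: "nat \<Rightarrow> state"
    using ne by (simp add: spmf_of_set_def spmf_of_pmf_def pmf.map_comp o_def)
  then show ?thesis using assms ne
    by (simp add: wp_def wpm_def Let_def nn_integral_pmf_of_set)
qed

lemma wp_Sample_le:
  assumes e: "exp_val \<alpha> B e s = k" "k > 0"
    and f: "\<And>x. x < k \<Longrightarrow> f (tick (s\<lparr>regs := (regs s)(r := x)\<rparr>)) \<le> ennreal (g x)"
    and g: "\<And>x. x < k \<Longrightarrow> 0 \<le> g x" "(\<Sum>x<k. g x) \<le> real k * b"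
  shows "wp \<alpha> B (Sample r e) f s \<le> ennreal b"
proof -
  have "wp \<alpha> B (Sample r e) f s \<le> (\<Sum>x<k. ennreal (g x)) / of_nat k"
    unfolding wp_Sample[OF e] by (intro divide_right_mono_ennreal sum_mono f) auto
  also have "\<dots> = ennreal ((\<Sum>x<k. g x) / real k)"
  proof -
    have "(\<Sum>x<k. ennreal (g x)) = ennreal (\<Sum>x<k. g x)" by (rule sum_ennreal) (use g(1) in auto)
    moreover have "0 \<le> (\<Sum>x<k. g x)" by (rule sum_nonneg) (use g(1) in auto)
    ultimately show ?thesis using e(2) by (simp add: divide_ennreal ennreal_of_nat_eq_real_of_nat)
  qed
  also have "\<dots> \<le> ennreal b"
    using g(2) e(2) by (intro ennreal_leI) (simp add: field_simps)
  finally show ?thesis .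
qed

lemma wp_While_unfold:
  "wp \<alpha> B (While e c) f s = (if exp_val \<alpha> B e s \<noteq> 0 then wp \<alpha> B c (wp \<alpha> B (While e c) f) (tick s) else f (tick s))"
  unfolding wp_def exec.simps by (subst while_spmf.simps) (simp add: wpm_bind)

text \<open>\<open>F\<close> is a supermartingale and \<open>V\<close> a variant that decreases on
  every outcome, because a violation costs \<open>\<infinity>\<close>. Loops are thus bounded from
  each start state, and induction on \<open>V\<close> replaces any limit argument.\<close>

lemma wp_While:
  fixes V :: "state \<Rightarrow> nat"
  assumes step: "\<And>s. I s \<Longrightarrow> exp_val \<alpha> B e s \<noteq> 0 \<Longrightarrow>
      wp \<alpha> B c (\<lambda>s'. if I s' \<and> V s' < V s then F s' else \<infinity>) (tick s) \<le> F s"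
    and exit: "\<And>s. I s \<Longrightarrow> exp_val \<alpha> B e s = 0 \<Longrightarrow> f (tick s) \<le> F s"
  shows "I s \<Longrightarrow> wp \<alpha> B (While e c) f s \<le> F s"
proof (induction "V s" arbitrary: s rule: less_induct)
  case less
  show ?case
  proof (cases "exp_val \<alpha> B e s = 0")
    case True
    then show ?thesis using exit less.prems by (subst wp_While_unfold) simp
  next
    case False
    have "wp \<alpha> B (While e c) f s = wp \<alpha> B c (wp \<alpha> B (While e c) f) (tick s)"
      using False by (subst wp_While_unfold) simp
    also have "\<dots> \<le> wp \<alpha> B c (\<lambda>s'. if I s' \<and> V s' < V s then F s' else \<infinity>) (tick s)"
      by (rule wp_mono) (use less.hyps in auto)
    also have "\<dots> \<le> F s" using step less.prems False by blast
    finally show ?thesis .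
  qed
qed

text \<open>For loops with a known number \<open>k\<close> of rounds: \<open>J i\<close> describes
  the state after \<open>i\<close> rounds, and the body is checked against every post-expectation
  that is bounded on \<open>J (Suc i)\<close>.\<close>

lemma wp_for_aux:
  assumes g: "\<And>i s. J i s \<Longrightarrow> i \<le> k \<Longrightarrow> (exp_val \<alpha> B e s \<noteq> 0) = (i < k)"
    and b: "\<And>i s f. J i s \<Longrightarrow> i < k \<Longrightarrow> (\<And>s'. J (Suc i) s' \<Longrightarrow> f s' \<le> b) \<Longrightarrow> wp \<alpha> B c f (tick s) \<le> b"
    and f: "\<And>s'. J k s' \<Longrightarrow> f (tick s') \<le> (b :: ennreal)"
  shows "J i s \<Longrightarrow> i \<le> k \<Longrightarrow> wp \<alpha> B (While e c) f s \<le> b"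
proof (induction "k - i" arbitrary: i s)
  case 0
  then show ?case using g f by (subst wp_While_unfold) auto
next
  case (Suc m)
  then have "i < k" by simp
  moreover have "wp \<alpha> B c (wp \<alpha> B (While e c) f) (tick s) \<le> b"
  proof (rule b[OF Suc.prems(1) \<open>i < k\<close>])
    fix s' assume "J (Suc i) s'"
    then show "wp \<alpha> B (While e c) f s' \<le> b" using Suc.hyps(1)[of "Suc i" s'] Suc.hyps(2) \<open>i < k\<close> by simp
  qed
  ultimately show ?case using g[OF Suc.prems] by (subst wp_While_unfold) simp
qed

lemma wp_for:
  assumes "J 0 s"
    and "\<And>i s. J i s \<Longrightarrow> i \<le> k \<Longrightarrow> (exp_val \<alpha> B e s \<noteq> 0) = (i < k)"
    and "\<And>i s f. J i s \<Longrightarrow> i < k \<Longrightarrow> (\<And>s'. J (Suc i) s' \<Longrightarrow> f s' \<le> b) \<Longrightarrow> wp \<alpha> B c f (tick s) \<le> b"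
    and "\<And>s'. J k s' \<Longrightarrow> f (tick s') \<le> (b :: ennreal)"
  shows "wp \<alpha> B (While e c) f s \<le> b"
proof (rule wp_for_aux[where J = J and k = k and i = 0])
  fix i s f assume "J i s" "i < k" "\<And>s'. J (Suc i) s' \<Longrightarrow> f s' \<le> b"
  then show "wp \<alpha> B c f (tick s) \<le> b" by (rule assms(3))
qed (use assms in auto)

lemma tick_simps [simp]: "regs (tick s) = regs s" "mem (tick s) = mem s" "reported (tick s) = reported s"
  "clock (tick s) = Suc (clock s)"
  by (simp_all add: tick_def)


section \<open>Contraction with undo\<close>

locale algo = mgraph G for G :: "(nat, nat) multigraph" +
  fixes n :: nat
  assumes verts_G: "verts G = {..<n}" and n2: "n \<ge> 2"
begin

text \<open>The vertices live at level \<open>k\<close> are \<open>rep 0, \<dots>, rep (k - 1)\<close>; the vertex \<open>rep j\<close> was merged into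
  \<open>par (rep j)\<close> when the level dropped from \<open>j + 1\<close> to \<open>j\<close>. \<open>lev rep par j\<close> maps every vertex to the
  live vertex representing it at level \<open>j\<close>.\<close>

primrec labd :: "(nat \<Rightarrow> nat) \<Rightarrow> (nat \<Rightarrow> nat) \<Rightarrow> nat \<Rightarrow> nat \<Rightarrow> nat" where
  "labd rep par 0 = (\<lambda>v. v)"
| "labd rep par (Suc d) = merge (rep (n - Suc d)) (par (rep (n - Suc d))) (labd rep par d)"

definition lev :: "(nat \<Rightarrow> nat) \<Rightarrow> (nat \<Rightarrow> nat) \<Rightarrow> nat \<Rightarrow> nat \<Rightarrow> nat" where
  "lev rep par j = labd rep par (n - j)"

definition fs :: "(nat \<Rightarrow> nat) \<Rightarrow> (nat \<Rightarrow> nat) \<Rightarrow> nat \<Rightarrow> nat" where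
  "fs x lab r = (\<Sum>u\<in>V. if lab u = r then x u else 0)"

text \<open>The rows of dead vertices keep the values of the level at which they died; this is what makes
  the contraction reversible.\<close>

definition good :: "(nat \<Rightarrow> nat) \<Rightarrow> nat \<Rightarrow> (nat \<Rightarrow> nat) \<Rightarrow> (nat \<Rightarrow> nat) \<Rightarrow> (nat \<Rightarrow> nat \<Rightarrow> nat) \<Rightarrow> (nat \<Rightarrow> nat) \<Rightarrow> (nat \<Rightarrow> nat) \<Rightarrow> bool" where
  "good x k rep par M D F \<longleftrightarrow> 1 \<le> k \<and> k \<le> n \<and> bij_betw rep {..<n} {..<n} \<and>
     (\<forall>r\<in>rep ` {..<k}. par r = r) \<and>
     (\<forall>m. k \<le> m \<and> m < n \<longrightarrow> par (rep m) \<in> rep ` {..<m}) \<and>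
     (\<forall>u<n. M u u = 0) \<and>
     (\<forall>r\<in>rep ` {..<k}. \<forall>s\<in>rep ` {..<k}. r \<noteq> s \<longrightarrow> M r s = wt (lev rep par k) r s) \<and>
     (\<forall>m. k \<le> m \<and> m < n \<longrightarrow> (\<forall>s\<in>rep ` {..<m}. M (rep m) s = wt (lev rep par (Suc m)) (rep m) s \<and>
                                  M s (rep m) = wt (lev rep par (Suc m)) s (rep m))) \<and>
     (\<forall>r\<in>rep ` {..<k}. D r = dg (lev rep par k) r \<and> F r = fs x (lev rep par k) r) \<and>
     (\<forall>m. k \<le> m \<and> m < n \<longrightarrow> D (rep m) = dg (lev rep par (Suc m)) (rep m) \<and> F (rep m) = fs x (lev rep par (Suc m)) (rep m)) \<and>
     (\<forall>j. k \<le> j \<and> j \<le> n \<longrightarrow> compact_lab (lev rep par j))"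

lemma lev_n: "lev rep par n = (\<lambda>v. v)" by (simp add: lev_def)

lemma lev_step: "j < n \<Longrightarrow> lev rep par j = merge (rep j) (par (rep j)) (lev rep par (Suc j))"
  by (simp add: lev_def Suc_diff_Suc[symmetric])

text \<open>Level \<open>j\<close> depends only on the merges recorded at positions from
  \<open>j\<close> on, so changes below leave the higher levels intact.\<close>

lemma lev_cong:
  assumes "\<And>i. j \<le> i \<Longrightarrow> i < n \<Longrightarrow> rep' i = rep i \<and> par' (rep i) = par (rep i)"
  shows "j \<le> n \<Longrightarrow> lev rep' par' j = lev rep par j"
  using assms
proof (induction "n - j" arbitrary: j)
  case 0
  then have "j = n" by simp
  then show ?case using lev_n by metis
next
  case (Suc d)
  then have "lev rep' par' (Suc j) = lev rep par (Suc j)" by (intro Suc.hyps(1)) auto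
  then show ?case using Suc by (simp add: lev_step)
qed

lemma rep_live:
  assumes "bij_betw rep {..<n} {..<n}" "j < n"
  shows "rep j < n" "rep j \<notin> rep ` {..<j}" "rep ` {..<Suc j} - {rep j} = rep ` {..<j}" "rep ` {..<j} \<subseteq> {..<n}"
proof -
  have inj: "inj_on rep {..<n}" and im: "rep ` {..<n} = {..<n}" using assms by (auto simp: bij_betw_def)
  show "rep j < n" using im assms by auto
  show ni: "rep j \<notin> rep ` {..<j}"
  proof
    assume "rep j \<in> rep ` {..<j}"
    then obtain x where "x < j" "rep j = rep x" by auto
    then show False using inj_onD[OF inj, of j x] assms by auto
  qed
  show "rep ` {..<Suc j} - {rep j} = rep ` {..<j}" using ni by (auto simp: lessThan_Suc)
  show "rep ` {..<j} \<subseteq> {..<n}" using im assms by (metis image_mono lessThan_subset_iff less_imp_le)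
qed

lemma live_card:
  assumes "bij_betw rep {..<n} {..<n}" "j \<le> n"
  shows "card (rep ` {..<j}) = j"
proof -
  have "inj_on rep {..<j}" by (rule inj_on_subset[of _ "{..<n}"]) (use assms in \<open>auto simp: bij_betw_def\<close>)
  then show ?thesis by (simp add: card_image)
qed

lemma lev_ok:
  assumes b: "bij_betw rep {..<n} {..<n}" and p: "\<And>m. k \<le> m \<Longrightarrow> m < n \<Longrightarrow> par (rep m) \<in> rep ` {..<m}"
  shows "k \<le> j \<Longrightarrow> j \<le> n \<Longrightarrow> lab_ok (lev rep par j) \<and> lev rep par j ` V = rep ` {..<j}"
proof (induction "n - j" arbitrary: j)
  case 0
  then have "j = n" by simp
  then show ?case using b by (simp add: lev_n verts_G bij_betw_def)
next
  case (Suc d)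
  have j: "j < n" using Suc by simp
  have IH: "lab_ok (lev rep par (Suc j))" "lev rep par (Suc j) ` V = rep ` {..<Suc j}"
    using Suc.hyps(1)[of "Suc j"] Suc by auto
  have pj: "par (rep j) \<in> rep ` {..<j}" using p[OF Suc.prems(1) j] .
  have h: "par (rep j) \<in> lev rep par (Suc j) ` V" "rep j \<in> lev rep par (Suc j) ` V" "par (rep j) \<noteq> rep j"
    unfolding IH(2) using pj rep_live(2)[OF b j] by (auto simp: lessThan_Suc)
  show ?case unfolding lev_step[OF j] using merge_ok[OF IH(1) h] merge_reps[OF IH(1) h] IH(2) rep_live(3)[OF b j] by simp
qed

lemma fs_merge_other: "r \<noteq> a \<Longrightarrow> r \<noteq> b \<Longrightarrow> fs x (merge b a lab) r = fs x lab r"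
  unfolding fs_def merge_def by (intro sum.cong refl) auto

lemma fs_merge: "a \<noteq> b \<Longrightarrow> fs x (merge b a lab) a = fs x lab a + fs x lab b"
  unfolding fs_def merge_def sum.distrib[symmetric] by (intro sum.cong refl) auto

lemma goodD:
  assumes "good x k rep par M D F"
  shows "1 \<le> k" "k \<le> n" "bij_betw rep {..<n} {..<n}"
    "\<And>r. r \<in> rep ` {..<k} \<Longrightarrow> par r = r"
    "\<And>m. k \<le> m \<Longrightarrow> m < n \<Longrightarrow> par (rep m) \<in> rep ` {..<m}"
    "\<And>u. u < n \<Longrightarrow> M u u = 0"
    "\<And>r s. r \<in> rep ` {..<k} \<Longrightarrow> s \<in> rep ` {..<k} \<Longrightarrow> r \<noteq> s \<Longrightarrow> M r s = wt (lev rep par k) r s"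
    "\<And>m s. k \<le> m \<Longrightarrow> m < n \<Longrightarrow> s \<in> rep ` {..<m} \<Longrightarrow> M (rep m) s = wt (lev rep par (Suc m)) (rep m) s"
    "\<And>m s. k \<le> m \<Longrightarrow> m < n \<Longrightarrow> s \<in> rep ` {..<m} \<Longrightarrow> M s (rep m) = wt (lev rep par (Suc m)) s (rep m)"
    "\<And>r. r \<in> rep ` {..<k} \<Longrightarrow> D r = dg (lev rep par k) r"
    "\<And>r. r \<in> rep ` {..<k} \<Longrightarrow> F r = fs x (lev rep par k) r"
    "\<And>m. k \<le> m \<Longrightarrow> m < n \<Longrightarrow> D (rep m) = dg (lev rep par (Suc m)) (rep m)"
    "\<And>m. k \<le> m \<Longrightarrow> m < n \<Longrightarrow> F (rep m) = fs x (lev rep par (Suc m)) (rep m)"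
    "\<And>j. k \<le> j \<Longrightarrow> j \<le> n \<Longrightarrow> compact_lab (lev rep par j)"
  using assms unfolding good_def by (simp_all only: Ball_def not_False_eq_True)

lemma goodI:
  assumes "1 \<le> k" "k \<le> n" "bij_betw rep {..<n} {..<n}"
    "\<And>r. r \<in> rep ` {..<k} \<Longrightarrow> par r = r"
    "\<And>m. k \<le> m \<Longrightarrow> m < n \<Longrightarrow> par (rep m) \<in> rep ` {..<m}"
    "\<And>u. u < n \<Longrightarrow> M u u = 0"
    "\<And>r s. r \<in> rep ` {..<k} \<Longrightarrow> s \<in> rep ` {..<k} \<Longrightarrow> r \<noteq> s \<Longrightarrow> M r s = wt (lev rep par k) r s"
    "\<And>m s. k \<le> m \<Longrightarrow> m < n \<Longrightarrow> s \<in> rep ` {..<m} \<Longrightarrow> M (rep m) s = wt (lev rep par (Suc m)) (rep m) s"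
    "\<And>m s. k \<le> m \<Longrightarrow> m < n \<Longrightarrow> s \<in> rep ` {..<m} \<Longrightarrow> M s (rep m) = wt (lev rep par (Suc m)) s (rep m)"
    "\<And>r. r \<in> rep ` {..<k} \<Longrightarrow> D r = dg (lev rep par k) r"
    "\<And>r. r \<in> rep ` {..<k} \<Longrightarrow> F r = fs x (lev rep par k) r"
    "\<And>m. k \<le> m \<Longrightarrow> m < n \<Longrightarrow> D (rep m) = dg (lev rep par (Suc m)) (rep m)"
    "\<And>m. k \<le> m \<Longrightarrow> m < n \<Longrightarrow> F (rep m) = fs x (lev rep par (Suc m)) (rep m)"
    "\<And>j. k \<le> j \<Longrightarrow> j \<le> n \<Longrightarrow> compact_lab (lev rep par j)"
  shows "good x k rep par M D F"
  unfolding good_def by (intro conjI ballI allI impI; (elim conjE)?; rule assms; assumption)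

lemma good_lev:
  assumes "good x k rep par M D F" "k \<le> j" "j \<le> n"
  shows "lab_ok (lev rep par j)" "lev rep par j ` V = rep ` {..<j}"
  using lev_ok[OF goodD(3)[OF assms(1)] goodD(5)[OF assms(1)]] assms by auto

lemma wt_id: "u \<in> V \<Longrightarrow> v \<in> V \<Longrightarrow> wt (\<lambda>v. v) u v = mu u v"
proof -
  assume uv: "u \<in> V" "v \<in> V"
  have "wt (\<lambda>v. v) u v = (\<Sum>u'\<in>V. if u' = u then (\<Sum>v'\<in>V. if v' = v then mu u' v' else 0) else 0)"
    unfolding wt_def by (intro sum.cong refl) auto
  then show ?thesis using uv by simp
qed

lemma dg_id: "u \<in> V \<Longrightarrow> dg (\<lambda>v. v) u = (\<Sum>v\<in>V. mu u v)"
proof -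
  assume u: "u \<in> V"
  have "dg (\<lambda>v. v) u = (\<Sum>u'\<in>V. if u' = u then (\<Sum>v'\<in>V. mu u' v') else 0)"
    unfolding dg_def by (intro sum.cong refl) (auto intro!: sum.cong)
  then show ?thesis using u by simp
qed

lemma good_init:
  assumes "\<And>u. u < n \<Longrightarrow> rep u = u" "\<And>u. u < n \<Longrightarrow> par u = u"
    "\<And>u v. u < n \<Longrightarrow> v < n \<Longrightarrow> M u v = mu u v"
    "\<And>u. u < n \<Longrightarrow> D u = (\<Sum>v<n. mu u v)" "\<And>u. u < n \<Longrightarrow> F u = x u"
  shows "good x n rep par M D F"
proof -
  have im: "rep ` {..<n} = {..<n}" using assms(1) by force
  then have b: "bij_betw rep {..<n} {..<n}" using assms(1) by (auto simp: bij_betw_def inj_on_def)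
  show ?thesis
    by (rule goodI) (use assms b n2 im in \<open>auto simp: lev_n wt_id dg_id verts_G fs_def compact_id\<close>)
qed

text \<open>The vertex \<open>b\<close> is swapped to position \<open>k - 1\<close>, which becomes
  the first dead one, and its row and column keep the weights of level \<open>k\<close>. Entries of
  \<open>a\<close> change only against live vertices; those against dead vertices belong to higher
  levels and stay frozen too.\<close>

lemma good_contract:
  assumes g: "good x k rep par M D F" and k: "2 \<le> k" and pq: "p < k" "q < k"
    and a: "a = rep p" and b: "b = rep q" and pos: "M a b > 0"
    and rep': "\<And>i. i < n \<Longrightarrow> rep' i = (rep(q := rep (k - 1), k - 1 := b)) i"
    and par': "\<And>u. u < n \<Longrightarrow> par' u = (par(b := a)) u"
    and M': "\<And>u v. u < n \<Longrightarrow> v < n \<Longrightarrow> M' u v =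
       (if u = a \<and> v = a then 0 else if u = a \<and> v \<in> rep ` {..<k} then M a v + M b v
        else if v = a \<and> u \<in> rep ` {..<k} then M a u + M b u else M u v)"
    and D': "\<And>u. u < n \<Longrightarrow> D' u = (D(a := D a + D b - 2 * M a b)) u"
    and F': "\<And>u. u < n \<Longrightarrow> F' u = (F(a := F a + F b)) u"
  shows "good x (k - 1) rep' par' M' D' F' \<and> (\<forall>j. k \<le> j \<and> j \<le> n \<longrightarrow> lev rep' par' j = lev rep par j) \<and>
     lev rep' par' (k - 1) = merge b a (lev rep par k)"
proof -
  let ?L = "lev rep par"
  note gd = goodD[OF g]
  have inj: "inj_on rep {..<n}" and im: "rep ` {..<n} = {..<n}" using gd(3) by (auto simp: bij_betw_def)
  have lt: "rep i < n" if "i < n" for i using im that by auto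
  have ab: "a \<noteq> b" using pos gd(6)[of a] lt[of p] pq gd(2) a by auto
  then have pq': "p \<noteq> q" using a b by auto
  have an: "a < n" "b < n" using lt pq gd(2) a b by auto
  have al: "a \<in> rep ` {..<k}" "b \<in> rep ` {..<k}" using pq a b by auto
  have live_ge: "rep' ` {..<m} = rep ` {..<m}" if "k \<le> m" "m \<le> n" for m
  proof -
    have "rep' ` {..<m} = (rep \<circ> Transposition.transpose q (k - 1)) ` {..<m}"
      by (rule image_cong) (use that rep' b in \<open>auto simp: Transposition.transpose_def\<close>)
    also have "\<dots> = rep ` (Transposition.transpose q (k - 1) ` {..<m})" by (simp add: image_comp)
    also have "Transposition.transpose q (k - 1) ` {..<m} = {..<m}" using that k pq by (simp add: transpose_image_eq)
    finally show ?thesis .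
  qed
  have rep_ge: "rep' i = rep i" if "k \<le> i" "i < n" for i using that rep'[of i] k pq by auto
  have repk: "rep' (k - 1) = b" using rep'[of "k - 1"] k gd(2) by auto
  have "inj_on rep' {..<n}" using live_ge[of n] gd(2) im by (intro eq_card_imp_inj_on) auto
  then have bij': "bij_betw rep' {..<n} {..<n}" using live_ge[of n] gd(2) im by (simp add: bij_betw_def)
  have live': "rep' ` {..<k - 1} = rep ` {..<k} - {b}"
    using rep_live(3)[OF bij', of "k - 1"] repk live_ge[of k] k gd(2) by simp
  have live_n: "rep ` {..<m} \<subseteq> {..<n}" if "m \<le> n" for m using im that by (metis image_mono lessThan_subset_iff)
  have dead: "rep m \<notin> rep ` {..<k}" "rep m \<noteq> a" "rep m \<noteq> b" if "k \<le> m" "m < n" for m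
  proof -
    show "rep m \<notin> rep ` {..<k}" using rep_live(2)[OF gd(3) that(2)] that(1) by auto
    then show "rep m \<noteq> a" "rep m \<noteq> b" using al by auto
  qed
  have lev_ge: "lev rep' par' j = ?L j" if "k \<le> j" "j \<le> n" for j
    by (rule lev_cong) (use that rep_ge par' lt dead in auto)
  have lev': "lev rep' par' (k - 1) = merge b a (?L k)"
    using lev_step[of "k - 1" rep' par'] repk k gd(2) lev_ge[of k] par'[OF an(2)] by simp
  have ok: "lab_ok (?L k)" "?L k ` V = rep ` {..<k}" using good_lev[OF g] gd(2) by auto
  have Mk: "M r s = wt (?L k) r s" if "r \<in> rep ` {..<k}" "s \<in> rep ` {..<k}" "r \<noteq> s" for r s using gd(7) that .
  have sub: "rep ` {..<k} \<subseteq> {..<n}" using live_n gd(2) by auto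
  have "good x (k - 1) rep' par' M' D' F'"
  proof (rule goodI)
    show "1 \<le> k - 1" "k - 1 \<le> n" using k gd(2) by auto
    show "bij_betw rep' {..<n} {..<n}" by (rule bij')
    show "par' r = r" if "r \<in> rep' ` {..<k - 1}" for r
      using that par'[of r] gd(4)[of r] sub unfolding live' by auto
    show "par' (rep' m) \<in> rep' ` {..<m}" if "k - 1 \<le> m" "m < n" for m
    proof (cases "m = k - 1")
      case True
      then show ?thesis using par'[OF an(2)] repk live' al ab by simp
    next
      case False
      then have m: "k \<le> m" using that by simp
      then show ?thesis using rep_ge[OF m that(2)] live_ge[OF m] that(2) gd(5)[OF m that(2)] par'[OF lt[OF that(2)]] dead[OF m that(2)] by simp
    qed
    show "M' u u = 0" if "u < n" for u
      using M'[OF that that] gd(6)[OF that] by auto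
    show "M' r s = wt (lev rep' par' (k - 1)) r s" if "r \<in> rep' ` {..<k - 1}" "s \<in> rep' ` {..<k - 1}" "r \<noteq> s" for r s
    proof -
      have rs: "r \<in> rep ` {..<k}" "r \<noteq> b" "s \<in> rep ` {..<k}" "s \<noteq> b" using that live' by auto
      then have n: "r < n" "s < n" using sub by auto
      show ?thesis unfolding lev' M'[OF n]
      proof (cases "r = a")
        case True
        then show "(if r = a \<and> s = a then 0 else if r = a \<and> s \<in> rep ` {..<k} then M a s + M b s
          else if s = a \<and> r \<in> rep ` {..<k} then M a r + M b r else M r s) = wt (merge b a (?L k)) r s"
          using wt_merge[OF ab, of s] that(3) rs al Mk[of a s] Mk[of b s] by auto
      next
        case False
        then show "(if r = a \<and> s = a then 0 else if r = a \<and> s \<in> rep ` {..<k} then M a s + M b s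
          else if s = a \<and> r \<in> rep ` {..<k} then M a r + M b r else M r s) = wt (merge b a (?L k)) r s"
          using wt_merge[OF ab, of r] wt_sym[of "merge b a (?L k)" r a] wt_merge_other[of r a b s] that(3) rs al Mk[of a r] Mk[of b r] Mk[of r s]
          by (cases "s = a") auto
      qed
    qed
    have old: "M' (rep m) s = M (rep m) s" "M' s (rep m) = M s (rep m)" if "k \<le> m" "m < n" "s \<in> rep ` {..<m}" for m s
    proof -
      have "s < n" using that live_n[of m] by auto
      then show "M' (rep m) s = M (rep m) s" "M' s (rep m) = M s (rep m)"
        using M'[of "rep m" s] M'[of s "rep m"] lt[OF that(2)] dead[OF that(1,2)] by auto
    qed
    show "M' (rep' m) s = wt (lev rep' par' (Suc m)) (rep' m) s" if m: "k - 1 \<le> m" "m < n" "s \<in> rep' ` {..<m}" for m s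
    proof (cases "m = k - 1")
      case True
      then have s: "s \<in> rep ` {..<k}" "s \<noteq> b" using m live' by auto
      \<comment> \<open>For \<open>s = a\<close> the new entry is \<open>M a b + M b b\<close>; the
        zero diagonal and the symmetry of \<open>wt\<close> turn it into the old one.\<close>
      then have "M' b s = M b s" using M'[of b s] an sub ab al gd(6)[of b] wt_sym[of "?L k" a b] Mk[of a b] Mk[of b a] by auto
      then show ?thesis using True repk k lev_ge[of k] gd(2) Mk[of b s] s al by simp
    next
      case False
      then have "k \<le> m" using m by simp
      then show ?thesis using old(1)[of m s] gd(8)[of m s] m rep_ge[of m] live_ge[of m] lev_ge[of "Suc m"] by simp
    qed
    show "M' s (rep' m) = wt (lev rep' par' (Suc m)) s (rep' m)" if m: "k - 1 \<le> m" "m < n" "s \<in> rep' ` {..<m}" for m s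
    proof (cases "m = k - 1")
      case True
      then have s: "s \<in> rep ` {..<k}" "s \<noteq> b" using m live' by auto
      then have "M' s b = M s b" using M'[of s b] an sub ab al gd(6)[of b] by auto
      then show ?thesis using True repk k lev_ge[of k] gd(2) Mk[of s b] s al by simp
    next
      case False
      then have "k \<le> m" using m by simp
      then show ?thesis using old(2)[of m s] gd(9)[of m s] m rep_ge[of m] live_ge[of m] lev_ge[of "Suc m"] by simp
    qed
    show "D' r = dg (lev rep' par' (k - 1)) r" "F' r = fs x (lev rep' par' (k - 1)) r" if "r \<in> rep' ` {..<k - 1}" for r
    proof -
      have r: "r \<in> rep ` {..<k}" "r \<noteq> b" "r < n" using that live' sub by auto
      have "D a + D b = dg (merge b a (?L k)) a + 2 * M a b"
        using dg_merge[OF ab, of "?L k"] gd(10)[of a] gd(10)[of b] al Mk[of a b] ab by simp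
      then show "D' r = dg (lev rep' par' (k - 1)) r"
        using D'[OF r(3)] dg_merge_other[of r a b "?L k"] gd(10)[of r] r unfolding lev' by (cases "r = a") auto
      show "F' r = fs x (lev rep' par' (k - 1)) r"
        using F'[OF r(3)] fs_merge_other[of r a b x "?L k"] fs_merge[OF ab, of x "?L k"] gd(11)[of r] gd(11)[of a] gd(11)[of b] r al
        unfolding lev' by (cases "r = a") auto
    qed
    show "D' (rep' m) = dg (lev rep' par' (Suc m)) (rep' m)" "F' (rep' m) = fs x (lev rep' par' (Suc m)) (rep' m)"
      if m: "k - 1 \<le> m" "m < n" for m
    proof -
      have "D' (rep' m) = dg (lev rep' par' (Suc m)) (rep' m) \<and> F' (rep' m) = fs x (lev rep' par' (Suc m)) (rep' m)"
      proof (cases "m = k - 1")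
        case True
        then show ?thesis using repk k lev_ge[of k] gd(2) D'[OF an(2)] F'[OF an(2)] ab gd(10)[of b] gd(11)[of b] al by simp
      next
        case False
        then have "k \<le> m" using m by simp
        then show ?thesis using D'[OF lt] F'[OF lt] dead[of m] gd(12)[of m] gd(13)[of m] m rep_ge[of m] lev_ge[of "Suc m"] by simp
      qed
      then show "D' (rep' m) = dg (lev rep' par' (Suc m)) (rep' m)" "F' (rep' m) = fs x (lev rep' par' (Suc m)) (rep' m)" by auto
    qed
    show "compact_lab (lev rep' par' j)" if "k - 1 \<le> j" "j \<le> n" for j
    proof (cases "j = k - 1")
      case True
      have "compact_lab (merge b a (?L k))"
        by (rule compact_merge) (use ok al ab gd(14)[of k] gd(2) pos Mk[of a b] in auto)
      then show ?thesis using True lev' by simp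
    next
      case False
      then show ?thesis using that lev_ge[of j] gd(14)[of j] by simp
    qed
  qed
  then show ?thesis using lev_ge lev' by blast
qed

lemma good_uncontract:
  assumes g: "good x k rep par M D F" and k: "k < n" and b: "b = rep k" and a: "a = par b"
    and par': "\<And>u. u < n \<Longrightarrow> par' u = (par(b := b)) u"
    and M': "\<And>u v. u < n \<Longrightarrow> v < n \<Longrightarrow> M' u v =
       (if u = a \<and> v = a then 0 else if u = a \<and> v \<in> rep ` {..<k} then M a v - M b v
        else if v = a \<and> u \<in> rep ` {..<k} then M a u - M b u else M u v)"
    and D': "\<And>u. u < n \<Longrightarrow> D' u = (D(a := D a + 2 * M a b - D b)) u"
    and F': "\<And>u. u < n \<Longrightarrow> F' u = (F(a := F a - F b)) u"
  shows "good x (Suc k) rep par' M' D' F' \<and> (\<forall>j. Suc k \<le> j \<and> j \<le> n \<longrightarrow> lev rep par' j = lev rep par j)"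
proof -
  let ?L = "lev rep par"
  note gd = goodD[OF g]
  have im: "rep ` {..<n} = {..<n}" using gd(3) by (auto simp: bij_betw_def)
  have lt: "rep i < n" if "i < n" for i using im that by auto
  have al: "a \<in> rep ` {..<k}" using gd(5)[of k] k a b by simp
  have bn: "b \<notin> rep ` {..<k}" using rep_live(2)[OF gd(3) k] b by simp
  have ab: "a \<noteq> b" using al bn by auto
  have live_n: "rep ` {..<m} \<subseteq> {..<n}" if "m \<le> n" for m using im that by (metis image_mono lessThan_subset_iff)
  have an: "a < n" "b < n" using lt[OF k] b al live_n[of k] k by auto
  have liveS: "rep ` {..<Suc k} = insert b (rep ` {..<k})" using b by (simp add: lessThan_Suc)
  have dead: "rep m \<notin> rep ` {..<Suc k}" "rep m \<noteq> a" "rep m \<noteq> b" if "Suc k \<le> m" "m < n" for m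
  proof -
    show "rep m \<notin> rep ` {..<Suc k}" using rep_live(2)[OF gd(3) that(2)] that(1) by auto
    then show "rep m \<noteq> a" "rep m \<noteq> b" using al liveS by auto
  qed
  have lev_ge: "lev rep par' j = ?L j" if "Suc k \<le> j" "j \<le> n" for j
    by (rule lev_cong) (use that par' lt dead in auto)
  have Lk: "?L k = merge b a (?L (Suc k))" using lev_step[OF k] a b by simp
  have Mb: "M b s = wt (?L (Suc k)) b s" "M s b = wt (?L (Suc k)) s b" if "s \<in> rep ` {..<k}" for s
    using gd(8)[of k s] gd(9)[of k s] that k b by auto
  have Ma: "M r s = wt (merge b a (?L (Suc k))) r s" if "r \<in> rep ` {..<k}" "s \<in> rep ` {..<k}" "r \<noteq> s" for r s
    using gd(7)[OF that] Lk by simp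
  have sub: "rep ` {..<k} \<subseteq> {..<n}" using live_n k by auto
  have "good x (Suc k) rep par' M' D' F'"
  proof (rule goodI)
    show "1 \<le> Suc k" "Suc k \<le> n" "bij_betw rep {..<n} {..<n}" using k gd(3) by auto
    show "par' r = r" if "r \<in> rep ` {..<Suc k}" for r
      using that par'[of r] gd(4)[of r] sub an unfolding liveS by auto
    show "par' (rep m) \<in> rep ` {..<m}" if "Suc k \<le> m" "m < n" for m
      using that gd(5)[of m] par'[OF lt[OF that(2)]] dead[OF that] by simp
    show "M' u u = 0" if "u < n" for u
      using M'[OF that that] gd(6)[OF that] by auto
    show "M' r s = wt (lev rep par' (Suc k)) r s" if rs: "r \<in> rep ` {..<Suc k}" "s \<in> rep ` {..<Suc k}" "r \<noteq> s" for r s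
    proof -
      have nn: "r < n" "s < n" using rs live_n[of "Suc k"] k by auto
      have eq: "lev rep par' (Suc k) = ?L (Suc k)" using lev_ge k by simp
      consider "r = b" | "s = b" "r \<noteq> b" | "r \<in> rep ` {..<k}" "s \<in> rep ` {..<k}" "r \<noteq> b" "s \<noteq> b"
        using rs liveS bn by auto
      then show ?thesis
      proof cases
        case 1
        then show ?thesis using M'[OF nn] eq Mb(1)[of s] rs liveS ab bn by auto
      next
        case 2
        then show ?thesis using M'[OF nn] eq Mb(2)[of r] rs liveS ab bn by auto
      next
        case 3
        show ?thesis unfolding eq M'[OF nn]
          using Ma[OF 3(1,2) rs(3)] Ma[of a s] Ma[of a r] Mb(1)[of s] Mb(1)[of r] wt_merge[OF ab, of s "?L (Suc k)"] wt_merge[OF ab, of r "?L (Suc k)"]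
            wt_merge_other[of r a b s "?L (Suc k)"] wt_sym[of "?L (Suc k)" r a] 3 al rs(3) by auto
      qed
    qed
    have old: "M' (rep m) s = M (rep m) s" "M' s (rep m) = M s (rep m)" if "Suc k \<le> m" "m < n" "s \<in> rep ` {..<m}" for m s
    proof -
      have "s < n" using that live_n[of m] by auto
      then show "M' (rep m) s = M (rep m) s" "M' s (rep m) = M s (rep m)"
        using M'[of "rep m" s] M'[of s "rep m"] lt[OF that(2)] dead[OF that(1,2)] liveS by auto
    qed
    show "M' (rep m) s = wt (lev rep par' (Suc m)) (rep m) s" "M' s (rep m) = wt (lev rep par' (Suc m)) s (rep m)"
      if m: "Suc k \<le> m" "m < n" "s \<in> rep ` {..<m}" for m s
      using old[OF m] gd(8)[of m s] gd(9)[of m s] m lev_ge[of "Suc m"] by auto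
    show "D' r = dg (lev rep par' (Suc k)) r" "F' r = fs x (lev rep par' (Suc k)) r" if "r \<in> rep ` {..<Suc k}" for r
    proof -
      have r: "r < n" using that live_n[of "Suc k"] k by auto
      have eq: "lev rep par' (Suc k) = ?L (Suc k)" using lev_ge k by simp
      have Db: "D b = dg (?L (Suc k)) b" "F b = fs x (?L (Suc k)) b" using gd(12)[of k] gd(13)[of k] k b by auto
      have Da: "D a = dg (merge b a (?L (Suc k))) a" "F a = fs x (merge b a (?L (Suc k))) a"
        using gd(10)[OF al] gd(11)[OF al] Lk by auto
      have Mab: "M a b = wt (?L (Suc k)) a b" using Mb(2)[OF al] .
      have rb: "r = b \<or> r \<in> rep ` {..<k} \<and> r \<noteq> b" using that liveS bn by auto
      show "D' r = dg (lev rep par' (Suc k)) r"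
        using D'[OF r] eq Db Da dg_merge[OF ab, of "?L (Suc k)"] Mab gd(10)[of r] rb Lk dg_merge_other[of r a b "?L (Suc k)"] by auto
      show "F' r = fs x (lev rep par' (Suc k)) r"
        using F'[OF r] eq Db Da fs_merge[OF ab, of x "?L (Suc k)"] gd(11)[of r] rb Lk fs_merge_other[of r a b x "?L (Suc k)"] by auto
    qed
    show "D' (rep m) = dg (lev rep par' (Suc m)) (rep m)" "F' (rep m) = fs x (lev rep par' (Suc m)) (rep m)"
      if m: "Suc k \<le> m" "m < n" for m
      using D'[OF lt[OF m(2)]] F'[OF lt[OF m(2)]] dead[OF m] gd(12)[of m] gd(13)[of m] m lev_ge[of "Suc m"] by auto
    show "compact_lab (lev rep par' j)" if "Suc k \<le> j" "j \<le> n" for j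
      using that lev_ge[of j] gd(14)[of j] by simp
  qed
  then show ?thesis using lev_ge by blast
qed

text \<open>Following a pointer never changes the label at level \<open>k\<close>, and every vertex
  is linked to its label by the pointers of successive merges. So the array needed for undoing
  serves as the reported union-find array.\<close>

lemma good_pointer_partition:
  assumes g: "good x k rep par M D F"
  shows "pointer_partition n par = part (lev rep par k)"
proof -
  let ?L = "lev rep par"
  note gd = goodD[OF g]
  define R where "R = {(v, par v) | v. v < n \<and> par v < n}"
  have im: "rep ` {..<n} = {..<n}" using gd(3) by (auto simp: bij_betw_def)
  have live_n: "rep ` {..<m} \<subseteq> {..<n}" if "m \<le> n" for m using im that by (metis image_mono lessThan_subset_iff)
  have fixl: "?L j v = v" if "k \<le> j" "j \<le> n" "v \<in> rep ` {..<j}" for j v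
    using good_lev[OF g that(1,2)] that(3) reps_fix by blast
  have Lpar: "?L k (par v) = ?L k v" if v: "v < n" for v
  proof -
    obtain m where m: "m < n" "v = rep m" using v im by (metis imageE lessThan_iff)
    show ?thesis
    proof (cases "m < k")
      case True
      then show ?thesis using gd(4)[of v] m by auto
    next
      case False
      then have km: "k \<le> m" by simp
      have "?L (Suc m) v = v" by (rule fixl) (use km m in auto)
      then have 1: "?L m v = par v" using lev_step[OF m(1)] m by (simp add: merge_def)
      have 2: "?L m (par v) = par v" by (rule fixl) (use km m gd(5)[of m] in auto)
      \<comment> \<open>At level \<open>m\<close> both vertices have the label \<open>par v\<close>,
        and all lower levels apply the same merges to both.\<close>
      have "j \<le> m \<Longrightarrow> k \<le> j \<Longrightarrow> ?L j v = ?L j (par v)" for j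
      proof (induction "m - j" arbitrary: j)
        case 0
        then show ?case using 1 2 by simp
      next
        case (Suc d)
        then have "?L (Suc j) v = ?L (Suc j) (par v)" by simp
        then show ?case using lev_step[of j rep par] Suc m by (simp add: merge_def)
      qed
      then show ?thesis using km by simp
    qed
  qed
  have conn: "(v, ?L j v) \<in> R\<^sup>*" if v: "v < n" and "k \<le> j" "j \<le> n" for j v
    using that(2,3)
  proof (induction "n - j" arbitrary: j)
    case 0
    then have "j = n" by simp
    then show ?case using lev_n by (metis rtrancl.rtrancl_refl)
  next
    case (Suc d)
    then have j: "j < n" by simp
    have IH: "(v, ?L (Suc j) v) \<in> R\<^sup>*" using Suc by simp
    have "par (rep j) < n" "rep j < n" using gd(5)[OF Suc.prems(1) j] live_n[of j] j im by auto
    then have "(rep j, par (rep j)) \<in> R" by (auto simp: R_def)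
    then show ?case using IH lev_step[OF j] by (auto simp: merge_def intro: rtrancl_into_rtrancl)
  qed
  have "(u, v) \<in> (R \<union> R\<inverse>)\<^sup>* \<longleftrightarrow> ?L k u = ?L k v" if uv: "u < n" "v < n" for u v
  proof
    assume "(u, v) \<in> (R \<union> R\<inverse>)\<^sup>*"
    then show "?L k u = ?L k v"
      by (induction rule: rtrancl_induct) (auto simp: R_def Lpar)
  next
    assume eq: "?L k u = ?L k v"
    have "R\<^sup>* \<subseteq> (R \<union> R\<inverse>)\<^sup>*" by (rule rtrancl_mono) auto
    then have 1: "(u, ?L k u) \<in> (R \<union> R\<inverse>)\<^sup>*" "(v, ?L k v) \<in> (R \<union> R\<inverse>)\<^sup>*" using conn uv gd(2) by auto
    have "sym ((R \<union> R\<inverse>)\<^sup>*)" by (rule sym_rtrancl) (rule sym_Un_converse)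
    then have "(?L k v, v) \<in> (R \<union> R\<inverse>)\<^sup>*" using 1(2) by (rule symD)
    then show "(u, v) \<in> (R \<union> R\<inverse>)\<^sup>*" using 1(1) eq by (metis rtrancl_trans)
  qed
  then have "{(u, v). u < n \<and> v < n \<and> (u, v) \<in> (R \<union> R\<inverse>)\<^sup>*} = {(u, v). u \<in> V \<and> v \<in> V \<and> ?L k u = ?L k v}"
    by (auto simp: verts_G)
  then show ?thesis unfolding pointer_partition_def part_def R_def[symmetric] Let_def by (simp add: verts_G)
qed

end


section \<open>The program\<close>

text \<open>Registers: 0 number of vertices, 1 level, 2 mode (1 while descending), 3 pass, 4 twice the least
  cut size seen, 5 loop counter, 6 twice the size and 7 the fingerprint of the current cut, 8 and 9 the
  vertices to be merged, 10 sample, 11 and 12 their positions, 13 to 15 scratch.\<close>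

definition eM :: "exp \<Rightarrow> exp \<Rightarrow> exp" where
  "eM e f = Plus (Times e (Reg 0)) f"

definition eP :: "exp \<Rightarrow> exp" where
  "eP e = Plus (Times (Reg 0) (Reg 0)) e"

text \<open>Five interleaved arrays: 0 degrees, 1 fingerprints, 2 live vertices, 3 pending revisits
  of a level, 4 marks of the fingerprints of reported cuts.\<close>

definition eX :: "nat \<Rightarrow> exp \<Rightarrow> exp" where
  "eX t e = Plus (Plus (Plus (Times (Reg 0) (Reg 0)) (Reg 0)) (Times (Const 8) e)) (Const t)"

fun block :: "prog list \<Rightarrow> prog" where
  "block [] = Skip"
| "block [c] = c"
| "block (c # cs) = Seq c (block cs)"

definition incr :: "nat \<Rightarrow> prog" where
  "incr r = Assign r (Plus (Reg r) (Const 1))"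

text \<open>The live degrees add up to twice the cut size, the squares of the live cluster sums to
  the fingerprint, so the current cut is evaluated in \<open>O(k)\<close> steps.\<close>

definition p_tot :: prog where
  "p_tot = block [Assign 5 (Const 0), Assign 6 (Const 0), Assign 7 (Const 0),
     While (Less (Reg 5) (Reg 1)) (block [
       Assign 13 (Load (eX 2 (Reg 5))),
       Assign 6 (Plus (Reg 6) (Load (eX 0 (Reg 13)))),
       Assign 7 (Plus (Reg 7) (Times (Load (eX 1 (Reg 13))) (Load (eX 1 (Reg 13))))),
       incr 5])]"

text \<open>Both sides of the comparison with \<alpha> are doubled sizes. Register 3 suppresses
  reports as long as the minimum is still being determined.\<close>

definition p_consider :: prog where
  "p_consider = block [
     If (Less (Reg 6) (Reg 4)) (Assign 4 (Reg 6)) Skip,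
     If (Reg 3) (If (LeAlpha (Reg 6) (Reg 4)) (If (Load (eX 4 (Reg 7))) Skip
       (block [Store (eX 4 (Reg 7)) (Const 1), Report (Times (Reg 0) (Reg 0)) (Reg 0)])) Skip) Skip]"

text \<open>The loop also writes a meaningless value to the diagonal entry of register 8, which is reset at the
  end.\<close>

definition p_merge_rows :: "(exp \<Rightarrow> exp \<Rightarrow> exp) \<Rightarrow> prog" where
  "p_merge_rows f = block [Assign 5 (Const 0),
     While (Less (Reg 5) (Reg 1)) (block [
       Assign 13 (Load (eX 2 (Reg 5))),
       Store (eM (Reg 8) (Reg 13)) (f (Load (eM (Reg 8) (Reg 13))) (Load (eM (Reg 9) (Reg 13)))),
       Store (eM (Reg 13) (Reg 8)) (Load (eM (Reg 8) (Reg 13))),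
       incr 5]),
     Store (eM (Reg 8) (Reg 8)) (Const 0)]"

text \<open>The matrix entry between the two vertices is read after their rows have been merged; it
  is still the old weight, because the diagonal is zero.\<close>

definition p_contract :: prog where
  "p_contract = block [p_merge_rows Plus,
     Store (eX 0 (Reg 8)) (Minus (Plus (Load (eX 0 (Reg 8))) (Load (eX 0 (Reg 9)))) (Times (Const 2) (Load (eM (Reg 8) (Reg 9))))),
     Store (eX 1 (Reg 8)) (Plus (Load (eX 1 (Reg 8))) (Load (eX 1 (Reg 9)))),
     Store (eP (Reg 9)) (Reg 8),
     Assign 1 (Minus (Reg 1) (Const 1)),
     Store (eX 2 (Reg 12)) (Load (eX 2 (Reg 1))),
     Store (eX 2 (Reg 1)) (Reg 9)]"

definition p_uncontract :: prog where
  "p_uncontract = block [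
     Assign 9 (Load (eX 2 (Reg 1))), Assign 8 (Load (eP (Reg 9))),
     p_merge_rows Minus,
     Store (eX 0 (Reg 8)) (Minus (Plus (Load (eX 0 (Reg 8))) (Times (Const 2) (Load (eM (Reg 8) (Reg 9))))) (Load (eX 0 (Reg 9)))),
     Store (eX 1 (Reg 8)) (Minus (Load (eX 1 (Reg 8))) (Load (eX 1 (Reg 9)))),
     Store (eP (Reg 9)) (Reg 9),
     incr 1]"

text \<open>\<open>HM\<close> bounds all fingerprints and hence the addresses of the mark array,
  whose cells are 8 words apart; being at least \<open>n\<close>, it also covers indices that are
  vertices or levels. \<open>B_weight\<close> excludes overflow in sums of degrees and doubled
  weights.\<close>

locale machine = algo G n for G :: "(nat, nat) multigraph" and n :: nat +
  fixes \<alpha> :: real and B HM :: nat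
  assumes B_addr: "n * n + 9 * n + 8 * HM + 100 < B" and B_weight: "4 * xw (=) + 4 < B" and n_HM: "n \<le> HM"
begin

abbreviation WP where "WP \<equiv> wp \<alpha> B"
abbreviation EV where "EV \<equiv> exp_val \<alpha> B"

section \<open>Memory layout\<close>

definition aM :: "nat \<Rightarrow> nat \<Rightarrow> nat" where "aM u v = u * n + v"
definition aP :: "nat \<Rightarrow> nat" where "aP v = n * n + v"
definition aX :: "nat \<Rightarrow> nat \<Rightarrow> nat" where "aX t v = n * n + n + 8 * v + t"

lemma aM_bound: "u < n \<Longrightarrow> v < n \<Longrightarrow> aM u v < n * n"
proof -
  assume uv: "u < n" "v < n"
  have "u * n + v < u * n + n" using uv by simp
  also have "\<dots> = Suc u * n" by simp
  also have "\<dots> \<le> n * n" using uv by (intro mult_right_mono) auto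
  finally show ?thesis by (simp add: aM_def)
qed

lemma aM_eq: "v < n \<Longrightarrow> v' < n \<Longrightarrow> aM u v = aM u' v' \<longleftrightarrow> u = u' \<and> v = v'"
proof -
  assume v: "v < n" "v' < n"
  have "(u * n + v) div n = u" "(u * n + v) mod n = v" "(u' * n + v') div n = u'" "(u' * n + v') mod n = v'"
    using v by auto
  then show ?thesis unfolding aM_def by metis
qed

lemma aX_eq [simp]: "t < 8 \<Longrightarrow> t' < 8 \<Longrightarrow> aX t v = aX t' v' \<longleftrightarrow> t = t' \<and> v = v'"
proof -
  assume t: "t < 8" "t' < 8"
  have "(8 * v + t) div 8 = v" "(8 * v + t) mod 8 = t" "(8 * v' + t') div 8 = v'" "(8 * v' + t') mod 8 = t'"
    using t by auto
  then have "8 * v + t = 8 * v' + t' \<longleftrightarrow> t = t' \<and> v = v'" by metis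
  then show ?thesis by (simp add: aX_def add.assoc)
qed

lemma aP_eq [simp]: "aP v = aP v' \<longleftrightarrow> v = v'" by (simp add: aP_def)

lemma aP_aX [simp]: "v < n \<Longrightarrow> aP v \<noteq> aX t w" "v < n \<Longrightarrow> aX t w \<noteq> aP v" by (auto simp: aP_def aX_def)

lemma aM_aP [simp]: "u < n \<Longrightarrow> v < n \<Longrightarrow> aM u v \<noteq> aP w" "u < n \<Longrightarrow> v < n \<Longrightarrow> aP w \<noteq> aM u v"
  using aM_bound[of u v] by (auto simp: aP_def)

lemma aM_aX [simp]: "u < n \<Longrightarrow> v < n \<Longrightarrow> aM u v \<noteq> aX t w" "u < n \<Longrightarrow> v < n \<Longrightarrow> aX t w \<noteq> aM u v"
  using aM_bound[of u v] by (auto simp: aX_def)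

lemma small_less [simp]: "v < n \<Longrightarrow> v < B" "v \<le> n \<Longrightarrow> v < B" "v < 100 \<Longrightarrow> v < B" "v \<le> HM \<Longrightarrow> v < B"
  using B_addr by auto

lemma B_simps [simp]: "0 < B" "B \<noteq> 0" "B \<noteq> Suc 0" "Suc 0 mod B = Suc 0"
  using B_addr by auto

lemma ev_X [simp]: "regs s 0 = n \<Longrightarrow> t < 8 \<Longrightarrow> EV e s \<le> HM \<Longrightarrow> EV (eX t e) s = aX t (EV e s)"
proof -
  assume h: "regs s 0 = n" "t < 8" "EV e s \<le> HM"
  define v where "v = EV e s"
  define m where "m = n * n"
  have "m + 9 * n + 8 * HM + 100 < B" "v \<le> HM" using B_addr h by (simp_all only: m_def v_def)
  then have b: "m < B" "m + n < B" "8 < B" "t < B" "8 * v < B" "m + n + 8 * v < B" "m + n + 8 * v + t < B"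
    using h(2) by linarith+
  show ?thesis unfolding eX_def aX_def exp_val.simps h(1) v_def[symmetric] m_def[symmetric]
    unfolding mod_less[OF b(1)] mod_less[OF b(2)] mod_less[OF b(3)] mod_less[OF b(4)] mod_less[OF b(5)] mod_less[OF b(6)] mod_less[OF b(7)] ..
qed

lemma ev_P [simp]: "regs s 0 = n \<Longrightarrow> EV e s < n \<Longrightarrow> EV (eP e) s = aP (EV e s)"
  using B_addr unfolding eP_def aP_def by simp

lemma ev_M [simp]: "regs s 0 = n \<Longrightarrow> EV e s < n \<Longrightarrow> EV f s < n \<Longrightarrow> EV (eM e f) s = aM (EV e s) (EV f s)"
proof -
  assume h: "regs s 0 = n" "EV e s < n" "EV f s < n"
  have "EV e s * n + EV f s < B" using aM_bound[OF h(2,3)] B_addr by (simp add: aM_def)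
  then show ?thesis using h unfolding eM_def aM_def by simp
qed

lemma less_HM [simp]: "v < n \<Longrightarrow> v \<le> HM" "v \<le> n \<Longrightarrow> v \<le> HM" using n_HM by auto

section \<open>The memory read as a contracted graph\<close>

abbreviation rp where "rp s \<equiv> \<lambda>i. mem s (aX 2 i)"
text \<open>Cut off outside the vertices, where the address would run into the next array; thus
  writes elsewhere leave the whole function unchanged.\<close>

abbreviation pr where "pr s \<equiv> \<lambda>v. if v < n then mem s (aP v) else 0"
abbreviation mt where "mt s \<equiv> \<lambda>u v. if u < n \<and> v < n then mem s (aM u v) else 0"
abbreviation de where "de s \<equiv> \<lambda>v. mem s (aX 0 v)"
abbreviation ff where "ff s \<equiv> \<lambda>v. mem s (aX 1 v)"
abbreviation fl where "fl s \<equiv> \<lambda>j. mem s (aX 3 j)"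
abbreviation hs where "hs s \<equiv> \<lambda>h. mem s (aX 4 h)"

text \<open>\<open>x\<close> is ghost data: the random vertex weights drawn at the start, which the
  memory shows only through sums over classes.\<close>

definition st :: "(nat \<Rightarrow> nat) \<Rightarrow> state \<Rightarrow> bool" where
  "st x s \<longleftrightarrow> regs s 0 = n \<and> (\<Sum>u<n. x u) ^ 2 \<le> HM \<and>
     good x (regs s 1) (rp s) (pr s) (mt s) (de s) (ff s)"

definition lv :: "state \<Rightarrow> nat \<Rightarrow> nat \<Rightarrow> nat" where
  "lv s j = lev (rp s) (pr s) j"

text \<open>For a partition this is the sum of the squared cluster sums of \<open>x\<close>, as
  \<open>hsh_reps\<close> shows. The double sum exhibits it as a quadratic form, which is what the
  collision bound needs.\<close>

definition hsh :: "(nat \<Rightarrow> nat) \<Rightarrow> (nat \<Rightarrow> nat \<Rightarrow> bool) \<Rightarrow> nat" where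
  "hsh x R = (\<Sum>u<n. \<Sum>v<n. if R u v then x u * x v else 0)"

lemma hsh_le: "(\<Sum>u<n. x u) ^ 2 \<le> HM \<Longrightarrow> hsh x R \<le> HM"
proof -
  have "hsh x R \<le> (\<Sum>u<n. \<Sum>v<n. x u * x v)" unfolding hsh_def by (intro sum_mono) auto
  also have "\<dots> = (\<Sum>u<n. x u) ^ 2" by (simp add: power2_eq_square sum_product)
  finally show "(\<Sum>u<n. x u) ^ 2 \<le> HM \<Longrightarrow> hsh x R \<le> HM" by simp
qed

lemma hsh_reps:
  assumes l: "lab_ok lab"
  shows "(\<Sum>r\<in>lab ` V. fs x lab r * fs x lab r) = hsh x (\<lambda>u v. lab u = lab v)"
proof -
  have "(\<Sum>r\<in>lab ` V. fs x lab r * fs x lab r) = (\<Sum>r\<in>lab ` V. \<Sum>u\<in>V. \<Sum>v\<in>V. (if lab u = r then x u else 0) * (if lab v = r then x v else 0))"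
    unfolding fs_def by (simp add: sum_product)
  also have "\<dots> = (\<Sum>u\<in>V. \<Sum>v\<in>V. \<Sum>r\<in>lab ` V. (if lab u = r then x u else 0) * (if lab v = r then x v else 0))"
    by (rule sum_swap3[symmetric])
  also have "\<dots> = (\<Sum>u\<in>V. \<Sum>v\<in>V. if lab u = lab v then x u * x v else 0)"
  proof (intro sum.cong refl)
    fix u v assume uv: "u \<in> V" "v \<in> V"
    have "(\<Sum>r\<in>lab ` V. (if lab u = r then x u else 0) * (if lab v = r then x v else 0))
       = (\<Sum>r\<in>lab ` V. if r = lab u then (if lab u = lab v then x u * x v else 0) else 0)"
      by (intro sum.cong refl) auto
    then show "(\<Sum>r\<in>lab ` V. (if lab u = r then x u else 0) * (if lab v = r then x v else 0)) = (if lab u = lab v then x u * x v else 0)"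
      using uv by simp
  qed
  finally show ?thesis by (simp add: hsh_def verts_G)
qed

lemma dg_le: "dg lab r \<le> xw (=)" unfolding dg_def xw_def by (intro sum_mono) auto
lemma xw_le: "xw R \<le> xw (=)" unfolding xw_def by (intro sum_mono) auto
lemma wt_le: "wt lab r s \<le> xw (=)" unfolding wt_def xw_def by (intro sum_mono) auto

lemma stD:
  assumes "st x s"
  shows "regs s 0 = n" "good x (regs s 1) (rp s) (pr s) (mt s) (de s) (ff s)" "1 \<le> regs s 1" "regs s 1 \<le> n"
    "(\<Sum>u<n. x u) ^ 2 \<le> HM"
proof -
  show *: "regs s 0 = n" "good x (regs s 1) (rp s) (pr s) (mt s) (de s) (ff s)" "(\<Sum>u<n. x u) ^ 2 \<le> HM"
    using assms unfolding st_def by simp_all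
  show "1 \<le> regs s 1" "regs s 1 \<le> n" using goodD(1,2)[OF *(2)] by simp_all
qed

lemma st_rp:
  assumes "st x s" "i < n" shows "rp s i < n"
  using rep_live(1)[OF goodD(3)[OF stD(2)[OF assms(1)]] assms(2)] .

lemma st_lab:
  assumes "st x s"
  shows "lab_ok (lv s (regs s 1))" "lv s (regs s 1) ` V = rp s ` {..<regs s 1}"
    "card (lv s (regs s 1) ` V) = regs s 1"
  using good_lev[OF stD(2)[OF assms]] live_card[OF goodD(3)[OF stD(2)[OF assms]]] stD(4)[OF assms]
  by (auto simp: lv_def)

lemma st_inj: "st x s \<Longrightarrow> inj_on (rp s) {..<n}"
  using goodD(3)[OF stD(2)] by (auto simp: bij_betw_def)

lemma st_sum: assumes "st x s" shows "(\<Sum>p<regs s 1. g (rp s p)) = (\<Sum>r\<in>lv s (regs s 1) ` V. g r)"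
proof -
  have "inj_on (rp s) {..<regs s 1}" using st_inj[OF assms] stD(4)[OF assms] by (rule_tac inj_on_subset) auto
  then show ?thesis unfolding st_lab(2)[OF assms] by (simp add: sum.reindex)
qed

lemma st_de: "st x s \<Longrightarrow> (\<Sum>p<regs s 1. de s (rp s p)) = xw (same (part (lv s (regs s 1))))"
proof -
  assume s: "st x s"
  have "(\<Sum>p<regs s 1. de s (rp s p)) = (\<Sum>p<regs s 1. dg (lv s (regs s 1)) (rp s p))"
    by (intro sum.cong refl) (use goodD(10)[OF stD(2)[OF s]] in \<open>auto simp: lv_def\<close>)
  then show ?thesis using st_sum[OF s, of "dg (lv s (regs s 1))"] dg_sum[OF st_lab(1)[OF s]] by simp
qed

lemma st_ff: "st x s \<Longrightarrow> (\<Sum>p<regs s 1. ff s (rp s p) * ff s (rp s p)) = hsh x (\<lambda>u v. lv s (regs s 1) u = lv s (regs s 1) v)"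
proof -
  assume s: "st x s"
  let ?f = "fs x (lv s (regs s 1))"
  have "(\<Sum>p<regs s 1. ff s (rp s p) * ff s (rp s p)) = (\<Sum>p<regs s 1. ?f (rp s p) * ?f (rp s p))"
    by (intro sum.cong refl) (use goodD(11)[OF stD(2)[OF s]] in \<open>auto simp: lv_def\<close>)
  then show ?thesis using st_sum[OF s, of "\<lambda>r. ?f r * ?f r"] hsh_reps[OF st_lab(1)[OF s]] by simp
qed

section \<open>Evaluating, reporting, contracting and undoing on the machine\<close>

lemma wp_tot:
  assumes s: "st x s"
    and f: "\<And>s'. (\<And>r. r \<notin> {5,6,7,13} \<Longrightarrow> regs s' r = regs s r) \<Longrightarrow>
      regs s' 6 = xw (same (part (lv s (regs s 1)))) \<Longrightarrow>
      regs s' 7 = hsh x (\<lambda>u v. lv s (regs s 1) u = lv s (regs s 1) v) \<Longrightarrow>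
      mem s' = mem s \<Longrightarrow> reported s' = reported s \<Longrightarrow> clock s' = clock s + 5 * regs s 1 + 4 \<Longrightarrow> f s' \<le> b"
  shows "WP p_tot f s \<le> b"
proof -
  let ?k = "regs s 1"
  define J where "J = (\<lambda>i (s' :: state). regs s' 5 = i \<and> regs s' 6 = (\<Sum>p<i. de s (rp s p)) \<and>
     regs s' 7 = (\<Sum>p<i. ff s (rp s p) * ff s (rp s p)) \<and> (\<forall>r. r \<notin> {5,6,7,13} \<longrightarrow> regs s' r = regs s r) \<and>
     mem s' = mem s \<and> reported s' = reported s \<and> clock s' = clock s + 3 + 5 * i)"
  have k: "?k \<le> n" using stD[OF s] by auto
  have WB: "(\<Sum>p<i. de s (rp s p)) < B" if "i \<le> ?k" for i
  proof -
    have "(\<Sum>p<i. de s (rp s p)) \<le> (\<Sum>p<?k. de s (rp s p))" by (rule sum_mono2) (use that in auto)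
    then show ?thesis using st_de[OF s] xw_le[of "same (part (lv s ?k))"] B_weight by linarith
  qed
  have HB: "(\<Sum>p<i. ff s (rp s p) * ff s (rp s p)) < B" if "i \<le> ?k" for i
  proof -
    have "(\<Sum>p<i. ff s (rp s p) * ff s (rp s p)) \<le> (\<Sum>p<?k. ff s (rp s p) * ff s (rp s p))" by (rule sum_mono2) (use that in auto)
    then show ?thesis using st_ff[OF s] hsh_le[OF stD(5)[OF s], of "\<lambda>u v. lv s ?k u = lv s ?k v"] B_addr by linarith
  qed
  show ?thesis unfolding p_tot_def block.simps wp_Seq wp_Assign
  proof (rule wp_for[where J = J and k = ?k], goal_cases)
    case 1
    show ?case by (simp add: J_def)
  next
    case (2 i s')
    then show ?case by (simp add: J_def)
  next
    case (3 i s' f)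
    then have J: "J i s'" and i: "i < ?k" and f: "\<And>s'. J (Suc i) s' \<Longrightarrow> f s' \<le> b" by auto
    have b1: "i < n" "rp s i < n" "Suc i < B" using i k st_rp[OF s, of i] by auto
    have b2: "(\<Sum>p<i. de s (rp s p)) + de s (rp s i) < B" "(\<Sum>p<i. ff s (rp s p) * ff s (rp s p)) + ff s (rp s i) * ff s (rp s i) < B"
      "ff s (rp s i) * ff s (rp s i) < B"
      using WB[of "Suc i"] HB[of "Suc i"] i by auto
    show ?case
      unfolding incr_def wp_Seq wp_Assign
      by (rule f) (use J b1 b2 stD(1)[OF s] in \<open>simp add: J_def\<close>)
  next
    case (4 s')
    then show ?case by (intro f) (use st_de[OF s] st_ff[OF s] in \<open>auto simp: J_def\<close>)
  qed
qed


lemma aX_ge [simp]: "n * n \<le> aX t v" and aP_ge [simp]: "n * n \<le> aP v"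
  by (auto simp: aX_def aP_def)

text \<open>Arrays 3 and 4 hold the pending visits and the marks; writing to them does not disturb
  the graph.\<close>

lemma st_cong:
  assumes "regs s' 0 = regs s 0" "regs s' 1 = regs s 1"
    "\<And>ad. (\<And>h. ad \<noteq> aX 3 h) \<Longrightarrow> (\<And>h. ad \<noteq> aX 4 h) \<Longrightarrow> mem s' ad = mem s ad"
  shows "st x s' = st x s" "lv s' = lv s"
proof -
  have "rp s' = rp s" "pr s' = pr s" "mt s' = mt s" "de s' = de s" "ff s' = ff s"
    by (rule ext assms(3) | simp add: assms(3))+
  then show "st x s' = st x s" "lv s' = lv s" unfolding st_def lv_def[abs_def] using assms by simp_all
qed

lemma pointer_partition_cong: "(\<And>v. v < m \<Longrightarrow> f v = g v) \<Longrightarrow> pointer_partition m f = pointer_partition m g"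
proof -
  assume h: "\<And>v. v < m \<Longrightarrow> f v = g v"
  have "{(v, f v) |v. v < m \<and> f v < m} = {(v, g v) |v. v < m \<and> g v < m}" using h by auto
  then show ?thesis unfolding pointer_partition_def by simp
qed

lemma wp_consider:
  assumes s: "st x s" and H: "regs s 7 \<le> HM"
    and f: "\<And>s'. (\<And>r. r \<noteq> 4 \<Longrightarrow> regs s' r = regs s r) \<Longrightarrow> regs s' 4 = min (regs s 4) (regs s 6) \<Longrightarrow>
      (\<And>ad. (\<And>h. ad \<noteq> aX 4 h) \<Longrightarrow> mem s' ad = mem s ad) \<Longrightarrow>
      (if regs s 3 \<noteq> 0 \<and> real (regs s 6) \<le> \<alpha> * real (regs s' 4) \<and> hs s (regs s 7) = 0
       then hs s' = (hs s)(regs s 7 := 1) \<and> reported s' = reported s @ [part (lv s (regs s 1))]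
       else hs s' = hs s \<and> reported s' = reported s) \<Longrightarrow>
      clock s' \<le> clock s + 10 \<Longrightarrow> f s' \<le> b"
  shows "WP p_consider f s \<le> b"
proof -
  have n: "regs s 0 = n" using stD[OF s] by simp
  have nB: "n * n < B" using B_addr by auto
  \<comment> \<open>The mark is written before the report, but outside the parent array.\<close>
  have pp: "pointer_partition n (\<lambda>v. ((mem s)(aX 4 (regs s 7) := 1)) ((n * n + v) mod B)) = part (lv s (regs s 1))"
  proof -
    have "pointer_partition n (\<lambda>v. ((mem s)(aX 4 (regs s 7) := 1)) ((n * n + v) mod B)) = pointer_partition n (pr s)"
    proof (rule pointer_partition_cong)
      fix v assume v: "v < n"
      have "n * n + v < B" using v B_addr by linarith
      moreover have "n * n + v \<noteq> aX 4 (regs s 7)" using v by (simp add: aX_def)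
      ultimately show "((mem s)(aX 4 (regs s 7) := 1)) ((n * n + v) mod B) = pr s v" using v by (simp add: aP_def)
    qed
    then show ?thesis using good_pointer_partition[OF stD(2)[OF s]] by (simp add: lv_def)
  qed
  define C where "C \<longleftrightarrow> regs s 3 \<noteq> 0 \<and> real (regs s 6) \<le> \<alpha> * real (min (regs s 4) (regs s 6)) \<and> hs s (regs s 7) = 0"
  have fin: "f S \<le> b" if S: "regs S = (regs s)(4 := min (regs s 4) (regs s 6))" "clock S \<le> clock s + 10"
     "mem S = (if C then (mem s)(aX 4 (regs s 7) := 1) else mem s)"
     "reported S = (if C then reported s @ [part (lv s (regs s 1))] else reported s)" for S
    by (rule f) (use S in \<open>auto simp: C_def\<close>)
  note pp' = pp[unfolded fun_upd_apply One_nat_def]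
  note simps = p_consider_def n H nB C_def pp'
  show ?thesis
  proof (cases "regs s 6 < regs s 4")
    case True
    then have m: "min (regs s 4) (regs s 6) = regs s 6" by simp
    show ?thesis unfolding p_consider_def block.simps
      by (cases "regs s 3 = 0"; cases "real (regs s 6) \<le> \<alpha> * real (regs s 6)"; cases "hs s (regs s 7) = 0";
          simp add: simps True; rule fin; simp add: simps m)
  next
    case False
    then have m: "min (regs s 4) (regs s 6) = regs s 4" by simp
    have r: "(regs s)(4 := regs s 4) = regs s" by simp
    show ?thesis unfolding p_consider_def block.simps
      by (cases "regs s 3 = 0"; cases "real (regs s 6) \<le> \<alpha> * real (regs s 4)"; cases "hs s (regs s 7) = 0";
          simp add: simps False; rule fin; simp add: simps m)
  qed
qed

text \<open>\<open>g\<close> is word addition for contraction and word subtraction for undo, so that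
  both share one loop proof.\<close>

lemma wp_merge_rows:
  assumes n: "regs s 0 = n" and k: "regs s 1 = k" "k \<le> n" and a: "regs s 8 = a" "a < n" and b: "regs s 9 = b" "b < n" "a \<noteq> b"
    and inj: "inj_on (rp s) {..<n}" and rn: "\<And>i. i < n \<Longrightarrow> rp s i < n"
    and op: "\<And>e1 e2 s. EV (oper e1 e2) s = g (EV e1 s) (EV e2 s)"
    and f: "\<And>s'. (\<And>r. r \<notin> {5, 13} \<Longrightarrow> regs s' r = regs s r) \<Longrightarrow>
      (\<And>u v. u < n \<Longrightarrow> v < n \<Longrightarrow> mem s' (aM u v) = (if u = a \<and> v = a then 0 else
          if u = a \<and> v \<in> rp s ` {..<k} then g (mem s (aM a v)) (mem s (aM b v))
          else if v = a \<and> u \<in> rp s ` {..<k} then g (mem s (aM a u)) (mem s (aM b u)) else mem s (aM u v))) \<Longrightarrow>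
      (\<And>ad. n * n \<le> ad \<Longrightarrow> mem s' ad = mem s ad) \<Longrightarrow> reported s' = reported s \<Longrightarrow>
      clock s' = clock s + 5 * k + 3 \<Longrightarrow> f s' \<le> z"
  shows "WP (p_merge_rows oper) f s \<le> z"
proof -
  define J where "J = (\<lambda>i (s' :: state). regs s' 5 = i \<and> (\<forall>r. r \<notin> {5, 13} \<longrightarrow> regs s' r = regs s r) \<and>
     (\<forall>u v. u < n \<longrightarrow> v < n \<longrightarrow> u \<noteq> a \<or> v \<noteq> a \<longrightarrow> mem s' (aM u v) =
         (if u = a \<and> v \<in> rp s ` {..<i} then g (mem s (aM a v)) (mem s (aM b v))
          else if v = a \<and> u \<in> rp s ` {..<i} then g (mem s (aM a u)) (mem s (aM b u)) else mem s (aM u v))) \<and>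
     (\<forall>ad. n * n \<le> ad \<longrightarrow> mem s' ad = mem s ad) \<and> reported s' = reported s \<and> clock s' = clock s + 1 + 5 * i)"
  have JD: "regs s' 5 = i" "\<And>r. r \<notin> {5, 13} \<Longrightarrow> regs s' r = regs s r"
      "\<And>u v. u < n \<Longrightarrow> v < n \<Longrightarrow> u \<noteq> a \<or> v \<noteq> a \<Longrightarrow> mem s' (aM u v) =
         (if u = a \<and> v \<in> rp s ` {..<i} then g (mem s (aM a v)) (mem s (aM b v))
          else if v = a \<and> u \<in> rp s ` {..<i} then g (mem s (aM a u)) (mem s (aM b u)) else mem s (aM u v))"
      "\<And>ad. n * n \<le> ad \<Longrightarrow> mem s' ad = mem s ad" "reported s' = reported s" "clock s' = clock s + 1 + 5 * i"
    if "J i s'" for i s'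
    using that unfolding J_def by (simp_all only: not_False_eq_True)
  show ?thesis unfolding p_merge_rows_def block.simps wp_Seq wp_Assign
  proof (rule wp_for[where J = J and k = k], goal_cases)
    case 1
    show ?case by (simp add: J_def)
  next
    case (2 i s')
    then show ?case using JD(1,2)[of i s'] k by simp
  next
    case (3 i s' f')
    then have J: "J i s'" and i: "i < k" and f: "\<And>s'. J (Suc i) s' \<Longrightarrow> f' s' \<le> z" by auto
    note jd = JD[OF J]
    define c where "c = rp s i"
    have i': "i < n" "i \<le> HM" "Suc i < B" using i k n_HM B_addr by auto
    have c: "c < n" using rn i' c_def by simp
    have rps: "rp s' i = c" unfolding c_def by (rule jd(4)) simp
    have r: "regs s' 0 = n" "regs s' 8 = a" "regs s' 9 = b" using jd(2)[of 0] jd(2)[of 8] jd(2)[of 9] n a b by auto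
    have cni: "c \<notin> rp s ` {..<i}"
    proof
      assume "c \<in> rp s ` {..<i}"
      then obtain i2 where "i2 < i" "rp s i = rp s i2" by (auto simp: c_def)
      then show False using inj_onD[OF inj, of i i2] i' by auto
    qed
    let ?y = "g (mem s' (aM a c)) (mem s' (aM b c))"
    \<comment> \<open>Positions of live vertices are distinct, so the two entries read in this round
      have not been overwritten in an earlier one.\<close>
    have y: "?y = g (mem s (aM a c)) (mem s (aM b c))" if "c \<noteq> a"
      using jd(3)[of a c] jd(3)[of b c] a b c that cni by simp
    let ?m = "(mem s')(aM a c := ?y, aM c a := ?y)"
    have live: "rp s ` {..<Suc i} = insert c (rp s ` {..<i})" by (simp add: lessThan_Suc c_def)
    have m: "?m (aM u v) = (if u = a \<and> v \<in> rp s ` {..<Suc i} then g (mem s (aM a v)) (mem s (aM b v))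
          else if v = a \<and> u \<in> rp s ` {..<Suc i} then g (mem s (aM a u)) (mem s (aM b u)) else mem s (aM u v))"
      if uv: "u < n" "v < n" "u \<noteq> a \<or> v \<noteq> a" for u v
    proof (cases "c \<noteq> a \<and> (u = a \<and> v = c \<or> u = c \<and> v = a)")
      case True
      have cin: "c \<in> rp s ` {..<Suc i}" unfolding live by simp
      from True show ?thesis
      proof (elim conjE disjE)
        assume "c \<noteq> a" "u = a" "v = c"
        then show ?thesis using y[OF \<open>c \<noteq> a\<close>] cin a c by (simp only: aM_eq fun_upd_apply simp_thms if_True if_False)
      next
        assume "c \<noteq> a" "u = c" "v = a"
        then show ?thesis using y[OF \<open>c \<noteq> a\<close>] cin a c by (simp only: aM_eq fun_upd_apply simp_thms if_True if_False)
      qed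
    next
      case False
      then have "aM u v \<noteq> aM a c" "aM u v \<noteq> aM c a" using uv a(2) c aM_eq[of v c u a] aM_eq[of v a u c] by metis+
      then have "?m (aM u v) = mem s' (aM u v)" by simp
      also note jd(3)[OF uv]
      finally have eq: "?m (aM u v) = (if u = a \<and> v \<in> rp s ` {..<i} then g (mem s (aM a v)) (mem s (aM b v))
          else if v = a \<and> u \<in> rp s ` {..<i} then g (mem s (aM a u)) (mem s (aM b u)) else mem s (aM u v))" .
      have e: "u = a \<longrightarrow> v \<noteq> c" "v = a \<longrightarrow> u \<noteq> c" using False uv(3) by blast+
      show ?thesis unfolding eq live insert_iff
        by (cases "u = a"; cases "v = a") (use e uv(3) in \<open>simp_all only: simp_thms if_True if_False\<close>)
    qed
    have fin: "J (Suc i) S" if S: "regs S = (regs s')(13 := c, 5 := Suc i)" "mem S = ?m" "reported S = reported s'" "clock S = clock s' + 5" for S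
      unfolding J_def S
    proof (intro conjI allI impI)
      fix u v assume "u < n" "v < n" "u \<noteq> a \<or> v \<noteq> a"
      then show "?m (aM u v) = (if u = a \<and> v \<in> rp s ` {..<Suc i} then g (mem s (aM a v)) (mem s (aM b v))
          else if v = a \<and> u \<in> rp s ` {..<Suc i} then g (mem s (aM a u)) (mem s (aM b u)) else mem s (aM u v))"
        by (rule m)
    next
      fix r assume "r \<notin> {5, 13::nat}" then show "((regs s')(13 := c, 5 := Suc i)) r = regs s r" using jd(2)[of r] by simp
    next
      fix ad assume "n * n \<le> ad"
      then show "?m ad = mem s ad" using jd(4)[of ad] aM_bound[OF a(2) c] aM_bound[OF c a(2)] by auto
    qed (use jd(5,6) in auto)
    show ?case unfolding incr_def wp_Seq wp_Assign wp_Store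
      by (rule f, rule fin) (use i' a b c in \<open>simp_all add: op r rps jd(1)\<close>)
  next
    case (4 s')
    note jd = JD[OF 4]
    have r: "regs s' 0 = n" "regs s' 8 = a" using jd(2)[of 0] jd(2)[of 8] n a by auto
    have "0 < B" using B_addr by simp
    have na: "ad \<noteq> aM a a" if "n * n \<le> ad" for ad using aM_bound[OF a(2) a(2)] that by auto
    show ?case unfolding wp_Store
      by (rule f) (use r a in \<open>simp_all add: aM_eq na jd(2,3,4,5,6)\<close>)
  qed
qed

lemma minus_mod [simp]:
  assumes "y \<le> x" "x < B"
  shows "(x + (B - y)) mod B = x - y" "(x + B - y) mod B = x - y"
proof -
  have 1: "x + (B - y) = (x - y) + B" "x + B - y = (x - y) + B" using assms by simp_all
  have "x - y < B" using assms by simp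
  then show "(x + (B - y)) mod B = x - y" "(x + B - y) mod B = x - y"
    unfolding 1 by simp_all
qed

lemma one_mod: "1 mod B = (1::nat)" by simp

lemma st_wt:
  assumes s: "st x s" and ij: "i < regs s 1" "j < regs s 1" "i \<noteq> j"
  shows "mem s (aM (rp s i) (rp s j)) = wt (lv s (regs s 1)) (rp s i) (rp s j)"
proof -
  have k: "regs s 1 \<le> n" using stD[OF s] by simp
  have "rp s i \<noteq> rp s j" using inj_onD[OF st_inj[OF s], of i j] ij k by auto
  then show ?thesis using goodD(7)[OF stD(2)[OF s], of "rp s i" "rp s j"] ij k st_rp[OF s, of i] st_rp[OF s, of j] by (simp add: lv_def)
qed

lemma wp_contract:
  assumes s: "st x s" and k: "regs s 1 = k" "2 \<le> k" and pq: "p < k" "regs s 12 = q" "q < k" "p \<noteq> q"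
    and a: "regs s 8 = a" "a = rp s p" and b: "regs s 9 = b" "b = rp s q" and pos: "mem s (aM a b) > 0"
    and f: "\<And>s'. st x s' \<Longrightarrow> regs s' 1 = k - 1 \<Longrightarrow> (\<And>r. r \<notin> {1, 5, 13} \<Longrightarrow> regs s' r = regs s r) \<Longrightarrow>
      (\<And>j. k \<le> j \<Longrightarrow> j \<le> n \<Longrightarrow> lv s' j = lv s j) \<Longrightarrow> lv s' (k - 1) = merge b a (lv s k) \<Longrightarrow>
      fl s' = fl s \<Longrightarrow> hs s' = hs s \<Longrightarrow> reported s' = reported s \<Longrightarrow> clock s' = clock s + 5 * k + 9 \<Longrightarrow> f s' \<le> z"
  shows "WP p_contract f s \<le> z"
proof -
  have kn: "k \<le> n" and n: "regs s 0 = n" using stD[OF s] k by auto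
  note gd = goodD[OF stD(2)[OF s], unfolded k]
  have lt: "rp s i < n" if "i < n" for i using st_rp[OF s that] .
  have an: "a < n" "b < n" using lt pq kn a b by auto
  have pqn: "p < n" "q < n" using pq kn by auto
  have ab: "a \<noteq> b" using inj_onD[OF st_inj[OF s], of p q] pq kn a b by auto
  have z: "mem s (aM u u) = 0" if "u < n" for u using gd(6)[OF that] that by simp
  have M: "mem s (aM r t) \<le> xw (=)" if "r \<in> rp s ` {..<k}" "t \<in> rp s ` {..<k}" for r t
  proof (cases "r = t")
    case True
    then show ?thesis using z lt that kn by auto
  next
    case False
    then have "mem s (aM r t) = wt (lev (rp s) (pr s) k) r t"
      using gd(7)[OF that False] lt that kn by auto
    then show ?thesis using wt_le by simp
  qed
  have live: "a \<in> rp s ` {..<k}" "b \<in> rp s ` {..<k}" using pq a b by auto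
  have plus: "(mem s (aM a v) + mem s (aM b v)) mod B = mem s (aM a v) + mem s (aM b v)" if "v \<in> rp s ` {..<k}" for v
    using M[OF live(1) that] M[OF live(2) that] B_weight by (intro mod_less) linarith
  have D: "mem s (aX 0 a) + mem s (aX 0 b) < B" "2 * mem s (aM a b) \<le> mem s (aX 0 a) + mem s (aX 0 b)" "2 * mem s (aM a b) < B"
  proof -
    have "mem s (aX 0 a) = dg (lev (rp s) (pr s) k) a" "mem s (aX 0 b) = dg (lev (rp s) (pr s) k) b"
      using gd(10) live by auto
    moreover have "mem s (aM a b) = wt (lev (rp s) (pr s) k) a b" using gd(7)[OF live ab] an by simp
    ultimately show "mem s (aX 0 a) + mem s (aX 0 b) < B" "2 * mem s (aM a b) \<le> mem s (aX 0 a) + mem s (aX 0 b)" "2 * mem s (aM a b) < B"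
      using dg_le[of "lev (rp s) (pr s) k" a] dg_le[of "lev (rp s) (pr s) k" b] B_weight
        wt_le_dg[OF ab, of "lev (rp s) (pr s) k"] wt_le_dg[OF ab[symmetric], of "lev (rp s) (pr s) k"]
        wt_sym[of "lev (rp s) (pr s) k" a b] by linarith+
  qed
  have F: "mem s (aX 1 a) + mem s (aX 1 b) < B"
  proof -
    have le: "fs x lab r \<le> (\<Sum>u<n. x u)" for lab r unfolding fs_def verts_G by (intro sum_mono) auto
    have "fs x (lev (rp s) (pr s) k) a + fs x (lev (rp s) (pr s) k) b \<le> 2 * (\<Sum>u<n. x u)" using le[of "lev (rp s) (pr s) k" a] le[of "lev (rp s) (pr s) k" b] by simp
    also have "(\<Sum>u<n. x u) \<le> (\<Sum>u<n. x u) ^ 2" by (simp add: power2_eq_square)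
    finally have "fs x (lev (rp s) (pr s) k) a + fs x (lev (rp s) (pr s) k) b \<le> 2 * HM" using stD(5)[OF s] by simp
    then show ?thesis using gd(11) live B_addr by simp
  qed
  have kB: "k < B" "k - 1 < n" "1 \<le> k" "k - 1 \<le> HM" "q \<le> HM" "a \<le> HM" "b \<le> HM" using k kn pqn an by auto
  show ?thesis unfolding p_contract_def block.simps wp_Seq
  proof (rule wp_merge_rows[OF n k(1) kn a(1) an(1) b(1) an(2) ab st_inj[OF s] lt, where g = "\<lambda>x y. (x + y) mod B"], goal_cases)
    case (3 s1)
    note regs1 = 3(1) and mem1 = 3(2) and hi = 3(3)
    have r: "regs s1 0 = n" "regs s1 1 = k" "regs s1 8 = a" "regs s1 9 = b" "regs s1 12 = q"
      using regs1[of 0] regs1[of 1] regs1[of 8] regs1[of 9] regs1[of 12] n k a b pq by auto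
    have h: "mem s1 (aX t v) = mem s (aX t v)" "mem s1 (aP v) = mem s (aP v)" for t v using hi by simp_all
    have Mab: "mem s1 (aM a b) = mem s (aM a b)"
      using mem1[OF an] ab live(2) z[OF an(2)] plus[OF live(2)] by simp
    let ?m = "(mem s1)(aX 0 a := mem s (aX 0 a) + mem s (aX 0 b) - 2 * mem s (aM a b),
       aX 1 a := mem s (aX 1 a) + mem s (aX 1 b), aP b := a, aX 2 q := rp s (k - 1), aX 2 (k - 1) := b)"
    have fin: "f S \<le> z" if S: "regs S = (regs s1)(1 := k - 1)" "mem S = ?m" "reported S = reported s1" "clock S = clock s1 + 6" for S
    proof -
      have g: "good x (k - 1) (rp S) (pr S) (mt S) (de S) (ff S) \<and> (\<forall>j. k \<le> j \<and> j \<le> n \<longrightarrow> lev (rp S) (pr S) j = lev (rp s) (pr s) j) \<and>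
         lev (rp S) (pr S) (k - 1) = merge b a (lev (rp s) (pr s) k)"
      proof (rule good_contract[OF stD(2)[OF s, unfolded k(1)] k(2) pq(1,3) a(2) b(2)], goal_cases)
        case 1
        then show ?case using pos an by simp
      next
        case (2 i)
        then show ?case using an by (simp add: S h)
      next
        case (3 u)
        then show ?case using an by (simp add: S h)
      next
        case (4 u v)
        then have "mt S u v = mem s1 (aM u v)" using an by (simp add: S)
        also note mem1[OF 4]
        also have "(if u = a \<and> v = a then 0 else if u = a \<and> v \<in> rp s ` {..<k} then (mem s (aM a v) + mem s (aM b v)) mod B
             else if v = a \<and> u \<in> rp s ` {..<k} then (mem s (aM a u) + mem s (aM b u)) mod B else mem s (aM u v))
          = (if u = a \<and> v = a then 0 else if u = a \<and> v \<in> rp s ` {..<k} then mt s a v + mt s b v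
             else if v = a \<and> u \<in> rp s ` {..<k} then mt s a u + mt s b u else mt s u v)"
          using 4 an by (simp only: plus simp_thms if_True cong: if_cong)
        finally show ?case .
      next
        case (5 u)
        then show ?case using an by (simp add: S h)
      next
        case (6 u)
        then show ?case using an by (simp add: S h)
      qed
      have "st x S" using g stD(5)[OF s] by (simp add: st_def S r)
      then show ?thesis
      proof (rule f)
        show "regs S 1 = k - 1" by (simp add: S)
        show "regs S r = regs s r" if "r \<notin> {1, 5, 13}" for r using regs1[of r] that by (simp add: S)
        show "lv S j = lv s j" if "k \<le> j" "j \<le> n" for j using g that by (simp add: lv_def)
        show "lv S (k - 1) = merge b a (lv s k)" using g by (simp add: lv_def)
        show "fl S = fl s" "hs S = hs s" using an by (simp_all add: S h fun_eq_iff)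
      qed (use 3 S in simp_all)
    qed
    show ?case
      apply (simp add: tick_def r h Mab an kB D F pqn one_mod del: One_nat_def)
      apply (rule fin)
      apply (simp_all add: r h del: One_nat_def)
      done
  qed simp_all
qed

lemma wp_uncontract:
  assumes s: "st x s" and k: "regs s 1 = k" "k < n"
    and f: "\<And>s'. st x s' \<Longrightarrow> regs s' 1 = Suc k \<Longrightarrow> (\<And>r. r \<notin> {1, 5, 8, 9, 13} \<Longrightarrow> regs s' r = regs s r) \<Longrightarrow>
      (\<And>j. Suc k \<le> j \<Longrightarrow> j \<le> n \<Longrightarrow> lv s' j = lv s j) \<Longrightarrow>
      fl s' = fl s \<Longrightarrow> hs s' = hs s \<Longrightarrow> reported s' = reported s \<Longrightarrow> clock s' = clock s + 5 * k + 9 \<Longrightarrow> f s' \<le> z"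
  shows "WP p_uncontract f s \<le> z"
proof -
  have n: "regs s 0 = n" using stD[OF s] k by auto
  note gd = goodD[OF stD(2)[OF s], unfolded k]
  let ?L = "lev (rp s) (pr s)"
  define b where "b = rp s k"
  define a where "a = pr s b"
  have lt: "rp s i < n" if "i < n" for i using st_rp[OF s that] .
  have al: "a \<in> rp s ` {..<k}" using gd(5)[OF order_refl k(2)] unfolding a_def b_def .
  have bn: "b \<notin> rp s ` {..<k}" using rep_live(2)[OF gd(3) k(2)] b_def by simp
  have ab: "a \<noteq> b" using al bn by auto
  have an: "a < n" "b < n" using lt[OF k(2)] b_def al lt k by auto
  have a': "a = mem s (aP b)" using an(2) by (simp add: a_def)
  have sub: "v < n" if "v \<in> rp s ` {..<k}" for v using that lt k by auto
  have z: "mem s (aM u u) = 0" if "u < n" for u using gd(6)[OF that] that by simp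
  have Lk: "?L k = merge b a (?L (Suc k))" using lev_step[OF k(2)] a_def b_def by simp
  have Mb: "mem s (aM b v) = wt (?L (Suc k)) b v" "mem s (aM v b) = wt (?L (Suc k)) v b" if "v \<in> rp s ` {..<k}" for v
    using gd(8)[of k v] gd(9)[of k v] that k b_def an sub[OF that] by auto
  \<comment> \<open>No wrap-around occurs: by \<open>wt_merge\<close> the row of \<open>a\<close>
    contains that of \<open>b\<close>. The diagonal entry is left out, as it is reset
    separately.\<close>
  have minus: "(mem s (aM a v) + (B - mem s (aM b v))) mod B = mem s (aM a v) - mem s (aM b v)" if v: "v \<in> rp s ` {..<k}" "v \<noteq> a" for v
  proof (rule minus_mod(1))
    have "mem s (aM a v) = wt (?L k) a v" using gd(7)[OF al v(1)] v an sub by auto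
    moreover have "v \<noteq> b" using v bn by auto
    ultimately have "mem s (aM a v) = wt (?L (Suc k)) a v + wt (?L (Suc k)) b v" using wt_merge[OF ab v(2)] Lk by simp
    then show "mem s (aM b v) \<le> mem s (aM a v)" using Mb[OF v(1)] by simp
    show "mem s (aM a v) < B" using \<open>mem s (aM a v) = wt (?L k) a v\<close> wt_le[of "?L k" a v] B_weight by linarith
  qed
  have D: "mem s (aX 0 a) + 2 * mem s (aM a b) < B" "mem s (aX 0 b) \<le> mem s (aX 0 a) + 2 * mem s (aM a b)" "2 * mem s (aM a b) < B"
  proof -
    have "mem s (aX 0 a) = dg (?L k) a" "mem s (aX 0 b) = dg (?L (Suc k)) b"
      using gd(10)[OF al] gd(12)[of k] k b_def by auto
    then show "mem s (aX 0 a) + 2 * mem s (aM a b) < B" "mem s (aX 0 b) \<le> mem s (aX 0 a) + 2 * mem s (aM a b)" "2 * mem s (aM a b) < B"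
      using dg_merge[OF ab, of "?L (Suc k)"] Lk Mb(2)[OF al] dg_le[of "?L k" a] wt_le[of "?L (Suc k)" a b] B_weight by simp_all
  qed
  have le: "fs x lab r \<le> HM" for lab r
  proof -
    have "fs x lab r \<le> (\<Sum>u<n. x u)" unfolding fs_def verts_G by (intro sum_mono) auto
    also have "(\<Sum>u<n. x u) \<le> (\<Sum>u<n. x u) ^ 2" by (simp add: power2_eq_square)
    finally show ?thesis using stD(5)[OF s] by simp
  qed
  have F: "mem s (aX 1 a) < B" "mem s (aX 1 b) \<le> mem s (aX 1 a)"
  proof -
    have "mem s (aX 1 a) = fs x (?L k) a" "mem s (aX 1 b) = fs x (?L (Suc k)) b"
      using gd(11)[OF al] gd(13)[of k] k b_def by auto
    then show "mem s (aX 1 a) < B" "mem s (aX 1 b) \<le> mem s (aX 1 a)"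
      using fs_merge[OF ab, of x "?L (Suc k)"] Lk le[of "?L k" a] B_addr by simp_all
  qed
  have kB: "Suc k < B" "k \<le> HM" "a \<le> HM" "b \<le> HM" "k < n" using k an by auto
  define s0 where "s0 = s\<lparr>regs := (regs s)(9 := b, 8 := a), clock := clock s + 2\<rparr>"
  have s0: "mem s0 = mem s" "reported s0 = reported s" "clock s0 = clock s + 2" "regs s0 0 = n" "regs s0 1 = k" "regs s0 8 = a" "regs s0 9 = b"
    "\<And>r. r \<notin> {1, 5, 8, 9, 13} \<Longrightarrow> regs s0 r = regs s r"
    using n k by (simp_all add: s0_def)
  \<comment> \<open>The two \<open>Skip\<close> stand for the assignments already executed in
    \<open>s0\<close>; \<open>tl\<close> removes them, which leaves the rest of the program as a
    block.\<close>
  have "WP p_uncontract f s = WP (block (tl (tl [Skip, Skip,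
     p_merge_rows Minus,
     Store (eX 0 (Reg 8)) (Minus (Plus (Load (eX 0 (Reg 8))) (Times (Const 2) (Load (eM (Reg 8) (Reg 9))))) (Load (eX 0 (Reg 9)))),
     Store (eX 1 (Reg 8)) (Minus (Load (eX 1 (Reg 8))) (Load (eX 1 (Reg 9)))),
     Store (eP (Reg 9)) (Reg 9),
     incr 1]))) f s0"
    unfolding p_uncontract_def block.simps wp_Seq wp_Assign list.sel
    by (rule arg_cong[where f = "WP _ _"]) (use n k kB an in \<open>simp add: s0_def tick_def b_def[symmetric] a'[symmetric]\<close>)
  also have "\<dots> \<le> z" unfolding list.sel block.simps wp_Seq
  proof (rule wp_merge_rows[OF s0(4,5) _ s0(6) an(1) s0(7) an(2) ab, where g = "\<lambda>x y. (x + (B - y)) mod B"], unfold s0(1-3), goal_cases)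
    case (5 s1)
    note regs1 = 5(1) and mem1 = 5(2) and hi = 5(3)
    have r: "regs s1 0 = n" "regs s1 1 = k" "regs s1 8 = a" "regs s1 9 = b"
      using regs1[of 0] regs1[of 1] regs1[of 8] regs1[of 9] s0 by auto
    have h: "mem s1 (aX t v) = mem s (aX t v)" "mem s1 (aP v) = mem s (aP v)" for t v using hi by simp_all
    have Mab: "mem s1 (aM a b) = mem s (aM a b)"
      using mem1[OF an] ab bn by simp
    let ?m = "(mem s1)(aX 0 a := mem s (aX 0 a) + 2 * mem s (aM a b) - mem s (aX 0 b),
       aX 1 a := mem s (aX 1 a) - mem s (aX 1 b), aP b := b)"
    have fin: "f S \<le> z" if S: "regs S = (regs s1)(1 := Suc k)" "mem S = ?m" "reported S = reported s1" "clock S = clock s1 + 4" for S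
    proof -
      have g: "good x (Suc k) (rp s) (pr S) (mt S) (de S) (ff S) \<and> (\<forall>j. Suc k \<le> j \<and> j \<le> n \<longrightarrow> lev (rp s) (pr S) j = ?L j)"
      proof (rule good_uncontract[OF stD(2)[OF s, unfolded k(1)] k(2) b_def a_def], goal_cases)
        case (1 u)
        then show ?case using an by (simp add: S h)
      next
        case (2 u v)
        then have "mt S u v = mem s1 (aM u v)" using an by (simp add: S)
        also note mem1[OF 2]
        also have "(if u = a \<and> v = a then 0 else if u = a \<and> v \<in> rp s ` {..<k} then (mem s (aM a v) + (B - mem s (aM b v))) mod B
             else if v = a \<and> u \<in> rp s ` {..<k} then (mem s (aM a u) + (B - mem s (aM b u))) mod B else mem s (aM u v))
          = (if u = a \<and> v = a then 0 else if u = a \<and> v \<in> rp s ` {..<k} then mt s a v - mt s b v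
             else if v = a \<and> u \<in> rp s ` {..<k} then mt s a u - mt s b u else mt s u v)"
          using 2 an minus[of v] minus[of u] by (cases "u = a"; cases "v = a"; simp only: simp_thms if_True if_False cong: if_cong)
        finally show ?case .
      next
        case (3 u)
        then show ?case using an by (simp add: S h)
      next
        case (4 u)
        then show ?case using an by (simp add: S h)
      qed
      have rS: "rp S = rp s" using an by (simp add: S h fun_eq_iff)
      have "st x S" using g stD(5)[OF s] unfolding st_def rS by (simp add: S r)
      then show ?thesis
      proof (rule f)
        show "regs S 1 = Suc k" by (simp add: S)
        show "regs S r = regs s r" if "r \<notin> {1, 5, 8, 9, 13}" for r using regs1[of r] s0(8)[of r] that by (simp add: S)
        show "lv S j = lv s j" if "Suc k \<le> j" "j \<le> n" for j using g that unfolding lv_def rS by simp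
        show "fl S = fl s" "hs S = hs s" using an by (simp_all add: S h fun_eq_iff)
      qed (use 5 S in simp_all)
    qed
    have k1: "(k + 1) mod B = Suc k" using kB by simp
    show ?case
      apply (simp add: tick_def incr_def r h Mab an kB D F one_mod k1 del: One_nat_def)
      apply (rule fin)
      apply (simp_all add: r h k1 del: One_nat_def)
      done
  qed (use k lt st_inj[OF s] in simp_all)
  finally show ?thesis .
qed

end


section \<open>Weighted sampling by prefix sums\<close>

text \<open>The bucket that contains \<open>y\<close> when buckets of widths \<open>w 0\<close>,
  \<open>w 1\<close>, and so on are laid side by side.\<close>

definition fnd :: "(nat \<Rightarrow> nat) \<Rightarrow> nat \<Rightarrow> nat" where
  "fnd w y = (LEAST i. y < (\<Sum>j<Suc i. w j))"

lemma fnd_props: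
  fixes w :: "nat \<Rightarrow> nat"
  assumes "y < (\<Sum>j<k. w j)"
  shows "fnd w y < k" "(\<Sum>j<fnd w y. w j) \<le> y" "y < (\<Sum>j<Suc (fnd w y). w j)"
    "\<And>i. i \<le> fnd w y \<Longrightarrow> (\<Sum>j<i. w j) \<le> y"
proof -
  have "k \<noteq> 0" using assms by (cases k) auto
  then have k: "y < (\<Sum>j<Suc (k - 1). w j)" using assms by simp
  show "y < (\<Sum>j<Suc (fnd w y). w j)" unfolding fnd_def by (rule LeastI[of _ "k - 1"]) (rule k)
  have "fnd w y \<le> k - 1" unfolding fnd_def by (rule Least_le) (rule k)
  then show "fnd w y < k" using \<open>k \<noteq> 0\<close> by simp
  have le: "(\<Sum>j<i. w j) \<le> y" if "i \<le> fnd w y" for i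
  proof (cases i)
    case (Suc i')
    then have "i' < (LEAST i. y < (\<Sum>j<Suc i. w j))" using that by (simp add: fnd_def)
    then have "\<not> y < (\<Sum>j<Suc i'. w j)" by (rule not_less_Least)
    then show ?thesis using Suc by simp
  qed simp
  show "(\<Sum>j<fnd w y. w j) \<le> y" using le by simp
  show "\<And>i. i \<le> fnd w y \<Longrightarrow> (\<Sum>j<i. w j) \<le> y" by (rule le)
qed

lemma fnd_eqI:
  fixes w :: "nat \<Rightarrow> nat"
  assumes "(\<Sum>j<i. w j) \<le> y" "y < (\<Sum>j<Suc i. w j)"
  shows "fnd w y = i"
  unfolding fnd_def
proof (rule Least_equality)
  fix m assume m: "y < (\<Sum>j<Suc m. w j)"
  show "i \<le> m"
  proof (rule ccontr)
    assume "\<not> i \<le> m"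
    then have "(\<Sum>j<Suc m. w j) \<le> (\<Sum>j<i. w j)" by (intro sum_mono2) auto
    then show False using m assms by simp
  qed
qed (rule assms(2))

text \<open>For uniform \<open>y\<close> a bucket is hit with probability proportional to its width,
  and the offset inside it is uniform again. The offset can therefore serve as a second
  sample.\<close>

lemma sum_fnd:
  fixes w :: "nat \<Rightarrow> nat" and g :: "nat \<Rightarrow> nat \<Rightarrow> real"
  shows "(\<Sum>y<(\<Sum>j<k. w j). g (fnd w y) (y - (\<Sum>j<fnd w y. w j))) = (\<Sum>i<k. \<Sum>z<w i. g i z)"
proof (induction k)
  case (Suc k)
  let ?S = "\<Sum>j<k. w j"
  have "(\<Sum>y<(\<Sum>j<Suc k. w j). g (fnd w y) (y - (\<Sum>j<fnd w y. w j)))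
      = (\<Sum>y<?S. g (fnd w y) (y - (\<Sum>j<fnd w y. w j))) + (\<Sum>y=?S..<?S + w k. g (fnd w y) (y - (\<Sum>j<fnd w y. w j)))"
    by (simp add: sum.atLeastLessThan_concat lessThan_atLeast0)
  also have "(\<Sum>y=?S..<?S + w k. g (fnd w y) (y - (\<Sum>j<fnd w y. w j))) = (\<Sum>z<w k. g k z)"
  proof -
    have "(\<Sum>y=?S..<?S + w k. g (fnd w y) (y - (\<Sum>j<fnd w y. w j))) = (\<Sum>y=?S..<?S + w k. g k (y - ?S))"
    proof (intro sum.cong refl)
      fix y assume "y \<in> {?S..<?S + w k}"
      then have "fnd w y = k" by (intro fnd_eqI) auto
      then show "g (fnd w y) (y - (\<Sum>j<fnd w y. w j)) = g k (y - ?S)" by simp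
    qed
    also have "\<dots> = (\<Sum>z=0..<w k. g k z)"
      using sum.shift_bounds_nat_ivl[of "\<lambda>y. g k (y - ?S)" 0 ?S "w k"] by (simp add: add.commute)
    finally show ?thesis by (simp add: lessThan_atLeast0)
  qed
  finally show ?case using Suc.IH by simp
qed simp

text \<open>Adding 1 on the right makes \<open>Less\<close> test whether \<open>e\<close> is at most
  the sample that remains.\<close>

definition p_search :: "nat \<Rightarrow> exp \<Rightarrow> prog" where
  "p_search r e = block [Assign r (Const 0),
     While (Less e (Plus (Reg 10) (Const 1))) (block [Assign 10 (Minus (Reg 10) e), incr r])]"

text \<open>The first search picks a vertex with probability proportional to its degree. Row sums
  equal degrees, so the offset it leaves is a uniform sample for the second search along the row,
  and one random word yields a random edge.\<close>

definition p_weighted :: prog where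
  "p_weighted = block [Sample 10 (Reg 6), p_search 11 (Load (eX 0 (Load (eX 2 (Reg 11))))),
     Assign 8 (Load (eX 2 (Reg 11))), p_search 12 (Load (eM (Reg 8) (Load (eX 2 (Reg 12))))),
     Assign 9 (Load (eX 2 (Reg 12)))]"

definition p_uniform :: prog where
  "p_uniform = block [Sample 11 (Reg 1), Sample 12 (Reg 1),
     Assign 8 (Load (eX 2 (Reg 11))), Assign 9 (Load (eX 2 (Reg 12)))]"

text \<open>The machine has access to \<open>\<alpha>\<close> through \<open>LeAlpha\<close> only. A sample below \<open>(k - k1) * n\<close> is at
  most \<open>\<alpha> * (2 * n)\<close> with a probability between \<open>2 * \<alpha> / (k - k1)\<close> and \<open>(2 * \<alpha> + 1 / n) / (k - k1)\<close>;
  the relative excess \<open>1 / n\<close> is too small to matter for the running time.\<close>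

definition p_dup :: "nat \<Rightarrow> nat \<Rightarrow> prog" where
  "p_dup k0 k1 = If (Less (Reg 1) (Const k0)) (Store (eX 3 (Reg 1)) (Const 0))
     (block [Sample 10 (Times (Minus (Plus (Reg 1) (Const 1)) (Const k1)) (Reg 0)),
        Store (eX 3 (Reg 1)) (LeAlpha (Reg 10) (Times (Const 2) (Reg 0)))])"

text \<open>A pair without an edge, which only the uniform choice can produce, ends the descent:
  merging it could destroy compactness.\<close>

definition p_branch :: "nat \<Rightarrow> nat \<Rightarrow> prog" where
  "p_branch k0 k1 = If (Load (eM (Reg 8) (Reg 9))) (block [p_contract, p_dup k0 k1]) (Assign 2 (Const 0))"

definition p_down :: "nat \<Rightarrow> nat \<Rightarrow> prog" where
  "p_down k0 k1 = block [p_tot, p_consider,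
     If (Less (Const 2) (Reg 1))
       (block [If (Less (Const k0) (Reg 1)) p_weighted p_uniform, p_branch k0 k1])
       (Assign 2 (Const 0))]"

definition p_up :: prog where
  "p_up = If (Load (eX 3 (Reg 1)))
     (block [Store (eX 3 (Reg 1)) (Minus (Load (eX 3 (Reg 1))) (Const 1)), Assign 2 (Const 1)])
     p_uncontract"

text \<open>The recursion is unrolled: register 2 tells whether a level is entered or left, and
  array 3 acts as the stack. Its cell for level \<open>n\<close> counts the visits from the top that
  are still to be made.\<close>

definition p_main :: "nat \<Rightarrow> nat \<Rightarrow> prog" where
  "p_main k0 k1 = While (Plus (Reg 2) (Plus (Less (Reg 1) (Reg 0)) (Load (eX 3 (Reg 0)))))
     (If (Reg 2) (p_down k0 k1) p_up)"

section \<open>Drawing the pair to be merged\<close>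

context machine begin

lemma wp_search:
  assumes r: "r \<in> {11, 12}" and X: "regs s 10 < (\<Sum>i<k. w i)" "regs s 10 + 1 < B" "k < B"
    and e: "\<And>s' i. i < k \<Longrightarrow> (\<And>r'. r' \<noteq> 10 \<Longrightarrow> r' \<noteq> r \<Longrightarrow> regs s' r' = regs s r') \<Longrightarrow> regs s' r = i \<Longrightarrow> mem s' = mem s \<Longrightarrow> EV e s' = w i"
    and f: "\<And>s'. (\<And>r'. r' \<noteq> 10 \<Longrightarrow> r' \<noteq> r \<Longrightarrow> regs s' r' = regs s r') \<Longrightarrow> regs s' r = fnd w (regs s 10) \<Longrightarrow>
       regs s' 10 = regs s 10 - (\<Sum>j<fnd w (regs s 10). w j) \<Longrightarrow> mem s' = mem s \<Longrightarrow> reported s' = reported s \<Longrightarrow>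
       clock s' \<le> clock s + 3 * k + 2 \<Longrightarrow> f s' \<le> z"
  shows "WP (p_search r e) f s \<le> z"
proof -
  let ?k = "fnd w (regs s 10)"
  note fp = fnd_props[OF X(1)]
  have r10: "r \<noteq> 10" using r by auto
  define J where "J = (\<lambda>i (s' :: state). (\<forall>r'. r' \<noteq> 10 \<longrightarrow> r' \<noteq> r \<longrightarrow> regs s' r' = regs s r') \<and> regs s' r = i \<and>
     regs s' 10 = regs s 10 - (\<Sum>j<i. w j) \<and> mem s' = mem s \<and> reported s' = reported s \<and> clock s' = clock s + 1 + 3 * i)"
  have ew: "EV e s' = w i" if "J i s'" "i < k" for i s' using e[of i s'] that unfolding J_def by blast
  show ?thesis unfolding p_search_def block.simps wp_Seq wp_Assign
  proof (rule wp_for[where J = J and k = ?k], goal_cases)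
    case 1
    show ?case using r10 by (simp add: J_def)
  next
    case (2 i s')
    have i: "i < k" using 2 fp by simp
    have "regs s' 10 = regs s 10 - (\<Sum>j<i. w j)" using 2 by (simp add: J_def)
    moreover have "(\<Sum>j<i. w j) \<le> regs s 10" using fp(4) 2 by simp
    moreover have "(\<Sum>j<Suc i. w j) \<le> regs s 10 \<longleftrightarrow> i < ?k"
    proof
      assume h: "(\<Sum>j<Suc i. w j) \<le> regs s 10"
      show "i < ?k" using fp(3) h 2(2) by (cases "i = ?k") auto
    next
      assume "i < ?k" then show "(\<Sum>j<Suc i. w j) \<le> regs s 10" using fp(4)[of "Suc i"] by simp
    qed
    moreover have "(regs s' 10 + 1) mod B = regs s' 10 + 1" using calculation(1) X(2) by simp
    ultimately show ?case using ew[OF 2(1) i] by (simp add: one_mod del: One_nat_def) linarith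
  next
    case (3 i s' f')
    have i: "i < k" "Suc i < B" using 3 fp X by simp_all
    have "regs s' 10 = regs s 10 - (\<Sum>j<i. w j)" using 3 by (simp add: J_def)
    moreover have "(\<Sum>j<Suc i. w j) \<le> regs s 10" using fp(4)[of "Suc i"] 3(2) by simp
    ultimately have sub: "w i \<le> regs s' 10" "regs s' 10 < B" "regs s' 10 - w i = regs s 10 - (\<Sum>j<Suc i. w j)" using X(2) by simp_all
    have fin: "J (Suc i) S" if "regs S = (regs s')(10 := regs s' 10 - w i, r := Suc i)" "mem S = mem s'" "reported S = reported s'" "clock S = clock s' + 3" for S
      using 3(1) that sub r10 by (simp add: J_def)
    have ri: "regs s' r = i" using 3(1) by (simp add: J_def)
    have et: "EV e (tick s') = w i" by (rule e[OF i(1)]) (use 3(1) in \<open>simp_all add: J_def\<close>)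
    show ?case
      apply (simp add: incr_def et sub ri r10 i del: One_nat_def)
      apply (rule 3(3), rule fin)
      apply (simp_all add: one_mod i ri r10 del: One_nat_def)
      apply (use i sub(3) in simp)
      done
  next
    case (4 s')
    show ?case by (rule f) (use 4 fp in \<open>simp_all add: J_def\<close>)
  qed
qed

lemma st_row_sum:
  assumes s: "st x s" and p: "p < regs s 1"
  shows "mem s (aX 0 (rp s p)) = (\<Sum>q<regs s 1. mem s (aM (rp s p) (rp s q)))"
proof -
  let ?L = "lv s (regs s 1)"
  have k: "regs s 1 \<le> n" using stD[OF s] by simp
  have pn: "p < n" using p k by simp
  have live: "rp s p \<in> ?L ` V" using st_lab(2)[OF s] p by auto
  have "mem s (aX 0 (rp s p)) = dg ?L (rp s p)" using goodD(10)[OF stD(2)[OF s], of "rp s p"] p by (auto simp: lv_def)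
  also have "\<dots> = (\<Sum>t\<in>?L ` V - {rp s p}. wt ?L (rp s p) t)" by (rule dg_reps[OF st_lab(1)[OF s] live])
  also have "\<dots> = (\<Sum>t\<in>?L ` V. if t = rp s p then 0 else wt ?L (rp s p) t)"
    by (simp add: sum.If_cases Diff_eq Collect_neg_eq)
  also have "\<dots> = (\<Sum>q<regs s 1. if rp s q = rp s p then 0 else wt ?L (rp s p) (rp s q))"
    using st_sum[OF s, of "\<lambda>t. if t = rp s p then 0 else wt ?L (rp s p) t"] by simp
  also have "\<dots> = (\<Sum>q<regs s 1. mem s (aM (rp s p) (rp s q)))"
  proof (intro sum.cong refl)
    fix q assume q: "q \<in> {..<regs s 1}"
    show "(if rp s q = rp s p then 0 else wt ?L (rp s p) (rp s q)) = mem s (aM (rp s p) (rp s q))"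
    proof (cases "q = p")
      case True
      then show ?thesis using goodD(6)[OF stD(2)[OF s], of "rp s p"] st_rp[OF s pn] by simp
    next
      case False
      then have "rp s q \<noteq> rp s p" using inj_onD[OF st_inj[OF s], of q p] q k pn by auto
      then show ?thesis using st_wt[OF s p, of q] False q by simp
    qed
  qed
  finally show ?thesis .
qed

text \<open>The hypothesis \<open>le\<close> bounds the expectation of \<open>g p q\<close> when an
  ordered pair has probability proportional to its weight.\<close>

lemma wp_weighted:
  assumes s: "st x s" and k: "regs s 1 = k" and W: "regs s 6 = W" "W = (\<Sum>p<k. mem s (aX 0 (rp s p)))" "W > 0" "W + 1 < B"
    and g: "\<And>p q. p < k \<Longrightarrow> q < k \<Longrightarrow> 0 \<le> g p q"
    and f: "\<And>s' p q. p < k \<Longrightarrow> q < k \<Longrightarrow> mem s (aM (rp s p) (rp s q)) > 0 \<Longrightarrow>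
       (\<And>r. r \<notin> {8, 9, 10, 11, 12} \<Longrightarrow> regs s' r = regs s r) \<Longrightarrow> regs s' 8 = rp s p \<Longrightarrow> regs s' 9 = rp s q \<Longrightarrow>
       regs s' 12 = q \<Longrightarrow> mem s' = mem s \<Longrightarrow> reported s' = reported s \<Longrightarrow> clock s' \<le> clock s + 6 * k + 7 \<Longrightarrow>
       f s' \<le> ennreal (g p q)"
    and le: "(\<Sum>p<k. \<Sum>q<k. real (mem s (aM (rp s p) (rp s q))) * g p q) \<le> real W * b"
  shows "WP p_weighted f s \<le> ennreal b"
proof -
  have kn: "k \<le> n" and n: "regs s 0 = n" using stD[OF s] k by auto
  define w where "w p = mem s (aX 0 (rp s p))" for p
  define m where "m p q = mem s (aM (rp s p) (rp s q))" for p q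
  have row: "w p = (\<Sum>q<k. m p q)" if "p < k" for p using st_row_sum[OF s, of p] that k by (simp add: w_def m_def)
  have lt: "rp s i < n" if "i < k" for i using st_rp[OF s, of i] that kn by simp
  \<comment> \<open>From the sample \<open>y\<close>: \<open>P y\<close> is the position of the
    first vertex, \<open>Y y\<close> the offset left over, \<open>Q y\<close> the position of the
    second vertex.\<close>
  define P where "P y = fnd w y" for y
  define Y where "Y y = y - (\<Sum>j<P y. w j)" for y
  define Q where "Q y = fnd (m (P y)) (Y y)" for y
  have P: "P y < k" "Y y < w (P y)" if "y < W" for y
  proof -
    have y: "y < (\<Sum>j<k. w j)" using that W(2) by (simp add: w_def)
    show "P y < k" using fnd_props(1)[OF y] by (simp add: P_def)
    show "Y y < w (P y)" using fnd_props(2,3)[OF y] unfolding P_def Y_def sum.lessThan_Suc by linarith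
  qed
  have Q: "Q y < k" "m (P y) (Q y) > 0" if "y < W" for y
  proof -
    have "Y y < (\<Sum>q<k. m (P y) q)" using P[OF that] row by simp
    note fp = fnd_props(1-3)[OF this, folded Q_def]
    show "Q y < k" by (rule fp(1))
    show "m (P y) (Q y) > 0" using fp(2,3) unfolding sum.lessThan_Suc by linarith
  qed
  show ?thesis unfolding p_weighted_def block.simps wp_Seq
  proof (rule wp_Sample_le[where k = W and g = "\<lambda>y. g (P y) (Q y)"], goal_cases)
    case (3 y)
    let ?s = "tick (s\<lparr>regs := (regs s)(10 := y)\<rparr>)"
    have kB: "k < B" using kn by simp
    show ?case
    proof (rule wp_search[where w = w and k = k], goal_cases)
      case (5 s' i)
      have r: "regs s' 0 = n" using 5(2)[of 0] n by simp
      show ?case using 5(1,3) r lt[OF 5(1)] kn by (simp add: 5(4) w_def)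
    next
      case (6 s1)
      have r: "regs s1 11 = P y" "regs s1 10 = Y y" "regs s1 0 = n" using 6(1)[of 0] 6(2,3) n by (simp_all add: P_def Y_def)
      have Pk: "P y < n" "P y \<le> HM" "rp s (P y) < n" using P[OF 3] kn lt by auto
      define s2 where "s2 = tick (s1\<lparr>regs := (regs s1)(8 := rp s (P y))\<rparr>)"
      have "WP (Assign 8 (Load (eX 2 (Reg 11)))) (WP (p_search 12 (Load (eM (Reg 8) (Load (eX 2 (Reg 12)))))) (WP (Assign 9 (Load (eX 2 (Reg 12)))) f)) s1
        = WP (p_search 12 (Load (eM (Reg 8) (Load (eX 2 (Reg 12)))))) (WP (Assign 9 (Load (eX 2 (Reg 12)))) f) s2"
        using 6(4) r Pk by (simp add: s2_def)
      also have "\<dots> \<le> ennreal (g (P y) (Q y))"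
      proof (rule wp_search[where w = "m (P y)" and k = k], goal_cases)
        case 2
        then show ?case using row[OF P(1)[OF 3]] P(2)[OF 3] r by (simp add: s2_def)
      next
        case 3
        then show ?case using r W(4) \<open>y < W\<close> by (simp add: s2_def Y_def)
      next
        case (5 s' i)
        have r': "regs s' 0 = n" "regs s' 8 = rp s (P y)" using 5(2)[of 0] 5(2)[of 8] r by (simp_all add: s2_def)
        show ?case using 5(1,3) r' lt[OF 5(1)] kn Pk by (simp add: 5(4) s2_def 6(4) m_def)
      next
        case (6 s3)
        have r3: "regs s3 12 = Q y" "regs s3 0 = n" using 6(1)[of 0] 6(2) r by (simp_all add: s2_def Q_def)
        have m3: "mem s3 = mem s" using 6(4) \<open>mem s1 = mem ?s\<close> by (simp add: s2_def)
        show ?case unfolding wp_Assign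
        proof (rule f[OF P(1)[OF 3] Q(1)[OF 3]], goal_cases)
          case 1
          then show ?case using Q(2)[OF 3] by (simp add: m_def)
        next
          case (2 r)
          then show ?case using 6(1)[of r] \<open>\<And>r'. r' \<noteq> 10 \<Longrightarrow> r' \<noteq> 11 \<Longrightarrow> regs s1 r' = regs ?s r'\<close> by (simp add: s2_def)
        next
          case 3
          then show ?case using 6(1)[of 8] by (simp add: s2_def)
        next
          case 4
          then show ?case using r3 m3 Q(1)[OF \<open>y < W\<close>] kn by simp
        next
          case 8
          then show ?case using 6(6) \<open>clock s1 \<le> clock ?s + 3 * k + 2\<close> by (simp add: s2_def)
        qed (use r3 m3 6(5) \<open>reported s1 = reported ?s\<close> in \<open>simp_all add: s2_def\<close>)
      qed (use kB in simp_all)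
      finally show ?case .
    qed (use 3 W kB in \<open>simp_all add: w_def\<close>)
  next
    case (4 y)
    then show ?case using g P Q by simp
  next
    case 5
    have "(\<Sum>y<W. g (P y) (Q y)) = (\<Sum>y<(\<Sum>p<k. w p). g (fnd w y) (fnd (m (fnd w y)) (y - (\<Sum>j<fnd w y. w j))))"
      unfolding Q_def Y_def P_def W(2) w_def ..
    also have "\<dots> = (\<Sum>p<k. \<Sum>z<w p. g p (fnd (m p) z))" by (rule sum_fnd)
    also have "\<dots> = (\<Sum>p<k. \<Sum>z<(\<Sum>q<k. m p q). g p (fnd (m p) z))" by (intro sum.cong refl) (simp add: row)
    also have "\<dots> = (\<Sum>p<k. \<Sum>q<k. \<Sum>z<m p q. g p q)"
    proof (rule sum.cong[OF refl])
      fix p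
      show "(\<Sum>z<(\<Sum>q<k. m p q). g p (fnd (m p) z)) = (\<Sum>q<k. \<Sum>z<m p q. g p q)"
        using sum_fnd[of "\<lambda>q _. g p q" "m p" k] by simp
    qed
    also have "\<dots> \<le> real W * b" using le by (simp add: m_def)
    finally show ?case .
  qed (use W in auto)
qed

lemma wp_uniform:
  assumes s: "st x s" and k: "regs s 1 = k" 
    and g: "\<And>p q. p < k \<Longrightarrow> q < k \<Longrightarrow> 0 \<le> g p q"
    and f: "\<And>s' p q. p < k \<Longrightarrow> q < k \<Longrightarrow>
       (\<And>r. r \<notin> {8, 9, 10, 11, 12} \<Longrightarrow> regs s' r = regs s r) \<Longrightarrow> regs s' 8 = rp s p \<Longrightarrow> regs s' 9 = rp s q \<Longrightarrow>
       regs s' 12 = q \<Longrightarrow> mem s' = mem s \<Longrightarrow> reported s' = reported s \<Longrightarrow> clock s' \<le> clock s + 6 * k + 7 \<Longrightarrow>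
       f s' \<le> ennreal (g p q)"
    and le: "(\<Sum>p<k. \<Sum>q<k. g p q) \<le> real k * real k * b"
  shows "WP p_uniform f s \<le> ennreal b"
proof -
  have kn: "k \<le> n" "k > 0" and n: "regs s 0 = n" using stD[OF s] k by auto
  show ?thesis unfolding p_uniform_def block.simps wp_Seq
  proof (rule wp_Sample_le[where k = k and g = "\<lambda>p. (\<Sum>q<k. g p q) / real k"], goal_cases)
    case (3 p)
    show ?case
    proof (rule wp_Sample_le[where k = k and g = "g p"], goal_cases)
      case (3 q)
      have h: "p < n" "q < n" using \<open>p < k\<close> 3 kn by auto
      show ?case using n h
        by (simp del: One_nat_def) (rule f[OF \<open>p < k\<close> 3]; simp)
    qed (use g 3 kn k in auto)
  next
    case (4 p)
    then show ?case by (intro divide_nonneg_nonneg sum_nonneg g) auto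
  next
    case 5
    have "(\<Sum>p<k. (\<Sum>q<k. g p q) / real k) = (\<Sum>p<k. \<Sum>q<k. g p q) / real k" by (simp add: sum_divide_distrib)
    also have "\<dots> \<le> real k * b" using le kn by (simp add: field_simps)
    finally show ?case .
  qed (use k kn in auto)
qed

end


locale search = machine G n \<alpha> B HM for G :: "(nat, nat) multigraph" and n :: nat and \<alpha> :: real and B HM :: nat +
  fixes k0 k1 :: nat
  assumes k1_k0: "k1 < k0" and k0_B: "k0 < B" and k0_2: "2 \<le> k0"
begin

text \<open>The exact probability with which \<open>p_dup\<close> schedules a revisit after a
  contraction from level \<open>k\<close> to \<open>k - 1\<close>.\<close>

definition rho :: "nat \<Rightarrow> real" where
  "rho k = real (card {y. y < (k - k1) * n \<and> real y \<le> \<alpha> * real (2 * n)}) / real ((k - k1) * n)"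

text \<open>The effect of evaluating and considering the current cut, stripped of machine detail;
  the failure analysis relies on this relation alone for minimum, marks and reports.\<close>

definition cons :: "(nat \<Rightarrow> nat) \<Rightarrow> state \<Rightarrow> state \<Rightarrow> bool" where
  "cons x s s' \<longleftrightarrow> (let lab = lv s (regs s 1); W = xw (same (part lab)); H = hsh x (\<lambda>u v. lab u = lab v) in
     regs s' 3 = regs s 3 \<and> regs s' 4 = min (regs s 4) W \<and>
     (if regs s 3 \<noteq> 0 \<and> real W \<le> \<alpha> * real (regs s' 4) \<and> hs s H = 0
      then hs s' = (hs s)(H := 1) \<and> reported s' = reported s @ [part lab]
      else hs s' = hs s \<and> reported s' = reported s))"

lemma wp_dup:
  assumes n: "regs s 0 = n" and k: "regs s 1 = k" "k < n" and h: "0 \<le> h 0" "0 \<le> h 1"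
    and f: "\<And>s' i. i \<in> {0, 1} \<Longrightarrow> (\<And>r. r \<noteq> 10 \<Longrightarrow> regs s' r = regs s r) \<Longrightarrow> mem s' = (mem s)(aX 3 k := i) \<Longrightarrow>
      reported s' = reported s \<Longrightarrow> clock s' \<le> clock s + 3 \<Longrightarrow> f s' \<le> ennreal (h i)"
    and le: "if k < k0 then h (0::nat) \<le> b else (1 - rho (Suc k)) * h 0 + rho (Suc k) * h 1 \<le> b"
  shows "WP (p_dup k0 k1) f s \<le> ennreal b"
proof (cases "k < k0")
  case True
  have "f S \<le> ennreal b" if "regs S = regs s" "mem S = (mem s)(aX 3 k := 0)" "reported S = reported s" "clock S = clock s + 2" for S
    using f[of 0 S] that le True by (auto intro: order_trans ennreal_leI)
  then show ?thesis using n k k0_B True unfolding p_dup_def by (simp del: One_nat_def)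
next
  case False
  let ?N = "(Suc k - k1) * n"
  have N: "?N > 0" "?N < B" "2 * n < B"
  proof -
    show "?N > 0" using False k1_k0 n2 by simp
    have "?N \<le> n * n" using k by (intro mult_right_mono) auto
    then show "?N < B" "2 * n < B" using B_addr by linarith+
  qed
  let ?s = "tick s"
  have e: "EV (Times (Minus (Plus (Reg 1) (Const 1)) (Const k1)) (Reg 0)) ?s = ?N"
  proof -
    have "(k + 1) mod B = Suc k" "k1 mod B = k1" using k k1_k0 k0_B by simp_all
    moreover have "(Suc k + (B - k1)) mod B = Suc k - k1" by (rule minus_mod) (use False k1_k0 k in auto)
    moreover have "(k + 1 - k1) * n mod B = (Suc k - k1) * n" using N by simp
    ultimately show ?thesis using n k N by (simp add: one_mod del: One_nat_def)
  qed
  let ?A = "{y. y < ?N \<and> real y \<le> \<alpha> * real (2 * n)}"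
  have "WP (Seq (Sample 10 (Times (Minus (Plus (Reg 1) (Const 1)) (Const k1)) (Reg 0)))
        (Store (eX 3 (Reg 1)) (LeAlpha (Reg 10) (Times (Const 2) (Reg 0))))) f ?s \<le> ennreal b"
    unfolding wp_Seq
  proof (rule wp_Sample_le[OF e N(1), where g = "\<lambda>y. if real y \<le> \<alpha> * real (2 * n) then h 1 else h 0"], goal_cases)
    case (1 y)
    have "f S \<le> ennreal (if real y \<le> \<alpha> * real (2 * n) then h 1 else h 0)"
      if "regs S = (regs s)(10 := y)" "mem S = (mem s)(aX 3 k := (if real y \<le> \<alpha> * real (2 * n) then 1 else 0))" "reported S = reported s" "clock S = clock s + 3" for S
      using f[of 0 S] f[of 1 S] that by auto
    then show ?case using n k N by (simp del: One_nat_def of_nat_mult)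
  next
    case (2 y)
    then show ?case using h by simp
  next
    case 3
    have c: "card ?A \<le> ?N" using card_mono[of "{..<?N}" ?A] by auto
    have "(\<Sum>y<?N. if real y \<le> \<alpha> * real (2 * n) then h 1 else h 0)
       = (\<Sum>y\<in>{..<?N} \<inter> {y. real y \<le> \<alpha> * real (2 * n)}. h 1) + (\<Sum>y\<in>{..<?N} \<inter> - {y. real y \<le> \<alpha> * real (2 * n)}. h 0)"
      by (simp add: sum.If_cases)
    also have "{..<?N} \<inter> {y. real y \<le> \<alpha> * real (2 * n)} = ?A" by auto
    also have "{..<?N} \<inter> - {y. real y \<le> \<alpha> * real (2 * n)} = {..<?N} - ?A" by auto
    also have "(\<Sum>y\<in>?A. h 1) + (\<Sum>y\<in>{..<?N} - ?A. h 0) = real (card ?A) * h 1 + (real ?N - real (card ?A)) * h 0"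
    proof -
      have "card ({..<?N} - ?A) = ?N - card ?A" by (subst card_Diff_subset) auto
      then show ?thesis using c by (simp add: of_nat_diff)
    qed
    also have "\<dots> = real ?N * ((1 - rho (Suc k)) * h 0 + rho (Suc k) * h 1)"
    proof -
      have "rho (Suc k) * real ?N = real (card ?A)" using N(1) by (simp add: rho_def del: of_nat_mult)
      then have "real (card ?A) * h 1 + (real ?N - real (card ?A)) * h 0 = rho (Suc k) * real ?N * h 1 + (real ?N - rho (Suc k) * real ?N) * h 0" by simp
      then show ?thesis by (simp only: algebra_simps)
    qed
    also have "\<dots> \<le> real ?N * b" using le False by (intro mult_left_mono) auto
    finally show ?case .
  qed
  then show ?thesis using n k k0_B False unfolding p_dup_def block.simps by (simp del: One_nat_def wp_Seq)
qed

lemma xw_pos: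
  assumes "lab_ok lab" "card (lab ` V) \<ge> 2" shows "xw (same (part lab)) > 0"
  using cut_size_pos[of "part lab"] is_cut_part[OF assms(1)] assms(2) xw_cut_size[OF part_partition] by simp

text \<open>\<open>gs\<close> bounds the continuation after the descent stops,
  \<open>gc p q i\<close> the one after merging positions \<open>p\<close> and \<open>q\<close> with
  revisit flag \<open>i\<close>. The last three hypotheses average these for level 2, the uniform
  and the weighted choice. Of the time \<open>16 * k\<close>, evaluation takes \<open>5 * k\<close>,
  sampling \<open>6 * k\<close> and merging rows \<open>5 * k\<close>.\<close>

lemma wp_down:
  assumes s: "st x s" and k: "regs s 1 = k" "2 \<le> k"
    and g: "0 \<le> gs" "\<And>p q i. 0 \<le> gc p q i"
    and fs: "\<And>s'. st x s' \<Longrightarrow> cons x s s' \<Longrightarrow> regs s' 1 = k \<Longrightarrow> regs s' 2 = 0 \<Longrightarrow> lv s' = lv s \<Longrightarrow> fl s' = fl s \<Longrightarrow>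
       clock s' \<le> clock s + 16 * k + 60 \<Longrightarrow> f s' \<le> ennreal gs"
    and fc: "\<And>s' p q i. 2 < k \<Longrightarrow> p < k \<Longrightarrow> q < k \<Longrightarrow> p \<noteq> q \<Longrightarrow> mem s (aM (rp s p) (rp s q)) > 0 \<Longrightarrow> i \<in> {0, 1::nat} \<Longrightarrow>
       st x s' \<Longrightarrow> cons x s s' \<Longrightarrow> regs s' 1 = k - 1 \<Longrightarrow> regs s' 2 = regs s 2 \<Longrightarrow>
       (\<And>j. k \<le> j \<Longrightarrow> j \<le> n \<Longrightarrow> lv s' j = lv s j) \<Longrightarrow> lv s' (k - 1) = merge (rp s q) (rp s p) (lv s k) \<Longrightarrow>
       fl s' = (fl s)(k - 1 := i) \<Longrightarrow> clock s' \<le> clock s + 16 * k + 60 \<Longrightarrow> f s' \<le> ennreal (gc p q i)"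
    and le2: "k = 2 \<Longrightarrow> gs \<le> b"
    and leu: "2 < k \<Longrightarrow> k \<le> k0 \<Longrightarrow> (\<Sum>p<k. \<Sum>q<k. if mem s (aM (rp s p) (rp s q)) > 0 then gc p q 0 else gs) \<le> real k * real k * b"
    and lew: "k0 < k \<Longrightarrow> (\<Sum>p<k. \<Sum>q<k. real (mem s (aM (rp s p) (rp s q))) * ((1 - rho k) * gc p q 0 + rho k * gc p q 1))
        \<le> real (xw (same (part (lv s k)))) * b"
  shows "WP (p_down k0 k1) f s \<le> ennreal b"
proof -
  have kn: "k \<le> n" and n: "regs s 0 = n" using stD[OF s] k by auto
  let ?W = "xw (same (part (lv s k)))" and ?H = "hsh x (\<lambda>u v. lv s k u = lv s k v)"
  have H: "?H \<le> HM" using hsh_le stD(5)[OF s] by blast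
  have Wpos: "?W > 0" using xw_pos[OF st_lab(1)[OF s]] st_lab(3)[OF s] k by simp
  have WB: "?W + 1 < B" using xw_le[of "same (part (lv s k))"] B_weight by linarith
  have rpn: "rp s p < n" if "p < k" for p using st_rp[OF s, of p] that kn by simp
  have diag: "p \<noteq> q" if "p < k" "mem s (aM (rp s p) (rp s q)) > 0" for p q
    using goodD(6)[OF stD(2)[OF s], of "rp s p"] rpn[OF that(1)] that by auto
  have kB: "2 < B" "k0 mod B = k0" using k0_B k0_2 by auto
  show ?thesis unfolding p_down_def block.simps wp_Seq
  proof (rule wp_tot[OF s], goal_cases)
    case (1 s1)
    note c1 = 1
    have r1: "regs s1 0 = n" "regs s1 1 = k" "regs s1 2 = regs s 2" "regs s1 3 = regs s 3" "regs s1 4 = regs s 4" "regs s1 6 = ?W" "regs s1 7 = ?H"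
      using c1(1)[of 0] c1(1)[of 1] c1(1)[of 2] c1(1)[of 3] c1(1)[of 4] c1(2,3) n k by simp_all
    have st1: "st x s1" and lv1: "lv s1 = lv s" using st_cong(1)[of s1 s x] st_cong(2)[of s1 s] s c1(4) r1 n k by simp_all
    show ?case
    proof (rule wp_consider[OF st1], goal_cases)
      case 1
      then show ?case using r1 H by simp
    next
      case (2 s2)
      note c2 = 2
      have r2: "regs s2 0 = n" "regs s2 1 = k" "regs s2 2 = regs s 2" "regs s2 3 = regs s 3" "regs s2 6 = ?W" "regs s2 4 = min (regs s 4) ?W"
        using c2(1)[of 0] c2(1)[of 1] c2(1)[of 2] c2(1)[of 3] c2(1)[of 6] c2(2) r1 by simp_all
      have m2: "mem s2 ad = mem s ad" if "\<And>h. ad \<noteq> aX 4 h" for ad using c2(3)[OF that] c1(4) by simp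
      have st2: "st x s2" and lv2: "lv s2 = lv s" using st_cong(1)[of s2 s x] st_cong(2)[of s2 s] m2 s r2 n k by simp_all
      have cs: "cons x s s'" if "regs s' 3 = regs s2 3" "regs s' 4 = regs s2 4" "hs s' = hs s2" "reported s' = reported s2" for s'
        using c2(4) unfolding cons_def Let_def that r1 r2 lv1 c1(4) c1(5) k(1) by simp
      have fl2: "fl s2 = fl s" using m2 by (simp add: fun_eq_iff)
      have clk2: "clock s2 \<le> clock s + 5 * k + 14" using c2(5) c1(6) k by simp
      have Mk: "mem s2 (aM (rp s p) (rp s q)) = mem s (aM (rp s p) (rp s q))" if "p < k" "q < k" for p q
        by (rule m2) (use that rpn in simp)
      have rp2: "mem s2 (aX 2 i) = mem s (aX 2 i)" for i using m2 by simp
      show ?case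
      proof (cases "k = 2")
        case True
        have fin: "f S \<le> ennreal b" if S: "regs S = (regs s2)(2 := 0)" "mem S = mem s2" "reported S = reported s2" "clock S = clock s2 + 2" for S
        proof -
          have "st x S" "lv S = lv s" using st_cong(1)[of S s2 x] st_cong(2)[of S s2] S st2 lv2 by simp_all
          then have "f S \<le> ennreal gs" by (intro fs) (use S r2 clk2 cs[of S] fl2 in simp_all)
          also have "\<dots> \<le> ennreal b" using le2[OF True] by (rule ennreal_leI)
          finally show ?thesis .
        qed
        show ?thesis using r2 True kB by (simp del: One_nat_def) (rule fin; simp)
      next
        case False
        then have k3: "2 < k" using k by simp
        have branch: "WP (p_branch k0 k1) f s3 \<le> ennreal (if mem s (aM (rp s p) (rp s q)) > 0
            then (if k \<le> k0 then gc p q 0 else (1 - rho k) * gc p q 0 + rho k * gc p q 1) else gs)"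
          if pq: "p < k" "q < k" and r: "\<And>r. r \<notin> {8, 9, 10, 11, 12} \<Longrightarrow> regs s3 r = regs s2 r" "regs s3 8 = rp s p" "regs s3 9 = rp s q"
            "regs s3 12 = q" and m: "mem s3 = mem s2" and rep: "reported s3 = reported s2" and clk: "clock s3 \<le> clock s2 + 6 * k + 9" for s3 p q
        proof -
          have r3: "regs s3 0 = n" "regs s3 1 = k" "regs s3 2 = regs s 2" "regs s3 3 = regs s2 3" "regs s3 4 = regs s2 4"
            using r(1)[of 0] r(1)[of 1] r(1)[of 2] r(1)[of 3] r(1)[of 4] r2 by simp_all
          have st3: "st x s3" and lv3: "lv s3 = lv s" using st_cong(1)[of s3 s2 x] st_cong(2)[of s3 s2] m st2 lv2 r2 r3 by simp_all
          have ld: "EV (Load (eM (Reg 8) (Reg 9))) s3 = mem s (aM (rp s p) (rp s q))" using r3 r rpn pq m Mk by simp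
          show ?thesis
          proof (cases "mem s (aM (rp s p) (rp s q)) > 0")
            case False
            have fin: "f S \<le> ennreal gs" if S: "regs S = (regs s3)(2 := 0)" "mem S = mem s3" "reported S = reported s3" "clock S = clock s3 + 2" for S
            proof -
              have "st x S" "lv S = lv s" using st_cong(1)[of S s3 x] st_cong(2)[of S s3] S st3 lv3 by simp_all
              then show ?thesis by (intro fs) (use S r3 clk clk2 m rep cs[of S] fl2 in simp_all)
            qed
            show ?thesis using False ld unfolding p_branch_def wp_If by (simp del: One_nat_def exp_val.simps(3)) (rule fin; simp)
          next
            case True
            let ?s3 = "tick s3"
            have pqne: "p \<noteq> q" using diag pq True by blast
            have st3': "st x ?s3" and lv3': "lv ?s3 = lv s" using st_cong(1)[of ?s3 s3 x] st_cong(2)[of ?s3 s3] st3 lv3 by simp_all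
            let ?b = "if k \<le> k0 then gc p q 0 else (1 - rho k) * gc p q 0 + rho k * gc p q 1"
            have "WP (Seq p_contract (p_dup k0 k1)) f ?s3 \<le> ennreal ?b"
              unfolding wp_Seq
            proof (rule wp_contract[OF st3' _ k(2) pq(1) _ pq(2) pqne _ refl _ refl], goal_cases)
              case 1 show ?case using r3 by simp
            next
              case 2 show ?case using r by simp
            next
              case 3 show ?case using r m rp2 by simp
            next
              case 4 show ?case using r m rp2 by simp
            next
              case 5 show ?case using True r m rp2 Mk pq by simp
            next
              case (6 s4)
              note c4 = 6
              have r4: "regs s4 0 = n" "regs s4 2 = regs s 2" "regs s4 3 = regs s2 3" "regs s4 4 = regs s2 4"
                using c4(3)[of 0] c4(3)[of 2] c4(3)[of 3] c4(3)[of 4] r3 by simp_all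
              show ?case
              proof (rule wp_dup[OF r4(1) c4(2), where h = "gc p q"], goal_cases)
                case 1 show ?case using k kn by simp
              next
                case (4 s5 i)
                have st5: "st x s5" and lv5: "lv s5 = lv s4"
                  using st_cong(1)[of s5 s4 x] st_cong(2)[of s5 s4] c4(1) 4(2)[of 0] 4(2)[of 1] 4(3) by simp_all
                have m5: "hs s5 = hs s2" "fl s5 = (fl s)(k - 1 := i)"
                  using 4(3) c4(7) c4(6) m fl2 by (simp_all add: fun_eq_iff)
                show ?case
                  by (rule fc[OF k3 pq pqne True 4(1) st5])
                     (use 4(2)[of 1] 4(2)[of 2] 4(2)[of 3] 4(2)[of 4] r4 c4 lv5 lv3' 4 m5 rep clk clk2 r m rp2 cs[of s5] in simp_all)
              next
                case 5
                \<comment> \<open>\<open>p_dup\<close> runs after the level has dropped, so its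
                  strict test agrees with the non-strict one made before sampling.\<close>
                have "k - 1 < k0 \<longleftrightarrow> k \<le> k0" "Suc (k - 1) = k" using k by linarith+
                then show ?case by simp
              qed (use g in auto)
            qed
            then show ?thesis using True ld unfolding p_branch_def wp_If block.simps by (simp del: One_nat_def exp_val.simps(3) wp_Seq)
          qed
        qed
        let ?b = "\<lambda>p q. if mem s (aM (rp s p) (rp s q)) > 0
            then (if k \<le> k0 then gc p q 0 else (1 - rho k) * gc p q 0 + rho k * gc p q 1) else gs"
        have rho: "0 \<le> rho k" "rho k \<le> 1"
        proof -
          have "card {y. y < (k - k1) * n \<and> real y \<le> \<alpha> * real (2 * n)} \<le> card {..<(k - k1) * n}" by (rule card_mono) auto
          then have "real (card {y. y < (k - k1) * n \<and> real y \<le> \<alpha> * real (2 * n)}) \<le> real ((k - k1) * n)" by (simp only: of_nat_le_iff card_lessThan)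
          then show "0 \<le> rho k" "rho k \<le> 1" unfolding rho_def by (auto simp del: of_nat_mult intro!: divide_le_eq_1[THEN iffD2])
        qed
        have bnn: "0 \<le> ?b p q" for p q using g rho by auto
        let ?s2 = "tick (tick s2)"
        have st2': "st x ?s2" using st_cong(1)[of ?s2 s2 x] st_cong(2)[of ?s2 s2] st2 by simp
        have br: "WP (p_branch k0 k1) f s3 \<le> ennreal (?b p q)"
          if "p < k" "q < k" "\<And>r. r \<notin> {8, 9, 10, 11, 12} \<Longrightarrow> regs s3 r = regs ?s2 r" "regs s3 8 = rp ?s2 p" "regs s3 9 = rp ?s2 q"
            "regs s3 12 = q" "mem s3 = mem ?s2" "reported s3 = reported ?s2" "clock s3 \<le> clock ?s2 + 6 * k + 7" for s3 p q
          by (rule branch) (use that rp2 in \<open>simp_all\<close>)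
        show ?thesis
        proof (cases "k0 < k")
          case True
          have "WP (Seq p_weighted (p_branch k0 k1)) f ?s2 \<le> ennreal b"
            unfolding wp_Seq
          proof (rule wp_weighted[OF st2', where W = ?W and k = k and g = ?b], goal_cases)
            case 3
            show ?case using st_de[OF st2'] r2 st_cong(2)[of ?s2 s2] lv2 by simp
          next
            case (7 s3 p q)
            then show ?case by (intro br)
          next
            case 8
            have "(\<Sum>p<k. \<Sum>q<k. real (mem ?s2 (aM (rp ?s2 p) (rp ?s2 q))) * ?b p q)
              = (\<Sum>p<k. \<Sum>q<k. real (mem s (aM (rp s p) (rp s q))) * ((1 - rho k) * gc p q 0 + rho k * gc p q 1))"
              by (intro sum.cong refl) (use Mk rp2 True in auto)
            then show ?case using lew[OF True] by simp
          qed (use r2 Wpos WB bnn in auto)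
          then show ?thesis using r2 k3 kB True by (simp del: One_nat_def)
        next
          case False
          have "WP (Seq p_uniform (p_branch k0 k1)) f ?s2 \<le> ennreal b"
            unfolding wp_Seq
          proof (rule wp_uniform[OF st2', where k = k and g = ?b], goal_cases)
            case (3 s3 p q)
            then show ?case by (intro br)
          next
            case 4
            have "(\<Sum>p<k. \<Sum>q<k. ?b p q) = (\<Sum>p<k. \<Sum>q<k. if mem s (aM (rp s p) (rp s q)) > 0 then gc p q 0 else gs)"
              by (intro sum.cong refl) (use False in auto)
            then show ?case using leu[OF k3] False by simp
          qed (use r2 bnn in auto)
          then show ?thesis using r2 k3 kB False by (simp del: One_nat_def)
        qed
      qed
    qed
  qed
qed

lemma wp_up:
  assumes s: "st x s" and k: "regs s 1 = k" and m: "fl s k > 0 \<or> k < n" "fl s k < B" and mode: "regs s 2 = 0"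
    and f1: "\<And>s'. fl s k > 0 \<Longrightarrow> st x s' \<Longrightarrow> regs s' = (regs s)(2 := 1) \<Longrightarrow> lv s' = lv s \<Longrightarrow> fl s' = (fl s)(k := fl s k - 1) \<Longrightarrow>
       hs s' = hs s \<Longrightarrow> reported s' = reported s \<Longrightarrow> clock s' \<le> clock s + 3 \<Longrightarrow> f s' \<le> b"
    and f2: "\<And>s'. fl s k = 0 \<Longrightarrow> k < n \<Longrightarrow> st x s' \<Longrightarrow> regs s' 1 = Suc k \<Longrightarrow> (\<And>r. r \<notin> {1, 5, 8, 9, 13} \<Longrightarrow> regs s' r = regs s r) \<Longrightarrow>
      (\<And>j. Suc k \<le> j \<Longrightarrow> j \<le> n \<Longrightarrow> lv s' j = lv s j) \<Longrightarrow> fl s' = fl s \<Longrightarrow> hs s' = hs s \<Longrightarrow> reported s' = reported s \<Longrightarrow>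
      clock s' \<le> clock s + 5 * k + 10 \<Longrightarrow> f s' \<le> b"
  shows "WP p_up f s \<le> b"
proof -
  have kn: "k \<le> n" and n: "regs s 0 = n" using stD[OF s] k by auto
  show ?thesis
  proof (cases "fl s k > 0")
    case True
    have fin: "f S \<le> b" if S: "regs S = (regs s)(2 := 1)" "mem S = (mem s)(aX 3 k := fl s k - 1)" "reported S = reported s" "clock S = clock s + 3" for S
    proof -
      have "st x S" "lv S = lv s" using st_cong(1)[of S s x] st_cong(2)[of S s] S s by simp_all
      then show ?thesis by (intro f1[OF True]) (use S in \<open>simp_all add: fun_eq_iff\<close>)
    qed
    show ?thesis using True n k kn m unfolding p_up_def
      by (simp add: one_mod del: One_nat_def) (rule fin; simp add: one_mod del: One_nat_def)
  next
    case False
    then have kn': "k < n" using m by simp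
    have st': "st x (tick s)" "lv (tick s) = lv s" using st_cong(1)[of "tick s" s x] st_cong(2)[of "tick s" s] s by simp_all
    have "WP p_uncontract f (tick s) \<le> b"
      by (rule wp_uncontract[OF st'(1) _ kn']) (use k f2 False kn' st'(2) in simp_all)
    then show ?thesis using False n k kn unfolding p_up_def by (simp del: One_nat_def)
  qed
qed

end


section \<open>The main loop\<close>

context search begin

text \<open>Below the top at most one revisit is pending per level; the counter at level
  \<open>n\<close> only has to keep clear of the modulus.\<close>

definition I0 :: "(nat \<Rightarrow> nat) \<Rightarrow> state \<Rightarrow> bool" where
  "I0 x s \<longleftrightarrow> st x s \<and> regs s 2 \<le> 1 \<and> 2 \<le> regs s 1 \<and> (\<forall>j. regs s 1 \<le> j \<and> j < n \<longrightarrow> fl s j \<le> 1) \<and> fl s n + 10 < B"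

definition stop_out where
  "stop_out x s s' \<longleftrightarrow> I0 x s' \<and> cons x s s' \<and> regs s' 1 = regs s 1 \<and> regs s' 2 = 0 \<and> lv s' = lv s \<and> fl s' = fl s \<and>
     clock s' \<le> clock s + 16 * regs s 1 + 62"

definition con_out where
  "con_out x s p q i s' \<longleftrightarrow> p < regs s 1 \<and> q < regs s 1 \<and> p \<noteq> q \<and> mem s (aM (rp s p) (rp s q)) > 0 \<and> 2 < regs s 1 \<and>
     i \<le> (1::nat) \<and> I0 x s' \<and> cons x s s' \<and> regs s' 1 = regs s 1 - 1 \<and> regs s' 2 = 1 \<and>
     (\<forall>j. regs s 1 \<le> j \<and> j \<le> n \<longrightarrow> lv s' j = lv s j) \<and> lv s' (regs s 1 - 1) = merge (rp s q) (rp s p) (lv s (regs s 1)) \<and>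
     fl s' = (fl s)(regs s 1 - 1 := i) \<and> clock s' \<le> clock s + 16 * regs s 1 + 62"

definition up1_out where
  "up1_out x s s' \<longleftrightarrow> fl s (regs s 1) > 0 \<and> I0 x s' \<and> regs s' = (regs s)(2 := 1) \<and> lv s' = lv s \<and>
     fl s' = (fl s)(regs s 1 := fl s (regs s 1) - 1) \<and> hs s' = hs s \<and> reported s' = reported s \<and> clock s' \<le> clock s + 5"

definition up2_out where
  "up2_out x s s' \<longleftrightarrow> fl s (regs s 1) = 0 \<and> regs s 1 < n \<and> I0 x s' \<and> regs s' 1 = Suc (regs s 1) \<and> regs s' 2 = 0 \<and> regs s' 3 = regs s 3 \<and>
     regs s' 4 = regs s 4 \<and> (\<forall>j. Suc (regs s 1) \<le> j \<and> j \<le> n \<longrightarrow> lv s' j = lv s j) \<and> fl s' = fl s \<and> hs s' = hs s \<and> reported s' = reported s \<and>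
     clock s' \<le> clock s + 5 * regs s 1 + 12"

text \<open>The one-step supermartingale condition: the successors' potentials, averaged over the
  random pair and the revisit flag, do not exceed \<open>b\<close>.\<close>

definition avg_ok :: "state \<Rightarrow> real \<Rightarrow> (nat \<Rightarrow> nat \<Rightarrow> nat \<Rightarrow> real) \<Rightarrow> real \<Rightarrow> bool" where
  "avg_ok s gs gc b \<longleftrightarrow> 0 \<le> gs \<and> (\<forall>p q i. 0 \<le> gc p q i) \<and> (let k = regs s 1; m = (\<lambda>p q. mem s (aM (rp s p) (rp s q))) in
     (k = 2 \<longrightarrow> gs \<le> b) \<and>
     (2 < k \<and> k \<le> k0 \<longrightarrow> (\<Sum>p<k. \<Sum>q<k. if m p q > 0 then gc p q 0 else gs) \<le> real k * real k * b) \<and>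
     (k0 < k \<longrightarrow> (\<Sum>p<k. \<Sum>q<k. real (m p q) * ((1 - rho k) * gc p q 0 + rho k * gc p q 1)) \<le> real (xw (same (part (lv s k)))) * b))"

lemma sum_con: "regs s 1 \<le> n \<Longrightarrow> 1 \<le> regs s 1 \<Longrightarrow> regs s' 1 = regs s 1 - 1 \<Longrightarrow> fl s' = (fl s)(regs s 1 - 1 := i) \<Longrightarrow>
    (\<Sum>j\<in>{regs s' 1..n}. g j (fl s' j)) = (g (regs s 1 - 1) i :: 'a :: comm_monoid_add) + (\<Sum>j\<in>{regs s 1..n}. g j (fl s j))"
proof -
  assume h: "regs s 1 \<le> n" "1 \<le> regs s 1" "regs s' 1 = regs s 1 - 1" and f: "fl s' = (fl s)(regs s 1 - 1 := i)"
  have fj: "fl s' j = ((fl s)(regs s 1 - 1 := i)) j" for j using fun_cong[OF f, of j] by simp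
  have "{regs s' 1..n} = insert (regs s 1 - 1) {regs s 1..n}" using h by auto
  then have "(\<Sum>j\<in>{regs s' 1..n}. g j (fl s' j)) = g (regs s 1 - 1) (fl s' (regs s 1 - 1)) + (\<Sum>j\<in>{regs s 1..n}. g j (fl s' j))"
    using h by simp
  also have "(\<Sum>j\<in>{regs s 1..n}. g j (fl s' j)) = (\<Sum>j\<in>{regs s 1..n}. g j (fl s j))"
    by (intro sum.cong refl) (use h in \<open>auto simp: fj\<close>)
  finally show ?thesis by (simp add: fj)
qed

lemma prod_con: "regs s 1 \<le> n \<Longrightarrow> 1 \<le> regs s 1 \<Longrightarrow> regs s' 1 = regs s 1 - 1 \<Longrightarrow> fl s' = (fl s)(regs s 1 - 1 := i) \<Longrightarrow>
    (\<Prod>j\<in>{regs s' 1..n}. g j (fl s' j)) = (g (regs s 1 - 1) i :: 'a :: comm_monoid_mult) * (\<Prod>j\<in>{regs s 1..n}. g j (fl s j))"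
proof -
  assume h: "regs s 1 \<le> n" "1 \<le> regs s 1" "regs s' 1 = regs s 1 - 1" and f: "fl s' = (fl s)(regs s 1 - 1 := i)"
  have fj: "fl s' j = ((fl s)(regs s 1 - 1 := i)) j" for j using fun_cong[OF f, of j] by simp
  have "{regs s' 1..n} = insert (regs s 1 - 1) {regs s 1..n}" using h by auto
  then have "(\<Prod>j\<in>{regs s' 1..n}. g j (fl s' j)) = g (regs s 1 - 1) (fl s' (regs s 1 - 1)) * (\<Prod>j\<in>{regs s 1..n}. g j (fl s' j))"
    using h by simp
  also have "(\<Prod>j\<in>{regs s 1..n}. g j (fl s' j)) = (\<Prod>j\<in>{regs s 1..n}. g j (fl s j))"
    by (intro prod.cong refl) (use h in \<open>auto simp: fj\<close>)
  finally show ?thesis by (simp add: fj)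
qed

lemma ivl_head: "k \<le> n \<Longrightarrow> {k..n} = insert k {Suc k..n}" by auto

text \<open>A worst-case variant. A visit of level \<open>k\<close> has weight \<open>4 ^ k\<close>
  because it causes at most two visits of level \<open>k - 1\<close>; a pending visit carries one
  unit more for being started, and each level still to be undone one unit.\<close>

definition Vr :: "state \<Rightarrow> nat" where
  "Vr s = (if regs s 2 = 0 then 0 else 4 ^ regs s 1) + (\<Sum>j\<in>{regs s 1..n}. fl s j * (4 ^ j + 1)) + (n - regs s 1)"

lemma st_tick [simp]: "st x (tick s) = st x s" "lv (tick s) = lv s"
  using st_cong(1)[of "tick s" s x] st_cong(2)[of "tick s" s] by simp_all

lemma cons_tick [simp]: "cons x (tick s) s' = cons x s s'"
  unfolding cons_def Let_def by simp

lemma I0D: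
  assumes "I0 x s"
  shows "st x s" "regs s 2 \<le> 1" "2 \<le> regs s 1" "\<And>j. regs s 1 \<le> j \<Longrightarrow> j < n \<Longrightarrow> fl s j \<le> 1" "fl s n + 10 < B" "regs s 1 \<le> n" "regs s 0 = n"
  using assms stD(1,4)[of x s] by (auto simp: I0_def)

text \<open>Reduces an analysis of the search to a potential \<open>\<Psi>\<close> that averages out
  while descending and does not increase while going up. It is applied with potentials for time and
  for failure, and with a constant one.\<close>

lemma main_rule:
  assumes down: "\<And>s. I0 x s \<Longrightarrow> Lg s \<Longrightarrow> regs s 2 = 1 \<Longrightarrow> \<exists>gs gc. avg_ok s gs gc (\<Psi> s) \<and>
        (\<forall>s'. stop_out x s s' \<longrightarrow> Lg s' \<and> \<Psi> s' \<le> gs) \<and> (\<forall>p q i s'. con_out x s p q i s' \<longrightarrow> Lg s' \<and> \<Psi> s' \<le> gc p q i)"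
    and up1: "\<And>s s'. I0 x s \<Longrightarrow> Lg s \<Longrightarrow> regs s 2 = 0 \<Longrightarrow> up1_out x s s' \<Longrightarrow> Lg s' \<and> \<Psi> s' \<le> \<Psi> s"
    and up2: "\<And>s s'. I0 x s \<Longrightarrow> Lg s \<Longrightarrow> regs s 2 = 0 \<Longrightarrow> up2_out x s s' \<Longrightarrow> Lg s' \<and> \<Psi> s' \<le> \<Psi> s"
    and exit: "\<And>s. I0 x s \<Longrightarrow> Lg s \<Longrightarrow> regs s 2 = 0 \<Longrightarrow> regs s 1 = n \<Longrightarrow> fl s n = 0 \<Longrightarrow> f (tick s) \<le> ennreal (\<Psi> s)"
    and s: "I0 x s" "Lg s"
  shows "WP (p_main k0 k1) f s \<le> ennreal (\<Psi> s)"
proof -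
  let ?e = "Plus (Reg 2) (Plus (Less (Reg 1) (Reg 0)) (Load (eX 3 (Reg 0))))"
  have ge: "EV ?e s = (regs s 2 + ((if regs s 1 < n then 1 else 0) + fl s n))" if "I0 x s" for s
    using I0D[OF that] n_HM by (simp del: One_nat_def add: mod_less)
  have "I0 x s \<and> Lg s \<Longrightarrow> WP (While ?e (If (Reg 2) (p_down k0 k1) p_up)) f s \<le> ennreal (\<Psi> s)"
  proof (rule wp_While[where I = "\<lambda>s. I0 x s \<and> Lg s" and V = Vr and F = "\<lambda>s. ennreal (\<Psi> s)"], goal_cases)
    case (1 s)
    note Is = I0D[OF conjunct1[OF 1(2)]] and I = conjunct1[OF 1(2)] and Lg = conjunct2[OF 1(2)]
    let ?s = "tick (tick s)"
    let ?f = "\<lambda>s'. if (I0 x s' \<and> Lg s') \<and> Vr s' < Vr s then ennreal (\<Psi> s') else \<infinity>"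
    have sts: "st x ?s" using Is by simp
    show ?case
    proof (cases "regs s 2 = 0")
      case False
      then have m1: "regs s 2 = 1" using Is(2) by simp
      obtain gs gc where a: "avg_ok s gs gc (\<Psi> s)" and ls: "\<And>s'. stop_out x s s' \<Longrightarrow> Lg s' \<and> \<Psi> s' \<le> gs"
        and lc: "\<And>p q i s'. con_out x s p q i s' \<Longrightarrow> Lg s' \<and> \<Psi> s' \<le> gc p q i" using down[OF I Lg m1] by blast
      have "WP (p_down k0 k1) ?f ?s \<le> ennreal (\<Psi> s)"
      proof (rule wp_down[OF sts, where k = "regs s 1" and gs = gs and gc = gc], goal_cases)
        case (5 s')
        have f': "fl s' j = fl s j" for j using fun_cong[OF 5(6), of j] by simp
        have so: "stop_out x s s'"
          unfolding stop_out_def I0_def using 5 Is m1 by (simp add: f' del: One_nat_def)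
        have "Vr s' < Vr s" unfolding Vr_def using 5 m1 by (simp add: f' del: One_nat_def)
        then show ?case using ls[OF so] so by (simp add: stop_out_def ennreal_leI)
      next
        case (6 s' p q i)
        have k3: "2 < regs s 1" by (rule 6(1))
        have f': "fl s' = (fl s)(regs s 1 - 1 := i)" using 6 by simp
        have fj: "fl s' j = ((fl s)(regs s 1 - 1 := i)) j" for j using fun_cong[OF f', of j] by simp
        have fn: "fl s' n = fl s n" using fj[of n] k3 Is by auto
        have i1: "i \<le> 1" using 6(6) by auto
        have I': "I0 x s'" unfolding I0_def
          using 6(7,9,10) Is k3 m1 fn i1 by (auto simp: fj simp del: One_nat_def)
        have co: "con_out x s p q i s'"
          unfolding con_out_def using 6 I' k3 m1 i1 by (auto simp del: One_nat_def)
        have "Vr s' < Vr s"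
        proof -
          have r: "regs s' 1 = regs s 1 - 1" "regs s' 2 = 1" using 6 m1 by simp_all
          have "(\<Sum>j\<in>{regs s' 1..n}. fl s' j * (4 ^ j + 1)) = i * (4 ^ (regs s 1 - 1) + 1) + (\<Sum>j\<in>{regs s 1..n}. fl s j * (4 ^ j + 1))"
            by (rule sum_con[where g = "\<lambda>j y. y * (4 ^ j + 1)", OF _ _ r(1) f']) (use Is in auto)
          moreover have "i * (4 ^ (regs s 1 - 1) + 1) \<le> 4 ^ (regs s 1 - 1) + 1" using i1 mult_right_mono[of i 1 "4 ^ (regs s 1 - 1) + 1"] by simp
          \<comment> \<open>Two of the four parts pay for the new visit and a possible revisit; the
            others exceed the two extra units.\<close>
          moreover have "(4::nat) ^ regs s 1 = 4 * 4 ^ (regs s 1 - 1)" using Is(3) by (metis One_nat_def Suc_pred less_le_trans pos2 power_Suc)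
          moreover have "(4::nat) ^ (regs s 1 - 1) > 1" using k3 by (intro one_less_power) auto
          moreover have "n - (regs s 1 - 1) \<le> n - regs s 1 + 1" by simp
          ultimately show ?thesis unfolding Vr_def r m1 by simp
        qed
        then show ?case using lc[OF co] I' by (simp add: ennreal_leI)
      qed (use Is a in \<open>simp_all add: avg_ok_def Let_def del: One_nat_def\<close>)
      then show ?thesis using False by simp
    next
      case True
      have g: "regs s 1 < n \<or> fl s n > 0" using 1(3) ge[OF I] True by (auto split: if_splits)
      have m: "fl ?s (regs s 1) > 0 \<or> regs s 1 < n" using g Is(6) by (cases "regs s 1 = n") auto
      have mB: "fl s (regs s 1) < B" using Is(4)[of "regs s 1"] Is(5,6) B_addr by (cases "regs s 1 = n") auto
      have "WP p_up ?f ?s \<le> ennreal (\<Psi> s)"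
      proof (rule wp_up[OF sts, where k = "regs s 1"], goal_cases)
        case (5 s')
        have f': "fl s' = (fl s)(regs s 1 := fl s (regs s 1) - 1)" using 5 by simp
        have fj: "fl s' j = ((fl s)(regs s 1 := fl s (regs s 1) - 1)) j" for j using fun_cong[OF f', of j] by simp
        have I': "I0 x s'" unfolding I0_def
        proof (intro conjI allI impI)
          fix j assume "regs s' 1 \<le> j \<and> j < n"
          then show "fl s' j \<le> 1" using Is(4)[of j] 5(3) unfolding fj by (auto simp del: One_nat_def)
        next
          show "fl s' n + 10 < B" using Is(5) unfolding fj by auto
        qed (use 5 Is in simp_all)
        have uo: "up1_out x s s'" unfolding up1_out_def using 5 I' f' by simp
        have "Vr s' < Vr s"
        proof -
          have r: "regs s' 1 = regs s 1" "regs s' 2 = 1" using 5 by simp_all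
          have "(\<Sum>j\<in>{Suc (regs s 1)..n}. fl s' j * (4 ^ j + 1)) = (\<Sum>j\<in>{Suc (regs s 1)..n}. fl s j * (4 ^ j + 1))"
            by (intro sum.cong refl) (simp add: fj)
          moreover have "fl s (regs s 1) * (4 ^ regs s 1 + 1) = (fl s (regs s 1) - 1) * (4 ^ regs s 1 + 1) + (4 ^ regs s 1 + 1)"
            using 5(1) by (cases "fl s (regs s 1)") auto
          moreover have "fl s' (regs s 1) = fl s (regs s 1) - 1" by (simp add: fj)
          ultimately show ?thesis unfolding Vr_def r True ivl_head[OF Is(6)] by simp
        qed
        then show ?case using up1[OF I Lg True uo] I' by (simp add: ennreal_leI)
      next
        case (6 s')
        have f': "fl s' j = fl s j" for j using fun_cong[OF 6(7), of j] by simp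
        have r: "regs s' 1 = Suc (regs s 1)" "regs s' 2 = 0" "regs s' 3 = regs s 3" "regs s' 4 = regs s 4"
          using 6(4) 6(5)[of 2] 6(5)[of 3] 6(5)[of 4] True by simp_all
        have I': "I0 x s'" unfolding I0_def using 6(3) r Is f' by (auto simp del: One_nat_def)
        have uo: "up2_out x s s'" unfolding up2_out_def using 6 r I' by simp
        have "Vr s' < Vr s" unfolding Vr_def r True ivl_head[OF Is(6)] using 6(1,2) by (simp add: f')
        then show ?case using up2[OF I Lg True uo] I' by (simp add: ennreal_leI)
      qed (use m mB True in simp_all)
      then show ?thesis using True by simp
    qed
  next
    case (2 s)
    then have "I0 x s" "EV ?e s = 0" by auto
    then have "regs s 2 = 0" "\<not> regs s 1 < n" "fl s n = 0" using ge[of s] by (auto split: if_splits)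
    then show ?case using exit[of s] 2 I0D(6)[of x s] by auto
  qed
  then show ?thesis using s unfolding p_main_def by simp
qed

end


locale search2 = search G n \<alpha> B HM k0 k1
  for G :: "(nat, nat) multigraph" and n :: nat and \<alpha> :: real and B HM k0 k1 :: nat +
  assumes alpha1: "1 \<le> \<alpha>" and k1_ge: "2 * \<alpha> \<le> real k1" and k0_ge: "2 * k1 \<le> k0"
begin

text \<open>The favourable samples run from 0 to the floor of \<open>2 * \<alpha> * n\<close>, so
  their number lies between \<open>2 * \<alpha> * n\<close> and \<open>2 * \<alpha> * n + 1\<close>.
  The lower bound serves the survival of cuts, the upper one the running time.\<close>

lemma rho_bounds:
  assumes "k0 < k"
  shows "2 * \<alpha> / (real k - 2 * \<alpha>) \<le> rho k" "rho k \<le> (2 * \<alpha> * real n + 1) / (real (k - k1) * real n)" "rho k \<le> 1" "0 \<le> rho k"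
proof -
  let ?N = "(k - k1) * n" and ?A = "{y. y < (k - k1) * n \<and> real y \<le> \<alpha> * real (2 * n)}"
  have kk: "k1 < k - k1" using assms k0_ge by simp
  have N0: "?N > 0" using kk n2 by simp
  have an: "0 \<le> \<alpha> * real (2 * n)" using alpha1 by simp
  let ?t = "nat \<lfloor>\<alpha> * real (2 * n)\<rfloor>"
  have t: "real ?t \<le> \<alpha> * real (2 * n)" "\<alpha> * real (2 * n) < real ?t + 1" using an by linarith+
  have A: "?A = {..<?N} \<inter> {..?t}"
    using t by (auto simp: le_nat_floor simp del: of_nat_mult)
  have c1: "card ?A \<le> ?N" using card_mono[of "{..<?N}" ?A] by auto
  have c2: "card ?A \<le> ?t + 1" unfolding A using card_mono[of "{..?t}" "{..<?N} \<inter> {..?t}"] by auto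
  have "2 * \<alpha> * real n \<le> real ?N"
  proof -
    have "2 * \<alpha> * real n \<le> real (k - k1) * real n" using k1_ge kk by (intro mult_right_mono) linarith+
    then show ?thesis by simp
  qed
  moreover have "card ?A = min ?N (?t + 1)"
  proof -
    have "{..<?N} \<inter> {..?t} = {..<min ?N (?t + 1)}" by auto
    then show ?thesis unfolding A by simp
  qed
  ultimately have lo: "2 * \<alpha> * real n \<le> real (card ?A)" using t(2) by (auto simp: min_def mult_ac)
  have n0: "real n > 0" using n2 by simp
  have d: "real (k - k1) > 0" using kk by simp
  have "2 * \<alpha> / (real k - 2 * \<alpha>) \<le> 2 * \<alpha> / real (k - k1)"
    using k1_ge kk alpha1 by (intro divide_left_mono mult_pos_pos) (auto simp: of_nat_diff)
  also have "\<dots> = 2 * \<alpha> * real n / real ?N" using n0 by simp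
  also have "\<dots> \<le> rho k" unfolding rho_def by (rule divide_right_mono[OF lo]) simp
  finally show "2 * \<alpha> / (real k - 2 * \<alpha>) \<le> rho k" .
  have "real (card ?A) \<le> 2 * \<alpha> * real n + 1" using c2 t(1) by (simp add: mult_ac)
  then have "rho k \<le> (2 * \<alpha> * real n + 1) / real ?N" unfolding rho_def by (rule divide_right_mono) simp
  then show "rho k \<le> (2 * \<alpha> * real n + 1) / (real (k - k1) * real n)" by simp
  show "rho k \<le> 1" "0 \<le> rho k" unfolding rho_def using c1 N0 by (simp_all del: of_nat_mult)
qed

lemma pair_sum:
  assumes s: "st x s" and h: "\<And>r. g r r = 0"
  shows "(\<Sum>p<regs s 1. \<Sum>q<regs s 1. g (rp s p) (rp s q) * mem s (aM (rp s p) (rp s q)))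
     = (\<Sum>r\<in>lv s (regs s 1) ` V. \<Sum>t\<in>lv s (regs s 1) ` V. g r t * wt (lv s (regs s 1)) r t)"
proof -
  let ?L = "lv s (regs s 1)" and ?k = "regs s 1"
  have k: "?k \<le> n" using stD[OF s] by simp
  have "(\<Sum>p<?k. \<Sum>q<?k. g (rp s p) (rp s q) * mem s (aM (rp s p) (rp s q))) = (\<Sum>p<?k. \<Sum>q<?k. g (rp s p) (rp s q) * wt ?L (rp s p) (rp s q))"
  proof (intro sum.cong refl)
    fix p q assume "p \<in> {..<?k}" "q \<in> {..<?k}"
    then show "g (rp s p) (rp s q) * mem s (aM (rp s p) (rp s q)) = g (rp s p) (rp s q) * wt ?L (rp s p) (rp s q)"
      using st_wt[OF s, of p q] h by (cases "p = q") simp_all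
  qed
  also have "\<dots> = (\<Sum>p<?k. \<Sum>t\<in>?L ` V. g (rp s p) t * wt ?L (rp s p) t)"
    by (intro sum.cong refl st_sum[OF s])
  also have "\<dots> = (\<Sum>r\<in>?L ` V. \<Sum>t\<in>?L ` V. g r t * wt ?L r t)"
    by (rule st_sum[OF s])
  finally show ?thesis .
qed

lemma st_diag: "st x s \<Longrightarrow> p < regs s 1 \<Longrightarrow> mem s (aM (rp s p) (rp s p)) = 0"
  using goodD(6)[OF stD(2), of x s "rp s p"] st_rp[of x s p] stD(4)[of x s] by simp

lemma weight_sum:
  assumes s: "st x s"
  shows "(\<Sum>p<regs s 1. \<Sum>q<regs s 1. real (mem s (aM (rp s p) (rp s q)))) = real (xw (same (part (lv s (regs s 1)))))"
proof -
  have "(\<Sum>p<regs s 1. \<Sum>q<regs s 1. mem s (aM (rp s p) (rp s q))) = xw (same (part (lv s (regs s 1))))"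
    using st_de[OF s] st_row_sum[OF s] by simp
  then show ?thesis by (metis (no_types, lifting) of_nat_sum sum.cong)
qed

lemma same_sum:
  assumes s: "st x s" and P: "partition_on V P" and c: "coarser P (lv s (regs s 1))"
  shows "(\<Sum>p<regs s 1. \<Sum>q<regs s 1. if same P (rp s p) (rp s q) then real (mem s (aM (rp s p) (rp s q))) else 0) + 2 * real (cut_size G P)
     = real (xw (same (part (lv s (regs s 1)))))"
proof -
  let ?k = "regs s 1" and ?L = "lv s (regs s 1)"
  let ?g = "\<lambda>r t. if r \<noteq> t \<and> same P r t then 1 else (0::nat)"
  have kn: "?k \<le> n" using stD[OF s] by simp
  have "(\<Sum>p<?k. \<Sum>q<?k. if same P (rp s p) (rp s q) then real (mem s (aM (rp s p) (rp s q))) else 0)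
     = real (\<Sum>p<?k. \<Sum>q<?k. ?g (rp s p) (rp s q) * mem s (aM (rp s p) (rp s q)))"
    unfolding of_nat_sum
  proof (intro sum.cong refl)
    fix p q assume pq: "p \<in> {..<?k}" "q \<in> {..<?k}"
    show "(if same P (rp s p) (rp s q) then real (mem s (aM (rp s p) (rp s q))) else 0) = real (?g (rp s p) (rp s q) * mem s (aM (rp s p) (rp s q)))"
    proof (cases "rp s p = rp s q")
      case True
      then have "mem s (aM (rp s p) (rp s q)) = 0" using st_diag[OF s, of p] pq by simp
      then show ?thesis by simp
    next
      case False
      then show ?thesis by simp
    qed
  qed
  also have "\<dots> = real (\<Sum>r\<in>?L`V. \<Sum>t\<in>?L`V. ?g r t * wt ?L r t)"
    by (subst pair_sum[OF s]) simp_all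
  also have "(\<Sum>r\<in>?L`V. \<Sum>t\<in>?L`V. ?g r t * wt ?L r t) = (\<Sum>r\<in>?L`V. \<Sum>t\<in>?L`V. if r \<noteq> t \<and> same P r t then wt ?L r t else 0)"
    by (intro sum.cong refl) simp
  finally have e: "(\<Sum>p<?k. \<Sum>q<?k. if same P (rp s p) (rp s q) then real (mem s (aM (rp s p) (rp s q))) else 0)
     = real (\<Sum>r\<in>?L`V. \<Sum>t\<in>?L`V. if r \<noteq> t \<and> same P r t then wt ?L r t else 0)" .
  show ?thesis unfolding e
    using arg_cong[OF same_weight[OF P st_lab(1)[OF s] c], of real] xw_cut_size[OF P] by simp
qed

lemma I0_tick [simp]: "I0 x (tick s) = I0 x s" by (simp add: I0_def)

text \<open>Bounds the expected cost of a visit of level \<open>k\<close>.\<close>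

primrec vis :: "nat \<Rightarrow> real" where
  "vis 0 = 0"
| "vis (Suc k) = 21 * real k + 90 + vis k + (if k0 < Suc k then rho (Suc k) * (vis k + 5) else 0)"

lemma vis_nonneg: "0 \<le> vis k"
  by (induction k) (auto simp: rho_bounds intro!: add_nonneg_nonneg mult_nonneg_nonneg)

text \<open>Time spent, the visit in progress, the pending visits with 5 steps for starting each,
  and the undoing of all levels up to the top; the 1 is the last test of the guard.\<close>

definition pt :: "state \<Rightarrow> real" where
  "pt s = real (clock s) + 1 + (if regs s 2 = 1 then vis (regs s 1) else 0) + (\<Sum>j\<in>{regs s 1..n}. real (fl s j) * (vis j + 5))
     + (\<Sum>j\<in>{regs s 1..<n}. real (5 * j + 12))"

text \<open>The constant \<open>c\<close> stands for the time spent after the search, so that rounds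
  can be chained.\<close>

lemma main_time:
  assumes s: "I0 x s" "regs s 2 = 0" "regs s 1 = n" and c: "0 \<le> c"
    and f: "\<And>s'. I0 x s' \<Longrightarrow> regs s' 2 = 0 \<Longrightarrow> regs s' 1 = n \<Longrightarrow> fl s' n = 0 \<Longrightarrow> f s' \<le> ennreal (real (clock s') + c)"
  shows "WP (p_main k0 k1) f s \<le> ennreal (real (clock s) + 1 + real (fl s n) * (vis n + 5) + c)"
proof -
  have "WP (p_main k0 k1) f s \<le> ennreal (pt s + c)"
  proof (rule main_rule[where Lg = "\<lambda>_. True" and x = x])
    fix s assume I: "I0 x s" and m: "regs s 2 = 1"
    note Is = I0D[OF I]
    let ?k = "regs s 1" and ?F = "\<Sum>j\<in>{regs s 1..n}. real (fl s j) * (vis j + 5)" and ?U = "\<Sum>j\<in>{regs s 1..<n}. real (5 * j + 12)"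
    define E where "E = real (clock s) + 1 + 16 * real ?k + 62 + ?F + ?U + c"
    define gc where "gc = (\<lambda>(p::nat) (q::nat) (i::nat). E + vis (?k - 1) + real i * (vis (?k - 1) + 5) + real (5 * (?k - 1) + 12))"
    have F0: "0 \<le> ?F" by (intro sum_nonneg mult_nonneg_nonneg) (auto simp: vis_nonneg intro: add_nonneg_nonneg)
    have "0 \<le> ?U" by (rule sum_nonneg) simp
    then have E0: "0 \<le> E" unfolding E_def using F0 c by linarith
    have kS: "?k = Suc (?k - 1)" using Is(3) by simp
    \<comment> \<open>The coefficients in \<open>vis\<close>: \<open>16 * k + 62\<close> for going
      down from level \<open>k\<close> and \<open>5 * (k - 1) + 12\<close> for undoing it later; a
      revisit costs 5 more to start.\<close>
    have vk: "vis ?k = 16 * real ?k + 62 + real (5 * (?k - 1) + 12) + vis (?k - 1) + (if k0 < ?k then rho ?k * (vis (?k - 1) + 5) else 0)"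
      by (subst kS, subst vis.simps, subst kS[symmetric]) (use Is(3) in \<open>simp add: of_nat_diff\<close>)
    have r0: "0 \<le> (if k0 < ?k then rho ?k * (vis (?k - 1) + 5) else 0)" using vis_nonneg[of "?k - 1"] by (auto simp: rho_bounds)
    have b: "pt s + c = E + real (5 * (?k - 1) + 12) + vis (?k - 1) + (if k0 < ?k then rho ?k * (vis (?k - 1) + 5) else 0)"
      unfolding pt_def E_def using vk m by simp
    have a: "avg_ok s E gc (pt s + c)"
      unfolding avg_ok_def Let_def
    proof (intro conjI allI impI)
      show "0 \<le> E" by (rule E0)
      show "0 \<le> gc p q i" for p q i unfolding gc_def using E0 vis_nonneg[of "?k - 1"] by (intro add_nonneg_nonneg mult_nonneg_nonneg) auto
      show "E \<le> pt s + c" unfolding b using r0 vis_nonneg[of "?k - 1"] by simp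
      assume "2 < ?k \<and> ?k \<le> k0"
      then have "gc p q 0 = pt s + c" for p q unfolding b gc_def by simp
      then have "(\<Sum>p<?k. \<Sum>q<?k. if mem s (aM (rp s p) (rp s q)) > 0 then gc p q 0 else E) \<le> (\<Sum>p<?k. \<Sum>q<?k. pt s + c)"
        using \<open>E \<le> pt s + c\<close> by (intro sum_mono) auto
      then show "(\<Sum>p<?k. \<Sum>q<?k. if mem s (aM (rp s p) (rp s q)) > 0 then gc p q 0 else E) \<le> real ?k * real ?k * (pt s + c)" by simp
    next
      assume k: "k0 < ?k"
      have "(1 - rho ?k) * gc p q 0 + rho ?k * gc p q 1 = pt s + c" for p q
        unfolding b gc_def using k by (simp add: algebra_simps)
      then have "(\<Sum>p<?k. \<Sum>q<?k. real (mem s (aM (rp s p) (rp s q))) * ((1 - rho ?k) * gc p q 0 + rho ?k * gc p q 1))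
        = (\<Sum>p<?k. \<Sum>q<?k. real (mem s (aM (rp s p) (rp s q)))) * (pt s + c)" by (simp add: sum_distrib_right)
      then show "(\<Sum>p<?k. \<Sum>q<?k. real (mem s (aM (rp s p) (rp s q))) * ((1 - rho ?k) * gc p q 0 + rho ?k * gc p q 1))
        \<le> real (xw (same (part (lv s ?k)))) * (pt s + c)" using weight_sum[OF Is(1)] by simp
    qed
    have "pt s' + c \<le> E" if so: "stop_out x s s'" for s'
    proof -
      have h: "regs s' 1 = ?k" "regs s' 2 = 0" "fl s' = fl s" "clock s' \<le> clock s + 16 * ?k + 62" using so unfolding stop_out_def by blast+
      have fj: "fl s' j = fl s j" for j using fun_cong[OF h(3), of j] by simp
      have "real (clock s') \<le> real (clock s) + 16 * real ?k + 62" using h(4) by linarith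
      then show ?thesis unfolding pt_def E_def h fj by simp
    qed
    moreover have "pt s' + c \<le> gc p q i" if co: "con_out x s p q i s'" for p q i s'
    proof -
      have h: "regs s' 1 = ?k - 1" "regs s' 2 = 1" "fl s' = (fl s)(?k - 1 := i)" "clock s' \<le> clock s + 16 * ?k + 62" using co unfolding con_out_def by blast+
      have F: "(\<Sum>j\<in>{regs s' 1..n}. real (fl s' j) * (vis j + 5)) = real i * (vis (?k - 1) + 5) + ?F"
        by (rule sum_con[where g = "\<lambda>j y. real y * (vis j + 5)", OF _ _ h(1,3)]) (use Is in auto)
      have "{?k - 1..<n} = insert (?k - 1) {?k..<n}" using Is(3,6) by auto
      then have U: "(\<Sum>j\<in>{?k - 1..<n}. real (5 * j + 12)) = real (5 * (?k - 1) + 12) + ?U" using Is(3) by simp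
      have "real (clock s') \<le> real (clock s) + 16 * real ?k + 62" using h(4) by linarith
      then show ?thesis unfolding pt_def E_def gc_def F unfolding h(1,2) U by simp
    qed
    ultimately show "\<exists>gs gc. avg_ok s gs gc (pt s + c) \<and> (\<forall>s'. stop_out x s s' \<longrightarrow> True \<and> pt s' + c \<le> gs) \<and>
        (\<forall>p q i s'. con_out x s p q i s' \<longrightarrow> True \<and> pt s' + c \<le> gc p q i)" using a by blast
  next
    fix s s' assume I: "I0 x s" and m: "regs s 2 = 0" and u: "up1_out x s s'"
    note Is = I0D[OF I]
    have h: "regs s' = (regs s)(2 := 1)" "fl s' = (fl s)(regs s 1 := fl s (regs s 1) - 1)" "clock s' \<le> clock s + 5" "fl s (regs s 1) > 0"
      using u unfolding up1_out_def by blast+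
    have fj: "fl s' j = ((fl s)(regs s 1 := fl s (regs s 1) - 1)) j" for j using fun_cong[OF h(2), of j] by simp
    have r: "regs s' 1 = regs s 1" "regs s' 2 = 1" using h by simp_all
    have "(\<Sum>j\<in>{Suc (regs s 1)..n}. real (fl s' j) * (vis j + 5)) = (\<Sum>j\<in>{Suc (regs s 1)..n}. real (fl s j) * (vis j + 5))"
      by (intro sum.cong refl) (simp add: fj)
    moreover have e: "real (fl s (regs s 1)) = real (fl s' (regs s 1)) + 1" using h(4) by (simp add: fj of_nat_diff)
    moreover have "real (clock s') \<le> real (clock s) + 5" using h(3) by linarith
    ultimately show "True \<and> pt s' + c \<le> pt s + c"
      unfolding pt_def r m ivl_head[OF Is(6)] by (simp add: e distrib_right del: One_nat_def)
  next
    fix s s' assume I: "I0 x s" and m: "regs s 2 = 0" and u: "up2_out x s s'"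
    note Is = I0D[OF I]
    have h: "fl s (regs s 1) = 0" "regs s 1 < n" "regs s' 1 = Suc (regs s 1)" "regs s' 2 = 0" "fl s' = fl s" "clock s' \<le> clock s + 5 * regs s 1 + 12"
      using u unfolding up2_out_def by blast+
    have fj: "fl s' j = fl s j" for j using fun_cong[OF h(5), of j] by simp
    have "{regs s 1..<n} = insert (regs s 1) {Suc (regs s 1)..<n}" using h by auto
    then have U: "(\<Sum>j\<in>{regs s 1..<n}. real (5 * j + 12)) = real (5 * regs s 1 + 12) + (\<Sum>j\<in>{Suc (regs s 1)..<n}. real (5 * j + 12))" by simp
    have "real (clock s') \<le> real (clock s) + 5 * real (regs s 1) + 12" using h(6) by linarith
    then show "True \<and> pt s' + c \<le> pt s + c"
      unfolding pt_def U h(3,4) m ivl_head[OF Is(6)] fj using h(1) by simp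
  next
    fix s assume I: "I0 x s" and m: "regs s 2 = 0" "regs s 1 = n" "fl s n = 0"
    have "f (tick s) \<le> ennreal (real (clock (tick s)) + c)" by (rule f) (use I m in simp_all)
    also have "\<dots> \<le> ennreal (pt s + c)" by (rule ennreal_leI) (use m in \<open>simp add: pt_def\<close>)
    finally show "f (tick s) \<le> ennreal (pt s + c)" .
  qed (use s in auto)
  also have "pt s + c = real (clock s) + 1 + real (fl s n) * (vis n + 5) + c" using s by (simp add: pt_def)
  finally show ?thesis .
qed

text \<open>A lower bound for the probability that a visit of level \<open>k\<close> meets a given cut that has survived
  up to this level.\<close>

primrec qq :: "nat \<Rightarrow> real" where
  "qq 0 = 1"
| "qq (Suc k) = (if Suc k \<le> k0 then qq k / real k0 ^ 2 else qq k * (1 - 2 * \<alpha> / real (Suc k) * qq k))"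

lemma qq_pred:
  "1 \<le> k \<Longrightarrow> k \<le> k0 \<Longrightarrow> qq k = qq (k - 1) / real k0 ^ 2"
  "k0 < k \<Longrightarrow> qq k = qq (k - 1) * (1 - 2 * \<alpha> / real k * qq (k - 1))"
  by (cases k; simp)+

lemma qq_bounds: "0 < qq k \<and> qq k \<le> 1"
proof (induction k)
  case (Suc k)
  show ?case
  proof (cases "Suc k \<le> k0")
    case True
    have k0p: "0 < k0" using k0_2 by linarith
    have "real k0 ^ 2 \<ge> 1" using k0p by (simp add: one_le_power)
    then have "qq k \<le> real k0 ^ 2" using Suc by linarith
    moreover note k0p
    ultimately show ?thesis using True Suc by auto
  next
    case False
    have "2 * \<alpha> / real (Suc k) \<le> 1 / 2" using False k0_ge k1_ge alpha1 by (simp add: field_simps)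
    then have "2 * \<alpha> / real (Suc k) * qq k \<le> 1 / 2 * 1" using Suc by (intro mult_mono) auto
    moreover have "0 \<le> 2 * \<alpha> / real (Suc k) * qq k" using alpha1 Suc by simp
    ultimately have "0 < 1 - 2 * \<alpha> / real (Suc k) * qq k" "1 - 2 * \<alpha> / real (Suc k) * qq k \<le> 1" by linarith+
    then show ?thesis using False Suc mult_le_one[of "qq k" "1 - 2 * \<alpha> / real (Suc k) * qq k"] by simp
  qed
qed simp

abbreviation SS :: "nat set set set" where "SS \<equiv> small_compact_cuts \<alpha> G"

text \<open>In the first pass it is enough that the recorded minimum is no larger than the cut; for
  a minimum cut this certifies that the minimum is known.\<close>

definition found :: "nat set set \<Rightarrow> state \<Rightarrow> bool" where
  "found P s \<longleftrightarrow> (if regs s 3 = 0 then regs s 4 \<le> 2 * cut_size G P else P \<in> set (reported s))"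

text \<open>In the second pass the marks are exactly the fingerprints of reported cuts, so by
  injectivity an unmarked wanted cut is a new one.\<close>

definition LI :: "(nat \<Rightarrow> nat) \<Rightarrow> state \<Rightarrow> bool" where
  "LI x s \<longleftrightarrow> inj_on (\<lambda>P. hsh x (same P)) SS \<and> 2 * min_cut_size G \<le> regs s 4 \<and>
     (if regs s 3 = 0 then reported s = [] \<and> (\<forall>h. hs s h = 0)
      else regs s 4 = 2 * min_cut_size G \<and> distinct (reported s) \<and> set (reported s) \<subseteq> SS \<and>
        (\<forall>h. hs s h \<noteq> 0 \<longleftrightarrow> (\<exists>P\<in>set (reported s). hsh x (same P) = h)))"

lemma LI_cong:
  assumes "regs s' 3 = regs s 3" "regs s' 4 = regs s 4" "\<And>h. hs s' h = hs s h" "reported s' = reported s"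
  shows "LI x s' = LI x s" "found P s' = found P s"
  unfolding LI_def found_def using assms by simp_all

lemma SS_D: "P \<in> SS \<Longrightarrow> compact_cut G P" "P \<in> SS \<Longrightarrow> partition_on V P" "P \<in> SS \<Longrightarrow> is_cut G P"
   "P \<in> SS \<Longrightarrow> real (cut_size G P) \<le> \<alpha> * real (min_cut_size G)"
  by (auto simp: small_compact_cuts_def compact_cut_def is_cut_iff)

lemma current_cut:
  assumes I: "I0 x s"
  shows "compact_cut G (part (lv s (regs s 1)))" "xw (same (part (lv s (regs s 1)))) = 2 * cut_size G (part (lv s (regs s 1)))"
    "min_cut_size G \<le> cut_size G (part (lv s (regs s 1)))"
    "hsh x (\<lambda>u v. lv s (regs s 1) u = lv s (regs s 1) v) = hsh x (same (part (lv s (regs s 1))))"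
proof -
  note Is = I0D[OF I]
  let ?L = "lv s (regs s 1)"
  have "compact_lab ?L" using goodD(14)[OF stD(2)[OF Is(1)], of "regs s 1"] Is(6) by (simp add: lv_def)
  then show c: "compact_cut G (part ?L)" using compact_part[OF st_lab(1)[OF Is(1)]] st_lab(3)[OF Is(1)] Is(3) by simp
  show "xw (same (part ?L)) = 2 * cut_size G (part ?L)" by (rule xw_cut_size[OF part_partition])
  show "min_cut_size G \<le> cut_size G (part ?L)" using c by (intro min_cut_le) (simp add: compact_cut_def)
  show "hsh x (\<lambda>u v. ?L u = ?L v) = hsh x (same (part ?L))"
    unfolding hsh_def by (intro sum.cong refl) (simp add: same_part verts_G)
qed

lemma cons_LI:
  assumes I: "I0 x s" and L: "LI x s" and c: "cons x s s'"
  shows "LI x s'" "found P s \<Longrightarrow> found P s'" "part (lv s (regs s 1)) = P \<Longrightarrow> P \<in> SS \<Longrightarrow> found P s'"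
proof -
  let ?Q = "part (lv s (regs s 1))"
  note cc = current_cut[OF I]
  have c': "regs s' 3 = regs s 3" "regs s' 4 = min (regs s 4) (2 * cut_size G ?Q)"
     "if regs s 3 \<noteq> 0 \<and> real (2 * cut_size G ?Q) \<le> \<alpha> * real (regs s' 4) \<and> hs s (hsh x (same ?Q)) = 0
      then hs s' = (hs s)(hsh x (same ?Q) := 1) \<and> reported s' = reported s @ [?Q]
      else hs s' = hs s \<and> reported s' = reported s"
    using c unfolding cons_def Let_def cc(2,4) by blast+
  have "LI x s' \<and> (found P s \<longrightarrow> found P s') \<and> (?Q = P \<longrightarrow> P \<in> SS \<longrightarrow> found P s')"
  proof (cases "regs s 3 = 0")
    case True
    then have h: "hs s' = hs s" "reported s' = reported s" using c'(3) by auto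
    have hj: "hs s' j = hs s j" for j using fun_cong[OF h(1), of j] by simp
    have "LI x s'" using L True c'(1,2) h(2) hj cc(3) unfolding LI_def by simp
    moreover have "found P s \<longrightarrow> found P s'" "?Q = P \<longrightarrow> found P s'" using True c'(1,2) by (auto simp: found_def)
    ultimately show ?thesis by blast
  next
    case False
    have l: "inj_on (\<lambda>P. hsh x (same P)) SS" "regs s 4 = 2 * min_cut_size G" "distinct (reported s)" "set (reported s) \<subseteq> SS"
      "\<And>h. hs s h \<noteq> 0 \<longleftrightarrow> (\<exists>P\<in>set (reported s). hsh x (same P) = h)"
      using L False unfolding LI_def by auto
    have r4: "regs s' 4 = 2 * min_cut_size G" using c'(2) l(2) cc(3) by simp
    have sm: "real (2 * cut_size G ?Q) \<le> \<alpha> * real (regs s' 4) \<longleftrightarrow> ?Q \<in> SS"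
      unfolding r4 using cc(1) by (simp add: small_compact_cuts_def)
    have H: "hs s (hsh x (same ?Q)) = 0 \<longleftrightarrow> ?Q \<notin> set (reported s)" if "?Q \<in> SS"
      using l(5)[of "hsh x (same ?Q)"] l(4) inj_onD[OF l(1) _ that] by (metis subsetD)
    show ?thesis
    proof (cases "?Q \<in> SS \<and> ?Q \<notin> set (reported s)")
      case True
      then have h: "hs s' = (hs s)(hsh x (same ?Q) := 1)" "reported s' = reported s @ [?Q]" using c'(3) sm H False by auto
      have hj: "hs s' j = ((hs s)(hsh x (same ?Q) := 1)) j" for j using fun_cong[OF h(1), of j] by simp
      have "hs s' h \<noteq> 0 \<longleftrightarrow> (\<exists>P\<in>set (reported s'). hsh x (same P) = h)" for h
        unfolding hj h(2) using l(5)[of h] by auto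
      then have "LI x s'" unfolding LI_def using l r4 False c'(1) True h(2) by simp
      moreover have "found P s \<longrightarrow> found P s'" "?Q = P \<longrightarrow> found P s'" using False c'(1) h(2) by (auto simp: found_def)
      ultimately show ?thesis by blast
    next
      case nt: False
      then have h: "hs s' = hs s" "reported s' = reported s" using c'(3) sm H False by (auto split: if_splits)
      have hj: "hs s' j = hs s j" for j using fun_cong[OF h(1), of j] by simp
      have "LI x s'" using L unfolding LI_def r4 h(2) hj c'(1) l(2) .
      moreover have "found P s \<longrightarrow> found P s'" using c'(1) h(2) False by (simp add: found_def)
      moreover have "?Q = P \<longrightarrow> P \<in> SS \<longrightarrow> found P s'" using nt c'(1) h(2) False by (auto simp: found_def)
      ultimately show ?thesis by blast
    qed
  qed
  then show "LI x s'" "found P s \<Longrightarrow> found P s'" "?Q = P \<Longrightarrow> P \<in> SS \<Longrightarrow> found P s'" by blast+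
qed

text \<open>Bounds the probability that one pending visit of level \<open>j\<close> misses
  \<open>P\<close>; a cut lost at that level is surely missed.\<close>

definition qa :: "nat set set \<Rightarrow> state \<Rightarrow> nat \<Rightarrow> real" where
  "qa P s j = (if coarser P (lv s j) then 1 - qq j else 1)"

lemma qa_bounds: "0 \<le> qa P s j" "qa P s j \<le> 1"
  using qq_bounds[of j] by (auto simp: qa_def)

text \<open>Bounds the probability that \<open>P\<close> is missed, considering the pending visits as independent.\<close>

definition pf :: "nat set set \<Rightarrow> state \<Rightarrow> real" where
  "pf P s = (if found P s then 0 else
     (if regs s 2 = 1 then qa P s (regs s 1) else 1) * (\<Prod>j\<in>{regs s 1..n}. qa P s j ^ fl s j))"

text \<open>One generation of the branching process: \<open>S / W\<close> is the chance of survival,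
  after which one visit misses with probability \<open>1 - q\<close> and two with its square. By the
  identity \<open>(1 - a / k) * (1 + a / (k - a) * (1 - q)) = 1 - a / k * q\<close>, the loss in the
  hit probability is only quadratic in \<open>q\<close>.\<close>

lemma pf_step_w:
  fixes W S q a k rest \<rho> :: real
  assumes "S \<ge> W * (1 - a / k)" "0 < q" "q \<le> 1" "a / (k - a) \<le> \<rho>" "0 < k - a" "0 \<le> a" "0 \<le> rest" "0 \<le> W"
  shows "(W - S) * rest + S * (rest * ((1 - \<rho>) * (1 - q) + \<rho> * (1 - q) ^ 2)) \<le> W * ((1 - q * (1 - a / k * q)) * rest)"
proof -
  have k: "k > 0" using assms by linarith
  have W: "0 \<le> W * (1 - a / k)" using assms k by (intro mult_nonneg_nonneg) (auto simp: field_simps)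
  have "W * (q * (1 - a / k * q)) = W * (1 - a / k) * (q * (1 + a / (k - a) * (1 - q)))"
  proof -
    have "(1 - a / k) * (1 + a / (k - a) * (1 - q)) = 1 - a / k * q" using assms(5) k by (simp add: field_simps)
    then have "W * q * ((1 - a / k) * (1 + a / (k - a) * (1 - q))) = W * q * (1 - a / k * q)" by simp
    then show ?thesis by (simp only: mult_ac)
  qed
  also have "\<dots> \<le> S * (q * (1 + \<rho> * (1 - q)))"
  proof (rule mult_mono[OF assms(1)])
    show "q * (1 + a / (k - a) * (1 - q)) \<le> q * (1 + \<rho> * (1 - q))"
      using assms by (intro mult_left_mono add_left_mono mult_right_mono) auto
    show "0 \<le> S" using W assms(1) by linarith
    show "0 \<le> q * (1 + a / (k - a) * (1 - q))" using assms by (intro mult_nonneg_nonneg add_nonneg_nonneg) auto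
  qed
  finally have "rest * (W * (q * (1 - a / k * q))) \<le> rest * (S * (q * (1 + \<rho> * (1 - q))))" using assms(7) by (rule mult_left_mono)
  then show ?thesis by (simp add: algebra_simps power2_eq_square)
qed

lemma alive_pair:
  assumes I: "I0 x s" and P: "P \<in> SS" and al: "coarser P (lv s (regs s 1))" and ne: "part (lv s (regs s 1)) \<noteq> P"
  obtains p q where "p < regs s 1" "q < regs s 1" "same P (rp s p) (rp s q)" "mem s (aM (rp s p) (rp s q)) > 0"
proof -
  note Is = I0D[OF I]
  let ?k = "regs s 1" and ?L = "lv s (regs s 1)"
  obtain r t where rt: "r \<in> ?L ` V" "t \<in> ?L ` V" "r \<noteq> t" "same P r t" "wt ?L r t > 0"
    by (rule contractible_pair[OF SS_D(1)[OF P] st_lab(1)[OF Is(1)] al]) (use ne in auto)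
  then obtain p q where pq: "p < ?k" "q < ?k" "r = rp s p" "t = rp s q" using st_lab(2)[OF Is(1)] by auto
  then have "p \<noteq> q" using rt by auto
  then have "mem s (aM (rp s p) (rp s q)) > 0" using st_wt[OF Is(1) pq(1,2)] rt pq by simp
  then show thesis using that pq rt by blast
qed

text \<open>At level 2 a contractible pair would exhaust the representatives, and \<open>P\<close>
  would consist of a single cluster.\<close>

lemma alive_level:
  assumes I: "I0 x s" and P: "P \<in> SS" and al: "coarser P (lv s (regs s 1))" and ne: "part (lv s (regs s 1)) \<noteq> P"
  shows "2 < regs s 1"
proof (rule ccontr)
  note Is = I0D[OF I]
  let ?k = "regs s 1" and ?L = "lv s (regs s 1)"
  assume "\<not> 2 < ?k"
  then have k: "?k = 2" using Is(3) by simp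
  obtain p q where pq: "p < ?k" "q < ?k" "same P (rp s p) (rp s q)" "mem s (aM (rp s p) (rp s q)) > 0"
    using alive_pair[OF assms] by blast
  have "p \<noteq> q" using st_diag[OF Is(1), of p] pq by auto
  then have "{p, q} = {..<2}" using pq k by auto
  then have L: "?L ` V = {rp s p, rp s q}" using st_lab(2)[OF Is(1)] k by auto
  have PP: "partition_on V P" using SS_D(2)[OF P] .
  have PV: "rp s p \<in> V" "rp s q \<in> V" using st_rp[OF Is(1)] pq Is(6) by (auto simp: verts_G)
  have "same P u v" if uv: "u \<in> V" "v \<in> V" for u v
  proof -
    have "?L u \<in> {rp s p, rp s q}" "?L v \<in> {rp s p, rp s q}" using L uv by blast+
    then have "same P (?L u) (?L v)" using pq(3) same_sym[OF pq(3)] same_refl[OF PP PV(1)] same_refl[OF PP PV(2)] by auto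
    then show ?thesis using coarserD[OF PP al uv] by simp
  qed
  then show False using cut_witness[OF SS_D(3)[OF P]] by blast
qed

text \<open>Given the current state, pending visits draw fresh random words; this is why the miss
  probabilities in \<open>pf\<close> multiply although visits share their upper levels.\<close>

lemma main_fail:
  assumes s: "I0 x s" "regs s 2 = 0" "regs s 1 = n" and L: "LI x s" and P: "P \<in> SS"
    and f: "\<And>s'. I0 x s' \<Longrightarrow> LI x s' \<Longrightarrow> regs s' 2 = 0 \<Longrightarrow> regs s' 1 = n \<Longrightarrow> fl s' n = 0 \<Longrightarrow> regs s' 3 = regs s 3 \<Longrightarrow>
       f s' \<le> (if found P s' then 0 else 1)"
  shows "WP (p_main k0 k1) f s \<le> ennreal ((1 - qq n) ^ fl s n)"
proof -
  have PP: "partition_on V P" using SS_D(2)[OF P] .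
  define pass where "pass = regs s 3"
  have "WP (p_main k0 k1) f s \<le> ennreal (pf P s)"
  proof (rule main_rule[where Lg = "\<lambda>s. LI x s \<and> regs s 3 = pass" and x = x])
    fix s assume I: "I0 x s" and L: "LI x s \<and> regs s 3 = pass" and m: "regs s 2 = 1"
    note Is = I0D[OF I] and ps = conjunct2[OF L] and L = conjunct1[OF L]
    let ?k = "regs s 1" and ?Q = "part (lv s (regs s 1))" and ?W = "real (xw (same (part (lv s (regs s 1)))))"
    define rest where "rest = (\<Prod>j\<in>{?k..n}. qa P s j ^ fl s j)"
    have rest0: "0 \<le> rest" unfolding rest_def by (intro prod_nonneg zero_le_power ballI qa_bounds)
    have stop: "LI x s' \<and> regs s' 3 = pass \<and> pf P s' \<le> rest \<and> (found P s \<or> ?Q = P \<longrightarrow> pf P s' = 0)" if so: "stop_out x s s'" for s'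
    proof -
      have h: "cons x s s'" "regs s' 1 = ?k" "regs s' 2 = 0" "lv s' = lv s" "fl s' = fl s" using so unfolding stop_out_def by blast+
      have fj: "fl s' j = fl s j" for j using fun_cong[OF h(5), of j] by simp
      note cl = cons_LI(1)[OF I L h(1)] cons_LI(2,3)[OF I L h(1), where P = P]
      have "regs s' 3 = pass" using h(1) ps unfolding cons_def Let_def by simp
      moreover have "pf P s' \<le> rest" using rest0 unfolding pf_def h(2,3) fj qa_def h(4) rest_def by simp
      moreover have "found P s \<or> ?Q = P \<longrightarrow> pf P s' = 0" using cl(2,3) P by (auto simp: pf_def)
      ultimately show ?thesis using cl(1) by blast
    qed
    define al where "al \<longleftrightarrow> coarser P (lv s ?k)"
    define q where "q = qq (?k - 1)"
    have q: "0 < q" "q \<le> 1" using qq_bounds[of "?k - 1"] by (auto simp: q_def)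
    define gc where "gc = (\<lambda>p p' i. rest * (if al \<and> same P (rp s p) (rp s p') then (1 - q) ^ Suc i else 1))"
    have gc0: "0 \<le> gc p p' i" for p p' i unfolding gc_def using rest0 q by (intro mult_nonneg_nonneg) auto
    have con: "LI x s' \<and> regs s' 3 = pass \<and> pf P s' \<le> gc p p' i \<and> (found P s \<or> ?Q = P \<longrightarrow> pf P s' = 0)" if co: "con_out x s p p' i s'" for p p' i s'
    proof -
      have h: "cons x s s'" "regs s' 1 = ?k - 1" "regs s' 2 = 1" "\<And>j. ?k \<le> j \<Longrightarrow> j \<le> n \<Longrightarrow> lv s' j = lv s j"
        "lv s' (?k - 1) = merge (rp s p') (rp s p) (lv s ?k)" "fl s' = (fl s)(?k - 1 := i)" "p < ?k" "p' < ?k"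
        using co unfolding con_out_def by blast+
      note cl = cons_LI(1)[OF I L h(1)] cons_LI(2,3)[OF I L h(1), where P = P]
      have 1: "regs s' 3 = pass" using h(1) ps unfolding cons_def Let_def by simp
      have 2: "found P s \<or> ?Q = P \<longrightarrow> pf P s' = 0" using cl(2,3) P by (auto simp: pf_def)
      have pr: "(\<Prod>j\<in>{regs s' 1..n}. qa P s' j ^ fl s' j) = qa P s' (?k - 1) ^ i * (\<Prod>j\<in>{?k..n}. qa P s' j ^ fl s j)"
        by (rule prod_con[where g = "\<lambda>j y. qa P s' j ^ y", OF _ _ h(2,6)]) (use Is in auto)
      also have "(\<Prod>j\<in>{?k..n}. qa P s' j ^ fl s j) = rest"
        unfolding rest_def by (intro prod.cong refl) (use h(4) in \<open>simp add: qa_def\<close>)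
      finally have "pf P s' = (if found P s' then 0 else qa P s' (?k - 1) * (qa P s' (?k - 1) ^ i * rest))"
        unfolding pf_def h(3) unfolding h(2) by simp
      also have "\<dots> \<le> qa P s' (?k - 1) * (qa P s' (?k - 1) ^ i * rest)"
        using rest0 qa_bounds[of P s' "?k - 1"] by simp
      also have "\<dots> = rest * qa P s' (?k - 1) ^ Suc i" by simp
      also have "\<dots> \<le> gc p p' i"
      proof (cases "al \<and> same P (rp s p) (rp s p')")
        case True
        have "rp s p' \<in> lv s ?k ` V" using st_lab(2)[OF Is(1)] h(8) by auto
        then have "coarser P (lv s' (?k - 1))" unfolding h(5)
          using merge_coarser[OF PP st_lab(1)[OF Is(1)], of "rp s p'" "rp s p"] True al_def by simp
        then show ?thesis using True by (simp add: gc_def qa_def q_def)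
      next
        case False
        then have "gc p p' i = rest * 1" unfolding gc_def by auto
        moreover have "rest * qa P s' (?k - 1) ^ Suc i \<le> rest * 1"
          using rest0 qa_bounds[of P s' "?k - 1"] by (intro mult_left_mono power_le_one) auto
        ultimately show ?thesis by simp
      qed
      finally show ?thesis using cl(1) 1 2 by blast
    qed
    show "\<exists>gs gc. avg_ok s gs gc (pf P s) \<and> (\<forall>s'. stop_out x s s' \<longrightarrow> (LI x s' \<and> regs s' 3 = pass) \<and> pf P s' \<le> gs) \<and>
        (\<forall>p q i s'. con_out x s p q i s' \<longrightarrow> (LI x s' \<and> regs s' 3 = pass) \<and> pf P s' \<le> gc p q i)"
    \<comment> \<open>Once \<open>P\<close> has been found or is the current cut, the potential of
      every successor is zero.\<close>
    proof (cases "found P s \<or> ?Q = P")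
      case True
      have "0 \<le> pf P s" unfolding pf_def by (auto intro!: mult_nonneg_nonneg prod_nonneg zero_le_power qa_bounds)
      then have "avg_ok s 0 (\<lambda>_ _ _. 0) (pf P s)" by (simp add: avg_ok_def Let_def)
      moreover have "(LI x s' \<and> regs s' 3 = pass) \<and> pf P s' \<le> 0" if "stop_out x s s'" for s' using stop[OF that] True by auto
      moreover have "(LI x s' \<and> regs s' 3 = pass) \<and> pf P s' \<le> 0" if "con_out x s p q i s'" for p q i s' using con[OF that] True by auto
      ultimately show ?thesis by (intro exI[of _ 0] exI[of _ "\<lambda>_ _ _. 0"]) blast
    next
      case nf: False
      have pfs: "pf P s = qa P s ?k * rest" using nf m by (simp add: pf_def rest_def)
      have "avg_ok s rest gc (pf P s)"
      proof (cases al)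
        case False
        then have g: "gc p p' i = rest" for p p' i by (simp add: gc_def)
        have b: "pf P s = rest" using pfs False by (simp add: qa_def al_def)
        have "(\<Sum>p<?k. \<Sum>p'<?k. real (mem s (aM (rp s p) (rp s p'))) * ((1 - rho ?k) * rest + rho ?k * rest)) = ?W * rest"
          unfolding weight_sum[OF Is(1), symmetric] sum_distrib_right by (simp add: algebra_simps)
        then show ?thesis unfolding avg_ok_def Let_def g b using rest0 by simp
      next
        case True
        have k2: "2 < ?k" using alive_level[OF I P] True nf al_def by blast
        have b: "pf P s = (1 - qq ?k) * rest" using pfs True by (simp add: qa_def al_def)
        obtain pa pb where pab: "pa < ?k" "pb < ?k" "same P (rp s pa) (rp s pb)" "mem s (aM (rp s pa) (rp s pb)) > 0"
          using alive_pair[OF I P] True nf al_def by blast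
        \<comment> \<open>At least one of the \<open>k * k\<close> ordered pairs keeps
          \<open>P\<close>, and it is drawn with probability at least
          \<open>1 / k0 ^ 2\<close>.\<close>
        have small: "(\<Sum>p<?k. \<Sum>p'<?k. if mem s (aM (rp s p) (rp s p')) > 0 then gc p p' 0 else rest) \<le> real ?k * real ?k * pf P s" if k: "?k \<le> k0"
        proof -
          let ?g = "\<lambda>z. if z = (pa, pb) then (1 - q) * rest else rest"
          have "(\<Sum>p<?k. \<Sum>p'<?k. if mem s (aM (rp s p) (rp s p')) > 0 then gc p p' 0 else rest) \<le> (\<Sum>p<?k. \<Sum>p'<?k. ?g (p, p'))"
          proof (intro sum_mono)
            fix p p'
            have "(1 - q) * rest \<le> 1 * rest" using q rest0 by (intro mult_right_mono) auto
            then show "(if mem s (aM (rp s p) (rp s p')) > 0 then gc p p' 0 else rest) \<le> ?g (p, p')"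
              using pab True by (auto simp: gc_def mult.commute)
          qed
          also have "\<dots> = (\<Sum>z\<in>{..<?k} \<times> {..<?k}. ?g z)"
            unfolding sum.cartesian_product by (rule sum.cong[OF refl]) (simp add: split_beta prod_eq_iff)
          also have "\<dots> = (1 - q) * rest + (\<Sum>z\<in>{..<?k} \<times> {..<?k} - {(pa, pb)}. ?g z)"
            using pab by (subst sum.remove[where x = "(pa, pb)"]) auto
          also have "(\<Sum>z\<in>{..<?k} \<times> {..<?k} - {(pa, pb)}. ?g z) = (\<Sum>z\<in>{..<?k} \<times> {..<?k} - {(pa, pb)}. rest)"
            by (intro sum.cong refl) auto
          also have "\<dots> = (real ?k * real ?k - 1) * rest"
          proof -
            have "card ({..<?k} \<times> {..<?k} - {(pa, pb)}) = ?k * ?k - 1" using pab by (subst card_Diff_singleton) auto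
            moreover have "1 \<le> ?k * ?k" using Is(3) by simp
            ultimately show ?thesis by (simp add: of_nat_diff)
          qed
          finally have 1: "(\<Sum>p<?k. \<Sum>p'<?k. if mem s (aM (rp s p) (rp s p')) > 0 then gc p p' 0 else rest) \<le> (real ?k * real ?k - q) * rest"
            by (simp add: algebra_simps)
          have "qq ?k = q / real k0 ^ 2" using qq_pred(1)[OF _ k] Is(3) by (simp add: q_def)
          then have "real ?k * real ?k * qq ?k = q * (real ?k * real ?k / real k0 ^ 2)" by simp
          also have "\<dots> \<le> q * 1"
          proof (rule mult_left_mono)
            have "real ?k * real ?k \<le> real k0 * real k0" using k by (intro mult_mono) auto
            then show "real ?k * real ?k / real k0 ^ 2 \<le> 1" using k0_2 by (simp add: power2_eq_square)
          qed (use q in simp)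
          finally have "(real ?k * real ?k - q) * rest \<le> (real ?k * real ?k - real ?k * real ?k * qq ?k) * rest" using rest0 by (intro mult_right_mono) auto
          then show ?thesis using 1 unfolding b by (simp add: algebra_simps)
        qed
        have big: "(\<Sum>p<?k. \<Sum>p'<?k. real (mem s (aM (rp s p) (rp s p'))) * ((1 - rho ?k) * gc p p' 0 + rho ?k * gc p p' 1)) \<le> ?W * pf P s" if k: "k0 < ?k"
        proof -
          define h where "h = rest * ((1 - rho ?k) * (1 - q) + rho ?k * (1 - q) ^ 2)"
          \<comment> \<open>The weight of the pairs that \<open>P\<close> does not separate; divided
            by \<open>?W\<close> it is the probability that \<open>P\<close> survives.\<close>
          define S where "S = (\<Sum>p<?k. \<Sum>p'<?k. if same P (rp s p) (rp s p') then real (mem s (aM (rp s p) (rp s p'))) else 0)"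
          have "(\<Sum>p<?k. \<Sum>p'<?k. real (mem s (aM (rp s p) (rp s p'))) * ((1 - rho ?k) * gc p p' 0 + rho ?k * gc p p' 1))
            = (\<Sum>p<?k. \<Sum>p'<?k. real (mem s (aM (rp s p) (rp s p'))) * rest + (if same P (rp s p) (rp s p') then real (mem s (aM (rp s p) (rp s p'))) else 0) * (h - rest))"
            by (intro sum.cong refl) (use True in \<open>simp add: gc_def h_def algebra_simps power2_eq_square\<close>)
          also have "\<dots> = ?W * rest + S * (h - rest)"
            unfolding weight_sum[OF Is(1), symmetric] S_def by (simp add: sum.distrib sum_distrib_right)
          also have "\<dots> = (?W - S) * rest + S * h" by (simp add: algebra_simps)
          also have "\<dots> \<le> ?W * ((1 - q * (1 - 2 * \<alpha> / real ?k * q)) * rest)"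
            unfolding h_def
          proof (rule pf_step_w)
            have "S + 2 * real (cut_size G P) = ?W" using same_sum[OF Is(1) PP] True unfolding S_def al_def by blast
            moreover have "2 * real (cut_size G P) \<le> ?W * (2 * \<alpha> / real ?k)"
            proof -
              have "?k * min_cut_size G \<le> xw (same ?Q)" using xw_ge[OF st_lab(1)[OF Is(1)]] st_lab(3)[OF Is(1)] Is(3) by simp
              then have "real ?k * real (min_cut_size G) \<le> ?W" by (metis of_nat_le_iff of_nat_mult)
              then have "real ?k * real (min_cut_size G) * (2 * \<alpha> / real ?k) \<le> ?W * (2 * \<alpha> / real ?k)" using alpha1 by (intro mult_right_mono) auto
              moreover have "real ?k * real (min_cut_size G) * (2 * \<alpha> / real ?k) = 2 * (\<alpha> * real (min_cut_size G))" using Is(3) by (simp add: field_simps)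
              ultimately have "2 * (\<alpha> * real (min_cut_size G)) \<le> ?W * (2 * \<alpha> / real ?k)" by linarith
              then show ?thesis using SS_D(4)[OF P] by linarith
            qed
            ultimately show "?W * (1 - 2 * \<alpha> / real ?k) \<le> S" by (simp add: algebra_simps)
            show "2 * \<alpha> / (real ?k - 2 * \<alpha>) \<le> rho ?k" by (rule rho_bounds(1)[OF k])
            show "0 < real ?k - 2 * \<alpha>" using k k0_ge k1_ge alpha1 by linarith
          qed (use q rest0 alpha1 in auto)
          also have "q * (1 - 2 * \<alpha> / real ?k * q) = qq ?k"
            using qq_pred(2)[OF k] by (simp add: q_def)
          finally show ?thesis unfolding b .
        qed
        show ?thesis unfolding avg_ok_def Let_def using rest0 gc0 k2 small big by auto
      qed
      moreover have "(LI x s' \<and> regs s' 3 = pass) \<and> pf P s' \<le> rest" if "stop_out x s s'" for s' using stop[OF that] by blast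
      moreover have "(LI x s' \<and> regs s' 3 = pass) \<and> pf P s' \<le> gc p q i" if "con_out x s p q i s'" for p q i s' using con[OF that] by blast
      ultimately show ?thesis by blast
    qed
  next
    fix s s' assume I: "I0 x s" and L: "LI x s \<and> regs s 3 = pass" and m: "regs s 2 = 0" and u: "up1_out x s s'"
    note Is = I0D[OF I]
    have h: "regs s' = (regs s)(2 := 1)" "lv s' = lv s" "fl s' = (fl s)(regs s 1 := fl s (regs s 1) - 1)" "fl s (regs s 1) > 0"
       "hs s' = hs s" "reported s' = reported s"
      using u unfolding up1_out_def by blast+
    have fj: "fl s' j = ((fl s)(regs s 1 := fl s (regs s 1) - 1)) j" for j using fun_cong[OF h(3), of j] by simp
    have r: "regs s' 1 = regs s 1" "regs s' 2 = 1" "regs s' 3 = regs s 3" "regs s' 4 = regs s 4" using h(1) by simp_all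
    have hj: "hs s' j = hs s j" for j using fun_cong[OF h(5), of j] by simp
    have lf: "LI x s' = LI x s" "found P s' = found P s" using LI_cong[of s' s] r h(6) hj by simp_all
    have qj: "qa P s' j = qa P s j" for j by (simp add: qa_def h(2))
    have "(\<Prod>j\<in>{Suc (regs s 1)..n}. qa P s j ^ fl s' j) = (\<Prod>j\<in>{Suc (regs s 1)..n}. qa P s j ^ fl s j)"
      by (intro prod.cong refl) (simp add: fj)
    moreover have "qa P s (regs s 1) ^ fl s (regs s 1) = qa P s (regs s 1) * qa P s (regs s 1) ^ (fl s (regs s 1) - 1)"
      using power_Suc[of "qa P s (regs s 1)" "fl s (regs s 1) - 1"] h(4) by (simp del: power_Suc)
    moreover have "fl s' (regs s 1) = fl s (regs s 1) - 1" by (simp add: fj)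
    ultimately have "pf P s' \<le> pf P s" unfolding pf_def lf r(1,2) m ivl_head[OF Is(6)] qj by (simp add: mult_ac)
    then show "(LI x s' \<and> regs s' 3 = pass) \<and> pf P s' \<le> pf P s" using lf r L by simp
  next
    fix s s' assume I: "I0 x s" and L: "LI x s \<and> regs s 3 = pass" and m: "regs s 2 = 0" and u: "up2_out x s s'"
    note Is = I0D[OF I]
    have h: "fl s (regs s 1) = 0" "regs s' 1 = Suc (regs s 1)" "regs s' 2 = 0" "fl s' = fl s" "regs s' 3 = regs s 3" "regs s' 4 = regs s 4"
      "hs s' = hs s" "reported s' = reported s" "\<And>j. Suc (regs s 1) \<le> j \<Longrightarrow> j \<le> n \<Longrightarrow> lv s' j = lv s j"
      using u unfolding up2_out_def by blast+
    have fj: "fl s' j = fl s j" for j using fun_cong[OF h(4), of j] by simp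
    have hj: "hs s' j = hs s j" for j using fun_cong[OF h(7), of j] by simp
    have lf: "LI x s' = LI x s" "found P s' = found P s" using LI_cong[of s' s] h hj by simp_all
    have "(\<Prod>j\<in>{Suc (regs s 1)..n}. qa P s' j ^ fl s' j) = (\<Prod>j\<in>{Suc (regs s 1)..n}. qa P s j ^ fl s j)"
      by (intro prod.cong refl) (use h(9) in \<open>simp add: fj qa_def\<close>)
    then have "pf P s' \<le> pf P s" unfolding pf_def lf h(2,3) m ivl_head[OF Is(6)] using h(1) by simp
    then show "(LI x s' \<and> regs s' 3 = pass) \<and> pf P s' \<le> pf P s" using lf h L by simp
  next
    fix s assume I: "I0 x s" and L: "LI x s \<and> regs s 3 = pass" and m: "regs s 2 = 0" "regs s 1 = n" "fl s n = 0"
    have lf: "LI x (tick s) = LI x s" "found P (tick s) = found P s" using LI_cong[of "tick s" s] by simp_all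
    have "f (tick s) \<le> (if found P (tick s) then 0 else 1)" by (rule f) (use I L lf m pass_def in simp_all)
    also have "\<dots> \<le> ennreal (pf P s)" using m lf by (simp add: pf_def)
    finally show "f (tick s) \<le> ennreal (pf P s)" .
  qed (use s L pass_def in auto)
  also have "ennreal (pf P s) \<le> ennreal ((1 - qq n) ^ fl s n)"
  proof (rule ennreal_leI)
    have "coarser P (lv s n)" unfolding lv_def lev_n by (rule coarser_id[OF PP])
    then show "pf P s \<le> (1 - qq n) ^ fl s n" using s qq_bounds[of n] by (simp add: pf_def qa_def)
  qed
  finally show ?thesis .
qed

end


section \<open>Fingerprints\<close>

text \<open>Expectation over the coordinates from \<open>n - m\<close> to \<open>n - 1\<close>,
  nested in the order in which the initialisation samples them; the remaining coordinates are taken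
  from \<open>y\<close>.\<close>

primrec avg :: "nat \<Rightarrow> nat \<Rightarrow> nat \<Rightarrow> ((nat \<Rightarrow> nat) \<Rightarrow> real) \<Rightarrow> (nat \<Rightarrow> nat) \<Rightarrow> real" where
  "avg N n 0 g y = g y"
| "avg N n (Suc m) g y = (\<Sum>t<N. avg N n m g (y(n - Suc m := t))) / real N"

lemma avg_mono: "(\<And>x. g x \<le> h x) \<Longrightarrow> avg N n m g y \<le> avg N n m h y"
  by (induction m arbitrary: y) (auto intro!: divide_right_mono sum_mono)

lemma avg_nonneg: "(\<And>x. 0 \<le> g x) \<Longrightarrow> 0 \<le> avg N n m g y"
  by (induction m arbitrary: y) (auto intro!: divide_nonneg_nonneg sum_nonneg)

lemma avg_const: "N > 0 \<Longrightarrow> avg N n m (\<lambda>_. c) y = c"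
  by (induction m arbitrary: y) auto

lemma avg_add: "avg N n m (\<lambda>x. g x + h x) y = avg N n m g y + avg N n m h y"
  by (induction m arbitrary: y) (auto simp: sum.distrib add_divide_distrib)

lemma avg_sum: "N > 0 \<Longrightarrow> avg N n m (\<lambda>x. \<Sum>i\<in>I. g i x) y = (\<Sum>i\<in>I. avg N n m (g i) y)"
  by (induction I rule: infinite_finite_induct) (auto simp: avg_const avg_add)

text \<open>Coordinate \<open>v\<close> precedes the averaged ones. For each choice of these at most
  one \<open>t\<close> is bad, so the total over \<open>t\<close> is at most 1 once the sums are
  exchanged.\<close>

lemma avg_unique_sampled:
  assumes N: "N > 0" and u: "\<And>x t t'. Z (x(v := t)) \<Longrightarrow> Z (x(v := t')) \<Longrightarrow> t = t'"
  shows "v < n - m \<Longrightarrow> m \<le> n \<Longrightarrow> (\<Sum>t<N. avg N n m (\<lambda>x. if Z x then 1 else 0) (y(v := t))) \<le> 1"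
proof (induction m arbitrary: y)
  case 0
  have "(\<Sum>t<N. avg N n 0 (\<lambda>x. if Z x then 1 else 0) (y(v := t))) = real (card {t. t < N \<and> Z (y(v := t))})"
    by (simp add: sum.If_cases Int_def)
  also have "\<dots> \<le> 1"
  proof -
    have "card {t. t < N \<and> Z (y(v := t))} \<le> Suc 0"
      by (subst card_le_Suc0_iff_eq) (use u in auto)
    then show ?thesis by simp
  qed
  finally show ?case .
next
  case (Suc m)
  have ne: "n - Suc m \<noteq> v" using Suc.prems by simp
  have "(\<Sum>t<N. avg N n (Suc m) (\<lambda>x. if Z x then 1 else 0) (y(v := t)))
    = (\<Sum>t<N. \<Sum>r<N. avg N n m (\<lambda>x. if Z x then 1 else 0) (y(n - Suc m := r, v := t))) / real N"
    by (simp add: sum_divide_distrib fun_upd_twist[OF ne])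
  also have "\<dots> = (\<Sum>r<N. \<Sum>t<N. avg N n m (\<lambda>x. if Z x then 1 else 0) (y(n - Suc m := r, v := t))) / real N"
    by (subst sum.swap) simp
  also have "\<dots> \<le> (\<Sum>r<N. 1) / real N"
    by (intro divide_right_mono sum_mono Suc.IH) (use Suc.prems in auto)
  also have "(\<Sum>r<N. 1) / real N = 1" using N by simp
  finally show ?case .
qed

text \<open>A Schwartz-Zippel bound for one variable, conditioning on all the other
  coordinates.\<close>

lemma avg_unique:
  assumes N: "N > 0" and u: "\<And>x t t'. Z (x(v := t)) \<Longrightarrow> Z (x(v := t')) \<Longrightarrow> t = t'"
  shows "n - m \<le> v \<Longrightarrow> v < n \<Longrightarrow> m \<le> n \<Longrightarrow> avg N n m (\<lambda>x. if Z x then 1 else 0) y \<le> 1 / real N"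
proof (induction m arbitrary: y)
  case (Suc m)
  show ?case
  proof (cases "n - Suc m = v")
    case True
    have "(\<Sum>t<N. avg N n m (\<lambda>x. if Z x then 1 else 0) (y(v := t))) \<le> 1"
      by (rule avg_unique_sampled[OF N u]) (use True Suc.prems in auto)
    then show ?thesis using True by (simp add: divide_right_mono)
  next
    case False
    have "(\<Sum>t<N. avg N n m (\<lambda>x. if Z x then 1 else 0) (y(n - Suc m := t))) \<le> (\<Sum>t<N. 1 / real N)"
      by (intro sum_mono Suc.IH) (use False Suc.prems in auto)
    then show ?thesis using N by (simp add: field_simps)
  qed
qed simp

lemma wpm_sum:
  assumes "finite I" "I \<noteq> {}"
  shows "wpm p (\<lambda>s. \<Sum>i\<in>I. f i s) = (\<Sum>i\<in>I. wpm p (f i))"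
proof -
  obtain i where "i \<in> I" using assms by auto
  then show ?thesis using wpm_add_sum[of "I - {i}" p "f i" f] assms by (simp add: sum.remove[of I i])
qed

section \<open>The complete program\<close>

primrec powE :: "nat \<Rightarrow> exp" where
  "powE 0 = Const 1"
| "powE (Suc k) = Times (Reg 0) (powE k)"

text \<open>The diagonal of the input matrix may contain loops; clearing it establishes the zero
  diagonal on which contraction relies.\<close>

definition p_sample :: prog where
  "p_sample = block [Store (eM (Reg 5) (Reg 5)) (Const 0), Sample 10 (Reg 14), Store (eX 1 (Reg 5)) (Reg 10),
     Store (eX 2 (Reg 5)) (Reg 5), Store (eP (Reg 5)) (Reg 5), incr 5]"

definition p_degrees :: prog where
  "p_degrees = block [Assign 5 (Const 0), While (Less (Reg 5) (Reg 0)) (block [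
     Assign 6 (Const 0), Assign 13 (Const 0),
     While (Less (Reg 13) (Reg 0)) (block [Assign 6 (Plus (Reg 6) (Load (eM (Reg 5) (Reg 13)))), incr 13]),
     Store (eX 0 (Reg 5)) (Reg 6), incr 5])]"

text \<open>\<open>0 - 1\<close> wraps around to the largest word, an initial minimum above twice
  every cut size. Register 14 holds the range of the fingerprint weights.\<close>

definition p_init :: "nat \<Rightarrow> prog" where
  "p_init K = block [Assign 4 (Minus (Const 0) (Const 1)), Assign 14 (powE K), Assign 5 (Const 0),
     While (Less (Reg 5) (Reg 0)) p_sample, p_degrees, Assign 1 (Reg 0), Assign 2 (Const 0)]"

text \<open>Register 15 counts doublings up to \<open>n\<close>, that is, the binary logarithm
  rounded up; its square scales the number of visits from the top.\<close>

definition p_prep :: "nat \<Rightarrow> nat \<Rightarrow> prog" where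
  "p_prep b KT = block [Assign 3 (Const b), Assign 15 (Const 0), Assign 10 (Const 1),
     While (Less (Reg 10) (Reg 0)) (block [Assign 10 (Times (Const 2) (Reg 10)), incr 15]),
     Store (eX 3 (Reg 0)) (Times (Const KT) (Times (Reg 15) (Reg 15)))]"

definition p_full :: "nat \<Rightarrow> nat \<Rightarrow> nat \<Rightarrow> nat \<Rightarrow> prog" where
  "p_full K KT k0 k1 = block [p_init K, p_prep 0 KT, p_main k0 k1, p_prep 1 KT, p_main k0 k1]"

definition clog :: "nat \<Rightarrow> nat" where
  "clog m = (LEAST l. m \<le> 2 ^ l)"

lemma clog_props: "m \<le> 2 ^ clog m" "\<And>l. l < clog m \<Longrightarrow> 2 ^ l < m"
proof -
  have "m \<le> 2 ^ m" using less_exp[of m] by simp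
  then show "m \<le> 2 ^ clog m" unfolding clog_def by (rule LeastI)
  show "\<And>l. l < clog m \<Longrightarrow> 2 ^ l < m" unfolding clog_def using not_less_Least by fastforce
qed

lemma clog_le: "clog m \<le> m"
  unfolding clog_def by (rule Least_le) (use less_exp[of m] in simp)

context search2 begin

text \<open>Let the partitions disagree on \<open>u\<close> and \<open>v\<close>. The difference of
  the fingerprints is a quadratic form with zero diagonal, hence affine in \<open>x v\<close> with
  slope \<open>2 * kap x\<close>, where \<open>kap\<close> is a linear form containing
  \<open>x u\<close>. Either \<open>kap\<close> vanishes or \<open>x v\<close> is determined, and
  both events have probability at most \<open>1 / N\<close>.\<close>

lemma collision:
  assumes P: "partition_on V P" and Q: "partition_on V Q" and ne: "P \<noteq> Q" and N: "N > 0"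
  shows "avg N n n (\<lambda>x. if hsh x (same P) = hsh x (same Q) then 1 else 0) y \<le> 2 / real N"
proof -
  obtain u v where uv: "u \<in> V" "v \<in> V" "same P u v \<noteq> same Q u v"
    using partition_on_eqI[OF P Q] ne by blast
  have "u \<noteq> v" using uv same_refl[OF P] same_refl[OF Q] by blast
  define c :: "nat \<Rightarrow> nat \<Rightarrow> int" where "c a b = of_bool (same P a b) - of_bool (same Q a b)" for a b
  have csym: "c a b = c b a" for a b using same_sym[of P a b] same_sym[of P b a] same_sym[of Q a b] same_sym[of Q b a] by (auto simp: c_def)
  have cd: "c v v = 0" using same_refl[OF P uv(2)] same_refl[OF Q uv(2)] by (simp add: c_def)
  have cuv: "c v u \<noteq> 0" using uv(3) csym[of v u] by (auto simp: c_def)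
  define kap where "kap x = (\<Sum>t\<in>{..<n} - {v}. c v t * int (x t))" for x :: "nat \<Rightarrow> nat"
  define R where "R x = (\<Sum>s\<in>{..<n} - {v}. \<Sum>t\<in>{..<n} - {v}. c s t * int (x s) * int (x t))" for x :: "nat \<Rightarrow> nat"
  have vn: "v < n" "u < n" using uv verts_G by auto
  have D: "int (hsh x (same P)) - int (hsh x (same Q)) = R x + 2 * int (x v) * kap x" for x
  proof -
    have "int (hsh x (same P)) - int (hsh x (same Q)) = (\<Sum>s<n. \<Sum>t<n. c s t * int (x s) * int (x t))"
      unfolding hsh_def of_nat_sum sum_subtractf[symmetric] by (intro sum.cong refl) (simp add: c_def)
    also have "\<dots> = (\<Sum>t<n. c v t * int (x v) * int (x t)) + (\<Sum>s\<in>{..<n} - {v}. \<Sum>t<n. c s t * int (x s) * int (x t))"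
      using vn by (subst sum.remove[of _ v]) auto
    also have "(\<Sum>t<n. c v t * int (x v) * int (x t)) = int (x v) * kap x"
      using vn by (subst sum.remove[of _ v]) (auto simp: cd kap_def sum_distrib_left mult_ac)
    also have "(\<Sum>s\<in>{..<n} - {v}. \<Sum>t<n. c s t * int (x s) * int (x t))
      = (\<Sum>s\<in>{..<n} - {v}. c s v * int (x s) * int (x v) + (\<Sum>t\<in>{..<n} - {v}. c s t * int (x s) * int (x t)))"
      using vn by (intro sum.cong refl) (subst sum.remove[of _ v], auto)
    also have "\<dots> = int (x v) * kap x + R x"
      unfolding sum.distrib R_def kap_def by (simp add: sum_distrib_left mult_ac csym)
    finally show ?thesis by simp
  qed
  have upd: "kap (x(v := t)) = kap x" "R (x(v := t)) = R x" for x t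
    unfolding kap_def R_def by (intro sum.cong refl; simp)+
  have kapu: "kap (x(u := t)) = c v u * int t + (\<Sum>t\<in>{..<n} - {v} - {u}. c v t * int (x t))" for x t
  proof -
    have "kap (x(u := t)) = c v u * int t + (\<Sum>t'\<in>{..<n} - {v} - {u}. c v t' * int ((x(u := t)) t'))"
      unfolding kap_def using vn \<open>u \<noteq> v\<close> by (subst sum.remove[of _ u]) auto
    also have "(\<Sum>t'\<in>{..<n} - {v} - {u}. c v t' * int ((x(u := t)) t')) = (\<Sum>t\<in>{..<n} - {v} - {u}. c v t * int (x t))"
      by (intro sum.cong refl) simp
    finally show ?thesis .
  qed
  let ?Z1 = "\<lambda>x. kap x = 0" and ?Z2 = "\<lambda>x. kap x \<noteq> 0 \<and> R x + 2 * int (x v) * kap x = 0"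
  have "avg N n n (\<lambda>x. if hsh x (same P) = hsh x (same Q) then 1 else 0) y
     \<le> avg N n n (\<lambda>x. (if ?Z1 x then 1 else 0) + (if ?Z2 x then 1 else 0)) y"
  proof (rule avg_mono)
    fix x show "(if hsh x (same P) = hsh x (same Q) then 1 else 0) \<le> (if ?Z1 x then 1 else 0) + (if ?Z2 x then 1 else (0::real))"
      using D[of x] by auto
  qed
  also have "\<dots> = avg N n n (\<lambda>x. if ?Z1 x then 1 else 0) y + avg N n n (\<lambda>x. if ?Z2 x then 1 else 0) y"
    by (rule avg_add)
  also have "\<dots> \<le> 1 / real N + 1 / real N"
  proof (rule add_mono)
    show "avg N n n (\<lambda>x. if ?Z1 x then 1 else 0) y \<le> 1 / real N"
    proof (rule avg_unique[OF N, where v = u])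
      fix x t t' assume "?Z1 (x(u := t))" "?Z1 (x(u := t'))"
      then have "c v u * int t = c v u * int t'" unfolding kapu by linarith
      then show "t = t'" using cuv by simp
    qed (use vn in auto)
    show "avg N n n (\<lambda>x. if ?Z2 x then 1 else 0) y \<le> 1 / real N"
    proof (rule avg_unique[OF N, where v = v])
      fix x t t' assume "?Z2 (x(v := t))" "?Z2 (x(v := t'))"
      then have "kap x \<noteq> 0" "R x + 2 * int t * kap x = 0" "R x + 2 * int t' * kap x = 0" by (simp_all add: upd)
      then have "2 * int t * kap x = 2 * int t' * kap x" by linarith
      then show "t = t'" using \<open>kap x \<noteq> 0\<close> by simp
    qed (use vn in auto)
  qed
  finally show ?thesis by simp
qed

text \<open>Used when only the invariant at the exit matters: a constant is a valid
  potential.\<close>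

lemma main_const:
  assumes s: "I0 x s" "regs s 2 = 0" "regs s 1 = n" and c: "0 \<le> c"
    and f: "\<And>s'. I0 x s' \<Longrightarrow> regs s' 2 = 0 \<Longrightarrow> regs s' 1 = n \<Longrightarrow> fl s' n = 0 \<Longrightarrow> f s' \<le> ennreal c"
  shows "WP (p_main k0 k1) f s \<le> ennreal c"
proof (rule main_rule[where Lg = "\<lambda>_. True" and x = x and \<Psi> = "\<lambda>_. c"])
  fix s assume I: "I0 x s"
  note Is = I0D[OF I]
  have "(\<Sum>p<regs s 1. \<Sum>p'<regs s 1. real (mem s (aM (rp s p) (rp s p'))) * ((1 - rho (regs s 1)) * c + rho (regs s 1) * c))
     = real (xw (same (part (lv s (regs s 1))))) * c"
    unfolding weight_sum[OF Is(1), symmetric] sum_distrib_right by (simp add: algebra_simps)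
  then have "avg_ok s c (\<lambda>_ _ _. c) c" unfolding avg_ok_def Let_def using c by simp
  then show "\<exists>gs gc. avg_ok s gs gc c \<and> (\<forall>s'. stop_out x s s' \<longrightarrow> True \<and> c \<le> gs) \<and>
        (\<forall>p q i s'. con_out x s p q i s' \<longrightarrow> True \<and> c \<le> gc p q i)"
    by (intro exI[of _ c] exI[of _ "\<lambda>_ _ _. c"]) simp
next
  fix s assume "I0 x s" "regs s 2 = 0" "regs s 1 = n" "fl s n = 0"
  then show "f (tick s) \<le> ennreal c" by (intro f) simp_all
qed (use s in auto)

definition TT :: "nat \<Rightarrow> nat" where "TT KT = KT * (clog n * clog n)"

section \<open>Initialisation and the two rounds\<close>

lemma wp_prep:
  assumes s: "I0 x s" "regs s 2 = 0" "regs s 1 = n" and b: "b \<le> 1" and KT: "KT * (n * n) + 10 < B"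
    and f: "\<And>s'. I0 x s' \<Longrightarrow> regs s' 2 = 0 \<Longrightarrow> regs s' 1 = n \<Longrightarrow> regs s' 3 = b \<Longrightarrow> regs s' 4 = regs s 4 \<Longrightarrow>
      fl s' n = TT KT \<Longrightarrow> (\<And>h. hs s' h = hs s h) \<Longrightarrow> reported s' = reported s \<Longrightarrow> clock s' \<le> clock s + 3 * n + 5 \<Longrightarrow> f s' \<le> z"
  shows "WP (p_prep b KT) f s \<le> z"
proof -
  note Is = I0D[OF s(1)]
  define J where "J = (\<lambda>i (s' :: state). regs s' 15 = i \<and> regs s' 10 = 2 ^ i \<and> regs s' 3 = b \<and>
     (\<forall>r. r \<notin> {3, 10, 15} \<longrightarrow> regs s' r = regs s r) \<and> mem s' = mem s \<and> reported s' = reported s \<and> clock s' = clock s + 3 + 3 * i)"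
  have cl: "clog n \<le> n" by (rule clog_le)
  have c2: "clog n * clog n \<le> n * n" using cl by (intro mult_mono) auto
  have T: "TT KT + 10 < B" "TT KT mod B = TT KT"
  proof -
    have "TT KT \<le> KT * (n * n)" unfolding TT_def using c2 by simp
    then show "TT KT + 10 < B" using KT by simp
    then show "TT KT mod B = TT KT" by simp
  qed
  have bB: "b mod B = b" "2 mod B = 2" using b B_addr by simp_all
  show ?thesis unfolding p_prep_def block.simps wp_Seq wp_Assign
  proof (rule wp_for[where J = J and k = "clog n"], goal_cases)
    case 1
    show ?case using bB one_mod by (simp add: J_def)
  next
    case (2 i s')
    then have "regs s' 10 = 2 ^ i" "regs s' 0 = n" using Is(7) by (auto simp: J_def)
    moreover have "2 ^ i < n \<longleftrightarrow> i < clog n"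
      using clog_props(1)[of n] clog_props(2)[of i n] 2(2) by (cases "i = clog n") auto
    ultimately show ?case by simp
  next
    case (3 i s' f')
    have "(2::nat) ^ i < n" using clog_props(2)[OF 3(2)] .
    then have l: "2 * 2 ^ i < B" "Suc i < B" using B_addr 3(2) cl by linarith+
    have fin: "J (Suc i) S" if "regs S = (regs s')(10 := 2 * 2 ^ i, 15 := Suc i)" "mem S = mem s'" "reported S = reported s'" "clock S = clock s' + 3" for S
      using 3(1) that by (simp add: J_def)
    show ?case
      using 3(1) l bB
      apply (simp add: incr_def J_def)
      apply (rule 3(3), rule fin)
      apply (simp_all)
      done
  next
    case (4 s')
    have r: "regs s' 15 = clog n" "regs s' 3 = b" "regs s' 0 = n" "regs s' 1 = n" "regs s' 2 = 0" "regs s' 4 = regs s 4"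
      and m: "mem s' = mem s" "reported s' = reported s" "clock s' = clock s + 3 + 3 * clog n"
      using 4 s Is(7) by (auto simp: J_def)
    have fin: "f S \<le> z" if S: "regs S = regs s'" "mem S = (mem s)(aX 3 n := TT KT)" "reported S = reported s" "clock S = clock s' + 2" for S
    proof (rule f)
      have stS: "st x S" using st_cong(1)[of S s x] S r Is s by simp
      show "I0 x S" unfolding I0_def using stS S r T Is(4) n2 by simp
      show "clock S \<le> clock s + 3 * n + 5" using S m cl by simp
    qed (use S r in simp_all)
    have e: "clog n * clog n mod B = clog n * clog n"
    proof -
      have "clog n * clog n < B" using c2 B_addr by linarith
      then show ?thesis by simp
    qed
    have KB: "KT mod B * (clog n * clog n) mod B = TT KT"
      using T(2) unfolding TT_def by (simp add: mod_mult_left_eq)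
    show ?case
      apply (simp add: r e KB m)
      apply (rule fin)
      apply (simp_all add: m)
      done
  qed
qed

lemma clog_pos: "1 \<le> clog n"
  using clog_props(1)[of n] n2 by (cases "clog n") auto

lemma powE_ev: "regs s 0 = n \<Longrightarrow> n ^ K < B \<Longrightarrow> EV (powE K) s = n ^ K"
proof (induction K)
  case (Suc K)
  have "n ^ K \<le> n ^ Suc K" using n2 by (intro power_increasing) auto
  then have "n ^ K < B" using Suc.prems(2) by linarith
  then show ?case using Suc by simp
qed (simp add: one_mod)

lemma wp_degrees:
  assumes n: "regs s 0 = n" and M: "\<And>u v. u < n \<Longrightarrow> v < n \<Longrightarrow> mem s (aM u v) = mu u v"
    and f: "\<And>s'. (\<And>r. r \<notin> {5, 6, 13} \<Longrightarrow> regs s' r = regs s r) \<Longrightarrow> (\<And>u. u < n \<Longrightarrow> mem s' (aX 0 u) = (\<Sum>v<n. mu u v)) \<Longrightarrow>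
      (\<And>ad. (\<And>u. ad \<noteq> aX 0 u) \<Longrightarrow> mem s' ad = mem s ad) \<Longrightarrow> reported s' = reported s \<Longrightarrow> clock s' \<le> clock s + 10 * (n * n) + 2 \<Longrightarrow> f s' \<le> z"
  shows "WP p_degrees f s \<le> z"
proof -
  have sB: "(\<Sum>v<m. mu u v) < B" if "u < n" "m \<le> n" for u m
  proof -
    have "(\<Sum>v<m. mu u v) \<le> (\<Sum>v<n. mu u v)" using that by (intro sum_mono2) auto
    also have "\<dots> = dg (\<lambda>v. v) u" using dg_id[of u] that by (simp add: verts_G)
    also have "\<dots> \<le> xw (=)" by (rule dg_le)
    finally show ?thesis using B_weight by linarith
  qed
  define J where "J = (\<lambda>i (s' :: state). regs s' 5 = i \<and> (\<forall>r. r \<notin> {5, 6, 13} \<longrightarrow> regs s' r = regs s r) \<and>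
     (\<forall>u<i. mem s' (aX 0 u) = (\<Sum>v<n. mu u v)) \<and> (\<forall>ad. (\<forall>u. ad \<noteq> aX 0 u) \<longrightarrow> mem s' ad = mem s ad) \<and>
     reported s' = reported s \<and> clock s' = clock s + 1 + (3 * n + 6) * i)"
  show ?thesis unfolding p_degrees_def block.simps wp_Seq wp_Assign
  proof (rule wp_for[where J = J and k = n], goal_cases)
    case 1
    show ?case by (simp add: J_def)
  next
    case (2 i s')
    then show ?case using n by (simp add: J_def)
  next
    case (3 i s1 f1)
    have j1: "regs s1 5 = i" "\<And>r. r \<notin> {5, 6, 13} \<Longrightarrow> regs s1 r = regs s r" "\<And>u. u < i \<Longrightarrow> mem s1 (aX 0 u) = (\<Sum>v<n. mu u v)"
      "\<And>ad. (\<And>u. ad \<noteq> aX 0 u) \<Longrightarrow> mem s1 ad = mem s ad" "reported s1 = reported s" "clock s1 = clock s + 1 + (3 * n + 6) * i"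
      using 3(1) unfolding J_def by blast+
    have n1: "regs s1 0 = n" using j1(2)[of 0] n by simp
    have iB: "i < B" "Suc i < B" "i \<le> HM" using 3(2) by simp_all
    have M1: "mem s1 (aM i v) = mu i v" if "v < n" for v using j1(4)[of "aM i v"] M[of i v] that 3(2) by simp
    define J2 where "J2 = (\<lambda>j (s' :: state). regs s' 13 = j \<and> regs s' 6 = (\<Sum>v<j. mu i v) \<and> (\<forall>r. r \<notin> {6, 13} \<longrightarrow> regs s' r = regs s1 r) \<and>
       mem s' = mem s1 \<and> reported s' = reported s1 \<and> clock s' = clock s1 + 3 + 3 * j)"
    show ?case unfolding wp_Seq wp_Assign
    proof (rule wp_for[where J = J2 and k = n], goal_cases)
      case 1
      show ?case by (simp add: J2_def)
    next
      case (2 j s')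
      then show ?case using n1 by (simp add: J2_def)
    next
      case (3 j s2 f2)
      have r2: "regs s2 13 = j" "regs s2 6 = (\<Sum>v<j. mu i v)" "regs s2 0 = n" "regs s2 5 = i" and m2: "mem s2 = mem s1"
        using 3(1) n1 j1(1) by (auto simp: J2_def)
      have sm: "(\<Sum>v<j. mu i v) + mu i j < B" using sB[of i "Suc j"] 3(2) \<open>i < n\<close> by simp
      have jB: "Suc j < B" using 3(2) by simp
      have fin: "J2 (Suc j) S" if "regs S = (regs s2)(6 := (\<Sum>v<j. mu i v) + mu i j, 13 := Suc j)" "mem S = mem s2" "reported S = reported s2" "clock S = clock s2 + 3" for S
        using 3(1) that by (simp add: J2_def)
      show ?case
        apply (simp add: incr_def r2 m2 M1 3 \<open>i < n\<close> sm jB)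
        apply (rule 3(3), rule fin)
        apply (simp_all add: m2)
        done
    next
      case (4 s2)
      have r2: "regs s2 6 = (\<Sum>v<n. mu i v)" "regs s2 0 = n" "regs s2 5 = i" "\<And>r. r \<notin> {5, 6, 13} \<Longrightarrow> regs s2 r = regs s r"
        and m2: "mem s2 = mem s1" "reported s2 = reported s1" "clock s2 = clock s1 + 3 + 3 * n"
        using 4 n1 j1(1,2) by (auto simp: J2_def)
      have fin: "J (Suc i) S" if S: "regs S = (regs s2)(5 := Suc i)" "mem S = (mem s1)(aX 0 i := (\<Sum>v<n. mu i v))" "reported S = reported s2" "clock S = clock s2 + 3" for S
        unfolding J_def
      proof (intro conjI allI impI)
        show "regs S r = regs s r" if "r \<notin> {5, 6, 13}" for r using r2(4)[OF that] that by (simp add: S)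
        show "mem S (aX 0 u) = (\<Sum>v<n. mu u v)" if "u < Suc i" for u using j1(3)[of u] that by (cases "u = i") (auto simp: S)
        show "mem S ad = mem s ad" if "\<forall>u. ad \<noteq> aX 0 u" for ad using j1(4)[of ad] that by (simp add: S)
        show "clock S = clock s + 1 + (3 * n + 6) * Suc i" using j1(6) m2 by (simp add: S algebra_simps)
      qed (use j1 m2 in \<open>simp_all add: S\<close>)
      show ?case
        apply (simp add: incr_def r2 m2 iB)
        apply (rule 3(3), rule fin)
        apply (simp_all add: m2)
        done
    qed
  next
    case (4 s')
    show ?case
    proof (rule f)
      have "n * 2 \<le> n * n" using n2 by (intro mult_left_mono) auto
      then show "clock (tick s') \<le> clock s + 10 * (n * n) + 2" using 4 by (simp add: J_def algebra_simps)
    qed (use 4 in \<open>auto simp: J_def\<close>)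
  qed
qed

text \<open>The bound \<open>g\<close> for the rest of the program may depend on the sampled
  weights; the degrees are computed from them on no random data, so only \<open>x\<close> is
  averaged.\<close>

lemma wp_init:
  assumes N: "N = n ^ K" "(n * N) ^ 2 \<le> HM"
    and f: "\<And>s' x. (\<And>u. u < n \<Longrightarrow> x u < N) \<Longrightarrow> I0 x s' \<Longrightarrow> regs s' 2 = 0 \<Longrightarrow> regs s' 1 = n \<Longrightarrow> regs s' 4 = B - 1 \<Longrightarrow>
      fl s' n = 0 \<Longrightarrow> (\<And>h. hs s' h = 0) \<Longrightarrow> reported s' = [] \<Longrightarrow> clock s' \<le> 10 * (n * n) + 7 * n + 20 \<Longrightarrow> f s' \<le> ennreal (g x)"
    and g: "\<And>x. 0 \<le> g x"
  shows "WP (p_init K) f (initial_state G) \<le> ennreal (avg N n n g (\<lambda>v. mem (initial_state G) (aX 1 v)))"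
proof -
  let ?s0 = "initial_state G"
  have cV: "card V = n" by (simp add: verts_G)
  have s0: "regs ?s0 0 = n" "\<And>r. r \<noteq> 0 \<Longrightarrow> regs ?s0 r = 0" "clock ?s0 = 0" "reported ?s0 = []"
    by (simp_all add: initial_state_def Let_def cV)
  have m0: "mem ?s0 (aM u v) = mu u v" if "u < n" "v < n" "u \<noteq> v" for u v
  proof -
    have "aM u v div n = u" "aM u v mod n = v" using that by (auto simp: aM_def)
    then show ?thesis using aM_bound[OF that(1,2)] that by (simp add: initial_state_def Let_def cV mu_def)
  qed
  have mX: "mem ?s0 (aX t v) = 0" for t v by (simp add: initial_state_def Let_def cV aX_def)
  have Npos: "N > 0" using N(1) n2 by simp
  have NB: "N < B"
  proof -
    have "N \<le> n * N" using n2 by simp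
    also have "\<dots> \<le> (n * N) ^ 2" by (simp add: power2_eq_square)
    finally show ?thesis using N(2) B_addr by linarith
  qed
  define J where "J = (\<lambda>s' :: state. regs s' 0 = n \<and> regs s' 14 = N \<and> regs s' 4 = B - 1 \<and> regs s' 5 \<le> n \<and>
     (\<forall>u<regs s' 5. mem s' (aX 2 u) = u \<and> mem s' (aP u) = u \<and> mem s' (aM u u) = 0 \<and> mem s' (aX 1 u) < N) \<and>
     (\<forall>u<n. \<forall>v<n. u \<noteq> v \<longrightarrow> mem s' (aM u v) = mu u v) \<and> (\<forall>j. mem s' (aX 3 j) = 0) \<and> (\<forall>h. mem s' (aX 4 h) = 0) \<and>
     reported s' = [] \<and> clock s' = 3 + 7 * regs s' 5)"
  \<comment> \<open>Coordinates below register 5 are already sampled and fixed; only the others are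
    averaged.\<close>
  let ?F = "\<lambda>s'. ennreal (avg N n (n - regs s' 5) g (\<lambda>v. mem s' (aX 1 v)))"
  have loop: "J s \<Longrightarrow> WP (While (Less (Reg 5) (Reg 0)) p_sample) (WP (block [p_degrees, Assign 1 (Reg 0), Assign 2 (Const 0)]) f) s \<le> ?F s" for s
  proof (rule wp_While[where I = J and V = "\<lambda>s. n - regs s 5" and F = ?F], goal_cases)
    case (1 s1)
    let ?i = "regs s1 5"
    have j: "regs s1 0 = n" "regs s1 14 = N" "?i < n" and J1: "J s1" using 1(2,3) by (auto simp: J_def split: if_splits)
    have nn: "n - ?i = Suc (n - Suc ?i)" "n - Suc (n - Suc ?i) = ?i" using j by simp_all
    define f' where "f' = (\<lambda>s'. if J s' \<and> n - regs s' 5 < n - ?i then ?F s' else \<infinity>)"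
    define s2 where "s2 = s1\<lparr>mem := (mem s1)(aM ?i ?i := 0), clock := clock s1 + 2\<rparr>"
    have r2: "regs s2 = regs s1" "mem s2 = (mem s1)(aM ?i ?i := 0)" "reported s2 = reported s1" "clock s2 = clock s1 + 2" by (simp_all add: s2_def)
    have iB: "Suc ?i < B" using j by simp
    have "WP p_sample f' (tick s1) = WP (Sample 10 (Reg 14)) (WP (block [Store (eX 1 (Reg 5)) (Reg 10),
     Store (eX 2 (Reg 5)) (Reg 5), Store (eP (Reg 5)) (Reg 5), incr 5]) f') s2"
      unfolding p_sample_def block.simps wp_Seq wp_Store
      by (rule arg_cong2[where f = "WP _"]) (use j in \<open>simp_all add: s2_def tick_def fun_eq_iff\<close>)
    also have "\<dots> \<le> ennreal ((\<Sum>t<N. avg N n (n - Suc ?i) g ((\<lambda>v. mem s1 (aX 1 v))(?i := t))) / real N)"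
    proof (rule wp_Sample_le[where k = N and g = "\<lambda>t. avg N n (n - Suc ?i) g ((\<lambda>v. mem s1 (aX 1 v))(?i := t))"], goal_cases)
      case (3 t)
      have fin: "f' S \<le> ennreal (avg N n (n - Suc ?i) g ((\<lambda>v. mem s1 (aX 1 v))(?i := t)))"
        if S: "regs S = (regs s1)(10 := t, 5 := Suc ?i)" "mem S = (mem s2)(aX 1 ?i := t, aX 2 ?i := ?i, aP ?i := ?i)" "reported S = reported s1" "clock S = clock s1 + 7" for S
      proof -
        have JS: "J S" unfolding J_def
        proof (intro conjI allI impI)
          fix u assume "u < regs S 5"
          then have u: "u < Suc ?i" "u < n" using j by (simp_all add: S)
          have o: "u \<noteq> ?i \<Longrightarrow> mem s1 (aX 2 u) = u \<and> mem s1 (aP u) = u \<and> mem s1 (aM u u) = 0 \<and> mem s1 (aX 1 u) < N"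
            using J1 u(1) unfolding J_def by simp
          show "mem S (aX 2 u) = u" "mem S (aP u) = u" "mem S (aM u u) = 0" "mem S (aX 1 u) < N"
            using o u j 3 by (cases "u = ?i"; simp add: S r2 aM_eq)+
        next
          fix u v assume uv: "u < n" "v < n" "u \<noteq> v"
          then show "mem S (aM u v) = mu u v" using J1 j by (auto simp: S r2 aM_eq J_def)
        qed (use J1 j in \<open>simp_all add: S r2 J_def\<close>)
        have ffS: "(\<lambda>v. mem S (aX 1 v)) = (\<lambda>v. mem s1 (aX 1 v))(?i := t)" using j by (simp add: S r2 fun_eq_iff)
        have r5: "regs S 5 = Suc ?i" by (simp add: S)
        have "n - Suc ?i < n - ?i" using j by linarith
        then have c: "J S \<and> n - regs S 5 < n - ?i" using JS r5 by simp
        show ?thesis unfolding f'_def ffS[symmetric] r5[symmetric] if_P[OF c] by (rule order_refl)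
      qed
      show ?case
        apply (simp add: tick_def incr_def r2 j iB one_mod del: One_nat_def)
        apply (rule fin)
        apply (simp_all add: r2 iB one_mod)
        done
    next
      case (4 t)
      show ?case by (rule avg_nonneg[OF g])
    qed (use j Npos r2 in simp_all)
    also have "\<dots> = ?F s1" unfolding nn(1) avg.simps nn(2) ..
    finally show ?case unfolding f'_def .
  next
    case (2 s1)
    have i: "regs s1 5 = n" and J1: "J s1" using 2(2,3) by (auto simp: J_def split: if_splits)
    have j: "regs s1 0 = n" "regs s1 4 = B - 1" "\<And>u. u < n \<Longrightarrow> mem s1 (aX 2 u) = u \<and> mem s1 (aP u) = u \<and> mem s1 (aM u u) = 0 \<and> mem s1 (aX 1 u) < N"
      "\<And>u v. u < n \<Longrightarrow> v < n \<Longrightarrow> u \<noteq> v \<Longrightarrow> mem s1 (aM u v) = mu u v" "\<And>j. mem s1 (aX 3 j) = 0" "\<And>h. mem s1 (aX 4 h) = 0"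
      "reported s1 = []" "clock s1 = 3 + 7 * n"
      using J1 i by (simp_all add: J_def)
    let ?x = "\<lambda>v. mem s1 (aX 1 v)"
    have M: "mem s1 (aM u v) = mu u v" if "u < n" "v < n" for u v using j(3)[of u] j(4)[of u v] that by (cases "u = v") auto
    have xs: "(\<Sum>u<n. ?x u) ^ 2 \<le> HM"
    proof -
      have "(\<Sum>u<n. ?x u) \<le> (\<Sum>u<n. N)" by (intro sum_mono) (use j(3) in \<open>simp add: less_imp_le\<close>)
      then have "(\<Sum>u<n. ?x u) ^ 2 \<le> (n * N) ^ 2" by (intro power_mono) simp_all
      then show ?thesis using N(2) by linarith
    qed
    have "WP (block [p_degrees, Assign 1 (Reg 0), Assign 2 (Const 0)]) f (tick s1) \<le> ennreal (g ?x)"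
      unfolding block.simps wp_Seq
    proof (rule wp_degrees, goal_cases)
      case (3 s')
      have h: "mem s' (aX t v) = mem s1 (aX t v)" if "t \<noteq> 0" "t < 8" for t v using 3(3)[of "aX t v"] that by simp
      have hP: "mem s' (aP v) = mem s1 (aP v)" if "v < n" for v using 3(3)[of "aP v"] that by simp
      have hM: "mem s' (aM u v) = mem s1 (aM u v)" if "u < n" "v < n" for u v using 3(3)[of "aM u v"] that by simp
      have r: "regs s' 0 = n" "regs s' 4 = B - 1" using 3(1)[of 0] 3(1)[of 4] j by simp_all
      have fin: "f S \<le> ennreal (g ?x)" if S: "regs S = (regs s')(1 := n, 2 := 0)" "mem S = mem s'" "reported S = reported s'" "clock S = clock s' + 2" for S
      proof (rule f)
        have "good ?x n (rp S) (pr S) (mt S) (de S) (ff S)"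
          by (rule good_init) (use j 3(2) in \<open>simp_all add: S h hP hM M\<close>)
        then have "st ?x S" unfolding st_def using xs by (simp add: S r)
        then show "I0 ?x S" unfolding I0_def using n2 B_addr j by (simp add: S h)
      qed (use j 3 r h in \<open>simp_all add: S\<close>)
      show ?case
        apply (simp add: r del: One_nat_def)
        apply (rule fin)
        apply simp_all
        done
    qed (use j M in simp_all)
    then show ?case by (simp add: i)
  qed
  have "WP (p_init K) f ?s0 = WP (While (Less (Reg 5) (Reg 0)) p_sample) (WP (block [p_degrees, Assign 1 (Reg 0), Assign 2 (Const 0)]) f)
      (?s0\<lparr>regs := (regs ?s0)(4 := B - 1, 14 := N, 5 := 0), clock := 3\<rparr>)"
  proof -
    have "EV (powE K) s = N" if "regs s 0 = n" for s using powE_ev[of s K] that N(1) NB by simp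
    then show ?thesis unfolding p_init_def block.simps using s0 by (simp add: tick_def wp_Seq[abs_def] numeral_3_eq_3 del: wp_Seq)
  qed
  also have "\<dots> \<le> ennreal (avg N n (n - 0) g (\<lambda>v. mem ?s0 (aX 1 v)))"
  proof -
    have "J (?s0\<lparr>regs := (regs ?s0)(4 := B - 1, 14 := N, 5 := 0), clock := 3\<rparr>)"
      using s0 m0 mX by (simp add: J_def)
    from loop[OF this] show ?thesis by simp
  qed
  finally show ?thesis by simp
qed

lemma wp_Seq_fun: "WP (Seq c d) f = WP c (WP d f)"
  by (rule ext) simp

lemma round_const:
  assumes s: "I0 x s" "regs s 2 = 0" "regs s 1 = n" and b: "b \<le> 1" and KT: "KT * (n * n) + 10 < B" and c: "0 \<le> c"
    and f: "\<And>s'. I0 x s' \<Longrightarrow> regs s' 2 = 0 \<Longrightarrow> regs s' 1 = n \<Longrightarrow> fl s' n = 0 \<Longrightarrow> f s' \<le> ennreal c"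
  shows "WP (p_prep b KT) (WP (p_main k0 k1) f) s \<le> ennreal c"
  by (rule wp_prep[OF s b KT], rule main_const[OF _ _ _ c f])

lemma round_time:
  assumes s: "I0 x s" "regs s 2 = 0" "regs s 1 = n" and b: "b \<le> 1" and KT: "KT * (n * n) + 10 < B" and c: "0 \<le> c"
    and f: "\<And>s'. I0 x s' \<Longrightarrow> regs s' 2 = 0 \<Longrightarrow> regs s' 1 = n \<Longrightarrow> fl s' n = 0 \<Longrightarrow> f s' \<le> ennreal (real (clock s') + c)"
  shows "WP (p_prep b KT) (WP (p_main k0 k1) f) s \<le> ennreal (real (clock s) + (3 * real n + 6 + real (TT KT) * (vis n + 5)) + c)"
proof (rule wp_prep[OF s b KT], goal_cases)
  case (1 s')
  have "WP (p_main k0 k1) f s' \<le> ennreal (real (clock s') + 1 + real (fl s' n) * (vis n + 5) + c)"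
    by (rule main_time[OF 1(1-3) c f])
  also have "\<dots> \<le> ennreal (real (clock s) + (3 * real n + 6 + real (TT KT) * (vis n + 5)) + c)"
    using 1(6,9) by (intro ennreal_leI) simp
  finally show ?case .
qed

lemma full_time:
  assumes KT: "KT * (n * n) + 10 < B" and N: "(n * n ^ K) ^ 2 \<le> HM"
  shows "WP (p_full K KT k0 k1) (\<lambda>s. of_nat (clock s)) (initial_state G)
     \<le> ennreal (10 * (real n * real n) + 7 * real n + 20 + 2 * (3 * real n + 6 + real (TT KT) * (vis n + 5)))"
proof -
  let ?R = "3 * real n + 6 + real (TT KT) * (vis n + 5)" and ?I = "10 * (real n * real n) + 7 * real n + 20"
  have R: "0 \<le> ?R" using vis_nonneg[of n] by simp
  let ?f = "WP (p_prep 0 KT) (WP (p_main k0 k1) (WP (p_prep 1 KT) (WP (p_main k0 k1) (\<lambda>s. of_nat (clock s)))))"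
  have "WP (p_init K) ?f (initial_state G) \<le> ennreal (avg (n ^ K) n n (\<lambda>_. ?I + 2 * ?R) (\<lambda>v. mem (initial_state G) (aX 1 v)))"
  proof (rule wp_init[OF refl N], goal_cases)
    case (1 s x)
    have "?f s \<le> ennreal (real (clock s) + ?R + ?R)"
    proof (rule round_time[OF 1(2-4) _ KT R], goal_cases)
      case (2 s')
      have "WP (p_prep 1 KT) (WP (p_main k0 k1) (\<lambda>s. of_nat (clock s))) s' \<le> ennreal (real (clock s') + ?R + 0)"
        by (rule round_time[OF 2(1-3) _ KT]) (simp_all add: ennreal_of_nat_eq_real_of_nat)
      then show ?case by simp
    qed simp
    also have "\<dots> \<le> ennreal (?I + 2 * ?R)"
    proof (rule ennreal_leI)
      have "real (clock s) \<le> real (10 * (n * n) + 7 * n + 20)" using 1(9) by (rule of_nat_mono)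
      then show "real (clock s) + ?R + ?R \<le> ?I + 2 * ?R" by simp
    qed
    finally show ?case .
  next
    case 2
    have "0 \<le> ?I" by simp
    then show ?case by (rule add_nonneg_nonneg[OF _ mult_nonneg_nonneg[OF _ R]]) simp
  qed
  then show ?thesis using n2 unfolding p_full_def block.simps wp_Seq_fun by (simp add: avg_const)
qed

lemma round_fail:
  assumes s: "I0 x s" "regs s 2 = 0" "regs s 1 = n" and b: "b \<le> 1" and KT: "KT * (n * n) + 10 < B"
    and L: "inj_on (\<lambda>P. hsh x (same P)) SS" "2 * min_cut_size G \<le> regs s 4" "b = 1 \<Longrightarrow> regs s 4 = 2 * min_cut_size G"
      "reported s = []" "\<And>h. hs s h = 0"
    and P: "P \<in> SS"
    and f: "\<And>s'. I0 x s' \<Longrightarrow> LI x s' \<Longrightarrow> regs s' 2 = 0 \<Longrightarrow> regs s' 1 = n \<Longrightarrow> fl s' n = 0 \<Longrightarrow> regs s' 3 = b \<Longrightarrow>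
       f s' \<le> (if found P s' then 0 else 1)"
  shows "WP (p_prep b KT) (WP (p_main k0 k1) f) s \<le> ennreal ((1 - qq n) ^ TT KT)"
proof (rule wp_prep[OF s b KT], goal_cases)
  case (1 s')
  have "LI x s'" unfolding LI_def using L 1 b by auto
  then have "WP (p_main k0 k1) f s' \<le> ennreal ((1 - qq n) ^ fl s' n)"
    by (rule main_fail[OF 1(1-3) _ P]) (use f 1(4) in auto)
  then show ?case using 1(6) by simp
qed

lemma lists_found:
  assumes "LI x s" "regs s 3 = 1" "\<And>P. P \<in> SS \<Longrightarrow> found P s"
  shows "lists_exactly (reported s) SS"
  using assms unfolding lists_exactly_def LI_def found_def by auto

lemma SS_ne: obtains P where "P \<in> SS" "cut_size G P = min_cut_size G"
proof -
  have "card V \<ge> 2" using n2 by (simp add: verts_G)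
  then obtain P where P: "compact_cut G P" "cut_size G P = min_cut_size G" by (rule compact_min_cut)
  have "1 * real (min_cut_size G) \<le> \<alpha> * real (min_cut_size G)" using alpha1 by (intro mult_right_mono) auto
  then have "P \<in> SS" using P by (simp add: small_compact_cuts_def)
  with P that show thesis by blast
qed

text \<open>Union bound over the wanted cuts, each of which is missed with the probability given by
  \<open>round_fail\<close>.\<close>

lemma second_round:
  assumes s: "I0 x s" "regs s 2 = 0" "regs s 1 = n" and KT: "KT * (n * n) + 10 < B"
    and L: "inj_on (\<lambda>P. hsh x (same P)) SS" "regs s 4 = 2 * min_cut_size G" "reported s = []" "\<And>h. hs s h = 0"
  shows "WP (p_prep 1 KT) (WP (p_main k0 k1) (\<lambda>s. if lists_exactly (reported s) SS then 0 else 1)) s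
     \<le> ennreal (real (card SS) * (1 - qq n) ^ TT KT)"
proof -
  \<comment> \<open>Infinite off the invariant, so that there a single summand already dominates the
    indicator of failure; \<open>SS_ne\<close> provides one.\<close>
  define fP where "fP = (\<lambda>P s'. if I0 x s' \<and> LI x s' \<and> regs s' 3 = 1 then (if found P s' then 0 else 1) else (\<infinity> :: ennreal))"
  have fin: "finite SS" by (rule finite_small_compact_cuts)
  have ne: "SS \<noteq> {}" using SS_ne by blast
  have q: "0 \<le> (1 - qq n) ^ TT KT" using qq_bounds[of n] by simp
  have le: "(if lists_exactly (reported s') SS then 0 else 1) \<le> (\<Sum>P\<in>SS. fP P s')" for s'
  proof (cases "I0 x s' \<and> LI x s' \<and> regs s' 3 = 1")
    case True
    show ?thesis
    proof (cases "\<forall>P\<in>SS. found P s'")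
      case True
      then show ?thesis using lists_found[of x s'] \<open>I0 x s' \<and> _\<close> by simp
    next
      case False
      then obtain P where P: "P \<in> SS" "\<not> found P s'" by auto
      have "fP P s' \<le> (\<Sum>P\<in>SS. fP P s')" using fin P by (intro member_le_sum) auto
      then show ?thesis using True P by (simp add: fP_def)
    qed
  next
    case False
    obtain P where P: "P \<in> SS" using ne by auto
    have "fP P s' \<le> (\<Sum>P\<in>SS. fP P s')" using fin P by (intro member_le_sum) auto
    moreover have "fP P s' = \<infinity>" using False unfolding fP_def by auto
    ultimately have "(\<Sum>P\<in>SS. fP P s') = \<infinity>" by (simp add: top_unique)
    then show ?thesis by simp
  qed
  have "WP (p_prep 1 KT) (WP (p_main k0 k1) (\<lambda>s. if lists_exactly (reported s) SS then 0 else 1)) s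
     \<le> WP (p_prep 1 KT) (WP (p_main k0 k1) (\<lambda>s. \<Sum>P\<in>SS. fP P s)) s"
    by (intro wp_mono le)
  also have "\<dots> = (\<Sum>P\<in>SS. WP (p_prep 1 KT) (WP (p_main k0 k1) (fP P)) s)"
    unfolding wp_Seq[symmetric] unfolding wp_def by (rule wpm_sum[OF fin ne])
  also have "\<dots> \<le> (\<Sum>P\<in>SS. ennreal ((1 - qq n) ^ TT KT))"
  proof (rule sum_mono)
    fix P assume P: "P \<in> SS"
    show "WP (p_prep 1 KT) (WP (p_main k0 k1) (fP P)) s \<le> ennreal ((1 - qq n) ^ TT KT)"
      by (rule round_fail[OF s _ KT L(1) _ _ L(3,4) P]) (use L(2) in \<open>simp_all add: fP_def\<close>)
  qed
  also have "\<dots> = ennreal (real (card SS) * (1 - qq n) ^ TT KT)"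
    using q by (simp add: ennreal_mult ennreal_of_nat_eq_real_of_nat)
  finally show ?thesis .
qed

text \<open>The first round fails only if it misses one fixed minimum cut, which adds 1 to the
  number of cuts in the union bound.\<close>

lemma both_rounds:
  assumes s: "I0 x s" "regs s 2 = 0" "regs s 1 = n" and KT: "KT * (n * n) + 10 < B"
    and L: "inj_on (\<lambda>P. hsh x (same P)) SS" "2 * min_cut_size G \<le> regs s 4" "reported s = []" "\<And>h. hs s h = 0"
  shows "WP (p_prep 0 KT) (WP (p_main k0 k1) (WP (p_prep 1 KT) (WP (p_main k0 k1) (\<lambda>s. if lists_exactly (reported s) SS then 0 else 1)))) s
     \<le> ennreal ((real (card SS) + 1) * (1 - qq n) ^ TT KT)"
proof -
  let ?e = "(1 - qq n) ^ TT KT"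
  let ?f = "WP (p_prep 1 KT) (WP (p_main k0 k1) (\<lambda>s. if lists_exactly (reported s) SS then 0 else 1))"
  obtain Pm where Pm: "Pm \<in> SS" "cut_size G Pm = min_cut_size G" by (rule SS_ne)
  define ex where "ex s' \<longleftrightarrow> I0 x s' \<and> LI x s' \<and> regs s' 2 = 0 \<and> regs s' 1 = n \<and> regs s' 3 = 0" for s'
  define ex2 where "ex2 s' \<longleftrightarrow> I0 x s' \<and> regs s' 2 = 0 \<and> regs s' 1 = n" for s'
  define h where "h s' = (if ex s' then (if found Pm s' then 0 else 1) else (\<infinity> :: ennreal))" for s'
  define A where "A s' = (if ex2 s' then ennreal (real (card SS) * ?e) else (\<infinity> :: ennreal))" for s'
  have q: "0 \<le> ?e" using qq_bounds[of n] by simp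
  \<comment> \<open>If the minimum cut was met, \<open>A\<close> covers the second round; otherwise
    \<open>h\<close> contributes 1 and any failure is conceded.\<close>
  have le: "?f s' \<le> A s' + h s'" for s'
  proof (cases "ex s'")
    case True
    have e: "I0 x s'" "LI x s'" "regs s' 2 = 0" "regs s' 1 = n" "regs s' 3 = 0" using True by (auto simp: ex_def)
    have l: "inj_on (\<lambda>P. hsh x (same P)) SS" "2 * min_cut_size G \<le> regs s' 4" "reported s' = []" "\<And>h. hs s' h = 0"
      using e(2,5) unfolding LI_def by auto
    show ?thesis
    proof (cases "found Pm s'")
      case True
      then have "regs s' 4 = 2 * min_cut_size G" using e(5) l(2) Pm(2) by (simp add: found_def)
      then have "?f s' \<le> ennreal (real (card SS) * ?e)" by (intro second_round[OF e(1,3,4) KT l(1)] l)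
      then show ?thesis using e by (simp add: A_def ex2_def h_def ex_def True)
    next
      case False
      have "?f s' \<le> ennreal 1" by (rule round_const[OF e(1,3,4) _ KT]) auto
      also have "\<dots> \<le> A s' + h s'" using False \<open>ex s'\<close> by (simp add: h_def)
      finally show ?thesis .
    qed
  next
    case False
    then show ?thesis by (simp add: h_def)
  qed
  have "WP (p_prep 0 KT) (WP (p_main k0 k1) ?f) s \<le> WP (p_prep 0 KT) (WP (p_main k0 k1) (\<lambda>s'. A s' + h s')) s"
    by (intro wp_mono le)
  also have "\<dots> = WP (p_prep 0 KT) (WP (p_main k0 k1) A) s + WP (p_prep 0 KT) (WP (p_main k0 k1) h) s"
    unfolding wp_Seq[symmetric] unfolding wp_def by (rule wpm_add)
  also have "\<dots> \<le> ennreal (real (card SS) * ?e) + ennreal ?e"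
  proof (rule add_mono)
    show "WP (p_prep 0 KT) (WP (p_main k0 k1) A) s \<le> ennreal (real (card SS) * ?e)"
      by (rule round_const[OF s _ KT]) (use q in \<open>simp_all add: A_def ex2_def\<close>)
    show "WP (p_prep 0 KT) (WP (p_main k0 k1) h) s \<le> ennreal ?e"
      by (rule round_fail[OF s _ KT L(1,2) _ L(3,4) Pm(1)]) (simp_all add: h_def ex_def)
  qed
  also have "\<dots> = ennreal ((real (card SS) + 1) * ?e)"
    using q by (simp add: distrib_right flip: ennreal_plus)
  finally show ?thesis .
qed

text \<open>Two sources of error: a collision between fingerprints of wanted cuts, summed over all
  pairs, and a miss in one of the rounds when there is no collision.\<close>

lemma full_fail:
  assumes KT: "KT * (n * n) + 10 < B" and N: "(n * n ^ K) ^ 2 \<le> HM"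
  shows "WP (p_full K KT k0 k1) (\<lambda>s. if lists_exactly (reported s) SS then 0 else 1) (initial_state G)
     \<le> ennreal (real (card SS) ^ 2 * (2 / real (n ^ K)) + (real (card SS) + 1) * (1 - qq n) ^ TT KT)"
proof -
  let ?e = "(real (card SS) + 1) * (1 - qq n) ^ TT KT" and ?N = "n ^ K"
  let ?f = "WP (p_prep 0 KT) (WP (p_main k0 k1) (WP (p_prep 1 KT) (WP (p_main k0 k1) (\<lambda>s. if lists_exactly (reported s) SS then 0 else 1))))"
  let ?I = "\<lambda>x. inj_on (\<lambda>P. hsh x (same P)) SS"
  let ?g = "\<lambda>x. if ?I x then ?e else 1"
  let ?y = "\<lambda>v. mem (initial_state G) (aX 1 v)"
  have Npos: "?N > 0" using n2 by simp
  have fin: "finite SS" by (rule finite_small_compact_cuts)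
  have e: "0 \<le> ?e" using qq_bounds[of n] by simp
  have "WP (p_init K) ?f (initial_state G) \<le> ennreal (avg ?N n n ?g ?y)"
  proof (rule wp_init[OF refl N], goal_cases)
    case (1 s x)
    show ?case
    proof (cases "?I x")
      case True
      obtain P where P: "P \<in> SS" "cut_size G P = min_cut_size G" by (rule SS_ne)
      have "2 * min_cut_size G = xw (same P)" using xw_cut_size[OF SS_D(2)[OF P(1)]] P(2) by simp
      then have "2 * min_cut_size G \<le> regs s 4" using xw_le[of "same P"] B_weight 1(5) by linarith
      then have "?f s \<le> ennreal ?e" by (intro both_rounds[OF 1(2-4) KT True] 1)
      then show ?thesis using True by simp
    next
      case False
      have "?f s \<le> ennreal 1"
        by (rule round_const[OF 1(2-4) _ KT], simp, simp, rule round_const[OF _ _ _ _ KT]) auto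
      then show ?thesis using False by simp
    qed
  qed (use e in auto)
  also have "avg ?N n n ?g ?y \<le> avg ?N n n (\<lambda>x. ?e + (\<Sum>z\<in>SS \<times> SS. if fst z \<noteq> snd z \<and> hsh x (same (fst z)) = hsh x (same (snd z)) then 1 else 0)) ?y"
  proof (rule avg_mono)
    fix x
    have nn: "0 \<le> (\<Sum>z\<in>SS \<times> SS. if fst z \<noteq> snd z \<and> hsh x (same (fst z)) = hsh x (same (snd z)) then 1 else (0::real))" by (intro sum_nonneg) auto
    show "?g x \<le> ?e + (\<Sum>z\<in>SS \<times> SS. if fst z \<noteq> snd z \<and> hsh x (same (fst z)) = hsh x (same (snd z)) then 1 else 0)"
    proof (cases "?I x")
      case True
      then show ?thesis using nn by simp
    next
      case False
      then obtain P Q where PQ: "P \<in> SS" "Q \<in> SS" "P \<noteq> Q" "hsh x (same P) = hsh x (same Q)" by (auto simp: inj_on_def)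
      have "(if fst (P, Q) \<noteq> snd (P, Q) \<and> hsh x (same (fst (P, Q))) = hsh x (same (snd (P, Q))) then 1 else (0::real))
        \<le> (\<Sum>z\<in>SS \<times> SS. if fst z \<noteq> snd z \<and> hsh x (same (fst z)) = hsh x (same (snd z)) then 1 else 0)"
        by (rule member_le_sum) (use PQ fin in auto)
      then show ?thesis using False PQ e by simp
    qed
  qed
  also have "\<dots> = ?e + (\<Sum>z\<in>SS \<times> SS. avg ?N n n (\<lambda>x. if fst z \<noteq> snd z \<and> hsh x (same (fst z)) = hsh x (same (snd z)) then 1 else 0) ?y)"
    using Npos by (simp add: avg_add avg_const avg_sum)
  also have "\<dots> \<le> ?e + (\<Sum>z\<in>SS \<times> SS. 2 / real ?N)"
  proof (intro add_left_mono sum_mono)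
    fix z assume z: "z \<in> SS \<times> SS"
    show "avg ?N n n (\<lambda>x. if fst z \<noteq> snd z \<and> hsh x (same (fst z)) = hsh x (same (snd z)) then 1 else 0) ?y \<le> 2 / real ?N"
    proof (cases "fst z = snd z")
      case True
      then show ?thesis using avg_const[OF Npos, of n n 0 ?y] by simp
    next
      case False
      have "avg ?N n n (\<lambda>x. if hsh x (same (fst z)) = hsh x (same (snd z)) then 1 else 0) ?y \<le> 2 / real ?N"
        by (rule collision[OF _ _ False Npos]) (use z SS_D(2) in auto)
      then show ?thesis using False by simp
    qed
  qed
  also have "\<dots> = real (card SS) ^ 2 * (2 / real ?N) + ?e"
    using fin by (simp add: power2_eq_square card_cartesian_product)
  finally show ?thesis unfolding p_full_def block.simps wp_Seq_fun by (simp add: ennreal_leI)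
qed

end


section \<open>Parameters\<close>

context search2 begin

lemma ln_diff_ge: "2 \<le> k \<Longrightarrow> 1 / real k \<le> ln (real k) - ln (real (k - 1))"
proof -
  assume k: "2 \<le> k"
  then have "ln (real (k - 1)) - ln (real k) = ln (real (k - 1) / real k)" by (subst ln_div) auto
  also have "\<dots> \<le> real (k - 1) / real k - 1" using k by (intro ln_le_minus_one) auto
  also have "\<dots> = - (1 / real k)" using k by (simp add: field_simps of_nat_diff)
  finally show ?thesis by simp
qed

lemma k_bounds: "2 \<le> k1" "4 \<le> k0"
  using k1_ge alpha1 k0_ge by linarith+

text \<open>For \<open>q' = q * (1 - t * q)\<close> with \<open>t * q \<le> 1 / 2\<close>, the
  reciprocals satisfy \<open>1 / q' \<le> 1 / q + 2 * t\<close>. As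
  \<open>t = 2 * \<alpha> / k\<close>, they grow like a harmonic series; the levels up to
  \<open>k0\<close> contribute the constant.\<close>

lemma qq_inverse: "1 \<le> k \<Longrightarrow> 1 / qq k \<le> real k0 ^ (2 * k0) + 4 * \<alpha> * ln (real k)"
proof (induction k rule: dec_induct)
  case base
  have "qq 1 = 1 / real k0 ^ 2" using qq_pred(1)[of 1] k_bounds by simp
  moreover have "real k0 ^ 2 \<le> real k0 ^ (2 * k0)" using k_bounds by (intro power_increasing) auto
  ultimately show ?case by simp
next
  case (step k)
  show ?case
  proof (cases "Suc k \<le> k0")
    case True
    have "j \<le> k0 \<Longrightarrow> 1 / qq j = real k0 ^ (2 * j)" for j
    proof (induction j)
      case (Suc j)
      have "1 / qq (Suc j) = real k0 ^ 2 * (1 / qq j)" using Suc.prems by simp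
      also have "\<dots> = real k0 ^ 2 * real k0 ^ (2 * j)" using Suc by simp
      finally show ?case by (simp add: power2_eq_square)
    qed simp
    then have "1 / qq (Suc k) = real k0 ^ (2 * Suc k)" using True by blast
    also have "\<dots> \<le> real k0 ^ (2 * k0)" using True k_bounds by (intro power_increasing) auto
    finally show ?thesis using alpha1 by (simp add: add_increasing2)
  next
    case False
    define q where "q = qq k"
    define t where "t = 2 * \<alpha> / real (Suc k)"
    have q: "0 < q" "q \<le> 1" using qq_bounds[of k] by (auto simp: q_def)
    have t: "0 \<le> t" "t \<le> 1 / 2" using False k0_ge k1_ge alpha1 by (auto simp: t_def field_simps)
    have tq: "t * q \<le> 1 / 2" using mult_mono[OF t(2) q(2)] q t by simp
    have e: "qq (Suc k) = q * (1 - t * q)" using False by (simp add: q_def t_def)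
    have "1 / (q * (1 - t * q)) \<le> 1 / q + 2 * t"
    proof -
      have "1 \<le> (1 + 2 * t * q) * (1 - t * q)"
      proof -
        have "0 \<le> t * q * (1 - 2 * (t * q))" using t q tq by (intro mult_nonneg_nonneg) auto
        then show ?thesis by (simp add: algebra_simps)
      qed
      then have "1 / (q * (1 - t * q)) \<le> (1 + 2 * t * q) / q" using q tq by (simp add: field_simps)
      then show ?thesis using q by (simp add: field_simps)
    qed
    moreover have "1 / q \<le> real k0 ^ (2 * k0) + 4 * \<alpha> * ln (real k)" using step by (simp add: q_def)
    moreover have "2 * t \<le> 4 * \<alpha> * (ln (real (Suc k)) - ln (real k))"
    proof -
      have "1 / real (Suc k) \<le> ln (real (Suc k)) - ln (real k)" using ln_diff_ge[of "Suc k"] step by simp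
      then have "4 * \<alpha> * (1 / real (Suc k)) \<le> 4 * \<alpha> * (ln (real (Suc k)) - ln (real k))" using alpha1 by (intro mult_left_mono) auto
      then show ?thesis by (simp add: t_def)
    qed
    ultimately show ?thesis unfolding e right_diff_distrib by linarith
  qed
qed

text \<open>Combines \<open>1 - 1 / m \<le> exp (- 1 / m)\<close> with
  \<open>1 + b / m \<le> exp (b / m)\<close>, so that the product of the factors
  \<open>1 + b / m\<close> telescopes into a power.\<close>

lemma powr_step:
  fixes m b :: real
  assumes "m > 1" "b \<ge> 0"
  shows "(m - 1) powr b * (1 + b / m) \<le> m powr b"
proof -
  have "ln (1 - 1 / m) \<le> - (1 / m)" using ln_le_minus_one[of "1 - 1 / m"] assms by simp
  then have "b * ln (1 - 1 / m) \<le> b * (- (1 / m))" using assms by (intro mult_left_mono) auto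
  then have "(1 - 1 / m) powr b \<le> exp (- (b / m))" using assms by (simp add: powr_def)
  moreover have "1 + b / m \<le> exp (b / m)" by (rule exp_ge_add_one_self)
  ultimately have "(1 - 1 / m) powr b * (1 + b / m) \<le> exp (- (b / m)) * exp (b / m)"
    using assms by (intro mult_mono) auto
  then have 1: "(1 - 1 / m) powr b * (1 + b / m) \<le> 1" by (simp add: exp_minus)
  have "m * (1 - 1 / m) = m - 1" using assms by (simp add: field_simps)
  then have "(m - 1) powr b = m powr b * (1 - 1 / m) powr b"
    using assms powr_mult[of m "1 - 1 / m" b] by simp
  then have "(m - 1) powr b * (1 + b / m) = m powr b * ((1 - 1 / m) powr b * (1 + b / m))" by simp
  also have "\<dots> \<le> m powr b * 1" using 1 by (intro mult_left_mono) auto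
  finally show ?thesis by simp
qed

lemma vis_small: "k \<le> k0 \<Longrightarrow> vis k + 5 \<le> 21 * real k ^ 2 + 90 * real k + 5"
  by (induction k) (auto simp: power2_eq_square algebra_simps)

abbreviation visD :: real where "visD \<equiv> 21 * real k0 ^ 2 + 90 * real k0 + 5"

text \<open>The factors \<open>1 + rho\<close> multiply up to a power of \<open>k - k1\<close> with
  exponent at least 2. Measured against this power, the own cost of level \<open>k\<close> is of
  order \<open>1 / k\<close>, which sums to a logarithm.\<close>

lemma vis_large:
  assumes "k0 \<le> k"
  shows "vis k + 5 \<le> real (k - k1) powr (2 * \<alpha> + 1 / real n) * (visD + 360 * ln (real k))"
  using assms
proof (induction k rule: dec_induct)
  case base
  have "1 \<le> real (k0 - k1) powr (2 * \<alpha> + 1 / real n)" using k0_ge k_bounds alpha1 by (intro ge_one_powr_ge_zero) auto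
  moreover have "0 \<le> ln (real k0)" using k_bounds by simp
  ultimately have "1 * visD \<le> real (k0 - k1) powr (2 * \<alpha> + 1 / real n) * (visD + 360 * ln (real k0))"
    by (intro mult_mono) auto
  then show ?case using vis_small[of k0] by simp
next
  case (step k)
  let ?b = "2 * \<alpha> + 1 / real n"
  define m where "m = real (Suc k - k1)"
  have kk: "k1 < k" "2 * k1 < Suc k" using step k0_ge k_bounds by linarith+
  have m: "m > 1" "real (k - k1) = m - 1" "m \<ge> real (Suc k) / 2" using kk by (auto simp: m_def of_nat_diff)
  have b: "2 \<le> ?b" using alpha1 by (simp add: add_increasing2)
  have l: "0 \<le> visD + 360 * ln (real k)" using step k_bounds by (intro add_nonneg_nonneg) auto
  have rho: "rho (Suc k) \<le> ?b / m"
  proof -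
    have "rho (Suc k) \<le> (2 * \<alpha> * real n + 1) / (real (Suc k - k1) * real n)" using rho_bounds(2)[of "Suc k"] step by simp
    also have "\<dots> = ?b / m" using n2 m by (simp add: m_def field_simps)
    finally show ?thesis .
  qed
  have v0: "0 \<le> vis k + 5" using vis_nonneg[of k] by simp
  have "vis (Suc k) + 5 = 21 * real k + 90 + (vis k + 5) * (1 + rho (Suc k))" using step by (simp add: algebra_simps)
  also have "\<dots> \<le> 90 * real (Suc k) + (m - 1) powr ?b * (visD + 360 * ln (real k)) * (1 + ?b / m)"
  proof (rule add_mono)
    show "(vis k + 5) * (1 + rho (Suc k)) \<le> (m - 1) powr ?b * (visD + 360 * ln (real k)) * (1 + ?b / m)"
      using step m rho v0 rho_bounds(4)[of "Suc k"] l by (intro mult_mono) auto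
  qed simp
  also have "(m - 1) powr ?b * (visD + 360 * ln (real k)) * (1 + ?b / m) = ((m - 1) powr ?b * (1 + ?b / m)) * (visD + 360 * ln (real k))" by simp
  also have "\<dots> \<le> m powr ?b * (visD + 360 * ln (real k))"
    using powr_step[of m ?b] m b l by (intro mult_right_mono) auto
  \<comment> \<open>\<open>m\<close> is at least half of \<open>k + 1\<close>, so
    \<open>m powr ?b\<close> is at least a quarter of its square; this turns 90 into 360.\<close>
  also have "90 * real (Suc k) \<le> m powr ?b * (360 * (ln (real (Suc k)) - ln (real k)))"
  proof -
    have "1 / real (Suc k) \<le> ln (real (Suc k)) - ln (real k)" using ln_diff_ge[of "Suc k"] step k_bounds by simp
    moreover have "(real (Suc k) / 2) ^ 2 \<le> m powr ?b"
    proof -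
      have "(real (Suc k) / 2) ^ 2 \<le> m ^ 2" using m by (intro power_mono) auto
      also have "\<dots> = m powr 2" using m by simp
      also have "\<dots> \<le> m powr ?b" using m b by (intro powr_mono) auto
      finally show ?thesis .
    qed
    ultimately have "(real (Suc k) / 2) ^ 2 * (360 * (1 / real (Suc k))) \<le> m powr ?b * (360 * (ln (real (Suc k)) - ln (real k)))"
      by (intro mult_mono mult_left_mono) auto
    moreover have "(real (Suc k) / 2) ^ 2 * (360 * (1 / real (Suc k))) = 90 * real (Suc k)" by (simp add: power2_eq_square)
    ultimately show ?thesis by simp
  qed
  finally show ?case unfolding m_def[symmetric] by (simp add: algebra_simps)
qed

text \<open>The surplus \<open>1 / n\<close> in the exponent costs a factor
  \<open>n powr (1 / n)\<close>, at most \<open>exp 1\<close> and hence at most 3.\<close>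

lemma vis_bound: "vis n + 5 \<le> 3 * real n powr (2 * \<alpha>) * (visD + 360 * ln (real n))"
proof -
  have n1: "1 \<le> real n" using n2 by simp
  have ln0: "0 \<le> ln (real n)" using n2 by simp
  have p1: "1 \<le> real n powr (2 * \<alpha>)" using n1 alpha1 by (intro ge_one_powr_ge_zero) auto
  show ?thesis
  proof (cases "k0 \<le> n")
    case True
    let ?b = "2 * \<alpha> + 1 / real n"
    have "real n powr (1 / real n) \<le> exp 1"
    proof -
      have "1 / real n * ln (real n) \<le> 1" using ln_le_minus_one[of "real n"] n1 by (simp add: field_simps)
      then show ?thesis using n1 by (simp add: powr_def)
    qed
    also have "exp 1 \<le> (3::real)" by (rule exp_le)
    finally have e: "real n powr (1 / real n) \<le> 3" .
    have "vis n + 5 \<le> real (n - k1) powr ?b * (visD + 360 * ln (real n))" by (rule vis_large[OF True])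
    also have "\<dots> \<le> real n powr ?b * (visD + 360 * ln (real n))"
      using ln0 alpha1 by (intro mult_right_mono powr_mono2) auto
    also have "real n powr ?b = real n powr (2 * \<alpha>) * real n powr (1 / real n)" by (rule powr_add)
    also have "\<dots> * (visD + 360 * ln (real n)) \<le> real n powr (2 * \<alpha>) * 3 * (visD + 360 * ln (real n))"
      using e ln0 by (intro mult_right_mono mult_left_mono) auto
    finally show ?thesis by (simp add: mult_ac)
  next
    case False
    have "vis n + 5 \<le> 21 * real n ^ 2 + 90 * real n + 5" using vis_small[of n] False by simp
    also have "\<dots> \<le> visD" using False by (intro add_mono mult_left_mono power_mono) auto
    also have "\<dots> \<le> 3 * real n powr (2 * \<alpha>) * visD"
    proof -
      have "0 \<le> visD" by simp
      then have "1 * visD \<le> 3 * real n powr (2 * \<alpha>) * visD" using p1 by (intro mult_right_mono) auto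
      then show ?thesis by simp
    qed
    also have "\<dots> \<le> 3 * real n powr (2 * \<alpha>) * (visD + 360 * ln (real n))" using ln0 by (intro mult_left_mono) auto
    finally show ?thesis .
  qed
qed

lemma clog_ln: "ln (real n) \<le> real (clog n)" "real (clog n) \<le> 4 * ln (real n)"
proof -
  have n1: "2 \<le> real n" using n2 by simp
  have l2: "1 / 2 \<le> ln (2::real)" using ln2_ge_two_thirds by simp
  have l2n: "ln 2 \<le> ln (real n)" using n1 by simp
  have "real n \<le> 2 ^ clog n" using clog_props(1)[of n] by (metis of_nat_le_iff of_nat_numeral of_nat_power)
  then have "ln (real n) \<le> ln (2 ^ clog n)" using n1 by simp
  also have "\<dots> = real (clog n) * ln 2" by (simp add: ln_realpow)
  also have "\<dots> \<le> real (clog n) * 1" using ln_2_less_1 by (intro mult_left_mono) auto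
  finally show "ln (real n) \<le> real (clog n)" by simp
  have "2 ^ (clog n - 1) < n" using clog_props(2)[of "clog n - 1" n] clog_pos by simp
  then have "(2::real) ^ (clog n - 1) \<le> real n" by (metis less_imp_le of_nat_le_iff of_nat_numeral of_nat_power)
  then have "ln ((2::real) ^ (clog n - 1)) \<le> ln (real n)" by (intro ln_mono) auto
  then have "real (clog n - 1) * ln 2 \<le> ln (real n)" by (simp add: ln_realpow)
  moreover have "real (clog n - 1) * (1 / 2) \<le> real (clog n - 1) * ln 2" using l2 by (intro mult_left_mono) auto
  ultimately have "real (clog n - 1) \<le> 2 * ln (real n)" by linarith
  moreover have "real (clog n) = real (clog n - 1) + 1" using clog_pos by (simp add: of_nat_diff)
  ultimately show "real (clog n) \<le> 4 * ln (real n)" using l2 l2n by linarith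
qed

text \<open>The probability is at most \<open>exp (- qq n * TT KT)\<close>. One factor
  \<open>clog n\<close> of \<open>TT\<close> cancels \<open>1 / qq n\<close>, the other dominates
  \<open>ln n\<close>, and \<open>KT\<close> supplies the exponent \<open>e\<close>.\<close>

lemma miss_bound:
  assumes KT: "(real k0 ^ (2 * k0) + 4 * \<alpha>) * real e \<le> real KT"
  shows "(1 - qq n) ^ TT KT \<le> 1 / real n ^ e"
proof -
  let ?A = "real k0 ^ (2 * k0)"
  have n1: "2 \<le> real n" using n2 by simp
  have q: "0 < qq n" "qq n \<le> 1" using qq_bounds[of n] by auto
  have L: "1 \<le> real (clog n)" "ln (real n) \<le> real (clog n)" using clog_pos clog_ln by auto
  have A: "0 < ?A" using k_bounds by simp
  have "1 / qq n \<le> ?A + 4 * \<alpha> * ln (real n)" using qq_inverse[of n] n2 by simp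
  also have "\<dots> \<le> ?A * real (clog n) + 4 * \<alpha> * real (clog n)"
    using L alpha1 A by (intro add_mono mult_left_mono) (auto simp: mult_le_cancel_left1)
  also have "\<dots> = (?A + 4 * \<alpha>) * real (clog n)" by (simp add: algebra_simps)
  finally have 1: "1 \<le> qq n * ((?A + 4 * \<alpha>) * real (clog n))" using q by (simp add: field_simps)
  have "real e * ln (real n) \<le> real e * real (clog n)" using L by (intro mult_left_mono) auto
  also have "\<dots> \<le> (real e * real (clog n)) * (qq n * ((?A + 4 * \<alpha>) * real (clog n)))"
    using mult_left_mono[OF 1, of "real e * real (clog n)"] by simp
  also have "\<dots> = qq n * (((?A + 4 * \<alpha>) * real e) * (real (clog n) * real (clog n)))" by (simp add: mult_ac)
  also have "\<dots> \<le> qq n * (real KT * (real (clog n) * real (clog n)))"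
    using q KT by (intro mult_left_mono mult_right_mono) auto
  also have "\<dots> = qq n * real (TT KT)" by (simp add: TT_def)
  finally have "real e * ln (real n) \<le> qq n * real (TT KT)" .
  have "(1 - qq n) ^ TT KT \<le> exp (- qq n) ^ TT KT"
    using q exp_ge_add_one_self[of "- qq n"] by (intro power_mono) auto
  also have "\<dots> = exp (- (qq n * real (TT KT)))" by (simp flip: exp_of_nat_mult add: mult_ac)
  also have "\<dots> \<le> exp (- (real e * ln (real n)))" using \<open>real e * ln (real n) \<le> qq n * real (TT KT)\<close> by simp
  also have "\<dots> = 1 / real n ^ e" using n1 by (simp add: exp_minus exp_of_nat_mult inverse_eq_divide)
  finally show ?thesis .
qed

text \<open>Two of the three logarithms come from the number of top visits, one from the cost of a
  visit. Set-up is quadratic and is absorbed because \<open>2 * \<alpha> \<ge> 2\<close> and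
  \<open>ln n \<ge> 1 / 2\<close>.\<close>

lemma time_bound:
  "10 * (real n * real n) + 7 * real n + 20 + 2 * (3 * real n + 6 + real (TT KT) * (vis n + 5))
    \<le> (1000 + 1000 * real KT * (visD + 360)) * real n powr (2 * \<alpha>) * ln (real n) ^ 3"
proof -
  let ?l = "ln (real n)" and ?p = "real n powr (2 * \<alpha>)"
  have n1: "2 \<le> real n" using n2 by simp
  have l: "1 / 2 \<le> ?l"
  proof -
    have "1 / 2 \<le> ln (2::real)" using ln2_ge_two_thirds by simp
    also have "\<dots> \<le> ?l" using n1 by simp
    finally show ?thesis .
  qed
  have l3: "1 / 8 \<le> ?l ^ 3" using power_mono[OF l, of 3] by (simp add: power3_eq_cube)
  have p: "real n * real n \<le> ?p"
  proof -
    have "real n * real n = real n powr 2" using n1 by (simp add: power2_eq_square)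
    also have "\<dots> \<le> ?p" using n1 alpha1 by (intro powr_mono) auto
    finally show ?thesis .
  qed
  have nn: "real n \<le> real n * real n" "1 \<le> real n * real n" using n1 mult_mono[of 1 "real n" "real n" "real n"] mult_mono[of 1 "real n" 1 "real n"] by auto
  have "10 * (real n * real n) + 7 * real n + 20 + 2 * (3 * real n + 6) \<le> 100 * (real n * real n)"
  proof -
    have "10 * z + 7 * y + 20 + 2 * (3 * y + 6) \<le> 100 * z" if "y \<le> z" "1 \<le> z" for y z :: real using that by (simp add: algebra_simps)
    from this[OF nn] show ?thesis .
  qed
  also have "\<dots> \<le> 100 * ?p" using p by simp
  also have "\<dots> \<le> 1000 * ?p * ?l ^ 3"
  proof -
    have "1000 * ?p * (1 / 8) \<le> 1000 * ?p * ?l ^ 3" using l3 by (intro mult_left_mono) auto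
    then show ?thesis using powr_ge_zero[of "real n" "2 * \<alpha>"] by linarith
  qed
  finally have 1: "10 * (real n * real n) + 7 * real n + 20 + 2 * (3 * real n + 6) \<le> 1000 * ?p * ?l ^ 3" .
  have T: "real (TT KT) \<le> real KT * (16 * (?l * ?l))"
  proof -
    have "real (clog n) * real (clog n) \<le> (4 * ?l) * (4 * ?l)" using clog_ln(2) by (intro mult_mono) auto
    then have "real KT * (real (clog n) * real (clog n)) \<le> real KT * (16 * (?l * ?l))" by (intro mult_left_mono) auto
    then show ?thesis by (simp add: TT_def)
  qed
  have D0: "0 \<le> visD" by simp
  have "vis n + 5 \<le> 3 * ?p * (visD + 360 * ?l)" by (rule vis_bound)
  also have "\<dots> \<le> 3 * ?p * (2 * ?l * (visD + 360))"
  proof (rule mult_left_mono)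
    have "1 * visD \<le> (2 * ?l) * visD" using l D0 by (intro mult_right_mono) auto
    then show "visD + 360 * ?l \<le> 2 * ?l * (visD + 360)" using l by (simp add: algebra_simps)
  qed simp
  finally have v: "vis n + 5 \<le> 3 * ?p * (2 * ?l * (visD + 360))" .
  have "real (TT KT) * (vis n + 5) \<le> (real KT * (16 * (?l * ?l))) * (3 * ?p * (2 * ?l * (visD + 360)))"
    using T v vis_nonneg[of n] l by (intro mult_mono) auto
  also have "\<dots> = 96 * (real KT * (visD + 360) * ?p * ?l ^ 3)" by (simp add: power3_eq_cube mult_ac)
  finally have "real (TT KT) * (vis n + 5) \<le> 96 * (real KT * (visD + 360) * ?p * ?l ^ 3)" .
  then have "2 * (real (TT KT) * (vis n + 5)) \<le> 192 * (real KT * (visD + 360) * ?p * ?l ^ 3)" by linarith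
  also have "\<dots> \<le> 1000 * (real KT * (visD + 360) * ?p * ?l ^ 3)"
    using l by (intro mult_right_mono mult_nonneg_nonneg zero_le_power) auto
  finally have "10 * (real n * real n) + 7 * real n + 20 + 2 * (3 * real n + 6) + 2 * (real (TT KT) * (vis n + 5))
      \<le> 1000 * ?p * ?l ^ 3 + 1000 * (real KT * (visD + 360) * ?p * ?l ^ 3)" using 1 by linarith
  then show ?thesis by (simp add: algebra_simps)
qed

text \<open>There are at most \<open>n ^ k1\<close> wanted cuts. Collisions spend
  \<open>2 * k1\<close> of the exponent on pairs, misses spend \<open>k1\<close>; both leave
  \<open>2 / n ^ (d + 2)\<close>, and \<open>n ^ 2 \<ge> 4\<close> absorbs the sum.\<close>

lemma fail_bound:
  assumes KT: "(real k0 ^ (2 * k0) + 4 * \<alpha>) * real (k1 + d + 2) \<le> real KT"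
  shows "real (card SS) ^ 2 * (2 / real (n ^ (2 * k1 + d + 2))) + (real (card SS) + 1) * (1 - qq n) ^ TT KT \<le> 1 / real n ^ d"
proof -
  have n1: "2 \<le> real n" using n2 by simp
  have "real (card SS) \<le> real (card V) powr (2 * \<alpha>)" by (rule card_small_compact_cuts[OF alpha1])
  also have "\<dots> = real n powr (2 * \<alpha>)" by (simp add: verts_G)
  also have "\<dots> \<le> real n powr real k1" using n1 k1_ge by (intro powr_mono) auto
  also have "\<dots> = real n ^ k1" using n1 by (simp add: powr_realpow)
  finally have S: "real (card SS) \<le> real n ^ k1" .
  have p1: "1 \<le> real n ^ k1" using n1 by simp
  have "real (card SS) ^ 2 \<le> (real n ^ k1) ^ 2" using S by (intro power_mono) auto
  then have "real (card SS) ^ 2 * (2 / real (n ^ (2 * k1 + d + 2))) \<le> (real n ^ k1) ^ 2 * (2 / real (n ^ (2 * k1 + d + 2)))"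
    by (rule mult_right_mono) simp
  also have "\<dots> = 2 / (real n ^ d * real n ^ 2)"
  proof -
    have "(real n ^ k1) ^ 2 = real n ^ (2 * k1)" by (simp add: power_mult[symmetric] mult.commute)
    moreover have "real (n ^ (2 * k1 + d + 2)) = real n ^ (2 * k1) * (real n ^ d * real n ^ 2)"
      by (simp only: of_nat_power of_nat_mult power_add mult.assoc)
    moreover have "0 < real n ^ (2 * k1)" using n1 by simp
    ultimately show ?thesis by simp
  qed
  finally have 1: "real (card SS) ^ 2 * (2 / real (n ^ (2 * k1 + d + 2))) \<le> 2 / (real n ^ d * real n ^ 2)" .
  have "(real (card SS) + 1) * (1 - qq n) ^ TT KT \<le> (2 * real n ^ k1) * (1 / real n ^ (k1 + d + 2))"
  proof (rule mult_mono[OF _ miss_bound[OF KT]])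
    show "real (card SS) + 1 \<le> 2 * real n ^ k1" using S p1 by linarith
  qed (use qq_bounds[of n] in auto)
  also have "\<dots> = 2 / (real n ^ d * real n ^ 2)" using n1 by (simp add: power_add power2_eq_square)
  finally have 2: "(real (card SS) + 1) * (1 - qq n) ^ TT KT \<le> 2 / (real n ^ d * real n ^ 2)" .
  have "4 \<le> real n ^ 2" using power_mono[of 2 "real n" 2] n1 by simp
  then have "4 / (real n ^ d * real n ^ 2) \<le> 1 / real n ^ d" using n1 by (simp add: field_simps)
  then show ?thesis using 1 2 by simp
qed

end


section \<open>Word length and choice of the parameters\<close>

lemma word_modulus_ge:
  assumes "card (verts G) + card (edges G) \<ge> 1"
  shows "(card (verts G) + card (edges G)) ^ \<kappa> \<le> word_modulus \<kappa> G"
proof -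
  let ?z = "card (verts G) + card (edges G)"
  let ?c = "nat \<lceil>log 2 (real ?z)\<rceil>"
  have "real ?z = 2 powr log 2 (real ?z)" using assms by (subst powr_log_cancel) auto
  also have "\<dots> \<le> 2 powr real ?c" by (intro powr_mono real_nat_ceiling_ge) auto
  also have "\<dots> = real (2 ^ ?c)" by (simp add: powr_realpow)
  finally have "?z \<le> 2 ^ ?c" by (simp only: of_nat_le_iff)
  then have "?z ^ \<kappa> \<le> (2 ^ ?c) ^ \<kappa>" by (intro power_mono) auto
  also have "\<dots> = word_modulus \<kappa> G" unfolding word_modulus_def by (simp add: power_mult[symmetric] mult.commute)
  finally show ?thesis .
qed

context mgraph begin

lemma xw_total: "xw (=) \<le> 2 * card (edges G)"
proof -
  have "xw (=) = xw (same (part (\<lambda>v. v)))" using xw_same_part[of "\<lambda>v. v"] by simp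
  also have "\<dots> = 2 * cut_size G (part (\<lambda>v. v))" by (rule xw_cut_size[OF part_partition])
  also have "cut_size G (part (\<lambda>v. v)) \<le> card (edges G)" unfolding cut_size_def by (intro card_mono) auto
  finally show ?thesis by simp
qed

end

text \<open>The exponent \<open>2 * K + 2\<close> covers the fingerprint bound
  \<open>(n * n ^ K) ^ 2\<close>. Since \<open>z ^ D > D\<close> for \<open>z \<ge> 2\<close>,
  raising the exponent by \<open>D\<close> pays for all constant factors.\<close>

lemma modulus_large:
  fixes n m z K KT k0 :: nat
  assumes n: "1 \<le> n" and z: "z = n + m" "2 \<le> z"
  defines "HM \<equiv> (n * n ^ K) ^ 2 + n"
  defines "D \<equiv> 300 + KT + k0"
  shows "n * n + 9 * n + 8 * HM + 100 < z ^ (2 * K + 2 + D)" "4 * (2 * m) + 4 < z ^ (2 * K + 2 + D)"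
    "KT * (n * n) + 10 < z ^ (2 * K + 2 + D)" "k0 < z ^ (2 * K + 2 + D)"
proof -
  let ?Z = "z ^ (2 * K + 2)"
  have Z: "D * ?Z < z ^ (2 * K + 2 + D)"
  proof -
    have "D < 2 ^ D" by (rule less_exp)
    also have "\<dots> \<le> z ^ D" using z by (intro power_mono) auto
    finally have "D * ?Z < z ^ D * ?Z" using z by (intro mult_strict_right_mono) auto
    then show ?thesis by (simp add: power_add mult_ac)
  qed
  have nz: "n \<le> z" "m \<le> z" using z by auto
  have zZ: "z \<le> ?Z" using power_increasing[of 1 "2 * K + 2" z] z by simp
  have z2: "z ^ 2 \<le> ?Z" by (rule power_increasing) (use z in auto)
  have nn: "n * n \<le> ?Z"
  proof -
    have "n * n \<le> z ^ 2" using nz unfolding power2_eq_square by (intro mult_mono) auto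
    then show ?thesis using z2 by (rule order_trans)
  qed
  have h: "(n * n ^ K) ^ 2 \<le> ?Z"
  proof -
    have "(n * n ^ K) ^ 2 = n ^ (Suc K * 2)" unfolding power_mult power_Suc ..
    also have "\<dots> = n ^ (2 * K + 2)" by (simp add: mult.commute)
    also have "\<dots> \<le> ?Z" using nz by (intro power_mono) auto
    finally show ?thesis .
  qed
  have one: "1 \<le> ?Z" using z by simp
  have D: "D * ?Z = 300 * ?Z + KT * ?Z + k0 * ?Z" by (simp add: D_def distrib_right)
  have kz: "k0 \<le> k0 * ?Z" using one by simp
  have Kz: "KT * (n * n) \<le> KT * ?Z" using nn by (rule mult_left_mono) simp
  show "n * n + 9 * n + 8 * HM + 100 < z ^ (2 * K + 2 + D)"
  proof -
    define a where "a = (n * n ^ K) ^ 2"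
    define b where "b = n * n"
    define Y where "Y = ?Z"
    have "D * Y = 300 * Y + KT * Y + k0 * Y" "b \<le> Y" "a \<le> Y" "n \<le> Y" "1 \<le> Y"
      using D nn h nz zZ one unfolding a_def b_def Y_def by linarith+
    then have "b + 9 * n + 8 * (a + n) + 100 \<le> D * Y" by simp
    then show ?thesis using Z unfolding HM_def a_def b_def Y_def by linarith
  qed
  show "4 * (2 * m) + 4 < z ^ (2 * K + 2 + D)" using Z D nz zZ one by linarith
  show "KT * (n * n) + 10 < z ^ (2 * K + 2 + D)" using Z D Kz one by linarith
  show "k0 < z ^ (2 * K + 2 + D)" using Z D kz one by linarith
qed

theorem enumerable:
  assumes "\<alpha> \<ge> 1"
  shows "enumerable_in_soft_O \<alpha> (small_compact_cuts \<alpha>) (2 * \<alpha>)"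
  unfolding enumerable_in_soft_O_def
proof
  fix d :: nat
  define k1 where "k1 = nat \<lceil>2 * \<alpha>\<rceil>"
  define k0 where "k0 = 2 * k1"
  \<comment> \<open>\<open>K\<close> and \<open>KT\<close> are dictated by
    \<open>fail_bound\<close>, the exponent \<open>\<kappa>\<close> by \<open>modulus_large\<close>;
    all of them depend only on \<open>\<alpha>\<close> and \<open>d\<close>, so one program serves
    all graphs.\<close>
  define K where "K = 2 * k1 + d + 2"
  define KT where "KT = nat \<lceil>(real k0 ^ (2 * k0) + 4 * \<alpha>) * real (k1 + d + 2)\<rceil>"
  define \<kappa> where "\<kappa> = 2 * K + 2 + (300 + KT + k0)"
  define C where "C = 1000 + 1000 * real KT * (21 * real k0 ^ 2 + 90 * real k0 + 5 + 360)"
  have k1: "2 * \<alpha> \<le> real k1" "2 \<le> k1" using assms by (auto simp: k1_def) linarith+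
  have KT: "(real k0 ^ (2 * k0) + 4 * \<alpha>) * real (k1 + d + 2) \<le> real KT"
    unfolding KT_def by (rule real_nat_ceiling_ge)
  show "\<exists>c \<kappa> (C::real) (l::nat). \<forall>G :: (nat, nat) multigraph. \<forall>n\<ge>2.
        finite_multigraph G \<and> connected_graph G \<and> verts G = {..<n} \<longrightarrow>
        expected_time (run \<alpha> \<kappa> c G) \<le> ennreal (C * real n powr (2 * \<alpha>) * ln (real n) ^ l) \<and>
        measure (measure_spmf (run \<alpha> \<kappa> c G)) {s. lists_exactly (reported s) (small_compact_cuts \<alpha> G)}
          \<ge> 1 - 1 / real n ^ d"
  proof (rule exI[of _ "p_full K KT k0 k1"], rule exI[of _ \<kappa>], rule exI[of _ C], rule exI[of _ 3], intro allI impI, goal_cases)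
    case (1 G n)
    note n = 1(1) and G = 1(2)
    let ?B = "word_modulus \<kappa> G" and ?m = "card (edges G)"
    define HM where "HM = (n * n ^ K) ^ 2 + n"
    interpret mgraph G using G by unfold_locales auto
    have cV: "card (verts G) = n" using G by simp
    have z: "2 \<le> n + ?m" using n by simp
    have B: "(n + ?m) ^ \<kappa> \<le> ?B" using word_modulus_ge[of G \<kappa>] cV n by simp
    note big = modulus_large[where n = n and m = ?m and z = "n + ?m" and K = K and KT = KT and ?k0.0 = k0, OF _ refl z, folded \<kappa>_def HM_def]
    interpret search2 G n \<alpha> ?B HM k0 k1
    proof
      show "verts G = {..<n}" "2 \<le> n" using G n by auto
      show "n * n + 9 * n + 8 * HM + 100 < ?B" using big(1) n B by simp
      show "4 * xw (=) + 4 < ?B" using big(2) n B xw_total by simp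
      show "n \<le> HM" by (simp add: HM_def)
      show "k1 < k0" "2 \<le> k0" using k1 by (auto simp: k0_def)
      show "k0 < ?B" using big(4) n B by simp
      show "1 \<le> \<alpha>" "2 * \<alpha> \<le> real k1" "2 * k1 \<le> k0" using assms k1 by (auto simp: k0_def)
    qed
    have KB: "KT * (n * n) + 10 < ?B" using big(3) n B by simp
    have N: "(n * n ^ K) ^ 2 \<le> HM" by (simp add: HM_def)
    have "expected_time (run \<alpha> \<kappa> (p_full K KT k0 k1) G) = wp \<alpha> ?B (p_full K KT k0 k1) (\<lambda>s. of_nat (clock s)) (initial_state G)"
      by (simp add: expected_time_wpm wp_def run_def)
    also have "\<dots> \<le> ennreal (10 * (real n * real n) + 7 * real n + 20 + 2 * (3 * real n + 6 + real (TT KT) * (vis n + 5)))"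
      by (rule full_time[OF KB N])
    also have "\<dots> \<le> ennreal (C * real n powr (2 * \<alpha>) * ln (real n) ^ 3)"
      unfolding C_def by (rule ennreal_leI[OF time_bound])
    finally have time: "expected_time (run \<alpha> \<kappa> (p_full K KT k0 k1) G) \<le> ennreal (C * real n powr (2 * \<alpha>) * ln (real n) ^ 3)" .
    have "wpm (run \<alpha> \<kappa> (p_full K KT k0 k1) G) (\<lambda>s. if s \<in> {s. lists_exactly (reported s) (small_compact_cuts \<alpha> G)} then 0 else 1)
       = wp \<alpha> ?B (p_full K KT k0 k1) (\<lambda>s. if lists_exactly (reported s) (small_compact_cuts \<alpha> G) then 0 else 1) (initial_state G)"
      by (simp add: wp_def run_def)
    also have "\<dots> \<le> ennreal (real (card SS) ^ 2 * (2 / real (n ^ K)) + (real (card SS) + 1) * (1 - qq n) ^ TT KT)"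
      by (rule full_fail[OF KB N])
    also have "\<dots> \<le> ennreal (1 / real n ^ d)"
      unfolding K_def by (rule ennreal_leI[OF fail_bound[OF KT]])
    finally have "wpm (run \<alpha> \<kappa> (p_full K KT k0 k1) G) (\<lambda>s. if s \<in> {s. lists_exactly (reported s) (small_compact_cuts \<alpha> G)} then 0 else 1)
       \<le> ennreal (1 / real n ^ d)" .
    then have "measure (measure_spmf (run \<alpha> \<kappa> (p_full K KT k0 k1) G)) {s. lists_exactly (reported s) (small_compact_cuts \<alpha> G)} \<ge> 1 - 1 / real n ^ d"
      by (intro measure_spmf_ge) simp_all
    with time show ?case by blast
  qed
qed

theorem theorem4p1:
  fixes \<alpha> :: real
  assumes "\<alpha> \<ge> 1"
  shows "(\<forall>G :: ('v, 'e) multigraph. finite_multigraph G \<and> connected_graph G \<longrightarrow>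
            real (card (small_compact_cuts \<alpha> G)) < 13 * real (card (verts G)) powr (2 * \<alpha>))
       \<and> enumerable_in_soft_O \<alpha> (small_compact_cuts \<alpha>) (2 * \<alpha>)"
proof (intro conjI allI impI)
  fix G :: "('v, 'e) multigraph"
  assume G: "finite_multigraph G \<and> connected_graph G"
  interpret mgraph G using G by unfold_locales auto
  have "real (card (verts G)) powr (2 * \<alpha>) > 0" using V_ne by simp
  then show "real (card (small_compact_cuts \<alpha> G)) < 13 * real (card (verts G)) powr (2 * \<alpha>)"
    using card_small_compact_cuts[OF assms] by linarith
qed (rule enumerable[OF assms])

end
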